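(* Let $K$ be an algebraically closed field of characteristic zero, let $C\subset\mathbb{P}^2$ be an irreducible plane curve of degree $d\ge 3$ over $K$, and let $p$ be an odd prime. Suppose that either (a) $P\in\mathbb{P}^2\setminus C$ is an extendable Galois point for $C$ and $d=p$, or (b) $P\in C\setminus\mathrm{Sing}(C)$ is an extendable Galois point for $C$ and $d-1=p$. Let $\overline{P}\in\mathbb{P}^{2*}$ be the point associated with $P$, let $f_P:\mathbb{P}^1\to\mathbb{P}^1$ be the morphism satisfying $f_P\circ\pi_P=\pi_{\overline{P}}\circ\gamma_C$, and let $r$ be the degree of $f_P$. If $r=2$, then $$G_{\overline{P}}\cong(\mathbb{Z}/p\mathbb{Z})\times D_{2p},$$ where $D_{2p}$ is the dihedral group of order $2p$.
   Context: $\mathrm{Sing}(C)$ is the singular locus of $C$. Homogeneous coordinates on $\mathbb{P}^2$ are $(X:Y:Z)$ and on the dual plane $\mathbb{P}^{2*}$ (parameterizing lines of $\mathbb{P}^2$) are $(U:V:W)$. For a plane curve $D$ in a projective plane and a point $Q$ of that plane, $\pi_Q:D\dashrightarrow\mathbb{P}^1$ is the projection from $Q$; $G_Q$ denotes the Galois group of the Galois closure of the function field extension $K(D)/\pi_Q^*K(\mathbb{P}^1)$. For $P\in\mathbb{P}^2$ we use $D=C$; for points of $\mathbb{P}^{2*}$ we use $D=C^*$. The point $Q$ is a Galois point for $D$ if $K(D)/\pi_Q^*K(\mathbb{P}^1)$ is Galois; in this case $G_Q$ acts on $D$ by birational transformations, and the Galois point is extendable if every birational transformation of $D$ induced by an element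 of $G_Q$ extends to a linear transformation of the projective plane. Dual curve: if $F$ is the homogeneous polynomial defining $C$, the dual map $\gamma_C:C\dashrightarrow\mathbb{P}^{2*}$ sends a smooth point $Q$ to $(F_X(Q):F_Y(Q):F_Z(Q))$, i.e. to the tangent line at $Q$; the dual curve $C^*$ is the closure of its image. The point $\overline{P}$: for an extendable Galois point $P$ of $C$, each $\sigma\in G_P$ extends to a linear transformation of $\mathbb{P}^2$ and induces a linear transformation $\overline{\sigma}$ of $\mathbb{P}^{2*}$ (by its action on lines). There is a unique point $\overline{P}\in\mathbb{P}^{2*}$ such that $\sigma\mapsto\overline{\sigma}$ gives an injective homomorphism $G_P\hookrightarrow G[\overline{P}]$, where $G[\overline{P}]=\{\tau\in\mathrm{Bir}(C^* ) \mid \tau(C^*\cap\ell\setminus\{\overline{P}\})\subset\ell \text{ for a general line } \ell\ni\overline{P}\}$. Standard coordinates and $f_P$: up to linear transformations of $\mathbb{P}^2$ one has $P=(1:0:0)$ and $C$ is given by $X^d+G(Y,Z)=0$ in case (a), by $X^{d-1}Z+G(Y,Z)=0$ in case (b), with $G$ homogeneous of degree $d$. Then $\overline{P}=(1:0:0)$ (the line $X=0$), $\pi_P$ is $(X:Y:Z)\mapsto(Y:Z)$, $\pi_{\overline{P}}$ is $(U:V:W)\mapsto(V:W)$, and $f_P$ exists and is represented by $(G_Y:G_Z)$ in case (a) and by $(G_YZ:-G+G_ZZ)$ in case (b), after removing common factors. *)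

theory Defs
  imports
    "HOL-Analysis.Cartesian_Space"
    "HOL-Computational_Algebra.Computational_Algebra"
    "HOL-Algebra.Algebra"
    "HOL-Algebra.Algebraic_Closure_Type"
begin

unbundle no fps_syntax

section \<open>Forms in two and three variables\<close>

text \<open>
  \<open>K[X,Y,Z]\<close> is rendered as the nested polynomial ring \<open>K[Z][Y][X]\<close> and \<open>K[S,T]\<close> as
  \<open>K[T][S]\<close>: the outermost variable is the first coordinate.
\<close>

type_synonym 'a form3 = "'a poly poly poly"
type_synonym 'a form2 = "'a poly poly"

definition homog3 :: "nat \<Rightarrow> 'a::zero form3 \<Rightarrow> bool" where
  "homog3 n F \<longleftrightarrow> (\<forall>i j k. Polynomial.coeff (Polynomial.coeff (Polynomial.coeff F i) j) k \<noteq> 0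
      \<longrightarrow> i + j + k = n)"

definition homog2 :: "nat \<Rightarrow> 'a::zero form2 \<Rightarrow> bool" where
  "homog2 n a \<longleftrightarrow> (\<forall>i j. Polynomial.coeff (Polynomial.coeff a i) j \<noteq> 0 \<longrightarrow> i + j = n)"

text \<open>Evaluation in a ring \<open>'b\<close> into which the coefficients are mapped by \<open>h\<close>.\<close>

definition eval3 :: "('a::comm_ring_1 \<Rightarrow> 'b::comm_ring_1) \<Rightarrow> 'a form3 \<Rightarrow> 'b ^ 3 \<Rightarrow> 'b" where
  "eval3 h F v =
     poly (map_poly (\<lambda>g. poly (map_poly (\<lambda>e. poly (map_poly h e) (v $ 3)) g) (v $ 2)) F) (v $ 1)"

definition eval2 :: "('a::comm_ring_1 \<Rightarrow> 'b::comm_ring_1) \<Rightarrow> 'a form2 \<Rightarrow> 'b ^ 2 \<Rightarrow> 'b" where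
  "eval2 h a v = poly (map_poly (\<lambda>g. poly (map_poly h g) (v $ 2)) a) (v $ 1)"

definition const3 :: "'a::zero \<Rightarrow> 'a form3" where
  "const3 c = [:[:[:c:]:]:]"

definition const2 :: "'a::zero \<Rightarrow> 'a form2" where
  "const2 c = [:[:c:]:]"

definition vars3 :: "'a::comm_ring_1 form3 ^ 3" where
  "vars3 = (\<chi> j. if j = 1 then [:0, 1:] else if j = 2 then [:[:0, 1:]:] else [:[:[:0, 1:]:]:])"

abbreviation form_at :: "'a::comm_ring_1 form3 \<Rightarrow> 'a ^ 3 \<Rightarrow> 'a" where
  "form_at F x \<equiv> eval3 (\<lambda>c. c) F x"

definition forms_at :: "'a::comm_ring_1 form3 ^ 'n \<Rightarrow> 'a ^ 3 \<Rightarrow> 'a ^ 'n" where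
  "forms_at \<phi> x = (\<chi> i. form_at (\<phi> $ i) x)"

text \<open>The linear forms given by the rows of a matrix.\<close>

definition lin_forms :: "'a::comm_ring_1 ^ 3 ^ 'n \<Rightarrow> 'a form3 ^ 'n" where
  "lin_forms A = (\<chi> i. \<Sum>j\<in>UNIV. const3 (A $ i $ j) * vars3 $ j)"

definition gradient :: "'a::idom form3 \<Rightarrow> 'a form3 ^ 3" where
  "gradient F = (\<chi> i. if i = 1 then pderiv F
     else if i = 2 then map_poly pderiv F else map_poly (map_poly pderiv) F)"


section \<open>The projective plane\<close>

text \<open>
  Points of a projective space are given by nonzero vectors of homogeneous coordinates, and a
  subset of the projective plane by the set of all coordinate vectors of its points.  A line
  is given by its coordinate vector \<open>u\<close>, which is a point of the dual plane.
\<close>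

definition proj_eq :: "'a::field ^ 'n \<Rightarrow> 'a ^ 'n \<Rightarrow> bool" where
  "proj_eq x y \<longleftrightarrow> (\<exists>c. c \<noteq> 0 \<and> x = c *s y)"

definition on_line :: "'a::field ^ 3 \<Rightarrow> 'a ^ 3 \<Rightarrow> bool" where
  "on_line x u \<longleftrightarrow> (\<Sum>i\<in>UNIV. u $ i * x $ i) = 0"

definition zero_locus :: "'a::field form3 \<Rightarrow> ('a ^ 3) set" where
  "zero_locus F = {x. x \<noteq> 0 \<and> form_at F x = 0}"

definition sing_locus :: "'a::field form3 \<Rightarrow> ('a ^ 3) set" where
  "sing_locus F = {x \<in> zero_locus F. forms_at (gradient F) x = 0}"

definition vanishes_on :: "'a::field form3 \<Rightarrow> ('a ^ 3) set \<Rightarrow> bool" where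
  "vanishes_on F D \<longleftrightarrow> (\<forall>x\<in>D. form_at F x = 0)"

definition zariski_closure :: "('a::field ^ 3) set \<Rightarrow> ('a ^ 3) set" where
  "zariski_closure S =
     {x. x \<noteq> 0 \<and> (\<forall>n G. homog3 n G \<longrightarrow> vanishes_on G S \<longrightarrow> form_at G x = 0)}"

definition dual_curve :: "'a::field form3 \<Rightarrow> ('a ^ 3) set" where
  "dual_curve F = zariski_closure (forms_at (gradient F) ` (zero_locus F - sing_locus F))"

text \<open>
  The matrix of a projection from \<open>Q\<close> to the projective line: a pair of linear forms whose only
  common zero is \<open>Q\<close>.  It is unique up to a linear change of coordinates on the line.
\<close>

definition projection_from :: "'a::field ^ 3 \<Rightarrow> 'a ^ 3 ^ 2 \<Rightarrow> bool" where
  "projection_from Q \<pi> \<longleftrightarrow> {x. \<pi> *v x = 0} = range (\<lambda>c. c *s Q)"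


section \<open>Function fields\<close>

text \<open>
  The function field of an irreducible closed set \<open>D\<close> is the local ring of all fractions of forms
  of equal degree whose denominator does not vanish identically on \<open>D\<close>, modulo the maximal ideal
  of those fractions whose numerator vanishes identically on \<open>D\<close>.
\<close>

definition local_ring :: "('a::field ^ 3) set \<Rightarrow> 'a form3 fract ring" where
  "local_ring D = ring_of_type_algebra \<lparr>carrier :=
     {Fract a b | a b. (\<exists>n. homog3 n a \<and> homog3 n b) \<and> \<not> vanishes_on b D}\<rparr>"

definition vanishing_ideal :: "('a::field ^ 3) set \<Rightarrow> 'a form3 fract set" where
  "vanishing_ideal D =
     {Fract a b | a b. (\<exists>n. homog3 n a \<and> homog3 n b) \<and> \<not> vanishes_on b D \<and> vanishes_on a D}"

definition function_field :: "('a::field ^ 3) set \<Rightarrow> 'a form3 fract set ring" where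
  "function_field D = local_ring D Quot vanishing_ideal D"

definition rat_fun :: "('a::field ^ 3) set \<Rightarrow> 'a form3 \<Rightarrow> 'a form3 \<Rightarrow> 'a form3 fract set" where
  "rat_fun D a b = vanishing_ideal D +>\<^bsub>local_ring D\<^esub> Fract a b"

text \<open>
  The subfield obtained by pulling back the function field of the projective line along the
  projection from \<open>Q\<close>; every choice of the matrix \<open>\<pi>\<close> gives the same functions.
\<close>

definition projection_subfield :: "('a::field ^ 3) set \<Rightarrow> 'a ^ 3 \<Rightarrow> 'a form3 fract set set" where
  "projection_subfield D Q =
     {rat_fun D (eval2 const3 a (lin_forms \<pi>)) (eval2 const3 b (lin_forms \<pi>)) | a b \<pi>.
        projection_from Q \<pi> \<and> (\<exists>n. homog2 n a \<and> homog2 n b) \<and>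
        \<not> vanishes_on (eval2 const3 b (lin_forms \<pi>)) D}"


section \<open>Galois theory\<close>

definition gal_group :: "('b, 'c) ring_scheme \<Rightarrow> 'b set \<Rightarrow> ('b \<Rightarrow> 'b) monoid" where
  "gal_group E k = BijGroup (carrier E)
     \<lparr>carrier := {\<sigma> \<in> ring_iso E E \<inter> extensional (carrier E). \<forall>x\<in>k. \<sigma> x = x}\<rparr>"

definition galois_extension :: "('b, 'c) ring_scheme \<Rightarrow> 'b set \<Rightarrow> bool" where
  "galois_extension E k \<longleftrightarrow> field E \<and> subfield k E \<and> ring.finite_dimension E k (carrier E) \<and>
     {x \<in> carrier E. \<forall>\<sigma>\<in>carrier (gal_group E k). \<sigma> x = x} = k"

text \<open>
  \<open>L\<close>, with the embedding \<open>\<iota>\<close> of \<open>E\<close>, is a Galois closure of the extension \<open>E\<close> of \<open>k\<close>: a Galois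
  extension of \<open>k\<close> containing \<open>E\<close>, and minimal as such.
\<close>

definition galois_closure ::
    "('b, 'd) ring_scheme \<Rightarrow> 'b set \<Rightarrow> 'c ring \<Rightarrow> ('b \<Rightarrow> 'c) \<Rightarrow> bool" where
  "galois_closure E k L \<iota> \<longleftrightarrow> \<iota> \<in> ring_hom E L \<and> galois_extension L (\<iota> ` k) \<and>
     (\<forall>M. subfield M L \<and> \<iota> ` carrier E \<subseteq> M \<and> galois_extension (L\<lparr>carrier := M\<rparr>) (\<iota> ` k)
        \<longrightarrow> M = carrier L)"


section \<open>Birational transformations\<close>

definition rat_triple :: "('a::field ^ 3) set \<Rightarrow> 'a form3 ^ 3 \<Rightarrow> bool" where
  "rat_triple D \<phi> \<longleftrightarrow> (\<exists>n. \<forall>i. homog3 n (\<phi> $ i)) \<and> (\<exists>i. \<not> vanishes_on (\<phi> $ i) D)"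

text \<open>A rational map from \<open>D\<close> to the plane is the set of all triples of forms representing it.\<close>

definition rat_map :: "('a::field ^ 3) set \<Rightarrow> 'a form3 ^ 3 \<Rightarrow> ('a form3 ^ 3) set" where
  "rat_map D \<phi> =
     {\<psi>. rat_triple D \<psi> \<and> (\<forall>i j. vanishes_on (\<phi> $ i * \<psi> $ j - \<phi> $ j * \<psi> $ i) D)}"

definition self_map :: "('a::field ^ 3) set \<Rightarrow> 'a form3 ^ 3 \<Rightarrow> bool" where
  "self_map D \<phi> \<longleftrightarrow> rat_triple D \<phi> \<and> (\<forall>x\<in>D. forms_at \<phi> x \<noteq> 0 \<longrightarrow> forms_at \<phi> x \<in> D)"

definition comp_triple :: "'a::comm_ring_1 form3 ^ 3 \<Rightarrow> 'a form3 ^ 3 \<Rightarrow> 'a form3 ^ 3" where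
  "comp_triple \<phi> \<psi> = (\<chi> i. eval3 const3 (\<phi> $ i) \<psi>)"

definition Bir :: "('a::field ^ 3) set \<Rightarrow> ('a form3 ^ 3) set monoid" where
  "Bir D =
     \<lparr>carrier = {rat_map D \<phi> | \<phi>. self_map D \<phi> \<and>
        (\<exists>\<psi>. self_map D \<psi> \<and> comp_triple \<phi> \<psi> \<in> rat_map D vars3 \<and>
           comp_triple \<psi> \<phi> \<in> rat_map D vars3)},
      monoid.mult = (\<lambda>S T. \<Union>\<phi>\<in>S. \<Union>\<psi>\<in>T. rat_map D (comp_triple \<phi> \<psi>)),
      one = rat_map D vars3\<rparr>"

text \<open>
  The birational transformation \<open>\<Phi>\<close> through which the field automorphism \<open>\<sigma>\<close> acts on \<open>D\<close>.  The
  convention is that \<open>\<sigma>\<close> is the inverse of the pullback along \<open>\<Phi>\<close>, so that \<open>\<sigma> \<mapsto> \<Phi>\<close> is a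
  homomorphism and not an antihomomorphism.
\<close>

definition induces :: "('a::field ^ 3) set \<Rightarrow> ('a form3 fract set \<Rightarrow> 'a form3 fract set) \<Rightarrow>
    ('a form3 ^ 3) set \<Rightarrow> bool" where
  "induces D \<sigma> \<Phi> \<longleftrightarrow> \<Phi> \<in> carrier (Bir D) \<and>
     (\<forall>\<phi>\<in>\<Phi>. \<forall>n a b. homog3 n a \<and> homog3 n b \<and> \<not> vanishes_on b D \<longrightarrow>
        \<sigma> (rat_fun D (eval3 const3 a \<phi>) (eval3 const3 b \<phi>)) = rat_fun D a b)"

text \<open>
  The transformations mapping \<open>D \<inter> \<ell> - {Q}\<close> into \<open>\<ell>\<close> for all but finitely many lines \<open>\<ell>\<close> through
  \<open>Q\<close>.
\<close>

definition line_preserving :: "('a::field ^ 3) set \<Rightarrow> 'a ^ 3 \<Rightarrow> ('a form3 ^ 3) set monoid" where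
  "line_preserving D Q = Bir D \<lparr>carrier := {T \<in> carrier (Bir D).
     \<exists>S. finite S \<and>
       (\<forall>u. u \<noteq> 0 \<and> on_line Q u \<and> (\<forall>s\<in>S. \<not> proj_eq u s) \<longrightarrow>
         (\<forall>x\<in>D. on_line x u \<and> \<not> proj_eq x Q \<longrightarrow>
           (\<forall>\<phi>\<in>T. forms_at \<phi> x \<noteq> 0 \<longrightarrow> on_line (forms_at \<phi> x) u)))}\<rparr>"


section \<open>Galois points\<close>

definition galois_point :: "('a::field ^ 3) set \<Rightarrow> 'a ^ 3 \<Rightarrow> bool" where
  "galois_point D Q \<longleftrightarrow> galois_extension (function_field D) (projection_subfield D Q)"

abbreviation galois_point_group :: "('a::field ^ 3) set \<Rightarrow> 'a ^ 3 \<Rightarrow>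
    ('a form3 fract set \<Rightarrow> 'a form3 fract set) monoid" where
  "galois_point_group D Q \<equiv> gal_group (function_field D) (projection_subfield D Q)"

definition extendable_galois_point :: "('a::field ^ 3) set \<Rightarrow> 'a ^ 3 \<Rightarrow> bool" where
  "extendable_galois_point D Q \<longleftrightarrow> galois_point D Q \<and>
     (\<forall>\<sigma>\<in>carrier (galois_point_group D Q). \<forall>\<Phi>. induces D \<sigma> \<Phi> \<longrightarrow>
        (\<exists>A. invertible A \<and> \<Phi> = rat_map D (lin_forms A)))"

text \<open>
  \<open>R\<close> is the point of the dual plane associated with the extendable Galois point \<open>P\<close>.  A linear
  transformation \<open>A\<close> moves the line with coordinates \<open>u\<close> to the line with coordinates
  \<open>transpose (matrix_inv A) *v u\<close>.
\<close>

definition associated_point :: "'a::field form3 \<Rightarrow> 'a ^ 3 \<Rightarrow> 'a ^ 3 \<Rightarrow> bool" where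
  "associated_point F P R \<longleftrightarrow> R \<noteq> 0 \<and>
     (\<exists>h \<in> hom (galois_point_group (zero_locus F) P) (line_preserving (dual_curve F) R).
        inj_on h (carrier (galois_point_group (zero_locus F) P)) \<and>
        (\<forall>\<sigma>\<in>carrier (galois_point_group (zero_locus F) P). \<forall>A. invertible A \<and>
           induces (zero_locus F) \<sigma> (rat_map (zero_locus F) (lin_forms A)) \<longrightarrow>
           h \<sigma> = rat_map (dual_curve F) (lin_forms (transpose (matrix_inv A)))))"


section \<open>Morphisms of the projective line\<close>

definition line_morphism :: "'a::field form2 ^ 2 \<Rightarrow> bool" where
  "line_morphism f \<longleftrightarrow> (\<exists>n. \<forall>i. homog2 n (f $ i)) \<and>
     (\<forall>v. v \<noteq> 0 \<longrightarrow> (\<exists>i. eval2 (\<lambda>c. c) (f $ i) v \<noteq> 0))"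

definition line_field :: "'a::field form2 fract ring" where
  "line_field = ring_of_type_algebra \<lparr>carrier :=
     {Fract a b | a b. (\<exists>n. homog2 n a \<and> homog2 n b) \<and> b \<noteq> 0}\<rparr>"

definition pullback_field :: "'a::field form2 ^ 2 \<Rightarrow> 'a form2 fract set" where
  "pullback_field f = {Fract (eval2 const2 a f) (eval2 const2 b f) | a b.
     (\<exists>n. homog2 n a \<and> homog2 n b) \<and> eval2 const2 b f \<noteq> 0}"

definition line_morphism_degree :: "'a::field form2 ^ 2 \<Rightarrow> nat \<Rightarrow> bool" where
  "line_morphism_degree f r \<longleftrightarrow>
     ring.dimension line_field r (pullback_field f) (carrier line_field)"

text \<open>
  \<open>f\<close> represents the morphism satisfying \<open>f \<circ> \<pi> = \<rho> \<circ> \<gamma>\<close>, where \<open>\<pi>\<close> and \<open>\<rho>\<close> are the projections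
  from \<open>P\<close> and \<open>R\<close> and \<open>\<gamma>\<close> is the dual map; the equality is that of rational maps, that is,
  on the points where \<open>\<gamma>\<close>, \<open>\<pi>\<close> and \<open>\<rho> \<circ> \<gamma>\<close> are defined.
\<close>

definition induced_line_morphism ::
    "'a::field form3 \<Rightarrow> 'a ^ 3 \<Rightarrow> 'a ^ 3 \<Rightarrow> 'a form2 ^ 2 \<Rightarrow> bool" where
  "induced_line_morphism F P R f \<longleftrightarrow> line_morphism f \<and>
     (\<exists>\<pi> \<rho>. projection_from P \<pi> \<and> projection_from R \<rho> \<and>
       (\<forall>x \<in> zero_locus F - sing_locus F.
          \<pi> *v x \<noteq> 0 \<and> \<rho> *v forms_at (gradient F) x \<noteq> 0 \<longrightarrow>
          proj_eq (\<chi> i. eval2 (\<lambda>c. c) (f $ i) (\<pi> *v x)) (\<rho> *v forms_at (gradient F) x)))"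


section \<open>Dihedral groups\<close>

text \<open>
  The dihedral group of order \<open>2 * n\<close>: \<open>(i, False)\<close> stands for the rotation \<open>\<rho>\<^sup>i\<close> and
  \<open>(i, True)\<close> for \<open>\<rho>\<^sup>i \<tau>\<close> with a fixed reflection \<open>\<tau>\<close>.
\<close>

definition dihedral_group :: "nat \<Rightarrow> (int \<times> bool) monoid" where
  "dihedral_group n =
     \<lparr>carrier = {0..<int n} \<times> UNIV,
      monoid.mult = (\<lambda>(i, s) (j, t). ((if s then i - j else i + j) mod int n, s \<noteq> t)),
      one = (0, False)\<rparr>"

end

theory Submission imports Defs "Berlekamp_Zassenhaus.Unique_Factorization_Poly" begin

text \<open>
  In suitable coordinates the curve is \<open>x\<^sup>p = g(z)\<close> with \<open>p\<close> not dividing \<open>deg g\<close>, and the dual curve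
  has function field \<open>K(u, t)\<close> with \<open>t = z - p g / g'\<close> and \<open>u = (t - z) / x\<close>; the projection from the
  associated point is \<open>t\<close>.  Since \<open>f\<close> has degree two, \<open>z\<close> is quadratic over \<open>K(t)\<close>, which
  forces \<open>g\<close> to have exactly two roots; so one may take \<open>q = z\<^sup>a (1 + z)\<^sup>b\<close> for \<open>g\<close>.  The conjugate \<open>z2\<close> of
  \<open>z\<close> over \<open>K(t)\<close> is a Moebius transform of \<open>z\<close>, and \<open>q\<close> and its conjugate are independent modulo
  \<open>p\<close>-th powers of \<open>K(z)\<close>.  Hence \<open>K(u, t) = K(x, z)\<close>, and its Galois closure over \<open>K(t)\<close> is
  obtained by adjoining a \<open>p\<close>-th root of the conjugate of \<open>q\<close>.  The group is the semidirect
  product of \<open>(\<int>/p)\<^sup>2\<close> with the involution exchanging the two factors; the diagonal is central and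
  the antidiagonal is inverted, which gives \<open>\<int>/p \<times> D\<close>.
\<close>

no_notation Formal_Power_Series.fps_nth (infixl "$" 75)
hide_const (open) Polynomials.degree Polynomials.lead_coeff Divisibility.irreducible Divisibility.prime Module.smult up_ring.monom up_ring.coeff
  Matrix.mat Matrix.vec Matrix.row Matrix.col
no_notation Matrix.vec_index (infixl "$" 100)

text \<open>The function fields are quotients of local rings, and the Galois closure
  \<open>L\<close> is an arbitrary field. All computations are therefore moved to one concrete
  field, the algebraic closure of \<open>K(Y,Z)\<close>: evaluation at a generic point turns the
  function field of the curve or of its dual into a subfield, and \<open>L\<close> enters only
  through its fixed field and its minimality. The condition on \<open>deg g\<close> is reached by
  moving a zero of a coefficient form to the point at infinity of \<open>z\<close>; after this the
  two cases of the theorem look alike. It also controls the roots: since \<open>p\<close> differs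
  from \<open>deg g\<close>, the degree of \<open>t\<close> as a rational function of
  \<open>z\<close> is the number of distinct roots of \<open>g\<close>, and this degree is two when
  \<open>z\<close> is quadratic over \<open>K(t)\<close>. The associated point is given by its
  defining property only and has to be located first: a homology of the dual plane preserves general
  lines through its centre and through no other point. That \<open>p\<close> is odd matters for the
  group: 2 is then invertible modulo \<open>p\<close>, so the diagonal and the antidiagonal span all
  of \<open>(Z/p)^2\<close>.\<close>

lemma vec_lambda_zero [simp]: "(\<chi> i. 0) = (0 :: 'a::zero ^ 'n)"
  by (simp add: Finite_Cartesian_Product.vec_eq_iff)

lemma map_poly_const_poly: "f 0 = 0 \<Longrightarrow> map_poly f [:c:] = [:f c:]"
  by (cases "c = 0") (simp_all add: map_poly_pCons)

lemma map_poly_one_poly: "f 0 = 0 \<Longrightarrow> map_poly f 1 = [:f 1:]"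
  using map_poly_const_poly[of f 1] by simp

section \<open>Evaluation of forms\<close>

lemma comm_ring_hom_I:
  fixes h :: "'a::comm_ring_1 \<Rightarrow> 'b::comm_ring_1"
  assumes "\<And>x y. h (x + y) = h x + h y" "\<And>x y. h (x * y) = h x * h y" "h 1 = 1"
  shows "comm_ring_hom h"
proof -
  have "h 0 = 0" using assms(1)[of 0 0] by simp
  then show ?thesis using assms by unfold_locales auto
qed

lemma comm_ring_hom_ident: "comm_ring_hom (\<lambda>c. c)"
  by (rule comm_ring_hom_I) auto

lemma comm_ring_hom_comp:
  assumes "comm_ring_hom f" "comm_ring_hom g" shows "comm_ring_hom (\<lambda>x. f (g x))"
proof -
  interpret f: comm_ring_hom f by fact
  interpret g: comm_ring_hom g by fact
  show ?thesis by (rule comm_ring_hom_I) (auto simp: f.hom_add g.hom_add f.hom_mult g.hom_mult)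
qed

lemma comm_ring_hom_poly_map:
  assumes "comm_ring_hom h" shows "comm_ring_hom (\<lambda>p. poly (map_poly h p) x)"
proof -
  interpret h: comm_ring_hom h by fact
  interpret m: map_poly_comm_ring_hom h ..
  show ?thesis by (rule comm_ring_hom_I) (auto simp: m.hom_add m.hom_mult)
qed

lemma comm_ring_hom_eval3: "comm_ring_hom h \<Longrightarrow> comm_ring_hom (\<lambda>F. eval3 h F v)"
  unfolding eval3_def by (intro comm_ring_hom_poly_map)

lemma comm_ring_hom_eval2: "comm_ring_hom h \<Longrightarrow> comm_ring_hom (\<lambda>F. eval2 h F v)"
  unfolding eval2_def by (intro comm_ring_hom_poly_map)

lemma comm_ring_hom_const3: "comm_ring_hom const3"
  by (rule comm_ring_hom_I) (auto simp: const3_def)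

lemma const3_0 [simp]: "const3 0 = 0" and const2_0 [simp]: "const2 0 = 0"
  by (simp_all add: const3_def const2_def)

lemma comm_ring_hom_const2: "comm_ring_hom const2"
  by (rule comm_ring_hom_I) (auto simp: const2_def)

lemma poly_map_pCons:
  assumes "comm_ring_hom h" shows "poly (map_poly h (pCons a p)) x = h a + x * poly (map_poly h p) x"
proof -
  interpret h: comm_ring_hom h by fact
  show ?thesis by (simp only: h.map_poly_pCons_hom poly_pCons)
qed

lemma eval3_const3 [simp]: "comm_ring_hom h \<Longrightarrow> eval3 h (const3 c) v = h c"
  by (simp add: eval3_def const3_def poly_map_pCons comm_ring_hom_poly_map)

lemma eval2_const2 [simp]: "comm_ring_hom h \<Longrightarrow> eval2 h (const2 c) v = h c"
  by (simp add: eval2_def const2_def poly_map_pCons comm_ring_hom_poly_map)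

definition vars2 :: "'a::comm_ring_1 form2 ^ 2" where
  "vars2 = (\<chi> j. if j = 1 then [:0, 1:] else [:[:0, 1:]:])"

lemma eval3_vars3 [simp]:
  assumes "comm_ring_hom h" shows "eval3 h (vars3 $ i) v = v $ i"
proof -
  interpret h: comm_ring_hom h by fact
  show ?thesis using assms exhaust_3[of i]
    by (auto simp: eval3_def vars3_def poly_map_pCons comm_ring_hom_poly_map)
qed

lemma eval2_vars2 [simp]:
  assumes "comm_ring_hom h" shows "eval2 h (vars2 $ i) v = v $ i"
proof -
  interpret h: comm_ring_hom h by fact
  show ?thesis using assms exhaust_2[of i]
    by (auto simp: eval2_def vars2_def poly_map_pCons comm_ring_hom_poly_map)
qed

lemma form2_induct [case_names const var add mult]:
  fixes a :: "'a::comm_ring_1 form2"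
  assumes c: "\<And>c. Q (const2 c)" and v: "\<And>i. Q (vars2 $ i)"
    and add: "\<And>a b. Q a \<Longrightarrow> Q b \<Longrightarrow> Q (a + b)" and mult: "\<And>a b. Q a \<Longrightarrow> Q b \<Longrightarrow> Q (a * b)"
  shows "Q a"
proof -
  have 1: "Q [:e:]" for e :: "'a poly"
  proof (induction e)
    case 0 show ?case using c[of 0] by (simp add: const2_def)
  next
    case (pCons a p)
    have "[:pCons a p:] = const2 a + vars2 $ 2 * [:p:]" by (simp add: const2_def vars2_def)
    then show ?case using pCons.IH by (simp only:) (intro add mult c v)
  qed
  show ?thesis
  proof (induction a)
    case 0 show ?case using 1[of 0] by simp
  next
    case (pCons a p)
    have "pCons a p = [:a:] + vars2 $ 1 * p" by (simp add: vars2_def)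
    then show ?case using pCons.IH by (simp only:) (intro add mult 1 v)
  qed
qed

lemma form3_induct [case_names const var add mult]:
  fixes a :: "'a::comm_ring_1 form3"
  assumes c: "\<And>c. Q (const3 c)" and v: "\<And>i. Q (vars3 $ i)"
    and add: "\<And>a b. Q a \<Longrightarrow> Q b \<Longrightarrow> Q (a + b)" and mult: "\<And>a b. Q a \<Longrightarrow> Q b \<Longrightarrow> Q (a * b)"
  shows "Q a"
proof -
  have 1: "Q [:e:]" for e :: "'a poly poly"
  proof (induction e rule: form2_induct)
    case (const c) show ?case using c[of c] by (simp add: const2_def const3_def)
  next
    case (var i)
    have "[:vars2 $ i:] = vars3 $ (if i = 1 then 2 else 3 :: 3)" 
      using exhaust_2[of i] by (auto simp: vars2_def vars3_def)
    then show ?case using v by metis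
  next
    case (add a b) then show ?case using assms(3)[of "[:a:]" "[:b:]"] by simp
  next
    case (mult a b) then show ?case using assms(4)[of "[:a:]" "[:b:]"] by (simp add: mult.commute)
  qed
  show ?thesis
  proof (induction a)
    case 0 show ?case using 1[of 0] by simp
  next
    case (pCons a p)
    have "pCons a p = [:a:] + vars3 $ 1 * p" by (simp add: vars3_def)
    then show ?case using pCons.IH by (simp only:) (intro add mult 1 v)
  qed
qed

text \<open>The uniqueness half of the universal property of \<open>K[X,Y,Z]\<close>. The laws for
  iterated substitution reduce to it, so that only constants and variables have to be
  compared.\<close>

lemma form3_hom_unique:
  assumes "comm_ring_hom f" "comm_ring_hom g" "\<And>c. f (const3 c) = g (const3 c)" "\<And>i. f (vars3 $ i) = g (vars3 $ i)"
  shows "f F = g F"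
proof -
  interpret f: comm_ring_hom f by fact
  interpret g: comm_ring_hom g by fact
  show ?thesis by (induction F rule: form3_induct) (auto simp: assms f.hom_add g.hom_add f.hom_mult g.hom_mult)
qed

lemma form2_hom_unique:
  assumes "comm_ring_hom f" "comm_ring_hom g" "\<And>c. f (const2 c) = g (const2 c)" "\<And>i. f (vars2 $ i) = g (vars2 $ i)"
  shows "f F = g F"
proof -
  interpret f: comm_ring_hom f by fact
  interpret g: comm_ring_hom g by fact
  show ?thesis by (induction F rule: form2_induct) (auto simp: assms f.hom_add g.hom_add f.hom_mult g.hom_mult)
qed

lemma hom_eval3:
  assumes "comm_ring_hom g" "comm_ring_hom h"
  shows "g (eval3 h F v) = eval3 (\<lambda>c. g (h c)) F (\<chi> i. g (v $ i))"
  by (rule form3_hom_unique[OF comm_ring_hom_comp[OF assms(1) comm_ring_hom_eval3[OF assms(2)]]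
        comm_ring_hom_eval3[OF comm_ring_hom_comp[OF assms]]])
     (simp_all add: assms comm_ring_hom_comp[OF assms])

lemma hom_eval2:
  assumes "comm_ring_hom g" "comm_ring_hom h"
  shows "g (eval2 h F v) = eval2 (\<lambda>c. g (h c)) F (\<chi> i. g (v $ i))"
  by (rule form2_hom_unique[OF comm_ring_hom_comp[OF assms(1) comm_ring_hom_eval2[OF assms(2)]]
        comm_ring_hom_eval2[OF comm_ring_hom_comp[OF assms]]])
     (simp_all add: assms comm_ring_hom_comp[OF assms])

lemma eval3_eval3:
  assumes "comm_ring_hom h"
  shows "eval3 h (eval3 const3 F \<phi>) v = eval3 h F (\<chi> i. eval3 h (\<phi> $ i) v)"
  using hom_eval3[OF comm_ring_hom_eval3[OF assms] comm_ring_hom_const3, where v = \<phi> and F = F] assms by simp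

lemma eval3_eval2:
  assumes "comm_ring_hom h"
  shows "eval3 h (eval2 const3 F \<phi>) v = eval2 h F (\<chi> i. eval3 h (\<phi> $ i) v)"
  using hom_eval2[OF comm_ring_hom_eval3[OF assms] comm_ring_hom_const3, where v = \<phi> and F = F] assms by simp

lemma eval2_eval2:
  assumes "comm_ring_hom h"
  shows "eval2 h (eval2 const2 F \<phi>) v = eval2 h F (\<chi> i. eval2 h (\<phi> $ i) v)"
  using hom_eval2[OF comm_ring_hom_eval2[OF assms] comm_ring_hom_const2, where v = \<phi> and F = F] assms by simp

lemma eval3_const3_vars3 [simp]: "eval3 const3 F vars3 = F"
  by (rule form3_hom_unique[of "\<lambda>F. eval3 const3 F vars3" "\<lambda>F. F"])
     (auto simp: comm_ring_hom_const3 comm_ring_hom_ident intro: comm_ring_hom_eval3)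

lemma eval3_in_form2:
  assumes "comm_ring_hom h"
  shows "eval3 h F v = poly (map_poly (\<lambda>g. eval2 h g (\<chi> i. v $ (if i = 1 then 2 else 3))) F) (v $ 1)"
  by (simp add: eval3_def eval2_def)

lemma eval3_lin_forms:
  assumes "comm_ring_hom h"
  shows "eval3 h (lin_forms A $ i) v = (\<Sum>j\<in>UNIV. h (A $ i $ j) * v $ j)"
proof -
  interpret e: comm_ring_hom "\<lambda>F. eval3 h F v" by (rule comm_ring_hom_eval3[OF assms])
  show ?thesis by (simp add: lin_forms_def e.hom_sum e.hom_mult assms)
qed

definition hmat :: "('a \<Rightarrow> 'b) \<Rightarrow> 'a ^ 'n ^ 'm \<Rightarrow> 'b ^ 'n ^ 'm" where
  "hmat h A = (\<chi> i j. h (A $ i $ j))"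

lemma eval3_lin_forms_vec:
  assumes "comm_ring_hom h"
  shows "(\<chi> i. eval3 h (lin_forms A $ i) v) = hmat h A *v v"
  by (simp add: eval3_lin_forms[OF assms] hmat_def matrix_vector_mult_def)

lemma hmat_mult:
  assumes "comm_ring_hom h" shows "hmat h (A ** B) = hmat h A ** hmat h B"
proof -
  interpret h: comm_ring_hom h by fact
  show ?thesis by (simp add: hmat_def matrix_matrix_mult_def h.hom_sum h.hom_mult Finite_Cartesian_Product.vec_eq_iff)
qed

lemma hmat_1: assumes "comm_ring_hom h" shows "hmat h (mat 1) = mat 1"
proof -
  interpret h: comm_ring_hom h by fact
  show ?thesis by (simp add: hmat_def Finite_Cartesian_Product.mat_def Finite_Cartesian_Product.vec_eq_iff if_distrib[of h] cong: if_cong)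
qed

lemma hmat_ident [simp]: "hmat (\<lambda>c. c) A = A"
  by (simp add: hmat_def)

subsection \<open>Homogeneity\<close>

lemma poly_map_poly_sum:
  fixes f :: "'a::comm_ring_1 \<Rightarrow> 'b::comm_ring_1"
  assumes "f 0 = 0" shows "poly (map_poly f p) x = (\<Sum>i\<le>Polynomial.degree p. f (Polynomial.coeff p i) * x ^ i)"
proof -
  have "poly (map_poly f p) x = (\<Sum>i\<le>Polynomial.degree (map_poly f p). f (Polynomial.coeff p i) * x ^ i)"
    by (subst Polynomial.poly_altdef) (simp add: coeff_map_poly assms)
  also have "\<dots> = (\<Sum>i\<le>Polynomial.degree p. f (Polynomial.coeff p i) * x ^ i)"
  proof (rule sum.mono_neutral_left)
    show "{..Polynomial.degree (map_poly f p)} \<subseteq> {..Polynomial.degree p}" using degree_map_poly_le[of f p] by auto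
    show "\<forall>i\<in>{..Polynomial.degree p} - {..Polynomial.degree (map_poly f p)}. f (Polynomial.coeff p i) * x ^ i = 0"
      by (auto simp: not_le coeff_map_poly[of f, OF assms, symmetric] coeff_eq_0)
  qed simp
  finally show ?thesis .
qed

lemma eval3_sum:
  assumes "comm_ring_hom h"
  shows "eval3 h F v = (\<Sum>i\<le>Polynomial.degree F. \<Sum>j\<le>Polynomial.degree (Polynomial.coeff F i).
    \<Sum>k\<le>Polynomial.degree (Polynomial.coeff (Polynomial.coeff F i) j).
      h (Polynomial.coeff (Polynomial.coeff (Polynomial.coeff F i) j) k) * v $ 1 ^ i * v $ 2 ^ j * v $ 3 ^ k)"
proof -
  interpret h: comm_ring_hom h by fact
  have 1: "poly (map_poly h e) x = (\<Sum>k\<le>Polynomial.degree e. h (Polynomial.coeff e k) * x ^ k)" for e x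
    by (rule poly_map_poly_sum) simp
  have 2: "poly (map_poly (\<lambda>e. poly (map_poly h e) x) g) y
    = (\<Sum>j\<le>Polynomial.degree g. poly (map_poly h (Polynomial.coeff g j)) x * y ^ j)" for g x y
    by (rule poly_map_poly_sum) simp
  have 3: "poly (map_poly (\<lambda>g. poly (map_poly (\<lambda>e. poly (map_poly h e) x) g) y) F) z
    = (\<Sum>i\<le>Polynomial.degree F. poly (map_poly (\<lambda>e. poly (map_poly h e) x) (Polynomial.coeff F i)) y * z ^ i)" for x y z
    by (rule poly_map_poly_sum) simp
  show ?thesis unfolding eval3_def
    by (subst 3, subst 2, subst 1, unfold sum_distrib_right, (rule sum.cong[OF refl])+, simp only: mult_ac)
qed

lemma eval2_sum:
  assumes "comm_ring_hom h"
  shows "eval2 h F v = (\<Sum>i\<le>Polynomial.degree F. \<Sum>j\<le>Polynomial.degree (Polynomial.coeff F i).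
      h (Polynomial.coeff (Polynomial.coeff F i) j) * v $ 1 ^ i * v $ 2 ^ j)"
proof -
  interpret h: comm_ring_hom h by fact
  have 1: "poly (map_poly h e) x = (\<Sum>k\<le>Polynomial.degree e. h (Polynomial.coeff e k) * x ^ k)" for e x
    by (rule poly_map_poly_sum) simp
  have 2: "poly (map_poly (\<lambda>e. poly (map_poly h e) x) g) y
    = (\<Sum>j\<le>Polynomial.degree g. poly (map_poly h (Polynomial.coeff g j)) x * y ^ j)" for g x y
    by (rule poly_map_poly_sum) simp
  show ?thesis unfolding eval2_def
    by (subst 2, subst 1, unfold sum_distrib_right, (rule sum.cong[OF refl])+, simp only: mult_ac)
qed

lemma homog3_scale:
  assumes "comm_ring_hom h" "homog3 n F"
  shows "eval3 h F (c *s v) = c ^ n * eval3 h F v"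
proof -
  interpret h: comm_ring_hom h by fact
  have "h (Polynomial.coeff (Polynomial.coeff (Polynomial.coeff F i) j) k) * (c * v $ 1) ^ i * (c * v $ 2) ^ j * (c * v $ 3) ^ k
    = c ^ n * (h (Polynomial.coeff (Polynomial.coeff (Polynomial.coeff F i) j) k) * v $ 1 ^ i * v $ 2 ^ j * v $ 3 ^ k)" for i j k
  proof (cases "Polynomial.coeff (Polynomial.coeff (Polynomial.coeff F i) j) k = 0")
    case False
    then have "n = i + j + k" using assms by (auto simp: homog3_def)
    then show ?thesis by (simp only: power_mult_distrib power_add mult_ac)
  qed simp
  then show ?thesis by (simp add: eval3_sum[OF assms(1)] sum_distrib_left)
qed

lemma homog2_scale:
  assumes "comm_ring_hom h" "homog2 n F"
  shows "eval2 h F (c *s v) = c ^ n * eval2 h F v"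
proof -
  interpret h: comm_ring_hom h by fact
  have "h (Polynomial.coeff (Polynomial.coeff F i) j) * (c * v $ 1) ^ i * (c * v $ 2) ^ j
    = c ^ n * (h (Polynomial.coeff (Polynomial.coeff F i) j) * v $ 1 ^ i * v $ 2 ^ j)" for i j
  proof (cases "Polynomial.coeff (Polynomial.coeff F i) j = 0")
    case False
    then have "n = i + j" using assms by (auto simp: homog2_def)
    then show ?thesis by (simp only: power_mult_distrib power_add mult_ac)
  qed simp
  then show ?thesis by (simp add: eval2_sum[OF assms(1)] sum_distrib_left)
qed

lemma homog3_0 [simp]: "homog3 n 0" and homog2_0 [simp]: "homog2 n 0"
  by (simp_all add: homog3_def homog2_def)

lemma homog3_add: "homog3 n F \<Longrightarrow> homog3 n G \<Longrightarrow> homog3 n (F + G)"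
  unfolding homog3_def
proof (intro allI impI)
  fix i j k
  assume *: "\<forall>i j k. Polynomial.coeff (Polynomial.coeff (Polynomial.coeff F i) j) k \<noteq> 0 \<longrightarrow> i + j + k = n"
    "\<forall>i j k. Polynomial.coeff (Polynomial.coeff (Polynomial.coeff G i) j) k \<noteq> 0 \<longrightarrow> i + j + k = n"
  assume "Polynomial.coeff (Polynomial.coeff (Polynomial.coeff (F + G) i) j) k \<noteq> 0"
  then have "Polynomial.coeff (Polynomial.coeff (Polynomial.coeff F i) j) k \<noteq> 0 \<or> Polynomial.coeff (Polynomial.coeff (Polynomial.coeff G i) j) k \<noteq> 0" by auto
  then show "i + j + k = n" using * by blast
qed

lemma homog2_add: "homog2 n F \<Longrightarrow> homog2 n G \<Longrightarrow> homog2 n (F + G)"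
  unfolding homog2_def
proof (intro allI impI)
  fix i j
  assume *: "\<forall>i j. Polynomial.coeff (Polynomial.coeff F i) j \<noteq> 0 \<longrightarrow> i + j = n"
    "\<forall>i j. Polynomial.coeff (Polynomial.coeff G i) j \<noteq> 0 \<longrightarrow> i + j = n"
  assume "Polynomial.coeff (Polynomial.coeff (F + G) i) j \<noteq> 0"
  then have "Polynomial.coeff (Polynomial.coeff F i) j \<noteq> 0 \<or> Polynomial.coeff (Polynomial.coeff G i) j \<noteq> 0" by auto
  then show "i + j = n" using * by blast
qed

lemma homog3_minus: "homog3 n F \<Longrightarrow> homog3 n (- F :: 'a::comm_ring_1 form3)"
  unfolding homog3_def by simp

lemma homog2_minus: "homog2 n F \<Longrightarrow> homog2 n (- F :: 'a::comm_ring_1 form2)"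
  unfolding homog2_def by simp

lemma homog3_sum: "(\<And>i. i \<in> I \<Longrightarrow> homog3 n (F i)) \<Longrightarrow> homog3 n (\<Sum>i\<in>I. F i)"
  by (induction I rule: infinite_finite_induct) (auto intro: homog3_add)

lemma homog2_sum: "(\<And>i. i \<in> I \<Longrightarrow> homog2 n (F i)) \<Longrightarrow> homog2 n (\<Sum>i\<in>I. F i)"
  by (induction I rule: infinite_finite_induct) (auto intro: homog2_add)

lemma homog3_mult:
  fixes F G :: "'a::comm_ring_1 form3"
  assumes "homog3 m F" "homog3 n G" shows "homog3 (m + n) (F * G)"
  unfolding homog3_def
proof (intro allI impI)
  fix i j k
  assume "Polynomial.coeff (Polynomial.coeff (Polynomial.coeff (F * G) i) j) k \<noteq> 0"
  then have "(\<Sum>a\<le>i. \<Sum>b\<le>j. \<Sum>c\<le>k. Polynomial.coeff (Polynomial.coeff (Polynomial.coeff F a) b) c *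
     Polynomial.coeff (Polynomial.coeff (Polynomial.coeff G (i - a)) (j - b)) (k - c)) \<noteq> 0"
    by (simp add: coeff_mult Polynomial.coeff_sum)
  then obtain a b c where abc: "a \<le> i" "b \<le> j" "c \<le> k"
     "Polynomial.coeff (Polynomial.coeff (Polynomial.coeff F a) b) c *
     Polynomial.coeff (Polynomial.coeff (Polynomial.coeff G (i - a)) (j - b)) (k - c) \<noteq> 0"
    by (meson atMost_iff sum.not_neutral_contains_not_neutral)
  then have "Polynomial.coeff (Polynomial.coeff (Polynomial.coeff F a) b) c \<noteq> 0"
     "Polynomial.coeff (Polynomial.coeff (Polynomial.coeff G (i - a)) (j - b)) (k - c) \<noteq> 0" by auto
  with assms have "a + b + c = m" "(i - a) + (j - b) + (k - c) = n" unfolding homog3_def by blast+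
  with abc show "i + j + k = m + n" by linarith
qed

lemma homog2_mult:
  fixes F G :: "'a::comm_ring_1 form2"
  assumes "homog2 m F" "homog2 n G" shows "homog2 (m + n) (F * G)"
  unfolding homog2_def
proof (intro allI impI)
  fix i j
  assume "Polynomial.coeff (Polynomial.coeff (F * G) i) j \<noteq> 0"
  then have "(\<Sum>a\<le>i. \<Sum>b\<le>j. Polynomial.coeff (Polynomial.coeff F a) b *
     Polynomial.coeff (Polynomial.coeff G (i - a)) (j - b)) \<noteq> 0"
    by (simp add: coeff_mult Polynomial.coeff_sum)
  then obtain a b where abc: "a \<le> i" "b \<le> j"
     "Polynomial.coeff (Polynomial.coeff F a) b * Polynomial.coeff (Polynomial.coeff G (i - a)) (j - b) \<noteq> 0"
    by (meson atMost_iff sum.not_neutral_contains_not_neutral)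
  then have "Polynomial.coeff (Polynomial.coeff F a) b \<noteq> 0"
     "Polynomial.coeff (Polynomial.coeff G (i - a)) (j - b) \<noteq> 0" by auto
  with assms have "a + b = m" "(i - a) + (j - b) = n" unfolding homog2_def by blast+
  with abc show "i + j = m + n" by linarith
qed

lemma coeff_const_poly: "Polynomial.coeff [:c:] i = (if i = 0 then c else 0)"
  by (cases i) auto

lemma coeff_var_poly: "Polynomial.coeff [:0, c:] i = (if i = 1 then c else 0)"
  by (auto simp: coeff_pCons split: nat.splits)

lemma coeff_pCons_0_1: "Polynomial.coeff (pCons 0 (1 :: 'a::comm_ring_1 poly)) i = (if i = 1 then 1 else 0)"
  by (auto simp: coeff_pCons split: nat.splits)

lemma homog3_const3 [simp]: "homog3 0 (const3 c)" and homog2_const2 [simp]: "homog2 0 (const2 c)"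
  by (auto simp: homog3_def homog2_def const3_def const2_def coeff_const_poly split: if_splits)

lemma homog3_vars3 [simp]: "homog3 (Suc 0) (vars3 $ i)" and homog2_vars2 [simp]: "homog2 (Suc 0) (vars2 $ j)"
  by (auto simp: homog3_def homog2_def vars3_def vars2_def coeff_const_poly coeff_var_poly coeff_pCons_0_1 split: if_splits)

lemma homog3_const_mult: "homog3 n (F :: 'a::comm_ring_1 form3) \<Longrightarrow> homog3 n (const3 c * F)"
  using homog3_mult[of 0 "const3 c" n F] by simp

lemma homog2_const_mult: "homog2 n (F :: 'a::comm_ring_1 form2) \<Longrightarrow> homog2 n (const2 c * F)"
  using homog2_mult[of 0 "const2 c" n F] by simp

lemma const3_1 [simp]: "const3 1 = (1 :: 'a::comm_ring_1 form3)" and const2_1 [simp]: "const2 1 = (1 :: 'a::comm_ring_1 form2)"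
  by (simp_all add: const3_def const2_def)

lemma homog3_1 [simp]: "homog3 0 (1 :: 'a::comm_ring_1 form3)" and homog2_1 [simp]: "homog2 0 (1 :: 'a::comm_ring_1 form2)"
  using homog3_const3[of "1 :: 'a"] homog2_const2[of "1 :: 'a"] by simp_all

lemma homog3_power: "homog3 n F \<Longrightarrow> homog3 (n * k) (F ^ k :: 'a::comm_ring_1 form3)"
  by (induction k) (auto intro: homog3_mult)

lemma homog2_power: "homog2 n F \<Longrightarrow> homog2 (n * k) (F ^ k :: 'a::comm_ring_1 form2)"
  by (induction k) (auto intro: homog2_mult)

lemma homog3_lin_forms [simp]: "homog3 (Suc 0) (lin_forms A $ i)"
  by (auto simp: lin_forms_def intro!: homog3_sum homog3_const_mult)

lemma homog3_eval3:
  assumes "homog3 n F" "\<And>i. homog3 m (\<phi> $ i)"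
  shows "homog3 (m * n) (eval3 const3 F \<phi>)"
  unfolding eval3_sum[OF comm_ring_hom_const3]
proof (intro homog3_sum)
  fix i j k
  let ?c = "Polynomial.coeff (Polynomial.coeff (Polynomial.coeff F i) j) k"
  show "homog3 (m * n) (const3 ?c * \<phi> $ 1 ^ i * \<phi> $ 2 ^ j * \<phi> $ 3 ^ k)"
  proof (cases "?c = 0")
    case False
    then have "i + j + k = n" using assms by (auto simp: homog3_def)
    then have "m * n = 0 + m * i + m * j + m * k" by (auto simp: algebra_simps)
    then show ?thesis by (simp only:) (intro homog3_mult homog3_power homog3_const3 assms)
  qed (simp add: const3_def)
qed

lemma homog3_eval2:
  assumes "homog2 n F" "\<And>i. homog3 m (\<phi> $ i)"
  shows "homog3 (m * n) (eval2 const3 F \<phi>)"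
  unfolding eval2_sum[OF comm_ring_hom_const3]
proof (intro homog3_sum)
  fix i j
  let ?c = "Polynomial.coeff (Polynomial.coeff F i) j"
  show "homog3 (m * n) (const3 ?c * \<phi> $ 1 ^ i * \<phi> $ 2 ^ j)"
  proof (cases "?c = 0")
    case False
    then have "i + j = n" using assms by (auto simp: homog2_def)
    then have "m * n = 0 + m * i + m * j" by (auto simp: algebra_simps)
    then show ?thesis by (simp only:) (intro homog3_mult homog3_power homog3_const3 assms)
  qed (simp add: const3_def)
qed

lemma homog2_eval2:
  assumes "homog2 n F" "\<And>i. homog2 m (\<phi> $ i)"
  shows "homog2 (m * n) (eval2 const2 F \<phi>)"
  unfolding eval2_sum[OF comm_ring_hom_const2]
proof (intro homog2_sum)
  fix i j
  let ?c = "Polynomial.coeff (Polynomial.coeff F i) j"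
  show "homog2 (m * n) (const2 ?c * \<phi> $ 1 ^ i * \<phi> $ 2 ^ j)"
  proof (cases "?c = 0")
    case False
    then have "i + j = n" using assms by (auto simp: homog2_def)
    then have "m * n = 0 + m * i + m * j" by (auto simp: algebra_simps)
    then show ?thesis by (simp only:) (intro homog2_mult homog2_power homog2_const2 assms)
  qed (simp add: const2_def)
qed

text \<open>The substitution \<open>v \<mapsto> t v\<close>, with \<open>t\<close> a new outermost variable.\<close>

definition scale_form :: "'a::idom form3 \<Rightarrow> 'a form3 poly" where
  "scale_form F = eval3 (\<lambda>c. [:const3 c:]) F (\<chi> i. [:0, vars3 $ i:])"

lemma comm_ring_hom_const_poly: "comm_ring_hom (\<lambda>c. [:c:])"
  by (rule comm_ring_hom_I) auto

lemma comm_ring_hom_scale_form: "comm_ring_hom scale_form"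
  unfolding scale_form_def
  by (intro comm_ring_hom_eval3 comm_ring_hom_comp[OF comm_ring_hom_const_poly comm_ring_hom_const3])

lemma scale_form_homog: "homog3 n F \<Longrightarrow> scale_form F = Polynomial.monom F n"
proof -
  assume F: "homog3 n F"
  let ?h = "\<lambda>c. [:const3 c:] :: 'a form3 poly"
  have h: "comm_ring_hom ?h" by (rule comm_ring_hom_comp[OF comm_ring_hom_const_poly comm_ring_hom_const3])
  have *: "(\<chi> i. [:0, vars3 $ i:] :: ('a form3 poly) ^ 3) = ([:0, 1:] *s (\<chi> i. [:vars3 $ i:]) :: ('a form3 poly) ^ 3)"
    by (simp add: Finite_Cartesian_Product.vec_eq_iff vector_scalar_mult_def)
  have "scale_form F = [:0, 1:] ^ n * eval3 ?h F (\<chi> i. [:vars3 $ i:])"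
    by (simp only: scale_form_def * homog3_scale[OF h F])
  also have "eval3 ?h F (\<chi> i. [:vars3 $ i:]) = [:F:]"
    using hom_eval3[OF comm_ring_hom_const_poly comm_ring_hom_const3, where v = vars3 and F = F] by simp
  also have "[:0, 1:] ^ n * [:F:] = Polynomial.monom F n"
    by (simp add: mult.commute monom_altdef)
  finally show ?thesis .
qed

text \<open>\<open>scale_form\<close> turns a form of degree \<open>n\<close> into a monomial of
  degree \<open>n\<close> in the new variable. Comparing coefficients in \<open>G = F * q\<close>
  gives the inequality; for equal degrees only the constant term of the scaled cofactor is left, and
  this is the value of \<open>q\<close> at the origin.\<close>

lemma homog3_dvd:
  fixes F G :: "'a::idom form3"
  assumes "homog3 m F" "homog3 n G" "F dvd G" "G \<noteq> 0"
  shows "m \<le> n" and "m = n \<Longrightarrow> \<exists>c. c \<noteq> 0 \<and> G = const3 c * F"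
proof -
  obtain q where q: "G = F * q" using assms by auto
  interpret s: comm_ring_hom scale_form by (rule comm_ring_hom_scale_form)
  have eq: "Polynomial.monom G n = Polynomial.monom F m * scale_form q"
    using s.hom_mult[of F q] by (simp add: q[symmetric] scale_form_homog[OF assms(1)] scale_form_homog[OF assms(2)])
  have c: "Polynomial.coeff (Polynomial.monom G n) n = (if m \<le> n then F * Polynomial.coeff (scale_form q) (n - m) else 0)"
    unfolding eq by (simp add: coeff_monom_mult)
  then show mn: "m \<le> n" using assms by (auto split: if_splits)
  have "F \<noteq> 0" using assms by auto
  assume "m = n"
  then have "G = F * Polynomial.coeff (scale_form q) 0" using c by simp
  then have "q = Polynomial.coeff (scale_form q) 0" using q \<open>F \<noteq> 0\<close> by simp
  also have "\<dots> = poly (scale_form q) 0" by (simp add: poly_0_coeff_0)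
  also have "\<dots> = eval3 const3 q 0"
  proof -
    have p: "comm_ring_hom (\<lambda>p. poly p (0 :: 'a form3))" by (rule comm_ring_hom_I) auto
    have h: "comm_ring_hom (\<lambda>c. [:const3 c:] :: 'a form3 poly)"
      by (rule comm_ring_hom_comp[OF comm_ring_hom_const_poly comm_ring_hom_const3])
    show ?thesis unfolding scale_form_def hom_eval3[OF p h] by simp
  qed
  also have "\<dots> = const3 (eval3 (\<lambda>c. c) q 0)"
    using hom_eval3[OF comm_ring_hom_const3 comm_ring_hom_ident, where F = q and v = 0] by simp
  finally have *: "q = const3 (eval3 (\<lambda>c. c) q 0)" .
  then have "eval3 (\<lambda>c. c) q 0 \<noteq> 0" using q assms by (auto simp: const3_def)
  with * q show "\<exists>c. c \<noteq> 0 \<and> G = const3 c * F" by (intro exI[of _ "eval3 (\<lambda>c. c) q 0"]) (simp add: mult.commute)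
qed

subsection \<open>The gradient\<close>

lemma pderiv_map_poly_add: "map_poly pderiv (p + q) = map_poly pderiv p + map_poly pderiv (q :: 'a::idom poly poly)"
  by (rule poly_eqI) (simp add: coeff_map_poly pderiv_add)

lemma pderiv_map_poly_mult: "map_poly pderiv (p * q) = map_poly pderiv p * q + p * map_poly pderiv (q :: 'a::idom poly poly)"
proof -
  have *: "pderiv (a * b) = pderiv a * b + a * pderiv b" for a b :: "'a poly"
    by (simp add: pderiv_mult mult.commute)
  show ?thesis
    by (rule poly_eqI) (simp only: coeff_map_poly pderiv_0 coeff_mult pderiv_sum * Polynomial.coeff_add sum.distrib)
qed

lemma pderiv_map_poly2_add: "map_poly (map_poly pderiv) (p + q) = map_poly (map_poly pderiv) p + map_poly (map_poly pderiv) (q :: 'a::idom poly poly poly)"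
  by (rule poly_eqI) (simp add: coeff_map_poly pderiv_map_poly_add)

lemma pderiv_map_poly_sum: "map_poly pderiv (\<Sum>i\<in>I. f i) = (\<Sum>i\<in>I. map_poly pderiv (f i :: 'a::idom poly poly))"
  by (induction I rule: infinite_finite_induct) (auto simp: pderiv_map_poly_add)

lemma pderiv_map_poly2_mult: "map_poly (map_poly pderiv) (p * q) = map_poly (map_poly pderiv) p * q + p * map_poly (map_poly pderiv) (q :: 'a::idom poly poly poly)"
  by (rule poly_eqI)
     (simp only: coeff_map_poly map_poly_0 coeff_mult pderiv_map_poly_sum pderiv_map_poly_mult Polynomial.coeff_add sum.distrib)

lemma gradient_add: "gradient (F + G) $ i = gradient F $ i + gradient G $ i"
  by (simp add: gradient_def pderiv_add pderiv_map_poly_add pderiv_map_poly2_add)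

lemma gradient_mult: "gradient (F * G) $ i = gradient F $ i * G + F * gradient G $ i"
  by (simp add: gradient_def pderiv_mult pderiv_map_poly_mult pderiv_map_poly2_mult algebra_simps)

lemma gradient_const3 [simp]: "gradient (const3 c) $ i = 0"
  by (simp add: gradient_def const3_def pderiv_pCons map_poly_const_poly)

lemma gradient_vars3: "gradient (vars3 $ j) $ i = (if i = j then 1 else 0)"
  using exhaust_3[of i] exhaust_3[of j]
  by (auto simp: gradient_def vars3_def pderiv_pCons map_poly_pCons map_poly_const_poly map_poly_one_poly)

lemma gradient_sum: "gradient (\<Sum>j\<in>I. f j) $ i = (\<Sum>j\<in>I. gradient (f j) $ i)"
proof (induction I rule: infinite_finite_induct)
  case empty show ?case using gradient_const3[of 0 i] by (simp add: const3_def)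
next
  case (infinite A) then show ?case using gradient_const3[of 0 i] by (simp add: const3_def)
qed (simp add: gradient_add)

lemma gradient_lin_forms: "gradient (lin_forms A $ j) $ i = const3 (A $ j $ i)"
proof -
  have "gradient (lin_forms A $ j) $ i = (\<Sum>k\<in>UNIV. if i = k then const3 (A $ j $ k) else 0)"
    unfolding lin_forms_def vec_lambda_beta gradient_sum
    by (intro sum.cong refl) (simp add: gradient_mult gradient_vars3)
  then show ?thesis by simp
qed

text \<open>The chain rule. Both sides are additive and satisfy the product rule in
  \<open>F\<close>, so the generators suffice.\<close>

lemma gradient_comp:
  "gradient (eval3 const3 F \<phi>) $ i = (\<Sum>j\<in>UNIV. eval3 const3 (gradient F $ j) \<phi> * gradient (\<phi> $ j) $ i)"
proof -
  interpret e: comm_ring_hom "\<lambda>F. eval3 const3 F \<phi>" by (rule comm_ring_hom_eval3[OF comm_ring_hom_const3])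
  show ?thesis
  proof (induction F rule: form3_induct)
    case (const c) show ?case by (simp add: eval3_const3[OF comm_ring_hom_const3])
  next
    case (var k)
    have "(\<Sum>j\<in>UNIV. eval3 const3 (gradient (vars3 $ k) $ j) \<phi> * gradient (\<phi> $ j) $ i)
      = (\<Sum>j\<in>UNIV. if j = k then gradient (\<phi> $ j) $ i else 0)"
      by (intro sum.cong) (auto simp: gradient_vars3)
    then show ?case by (simp add: comm_ring_hom_const3)
  qed (simp_all add: gradient_add gradient_mult e.hom_add e.hom_mult sum.distrib sum_distrib_left sum_distrib_right algebra_simps)
qed

lemma coeff_pderiv_var: "Polynomial.coeff ([:0, 1:] * pderiv F) i = of_nat i * Polynomial.coeff (F :: 'a::idom poly) i"
  by (cases i) (simp_all add: coeff_pderiv)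

lemma coeff_const_mult: "Polynomial.coeff ([:c:] * (p :: 'a::comm_ring_1 poly)) n = c * Polynomial.coeff p n"
  by simp

text \<open>Euler's relation, checked on coefficients: a variable times its partial derivative
  multiplies each monomial by the exponent of that variable.\<close>

lemma euler3:
  assumes "homog3 n F"
  shows "(\<Sum>i\<in>UNIV. vars3 $ i * gradient F $ i) = of_nat n * F"
proof (rule poly_eqI, rule poly_eqI, rule poly_eqI)
  fix i j k
  let ?c = "Polynomial.coeff (Polynomial.coeff (Polynomial.coeff F i) j) k"
  have onat: "Polynomial.coeff (Polynomial.coeff (of_nat a * b) c) d = of_nat a * Polynomial.coeff (Polynomial.coeff b c) d" for a c d and b :: "'a poly poly"
    by (simp add: of_nat_poly)
  have onat3: "Polynomial.coeff (Polynomial.coeff (Polynomial.coeff (of_nat a * G) i) j) k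
      = of_nat a * Polynomial.coeff (Polynomial.coeff (Polynomial.coeff G i) j) k" for a and G :: "'a form3"
    by (simp add: of_nat_poly)
  have onat1: "Polynomial.coeff (of_nat a * b) d = of_nat a * Polynomial.coeff b d" for a d and b :: "'a poly"
    by (simp add: of_nat_poly)
  have 1: "Polynomial.coeff (Polynomial.coeff (Polynomial.coeff (vars3 $ 1 * gradient F $ 1) i) j) k = of_nat i * ?c"
  proof -
    have "vars3 $ 1 = ([:0,1:] :: 'a form3)" "gradient F $ 1 = pderiv F" by (simp_all add: vars3_def gradient_def)
    then show ?thesis by (simp only: coeff_pderiv_var onat)
  qed
  have 2: "Polynomial.coeff (Polynomial.coeff (Polynomial.coeff (vars3 $ 2 * gradient F $ 2) i) j) k = of_nat j * ?c"
  proof -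
    have "vars3 $ 2 = ([:[:0,1:]:] :: 'a form3)" "gradient F $ 2 = map_poly pderiv F" by (simp_all add: vars3_def gradient_def)
    then show ?thesis by (simp only: coeff_const_mult coeff_map_poly pderiv_0 coeff_pderiv_var onat1)
  qed
  have 3: "Polynomial.coeff (Polynomial.coeff (Polynomial.coeff (vars3 $ 3 * gradient F $ 3) i) j) k = of_nat k * ?c"
  proof -
    have "vars3 $ 3 = ([:[:[:0,1:]:]:] :: 'a form3)" "gradient F $ 3 = map_poly (map_poly pderiv) F" by (simp_all add: vars3_def gradient_def)
    then show ?thesis by (simp only: coeff_const_mult coeff_map_poly pderiv_0 map_poly_0 coeff_pderiv_var)
  qed
  have "Polynomial.coeff (Polynomial.coeff (Polynomial.coeff (\<Sum>i\<in>UNIV. vars3 $ i * gradient F $ i) i) j) k = of_nat (i + j + k) * ?c"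
    unfolding sum_3 Polynomial.coeff_add 1 2 3 by (simp add: algebra_simps)
  also have "\<dots> = of_nat n * ?c" using assms by (cases "?c = 0") (auto simp: homog3_def)
  also have "\<dots> = Polynomial.coeff (Polynomial.coeff (Polynomial.coeff (of_nat n * F) i) j) k" by (rule onat3[symmetric])
  finally show "Polynomial.coeff (Polynomial.coeff (Polynomial.coeff (\<Sum>i\<in>UNIV. vars3 $ i * gradient F $ i) i) j) k = \<dots>" .
qed

lemma homog3_gradient:
  assumes "homog3 n F" "n > 0" shows "homog3 (n - 1) (gradient F $ i)"
proof -
  have "Polynomial.coeff (Polynomial.coeff (Polynomial.coeff F (a + (if i = 1 then 1 else 0)))
     (b + (if i = 2 then 1 else 0))) (c + (if i = 3 then 1 else 0)) \<noteq> 0"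
    if "Polynomial.coeff (Polynomial.coeff (Polynomial.coeff (gradient F $ i) a) b) c \<noteq> 0" for a b c
    using that exhaust_3[of i] by (auto simp: gradient_def coeff_pderiv coeff_map_poly of_nat_poly simp flip: of_nat_Suc)
  then show ?thesis using assms exhaust_3[of i] unfolding homog3_def by (fastforce split: if_splits)
qed

section \<open>Generic points\<close>

text \<open>The coefficients form no field, so an element \<open>g\<close> of least degree in the
  ideal of \<open>F\<close> and \<open>b\<close> divides the others only after multiplication by a
  constant (pseudo-division). If \<open>g\<close> had positive degree, the prime \<open>F\<close>
  would divide \<open>g\<close>, and then a constant multiple of \<open>b\<close>, hence
  \<open>b\<close>.\<close>

lemma irreducible_coprime_bezout:
  fixes F b :: "'r::ufd poly"
  assumes F: "Factorial_Ring.irreducible F" "Polynomial.degree F > 0" and nd: "\<not> F dvd b"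
  shows "\<exists>u v e. e \<noteq> 0 \<and> u * F + v * b = [:e:]"
proof -
  have prime: "prime_elem F" using F by simp
  define I where "I = {g. g \<noteq> 0 \<and> (\<exists>u v. g = u * F + v * b)}"
  have "F \<noteq> 0" using F by auto
  then have "F = 1 * F + 0 * b" by simp
  then have "F \<in> I" unfolding I_def using \<open>F \<noteq> 0\<close> by blast
  then obtain g where g: "g \<in> I" and min: "\<And>f. f \<in> I \<Longrightarrow> Polynomial.degree g \<le> Polynomial.degree f"
    using ex_has_least_nat[of "\<lambda>g. g \<in> I" F Polynomial.degree] by auto
  then obtain u v where uv: "g = u * F + v * b" and "g \<noteq> 0" unfolding I_def by auto
  have div: "\<exists>e q. e \<noteq> 0 \<and> smult e f = g * q" if f: "\<exists>u v. f = u * F + v * b" for f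
  proof -
    obtain q r where qr: "pseudo_divmod f g = (q, r)" by force
    define e where "e = Polynomial.lead_coeff g ^ (Suc (Polynomial.degree f) - Polynomial.degree g)"
    have e: "e \<noteq> 0" unfolding e_def using \<open>g \<noteq> 0\<close> by simp
    have *: "smult e f = g * q + r" "r = 0 \<or> Polynomial.degree r < Polynomial.degree g"
      using pseudo_divmod[OF \<open>g \<noteq> 0\<close> qr] by (simp_all add: e_def)
    obtain u' v' where f': "f = u' * F + v' * b" using f by blast
    have "r = smult e f - g * q" using * by simp
    also have "\<dots> = (smult e u' - u * q) * F + (smult e v' - v * q) * b"
      by (simp add: uv f' smult_add_right algebra_simps)
    finally have r: "r = (smult e u' - u * q) * F + (smult e v' - v * q) * b" .
    have "r = 0"
    proof (rule ccontr)
      assume "r \<noteq> 0"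
      then have "r \<in> I" unfolding I_def using r by blast
      then have "Polynomial.degree g \<le> Polynomial.degree r" by (rule min)
      with *(2) \<open>r \<noteq> 0\<close> show False by simp
    qed
    then have "smult e f = g * q" using *(1) by simp
    then show ?thesis using e by blast
  qed
  have "Polynomial.degree g = 0"
  proof (rule ccontr)
    assume deg: "Polynomial.degree g \<noteq> 0"
    have "\<exists>u v. F = u * F + v * b" by (rule exI[of _ 1], rule exI[of _ 0]) simp
    from div[OF this] obtain e q where eq: "e \<noteq> 0" "smult e F = g * q" by blast
    have "F dvd g * q" unfolding eq(2)[symmetric] by (rule dvd_smult) simp
    have "F dvd g"
    proof (rule ccontr)
      assume "\<not> F dvd g"
      then have "F dvd q" using prime_elem_dvd_multD[OF prime \<open>F dvd g * q\<close>] by simp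
      have "q \<noteq> 0" using eq \<open>F \<noteq> 0\<close> by auto
      then have "Polynomial.degree F \<le> Polynomial.degree q" using \<open>F dvd q\<close> by (simp add: dvd_imp_degree_le)
      moreover have "Polynomial.degree F = Polynomial.degree g + Polynomial.degree q"
        using arg_cong[OF eq(2), of Polynomial.degree] eq(1) \<open>q \<noteq> 0\<close> \<open>g \<noteq> 0\<close> by (simp add: degree_mult_eq)
      ultimately show False using deg by simp
    qed
    have "\<exists>u v. b = u * F + v * b" by (rule exI[of _ 0], rule exI[of _ 1]) simp
    from div[OF this] obtain e' q' where eq': "e' \<noteq> 0" "smult e' b = g * q'" by blast
    have "[:e':] * b = g * q'" using eq' by simp
    then have "F dvd [:e':] * b" using \<open>F dvd g\<close> by simp
    from prime_elem_dvd_multD[OF prime this] have "F dvd [:e':]" using nd by simp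
    then have "Polynomial.degree F \<le> Polynomial.degree [:e':]" using eq'(1) by (intro dvd_imp_degree_le) auto
    then show False using F(2) by simp
  qed
  then obtain e where "g = [:e:]" by (rule degree_eq_zeroE)
  then show ?thesis using uv \<open>g \<noteq> 0\<close> by (intro exI[of _ u] exI[of _ v] exI[of _ e]) auto
qed

text \<open>
  The algebraic closure of \<open>K(Y,Z)\<close>.  If \<open>x\<close> is a root of \<open>G(X,Y,Z)\<close> in it, then \<open>(x : Y : Z)\<close> is a
  generic point of the curve \<open>G = 0\<close>: a form vanishes there if and only if \<open>G\<close> divides it.
\<close>

type_synonym 'a gen = "'a poly poly fract alg_closure"

definition emb :: "'a::field poly poly \<Rightarrow> 'a gen" where
  "emb a = to_ac (to_fract a)"

definition kemb :: "'a::field \<Rightarrow> 'a gen" where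
  "kemb c = emb (const2 c)"

lemma comm_ring_hom_emb: "comm_ring_hom emb"
  by (rule comm_ring_hom_I) (auto simp: emb_def)

lemma emb_eq_0_iff [simp]: "emb a = 0 \<longleftrightarrow> a = 0"
  by (simp add: emb_def)

lemma comm_ring_hom_kemb: "comm_ring_hom kemb"
  unfolding kemb_def by (rule comm_ring_hom_comp[OF comm_ring_hom_emb comm_ring_hom_const2])

lemma kemb_eq_0_iff [simp]: "kemb c = 0 \<longleftrightarrow> c = 0"
  by (simp add: kemb_def const2_def)

definition gpt :: "'a::field gen \<Rightarrow> 'a gen ^ 3" where
  "gpt x = (\<chi> i. if i = 1 then x else if i = 2 then emb (vars2 $ 1) else emb (vars2 $ 2))"

lemma gpt_nth [simp]: "gpt x $ 1 = x" "gpt x $ 2 = emb (vars2 $ 1)" "gpt x $ 3 = emb (vars2 $ 2)"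
  by (simp_all add: gpt_def)

lemma eval2_emb: "eval2 kemb a (\<chi> i. emb (vars2 $ i)) = emb a"
  by (rule form2_hom_unique[OF comm_ring_hom_eval2[OF comm_ring_hom_kemb] comm_ring_hom_emb])
     (auto simp: comm_ring_hom_kemb kemb_def)

lemma eval3_gpt: "eval3 kemb F (gpt x) = poly (map_poly emb F) x"
proof -
  have "(\<chi> i. gpt x $ (if i = 1 then 2 else 3)) = ((\<chi> i. emb (vars2 $ i)) :: 'a gen ^ 2)"
    by (auto simp: Finite_Cartesian_Product.vec_eq_iff forall_2)
  then show ?thesis by (simp add: eval3_in_form2[OF comm_ring_hom_kemb] eval2_emb)
qed

lemma form2_nonzero_point:
  fixes a :: "'a::field_char_0 form2"
  assumes "a \<noteq> 0" shows "\<exists>w. eval2 (\<lambda>c. c) a w \<noteq> 0"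
proof -
  have inf: "\<exists>z. poly q z \<noteq> 0" if "q \<noteq> 0" for q :: "'a poly"
  proof (rule ccontr)
    assume "\<not> (\<exists>z. poly q z \<noteq> 0)"
    then have "{z. poly q z = 0} = UNIV" by auto
    then show False using poly_roots_finite[OF that] infinite_UNIV_char_0[where 'a = 'a] by simp
  qed
  obtain z where z: "poly (Polynomial.lead_coeff a) z \<noteq> 0" using inf[of "Polynomial.lead_coeff a"] assms by auto
  define q where "q = map_poly (\<lambda>g. poly g z) a"
  have "Polynomial.coeff q (Polynomial.degree a) \<noteq> 0" using z by (simp add: q_def coeff_map_poly)
  then have "q \<noteq> 0" by auto
  then obtain y where "poly q y \<noteq> 0" using inf by blast
  then show ?thesis by (intro exI[of _ "\<chi> i. if i = 1 then y else z"]) (simp add: eval2_def q_def map_poly_idI)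
qed

text \<open>A Nullstellensatz for irreducible plane curves. If \<open>F\<close> did not divide
  \<open>b\<close>, a Bezout relation would express a nonzero binary form \<open>e\<close> through
  \<open>F\<close> and \<open>b\<close>; over a point of the line where \<open>e\<close> is nonzero
  the curve still has a point, and \<open>b\<close> would vanish there.\<close>

lemma vanish_imp_dvd:
  fixes F b :: "'a::{alg_closed_field, field_char_0} form3"
  assumes F: "Factorial_Ring.irreducible F" "Polynomial.degree F > 0" and b: "vanishes_on b (zero_locus F)"
  shows "F dvd b"
proof (rule ccontr)
  assume "\<not> F dvd b"
  then obtain u v e where e: "e \<noteq> 0" "u * F + v * b = [:e:]" using irreducible_coprime_bezout[OF F, of b] by blast
  have "F \<noteq> 0" using F by auto
  \<comment> \<open>The point \<open>w\<close> must avoid three things: zeros of \<open>e\<close>,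
    for the contradiction; zeros of the leading coefficient, so that the specialised
    \<open>F\<close> keeps its degree and has a root; and a zero second coordinate, so that the
    resulting vector is a point.\<close>
  then have "e * Polynomial.lead_coeff F * vars2 $ 2 \<noteq> 0" using e by (simp add: vars2_def)
  then obtain w where w: "eval2 (\<lambda>c. c) (e * Polynomial.lead_coeff F * vars2 $ 2) w \<noteq> 0" using form2_nonzero_point by blast
  interpret w: comm_ring_hom "\<lambda>a. eval2 (\<lambda>c. c) a w" by (rule comm_ring_hom_eval2[OF comm_ring_hom_ident])
  have w': "eval2 (\<lambda>c. c) e w \<noteq> 0" "eval2 (\<lambda>c. c) (Polynomial.lead_coeff F) w \<noteq> 0" "w $ 2 \<noteq> 0"
    using w by (auto simp: w.hom_mult eval2_vars2[OF comm_ring_hom_ident])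
  define q where "q = map_poly (\<lambda>a. eval2 (\<lambda>c. c) a w) F"
  have "Polynomial.coeff q (Polynomial.degree F) \<noteq> 0" using w' by (simp add: q_def coeff_map_poly)
  then have "Polynomial.degree q > 0" using F(2) le_degree by fastforce
  then obtain x where x: "poly q x = 0" using alg_closed_imp_poly_has_root by blast
  define p where "p = (\<chi> i::3. if i = 1 then x else if i = 2 then w $ 1 else w $ 2)"
  have ww: "(\<chi> i. p $ (if i = 1 then 2 else 3)) = w"
    by (auto simp: Finite_Cartesian_Product.vec_eq_iff forall_2 p_def)
  have "form_at F p = 0" using x by (simp add: eval3_in_form2[OF comm_ring_hom_ident] ww) (simp add: p_def q_def)
  moreover have "p \<noteq> 0"
  proof
    assume "p = 0"
    then have "p $ 3 = 0" by simp
    then show False using w'(3) by (simp add: p_def)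
  qed
  ultimately have "p \<in> zero_locus F" by (simp add: zero_locus_def)
  then have "form_at b p = 0" using b by (simp add: vanishes_on_def)
  interpret p: comm_ring_hom "\<lambda>a. form_at a p" by (rule comm_ring_hom_eval3[OF comm_ring_hom_ident])
  have "form_at [:e:] p = 0" using arg_cong[OF e(2), of "\<lambda>a. form_at a p"] \<open>form_at F p = 0\<close> \<open>form_at b p = 0\<close>
    by (simp add: p.hom_add p.hom_mult)
  moreover have "form_at [:e:] p = eval2 (\<lambda>c. c) e w"
    unfolding eval3_in_form2[OF comm_ring_hom_ident] ww by (simp add: map_poly_const_poly)
  ultimately show False using w'(1) by simp
qed

text \<open>The same Bezout relation is evaluated at a root over \<open>K(Y,Z)\<close>, where the
  nonzero form \<open>e\<close> stays nonzero.\<close>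

lemma gpt_zero_imp_dvd:
  assumes F: "Factorial_Ring.irreducible F" "Polynomial.degree F > 0" "poly (map_poly emb F) x = 0"
    and b: "poly (map_poly emb b) x = 0"
  shows "F dvd b"
proof (rule ccontr)
  assume "\<not> F dvd b"
  then obtain u v e where e: "e \<noteq> 0" "u * F + v * b = [:e:]" using irreducible_coprime_bezout[OF F(1,2), of b] by blast
  interpret p: comm_ring_hom "\<lambda>a. poly (map_poly emb a) x" by (rule comm_ring_hom_poly_map[OF comm_ring_hom_emb])
  have "poly (map_poly emb [:e:]) x = 0" using arg_cong[OF e(2), of "\<lambda>a. poly (map_poly emb a) x"] F(3) b
    by (simp add: p.hom_add p.hom_mult)
  then show False using e(1) by (simp add: map_poly_const_poly)
qed

section \<open>Linear substitutions of the coordinates\<close>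

definition subst_mat :: "'a::comm_ring_1 form3 \<Rightarrow> 'a ^ 3 ^ 3 \<Rightarrow> 'a form3" where
  "subst_mat F M = eval3 const3 F (lin_forms M)"

lemma comm_ring_hom_subst_mat: "comm_ring_hom (\<lambda>F. subst_mat F M)"
  unfolding subst_mat_def by (rule comm_ring_hom_eval3[OF comm_ring_hom_const3])

lemma eval3_subst_mat:
  assumes "comm_ring_hom h" shows "eval3 h (subst_mat F M) v = eval3 h F (hmat h M *v v)"
  by (simp add: subst_mat_def eval3_eval3[OF assms] eval3_lin_forms_vec[OF assms])

lemma form_at_subst_mat: "form_at (subst_mat F M) v = form_at F (M *v v)"
  using eval3_subst_mat[OF comm_ring_hom_ident, of F M v] by simp

lemma lin_forms_mat_1: "lin_forms (mat 1) = (vars3 :: 'a::comm_ring_1 form3 ^ 3)"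
proof -
  have "lin_forms (mat 1) $ i = (\<Sum>j\<in>UNIV. if j = i then vars3 $ j else (0 :: 'a form3))" for i :: 3
    unfolding lin_forms_def vec_lambda_beta by (intro sum.cong refl) (auto simp: Finite_Cartesian_Product.mat_def)
  then show ?thesis by (simp add: Finite_Cartesian_Product.vec_eq_iff)
qed

lemma subst_mat_subst_mat: "subst_mat (subst_mat F M) N = subst_mat F (M ** N)"
proof -
  interpret c: comm_ring_hom const3 by (rule comm_ring_hom_const3)
  have "eval3 const3 (lin_forms M $ i) (lin_forms N) = lin_forms (M ** N) $ i" for i
  proof -
    have "eval3 const3 (lin_forms M $ i) (lin_forms N) = (\<Sum>j\<in>UNIV. const3 (M $ i $ j) * lin_forms N $ j)"
      by (rule eval3_lin_forms[OF comm_ring_hom_const3])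
    also have "\<dots> = (\<Sum>j\<in>UNIV. \<Sum>k\<in>UNIV. const3 (M $ i $ j) * const3 (N $ j $ k) * vars3 $ k)"
      by (simp add: lin_forms_def sum_distrib_left mult.assoc)
    also have "\<dots> = (\<Sum>k\<in>UNIV. \<Sum>j\<in>UNIV. const3 (M $ i $ j) * const3 (N $ j $ k) * vars3 $ k)"
      by (rule sum.swap)
    also have "\<dots> = lin_forms (M ** N) $ i"
      by (simp add: lin_forms_def matrix_matrix_mult_def c.hom_sum c.hom_mult sum_distrib_right)
    finally show ?thesis .
  qed
  then have "(\<chi> i. eval3 const3 (lin_forms M $ i) (lin_forms N)) = lin_forms (M ** N)"
    by (simp add: Finite_Cartesian_Product.vec_eq_iff)
  then show ?thesis by (simp add: subst_mat_def eval3_eval3[OF comm_ring_hom_const3])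
qed

lemma subst_mat_1 [simp]: "subst_mat F (mat 1) = F"
  by (simp add: subst_mat_def lin_forms_mat_1)

lemma homog3_subst_mat: "homog3 n F \<Longrightarrow> homog3 n (subst_mat F M)"
  using homog3_eval3[of n F 1 "lin_forms M"] by (simp add: subst_mat_def)

lemma irreducible_subst_mat:
  fixes F :: "'a::field form3"
  assumes "Factorial_Ring.irreducible F" "M ** N = mat 1"
  shows "Factorial_Ring.irreducible (subst_mat F M)"
proof -
  interpret M: comm_ring_hom "\<lambda>F. subst_mat F M" by (rule comm_ring_hom_subst_mat)
  interpret N: comm_ring_hom "\<lambda>F. subst_mat F N" by (rule comm_ring_hom_subst_mat)
  have NM: "N ** M = mat 1" using assms(2) by (simp add: matrix_left_right_inverse)
  have MN: "subst_mat (subst_mat f M) N = f" "subst_mat (subst_mat f N) M = f" for f :: "'a form3"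
    using assms(2) NM by (simp_all add: subst_mat_subst_mat)
  have unit: "a dvd 1" if u: "subst_mat a N dvd 1" for a :: "'a form3"
  proof -
    from u obtain b where "1 = subst_mat a N * b" by (rule dvdE)
    then have "subst_mat 1 M = subst_mat (subst_mat a N * b) M" by simp
    then have "1 = a * subst_mat b M" using MN by (simp add: M.hom_mult)
    then show ?thesis by (rule dvdI)
  qed
  show ?thesis
  proof (rule Factorial_Ring.irreducibleI)
    show "subst_mat F M \<noteq> 0" using MN(1)[of F] assms(1) by (auto simp: N.hom_zero)
    show "\<not> subst_mat F M dvd 1"
    proof
      assume "subst_mat F M dvd 1"
      then obtain b where "1 = subst_mat F M * b" by (rule dvdE)
      then have "subst_mat 1 N = subst_mat (subst_mat F M * b) N" by simp
      then have "1 = F * subst_mat b N" using MN by (simp add: N.hom_mult)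
      then have "F dvd 1" by (rule dvdI)
      then show False using Factorial_Ring.irreducible_not_unit[OF assms(1)] by simp
    qed
    fix a b assume ab: "subst_mat F M = a * b"
    then have "F = subst_mat a N * subst_mat b N" using MN(1)[of F] by (simp add: N.hom_mult)
    then have "subst_mat a N dvd 1 \<or> subst_mat b N dvd 1" by (rule Factorial_Ring.irreducibleD[OF assms(1)])
    then show "a dvd 1 \<or> b dvd 1" using unit by blast
  qed
qed

lemma hmat_inverse:
  assumes "comm_ring_hom h" "M ** N = mat 1"
  shows "hmat h M *v (hmat h N *v v) = v"
  by (simp add: matrix_vector_mul_assoc hmat_mult[OF assms(1), symmetric] assms(2) hmat_1[OF assms(1)])

lemma zero_locus_subst_mat:
  fixes M :: "'a::field ^ 3 ^ 3"
  assumes "M ** N = mat 1" shows "x \<in> zero_locus (subst_mat F M) \<longleftrightarrow> M *v x \<in> zero_locus F"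
proof -
  have "N ** M = mat 1" using assms by (simp add: matrix_left_right_inverse)
  then have "N *v (M *v x) = x" by (simp add: matrix_vector_mul_assoc)
  then have "x \<noteq> 0 \<longleftrightarrow> M *v x \<noteq> 0" by auto
  then show ?thesis by (simp add: zero_locus_def form_at_subst_mat)
qed

text \<open>Vanishing at all points of the curve and vanishing at one generic point are both
  equivalent to divisibility by \<open>F\<close>, so they can be exchanged. The matrix
  \<open>M\<close> allows coordinates in which \<open>F\<close> really involves the first
  variable.\<close>

theorem generic_point_curve:
  fixes F :: "'a::{alg_closed_field, field_char_0} form3"
  assumes F: "Factorial_Ring.irreducible F" and MN: "M ** N = mat 1"
    and deg: "Polynomial.degree (subst_mat F M) > 0" and x: "poly (map_poly emb (subst_mat F M)) x = 0"
  shows "eval3 kemb b (hmat kemb M *v gpt x) = 0 \<longleftrightarrow> F dvd b"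
    and "vanishes_on b (zero_locus F) \<longleftrightarrow> F dvd b"
proof -
  interpret M: comm_ring_hom "\<lambda>F. subst_mat F M" by (rule comm_ring_hom_subst_mat)
  interpret N: comm_ring_hom "\<lambda>F. subst_mat F N" by (rule comm_ring_hom_subst_mat)
  have NM: "N ** M = mat 1" using MN by (simp add: matrix_left_right_inverse)
  note irr = irreducible_subst_mat[OF F MN]
  have dvd: "F dvd b" if u: "subst_mat F M dvd subst_mat b M" for b
  proof -
    from u obtain q where "subst_mat b M = subst_mat F M * q" by (rule dvdE)
    then have "subst_mat (subst_mat b M) N = subst_mat (subst_mat F M) N * subst_mat q N" by (simp add: N.hom_mult)
    then show ?thesis using MN by (simp add: subst_mat_subst_mat)
  qed
  interpret e: comm_ring_hom "\<lambda>b. eval3 kemb b (hmat kemb M *v gpt x)" by (rule comm_ring_hom_eval3[OF comm_ring_hom_kemb])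
  have ev: "eval3 kemb b (hmat kemb M *v gpt x) = poly (map_poly emb (subst_mat b M)) x" for b
    by (simp add: eval3_subst_mat[OF comm_ring_hom_kemb, symmetric] eval3_gpt)
  show "eval3 kemb b (hmat kemb M *v gpt x) = 0 \<longleftrightarrow> F dvd b"
  proof
    assume "eval3 kemb b (hmat kemb M *v gpt x) = 0"
    then show "F dvd b" using gpt_zero_imp_dvd[OF irr deg x] ev dvd by simp
  next
    assume "F dvd b"
    then show "eval3 kemb b (hmat kemb M *v gpt x) = 0" using ev[of F] x by (auto simp: e.hom_mult)
  qed
  show "vanishes_on b (zero_locus F) \<longleftrightarrow> F dvd b"
  proof
    assume b: "vanishes_on b (zero_locus F)"
    have "vanishes_on (subst_mat b M) (zero_locus (subst_mat F M))"
      unfolding vanishes_on_def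
    proof
      fix y assume "y \<in> zero_locus (subst_mat F M)"
      then have "M *v y \<in> zero_locus F" using zero_locus_subst_mat[OF MN] by simp
      then show "form_at (subst_mat b M) y = 0" using b by (simp add: vanishes_on_def form_at_subst_mat)
    qed
    from dvd[OF vanish_imp_dvd[OF irr deg this]] show "F dvd b" .
  next
    assume "F dvd b"
    then obtain q where q: "b = F * q" by (rule dvdE)
    show "vanishes_on b (zero_locus F)" unfolding vanishes_on_def
    proof
      fix y assume "y \<in> zero_locus F"
      interpret y: comm_ring_hom "\<lambda>a. form_at a y" by (rule comm_ring_hom_eval3[OF comm_ring_hom_ident])
      show "form_at b y = 0" using \<open>y \<in> zero_locus F\<close> by (simp add: zero_locus_def q y.hom_mult)
    qed
  qed
qed

section \<open>Function fields as fields of values at a generic point\<close>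

abbreviation "RT \<equiv> ring_of_type_algebra"

lemma RT_simps [simp]:
  "carrier RT = UNIV" "x \<otimes>\<^bsub>RT\<^esub> y = x * y" "x \<oplus>\<^bsub>RT\<^esub> y = x + y" "\<one>\<^bsub>RT\<^esub> = 1" "\<zero>\<^bsub>RT\<^esub> = 0"
  by (simp_all add: ring_of_type_algebra_def)

lemma ring_RT: "Ring.ring (RT :: 'x::comm_ring_1 ring)"
  by (rule ring_from_type_algebra)

lemma field_RT: "Ring.field (RT :: 'x::field ring)"
  by (rule field_from_type_algebra)

lemma RT_minus [simp]: "\<ominus>\<^bsub>RT\<^esub> x = - (x :: 'x::comm_ring_1)"
proof -
  interpret R: Ring.ring "RT :: 'x ring" by (rule ring_RT)
  show ?thesis by (rule R.minus_equality) simp_all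
qed

lemma RT_inv: "x \<noteq> 0 \<Longrightarrow> inv\<^bsub>RT\<^esub> x = inverse (x :: 'x::field)"
proof -
  interpret R: Ring.ring "RT :: 'x ring" by (rule ring_RT)
  assume "x \<noteq> 0"
  then show ?thesis by (intro R.inv_char) simp_all
qed

lemma subring_RT:
  fixes S :: "'x::comm_ring_1 set"
  assumes "1 \<in> S" "\<And>x. x \<in> S \<Longrightarrow> - x \<in> S" "\<And>x y. x \<in> S \<Longrightarrow> y \<in> S \<Longrightarrow> x * y \<in> S"
    "\<And>x y. x \<in> S \<Longrightarrow> y \<in> S \<Longrightarrow> x + y \<in> S"
  shows "subring S RT"
proof -
  interpret R: Ring.ring "RT :: 'x ring" by (rule ring_RT)
  show ?thesis by (rule R.subringI) (simp_all add: assms)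
qed

lemma subfield_RT:
  fixes S :: "'x::field set"
  assumes "1 \<in> S" "\<And>x. x \<in> S \<Longrightarrow> - x \<in> S" "\<And>x y. x \<in> S \<Longrightarrow> y \<in> S \<Longrightarrow> x * y \<in> S"
    "\<And>x y. x \<in> S \<Longrightarrow> y \<in> S \<Longrightarrow> x + y \<in> S" "\<And>x. x \<in> S \<Longrightarrow> x \<noteq> 0 \<Longrightarrow> inverse x \<in> S"
  shows "subfield S RT"
proof -
  interpret R: Ring.field "RT :: 'x ring" by (rule field_RT)
  show ?thesis by (rule R.subfieldI'[OF subring_RT[OF assms(1-4)]]) (simp_all add: RT_inv assms)
qed

section \<open>Fields of values of homogeneous fractions of degree zero\<close>

definition rat3 :: "('a::field \<Rightarrow> 'w::field) \<Rightarrow> 'w ^ 3 \<Rightarrow> 'w set" where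
  "rat3 h \<xi> = {eval3 h a \<xi> / eval3 h b \<xi> | a b. (\<exists>n. homog3 n a \<and> homog3 n b) \<and> eval3 h b \<xi> \<noteq> 0}"

definition rat2 :: "('a::field \<Rightarrow> 'w::field) \<Rightarrow> 'w ^ 2 \<Rightarrow> 'w set" where
  "rat2 h w = {eval2 h a w / eval2 h b w | a b. (\<exists>n. homog2 n a \<and> homog2 n b) \<and> eval2 h b w \<noteq> 0}"

lemma rat3I: "homog3 n a \<Longrightarrow> homog3 n b \<Longrightarrow> eval3 h b \<xi> \<noteq> 0 \<Longrightarrow> eval3 h a \<xi> / eval3 h b \<xi> \<in> rat3 h \<xi>"
  unfolding rat3_def by blast

lemma rat2I: "homog2 n a \<Longrightarrow> homog2 n b \<Longrightarrow> eval2 h b \<xi> \<noteq> 0 \<Longrightarrow> eval2 h a \<xi> / eval2 h b \<xi> \<in> rat2 h \<xi>"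
  unfolding rat2_def by blast

lemma rat3E:
  assumes "x \<in> rat3 h \<xi>"
  obtains n a b where "homog3 n a" "homog3 n b" "eval3 h b \<xi> \<noteq> 0" "x = eval3 h a \<xi> / eval3 h b \<xi>"
  using assms unfolding rat3_def by blast

lemma rat2E:
  assumes "x \<in> rat2 h \<xi>"
  obtains n a b where "homog2 n a" "homog2 n b" "eval2 h b \<xi> \<noteq> 0" "x = eval2 h a \<xi> / eval2 h b \<xi>"
  using assms unfolding rat2_def by blast

lemma rat3_closed:
  fixes h :: "'a::field \<Rightarrow> 'w::field"
  assumes "comm_ring_hom h"
  shows "h c \<in> rat3 h \<xi>" "x \<in> rat3 h \<xi> \<Longrightarrow> - x \<in> rat3 h \<xi>" "x \<in> rat3 h \<xi> \<Longrightarrow> inverse x \<in> rat3 h \<xi>"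
    "x \<in> rat3 h \<xi> \<Longrightarrow> y \<in> rat3 h \<xi> \<Longrightarrow> x * y \<in> rat3 h \<xi>"
    "x \<in> rat3 h \<xi> \<Longrightarrow> y \<in> rat3 h \<xi> \<Longrightarrow> x + y \<in> rat3 h \<xi>"
proof -
  interpret e: comm_ring_hom "\<lambda>a. eval3 h a \<xi>" by (rule comm_ring_hom_eval3[OF assms])
  show c: "h c \<in> rat3 h \<xi>" for c
    using rat3I[of 0 "const3 c" 1 h \<xi>] assms by (simp add: e.hom_one)
  show "- x \<in> rat3 h \<xi>" if "x \<in> rat3 h \<xi>" for x
  proof -
    from that obtain n a b where "homog3 n a" "homog3 n b" "eval3 h b \<xi> \<noteq> 0" "x = eval3 h a \<xi> / eval3 h b \<xi>" by (rule rat3E)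
    then show ?thesis using rat3I[of n "- a" b h \<xi>] by (simp add: homog3_minus e.hom_uminus)
  qed
  show "inverse x \<in> rat3 h \<xi>" if "x \<in> rat3 h \<xi>" for x
  proof (cases "x = 0")
    case True then show ?thesis using that by simp
  next
    case False
    from that obtain n a b where "homog3 n a" "homog3 n b" "eval3 h b \<xi> \<noteq> 0" "x = eval3 h a \<xi> / eval3 h b \<xi>" by (rule rat3E)
    then show ?thesis using rat3I[of n b a h \<xi>] False by simp
  qed
  fix x y assume "x \<in> rat3 h \<xi>"
  then obtain n a b where 1: "homog3 n a" "homog3 n b" "eval3 h b \<xi> \<noteq> 0" "x = eval3 h a \<xi> / eval3 h b \<xi>" by (rule rat3E)
  assume "y \<in> rat3 h \<xi>"
  then obtain n' a' b' where 2: "homog3 n' a'" "homog3 n' b'" "eval3 h b' \<xi> \<noteq> 0" "y = eval3 h a' \<xi> / eval3 h b' \<xi>" by (rule rat3E)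
  have "eval3 h (a * a') \<xi> / eval3 h (b * b') \<xi> \<in> rat3 h \<xi>"
    using 1 2 by (intro rat3I[of "n + n'"] homog3_mult) (simp_all add: e.hom_mult)
  then show "x * y \<in> rat3 h \<xi>" using 1 2 by (simp add: e.hom_mult)
  have "homog3 (n + n') (a' * b)" using homog3_mult[OF 2(1) 1(2)] by (simp add: add.commute)
  then have "eval3 h (a * b' + a' * b) \<xi> / eval3 h (b * b') \<xi> \<in> rat3 h \<xi>"
    using 1 2 by (intro rat3I[OF homog3_add[OF homog3_mult[OF 1(1) 2(2)] \<open>homog3 (n + n') (a' * b)\<close>] homog3_mult[OF 1(2) 2(2)]]) (simp add: e.hom_mult)
  moreover have "eval3 h (a * b' + a' * b) \<xi> / eval3 h (b * b') \<xi> = x + y"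
    using 1 2 by (simp add: e.hom_mult e.hom_add add_divide_distrib)
  ultimately show "x + y \<in> rat3 h \<xi>" by simp
qed

lemma rat2_closed:
  fixes h :: "'a::field \<Rightarrow> 'w::field"
  assumes "comm_ring_hom h"
  shows "h c \<in> rat2 h \<xi>" "x \<in> rat2 h \<xi> \<Longrightarrow> - x \<in> rat2 h \<xi>" "x \<in> rat2 h \<xi> \<Longrightarrow> inverse x \<in> rat2 h \<xi>"
    "x \<in> rat2 h \<xi> \<Longrightarrow> y \<in> rat2 h \<xi> \<Longrightarrow> x * y \<in> rat2 h \<xi>"
    "x \<in> rat2 h \<xi> \<Longrightarrow> y \<in> rat2 h \<xi> \<Longrightarrow> x + y \<in> rat2 h \<xi>"
proof -
  interpret e: comm_ring_hom "\<lambda>a. eval2 h a \<xi>" by (rule comm_ring_hom_eval2[OF assms])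
  show c: "h c \<in> rat2 h \<xi>" for c
    using rat2I[of 0 "const2 c" 1 h \<xi>] assms by (simp add: e.hom_one)
  show "- x \<in> rat2 h \<xi>" if "x \<in> rat2 h \<xi>" for x
  proof -
    from that obtain n a b where "homog2 n a" "homog2 n b" "eval2 h b \<xi> \<noteq> 0" "x = eval2 h a \<xi> / eval2 h b \<xi>" by (rule rat2E)
    then show ?thesis using rat2I[of n "- a" b h \<xi>] by (simp add: homog2_minus e.hom_uminus)
  qed
  show "inverse x \<in> rat2 h \<xi>" if "x \<in> rat2 h \<xi>" for x
  proof (cases "x = 0")
    case True then show ?thesis using that by simp
  next
    case False
    from that obtain n a b where "homog2 n a" "homog2 n b" "eval2 h b \<xi> \<noteq> 0" "x = eval2 h a \<xi> / eval2 h b \<xi>" by (rule rat2E)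
    then show ?thesis using rat2I[of n b a h \<xi>] False by simp
  qed
  fix x y assume "x \<in> rat2 h \<xi>"
  then obtain n a b where 1: "homog2 n a" "homog2 n b" "eval2 h b \<xi> \<noteq> 0" "x = eval2 h a \<xi> / eval2 h b \<xi>" by (rule rat2E)
  assume "y \<in> rat2 h \<xi>"
  then obtain n' a' b' where 2: "homog2 n' a'" "homog2 n' b'" "eval2 h b' \<xi> \<noteq> 0" "y = eval2 h a' \<xi> / eval2 h b' \<xi>" by (rule rat2E)
  have "eval2 h (a * a') \<xi> / eval2 h (b * b') \<xi> \<in> rat2 h \<xi>"
    using 1 2 by (intro rat2I[of "n + n'"] homog2_mult) (simp_all add: e.hom_mult)
  then show "x * y \<in> rat2 h \<xi>" using 1 2 by (simp add: e.hom_mult)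
  have "homog2 (n + n') (a' * b)" using homog2_mult[OF 2(1) 1(2)] by (simp add: add.commute)
  then have "eval2 h (a * b' + a' * b) \<xi> / eval2 h (b * b') \<xi> \<in> rat2 h \<xi>"
    using 1 2 by (intro rat2I[OF homog2_add[OF homog2_mult[OF 1(1) 2(2)] \<open>homog2 (n + n') (a' * b)\<close>] homog2_mult[OF 1(2) 2(2)]]) (simp add: e.hom_mult)
  moreover have "eval2 h (a * b' + a' * b) \<xi> / eval2 h (b * b') \<xi> = x + y"
    using 1 2 by (simp add: e.hom_mult e.hom_add add_divide_distrib)
  ultimately show "x + y \<in> rat2 h \<xi>" by simp
qed

lemma rat3_1: "comm_ring_hom h \<Longrightarrow> 1 \<in> rat3 h \<xi>" and rat2_1: "comm_ring_hom h \<Longrightarrow> 1 \<in> rat2 h w"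
proof -
  assume h: "comm_ring_hom h"
  then interpret h: comm_ring_hom h .
  show "1 \<in> rat3 h \<xi>" "1 \<in> rat2 h w"
    using rat3_closed(1)[OF h, of 1 \<xi>] rat2_closed(1)[OF h, of 1 w] by (simp_all add: h.hom_one)
qed

lemma subfield_rat3: "comm_ring_hom h \<Longrightarrow> subfield (rat3 h \<xi>) RT"
  by (rule subfield_RT) (simp_all add: rat3_closed rat3_1)

lemma subfield_rat2: "comm_ring_hom h \<Longrightarrow> subfield (rat2 h \<xi>) RT"
  by (rule subfield_RT) (simp_all add: rat2_closed rat2_1)

text \<open>Two projections from one point differ by a linear map of the target, so this inclusion
  makes the pulled back field independent of the chosen matrix.\<close>

lemma rat2_linear_image:
  fixes w :: "'w::field ^ 2"
  assumes h: "comm_ring_hom h" shows "rat2 h (hmat h T *v w) \<subseteq> rat2 h w"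
proof
  fix x assume "x \<in> rat2 h (hmat h T *v w)"
  then obtain n a b where 1: "homog2 n a" "homog2 n b" "eval2 h b (hmat h T *v w) \<noteq> 0"
     "x = eval2 h a (hmat h T *v w) / eval2 h b (hmat h T *v w)" by (rule rat2E)
  define l where "l = (\<chi> i. \<Sum>j\<in>UNIV. const2 (T $ i $ j) * vars2 $ j)"
  interpret e: comm_ring_hom "\<lambda>a. eval2 h a w" by (rule comm_ring_hom_eval2[OF h])
  have l: "homog2 1 (l $ i)" for i
    unfolding l_def vec_lambda_beta by (intro homog2_sum) (simp add: homog2_const_mult)
  have "(\<chi> i. eval2 h (l $ i) w) = hmat h T *v w"
    by (simp add: l_def e.hom_sum e.hom_mult h hmat_def matrix_vector_mult_def Finite_Cartesian_Product.vec_eq_iff)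
  then have ev: "eval2 h (eval2 const2 a l) w = eval2 h a (hmat h T *v w)" for a
    by (simp add: eval2_eval2[OF h])
  have "eval2 h (eval2 const2 a l) w / eval2 h (eval2 const2 b l) w \<in> rat2 h w"
    using 1 l by (intro rat2I[of "1 * n"] homog2_eval2) (simp_all add: ev)
  then show "x \<in> rat2 h w" using 1 by (simp add: ev)
qed

text \<open>One fraction has representatives whose denominators vanish at \<open>\<xi>\<close>; the
  value is taken from any representative for which this does not happen.\<close>

definition rval :: "('a::field \<Rightarrow> 'w::field) \<Rightarrow> 'w ^ 3 \<Rightarrow> 'a form3 fract \<Rightarrow> 'w" where
  "rval h \<xi> q = (THE w. \<exists>a b. q = Fract a b \<and> eval3 h b \<xi> \<noteq> 0 \<and> w = eval3 h a \<xi> / eval3 h b \<xi>)"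

lemma rval_Fract:
  assumes h: "comm_ring_hom h" and b: "eval3 h b \<xi> \<noteq> 0"
  shows "rval h \<xi> (Fract a b) = eval3 h a \<xi> / eval3 h b \<xi>"
  unfolding rval_def
proof (rule the_equality)
  show "\<exists>a' b'. Fract a b = Fract a' b' \<and> eval3 h b' \<xi> \<noteq> 0 \<and> eval3 h a \<xi> / eval3 h b \<xi> = eval3 h a' \<xi> / eval3 h b' \<xi>"
    using b by blast
  interpret e: comm_ring_hom "\<lambda>a. eval3 h a \<xi>" by (rule comm_ring_hom_eval3[OF h])
  fix w assume "\<exists>a' b'. Fract a b = Fract a' b' \<and> eval3 h b' \<xi> \<noteq> 0 \<and> w = eval3 h a' \<xi> / eval3 h b' \<xi>"
  then obtain a' b' where *: "Fract a b = Fract a' b'" "eval3 h b' \<xi> \<noteq> 0" "w = eval3 h a' \<xi> / eval3 h b' \<xi>" by blast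
  have "b \<noteq> 0" "b' \<noteq> 0" using b *(2) by (auto simp: e.hom_zero)
  then have "a * b' = a' * b" using *(1) by (simp add: eq_fract)
  then have "eval3 h a \<xi> * eval3 h b' \<xi> = eval3 h a' \<xi> * eval3 h b \<xi>" by (simp add: e.hom_mult[symmetric])
  then show "w = eval3 h a \<xi> / eval3 h b \<xi>" using * b by (simp add: frac_eq_eq)
qed

text \<open>
  At a generic point \<open>\<xi>\<close> of \<open>D\<close>, the function field, a quotient of a local ring, turns into the
  subfield \<open>rat3 h \<xi>\<close> of \<open>'w\<close>, and the pullback fields of projections into subfields \<open>rat2 h w\<close>.
\<close>

locale gen_pt =
  fixes D :: "('a::field ^ 3) set" and h :: "'a \<Rightarrow> 'w::field" and \<xi> :: "'w ^ 3"
  assumes h: "comm_ring_hom h" and nz: "\<xi> \<noteq> 0"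
    and gen: "\<And>n b. homog3 n b \<Longrightarrow> vanishes_on b D \<longleftrightarrow> eval3 h b \<xi> = 0"
begin

lemma local_ring_carrier:
  "carrier (local_ring D) = {Fract a b | a b. (\<exists>n. homog3 n a \<and> homog3 n b) \<and> eval3 h b \<xi> \<noteq> 0}"
  using gen by (auto simp: local_ring_def)

lemma ring_local_ring: "Ring.ring (local_ring D)"
proof -
  interpret e: comm_ring_hom "\<lambda>a. eval3 h a \<xi>" by (rule comm_ring_hom_eval3[OF h])
  let ?S = "{Fract a b | a b. (\<exists>n. homog3 n a \<and> homog3 n b) \<and> eval3 h b \<xi> \<noteq> 0}"
  have "subring ?S RT"
  proof (rule subring_RT)
    show "1 \<in> ?S" unfolding One_fract_def by (rule CollectI, rule exI[of _ 1], rule exI[of _ 1]) (auto simp: e.hom_one intro: exI[of _ 0])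
    show "- x \<in> ?S" if "x \<in> ?S" for x
    proof -
      from that obtain a b n where 1: "x = Fract a b" "homog3 n a" "homog3 n b" "eval3 h b \<xi> \<noteq> 0" by blast
      have "- x = Fract (- a) b \<and> ((\<exists>n. homog3 n (- a) \<and> homog3 n b) \<and> eval3 h b \<xi> \<noteq> 0)"
        using 1 homog3_minus by auto
      then show ?thesis by blast
    qed
    fix x y assume "x \<in> ?S"
    then obtain a b n where 1: "x = Fract a b" "homog3 n a" "homog3 n b" "eval3 h b \<xi> \<noteq> 0" by blast
    assume "y \<in> ?S"
    then obtain a' b' n' where 2: "y = Fract a' b'" "homog3 n' a'" "homog3 n' b'" "eval3 h b' \<xi> \<noteq> 0" by blast
    have "homog3 (n + n') (a * a') \<and> homog3 (n + n') (b * b')" using 1 2 homog3_mult by blast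
    moreover have "eval3 h (b * b') \<xi> \<noteq> 0" using 1 2 by (simp add: e.hom_mult)
    ultimately have "x * y = Fract (a * a') (b * b') \<and> ((\<exists>n. homog3 n (a * a') \<and> homog3 n (b * b')) \<and> eval3 h (b * b') \<xi> \<noteq> 0)"
      using 1(1) 2(1) by auto
    then show "x * y \<in> ?S" by blast
    have nn: "b \<noteq> 0" "b' \<noteq> 0" using 1 2 by (auto simp: e.hom_zero)
    have "homog3 (n + n') (a * b' + a' * b) \<and> homog3 (n + n') (b * b')"
      using homog3_mult[OF 1(2) 2(3)] homog3_mult[OF 2(2) 1(3)] homog3_mult[OF 1(3) 2(3)] by (auto simp: add.commute[of n'] intro: homog3_add)
    moreover have "eval3 h (b * b') \<xi> \<noteq> 0" using 1 2 by (simp add: e.hom_mult)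
    moreover have "x + y = Fract (a * b' + a' * b) (b * b')" using 1(1) 2(1) nn by simp
    ultimately show "x + y \<in> ?S" by blast
  qed
  from ring.subring_is_ring[OF ring_RT this] show ?thesis
    using local_ring_carrier by (simp add: local_ring_def)
qed

lemma local_ring_ops [simp]: "x \<oplus>\<^bsub>local_ring D\<^esub> y = x + y" "x \<otimes>\<^bsub>local_ring D\<^esub> y = x * y"
  "\<one>\<^bsub>local_ring D\<^esub> = 1" "\<zero>\<^bsub>local_ring D\<^esub> = 0"
  by (simp_all add: local_ring_def)

lemma local_ringI: "homog3 n a \<Longrightarrow> homog3 n b \<Longrightarrow> eval3 h b \<xi> \<noteq> 0 \<Longrightarrow> Fract a b \<in> carrier (local_ring D)"
  unfolding local_ring_carrier by blast

lemma local_ringE: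
  assumes "x \<in> carrier (local_ring D)"
  obtains n a b where "homog3 n a" "homog3 n b" "eval3 h b \<xi> \<noteq> 0" "x = Fract a b"
  using assms unfolding local_ring_carrier by blast

lemma ring_hom_ring_rval: "ring_hom_ring (local_ring D) RT (rval h \<xi>)"
proof (rule ring_hom_ringI2[OF ring_local_ring ring_RT], rule ring_hom_memI)
  interpret e: comm_ring_hom "\<lambda>a. eval3 h a \<xi>" by (rule comm_ring_hom_eval3[OF h])
  show "rval h \<xi> x \<in> carrier RT" for x by simp
  show "rval h \<xi> \<one>\<^bsub>local_ring D\<^esub> = \<one>\<^bsub>RT\<^esub>"
    using rval_Fract[OF h, of 1 \<xi> 1] by (simp add: One_fract_def e.hom_one)
  fix x y assume "x \<in> carrier (local_ring D)"
  then obtain n a b where 1: "homog3 n a" "homog3 n b" "eval3 h b \<xi> \<noteq> 0" "x = Fract a b" by (rule local_ringE)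
  assume "y \<in> carrier (local_ring D)"
  then obtain n' a' b' where 2: "homog3 n' a'" "homog3 n' b'" "eval3 h b' \<xi> \<noteq> 0" "y = Fract a' b'" by (rule local_ringE)
  have nn: "b \<noteq> 0" "b' \<noteq> 0" "eval3 h (b * b') \<xi> \<noteq> 0" using 1 2 by (auto simp: e.hom_zero e.hom_mult)
  show "rval h \<xi> (x \<otimes>\<^bsub>local_ring D\<^esub> y) = rval h \<xi> x \<otimes>\<^bsub>RT\<^esub> rval h \<xi> y"
    using rval_Fract[OF h 1(3), of a] rval_Fract[OF h 2(3), of a'] rval_Fract[OF h nn(3), of "a * a'"]
    by (simp add: 1(4) 2(4) e.hom_mult)
  show "rval h \<xi> (x \<oplus>\<^bsub>local_ring D\<^esub> y) = rval h \<xi> x \<oplus>\<^bsub>RT\<^esub> rval h \<xi> y"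
    using rval_Fract[OF h 1(3), of a] rval_Fract[OF h 2(3), of a'] rval_Fract[OF h nn(3), of "a * b' + a' * b"] 1(3) 2(3) nn
    by (simp add: 1(4) 2(4) e.hom_mult e.hom_add add_divide_distrib)
qed

lemma kernel_rval: "a_kernel (local_ring D) RT (rval h \<xi>) = vanishing_ideal D"
proof (intro Set.set_eqI iffI)
  fix x assume "x \<in> a_kernel (local_ring D) RT (rval h \<xi>)"
  then have x: "x \<in> carrier (local_ring D)" "rval h \<xi> x = 0" by (simp_all add: a_kernel_def')
  from x(1) obtain n a b where 1: "homog3 n a" "homog3 n b" "eval3 h b \<xi> \<noteq> 0" "x = Fract a b" by (rule local_ringE)
  then have "eval3 h a \<xi> = 0" using x(2) rval_Fract[OF h 1(3), of a] by simp
  then have "x = Fract a b \<and> ((\<exists>n. homog3 n a \<and> homog3 n b) \<and> \<not> vanishes_on b D \<and> vanishes_on a D)"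
    using 1 gen by blast
  then show "x \<in> vanishing_ideal D" unfolding vanishing_ideal_def by blast
next
  fix x assume "x \<in> vanishing_ideal D"
  then obtain n a b where 1: "x = Fract a b" "homog3 n a" "homog3 n b" "\<not> vanishes_on b D" "vanishes_on a D"
    unfolding vanishing_ideal_def by blast
  have b: "eval3 h b \<xi> \<noteq> 0" "eval3 h a \<xi> = 0" using 1 gen by blast+
  show "x \<in> a_kernel (local_ring D) RT (rval h \<xi>)"
    unfolding a_kernel_def' using local_ringI[OF 1(2,3) b(1)] rval_Fract[OF h b(1), of a] b 1 by simp
qed

text \<open>\<open>rval h \<xi>\<close> has the vanishing ideal as its kernel, hence is constant on
  a coset, and the image is a singleton.\<close>

definition fval :: "'a form3 fract set \<Rightarrow> 'w" where
  "fval S = the_elem (rval h \<xi> ` S)"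

lemma fval_rat_fun:
  assumes "homog3 n a" "homog3 n b" "eval3 h b \<xi> \<noteq> 0"
  shows "rat_fun D a b \<in> carrier (function_field D)" "fval (rat_fun D a b) = eval3 h a \<xi> / eval3 h b \<xi>"
proof -
  interpret r: ring_hom_ring "local_ring D" RT "rval h \<xi>" by (rule ring_hom_ring_rval)
  note F = local_ringI[OF assms]
  show "rat_fun D a b \<in> carrier (function_field D)"
    unfolding rat_fun_def function_field_def FactRing_def A_RCOSETS_def' using F by auto
  show "fval (rat_fun D a b) = eval3 h a \<xi> / eval3 h b \<xi>"
    unfolding fval_def rat_fun_def kernel_rval[symmetric] r.the_elem_simp[OF F] by (rule rval_Fract[OF h assms(3)])
qed

lemma fval_iso: "fval \<in> ring_iso (function_field D) (RT\<lparr>carrier := rat3 h \<xi>\<rparr>)"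
proof -
  interpret r: ring_hom_ring "local_ring D" RT "rval h \<xi>" by (rule ring_hom_ring_rval)
  have "rval h \<xi> ` carrier (local_ring D) = rat3 h \<xi>"
  proof (intro Set.set_eqI iffI)
    fix w assume "w \<in> rval h \<xi> ` carrier (local_ring D)"
    then obtain x where x: "x \<in> carrier (local_ring D)" "w = rval h \<xi> x" by blast
    from x(1) obtain n a b where 1: "homog3 n a" "homog3 n b" "eval3 h b \<xi> \<noteq> 0" "x = Fract a b" by (rule local_ringE)
    then show "w \<in> rat3 h \<xi>" using x(2) rval_Fract[OF h 1(3), of a] rat3I[OF 1(1-3)] by simp
  next
    fix w assume "w \<in> rat3 h \<xi>"
    then obtain n a b where 1: "homog3 n a" "homog3 n b" "eval3 h b \<xi> \<noteq> 0" "w = eval3 h a \<xi> / eval3 h b \<xi>" by (rule rat3E)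
    then have "w = rval h \<xi> (Fract a b)" using rval_Fract[OF h 1(3), of a] by simp
    then show "w \<in> rval h \<xi> ` carrier (local_ring D)" using local_ringI[OF 1(1-3)] by blast
  qed
  moreover have "fval = (\<lambda>S. the_elem (rval h \<xi> ` S))" by (rule ext) (simp add: fval_def)
  ultimately show ?thesis using r.FactRing_iso_set_aux by (simp add: kernel_rval function_field_def)
qed

lemma fval_inj: "S \<in> carrier (function_field D) \<Longrightarrow> T \<in> carrier (function_field D) \<Longrightarrow> fval S = fval T \<Longrightarrow> S = T"
  using fval_iso unfolding ring_iso_def bij_betw_def inj_on_def by blast

lemma fval_carrier: "fval ` carrier (function_field D) = rat3 h \<xi>"
  using fval_iso unfolding ring_iso_def bij_betw_def by simp

end

section \<open>Matrices of projections\<close>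

lemma projection_from_complete:
  fixes \<pi> :: "'a::field ^ 3 ^ 2"
  assumes "projection_from Q \<pi>" "Q \<noteq> 0"
  shows "\<exists>(M :: 'a ^ 3 ^ 3) (N :: 'a ^ 3 ^ 3). M ** N = mat 1 \<and> N ** M = mat 1 \<and> N *v Q = axis 1 1 \<and>
     (\<forall>x. (\<pi> *v x) $ 1 = (N *v x) $ 2 \<and> (\<pi> *v x) $ 2 = (N *v x) $ 3)"
proof -
  from assms(2) obtain k where k: "Q $ k \<noteq> 0" by (auto simp: Finite_Cartesian_Product.vec_eq_iff)
  \<comment> \<open>The first row is a coordinate form normalised to the value 1 at
    \<open>Q\<close>. As the common zeros of the rows of \<open>\<pi>\<close> are the multiples of
    \<open>Q\<close>, the three rows have no common zero but the origin.\<close>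
  define N :: "'a ^ 3 ^ 3" where
    "N = (\<chi> i. if i = 1 then axis k (inverse (Q $ k)) else if i = 2 then \<pi> $ 1 else \<pi> $ 2)"
  have N1: "(N *v x) $ 1 = inverse (Q $ k) * x $ k" for x
    by (simp add: N_def matrix_vector_mult_def axis_def if_distrib[of "\<lambda>y. y * _"] cong: if_cong)
  have N23: "(N *v x) $ 2 = (\<pi> *v x) $ 1" "(N *v x) $ 3 = (\<pi> *v x) $ 2" for x
    by (simp_all add: N_def matrix_vector_mult_def)
  have ker: "\<pi> *v x = 0 \<longleftrightarrow> (\<exists>c. x = c *s Q)" for x
    using assms(1) unfolding projection_from_def by blast
  have "x = 0" if "N *v x = 0" for x
  proof -
    have "\<pi> *v x = 0" using that N23[of x] by (simp add: Finite_Cartesian_Product.vec_eq_iff forall_2)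
    then obtain c where c: "x = c *s Q" using ker by blast
    have "inverse (Q $ k) * x $ k = 0" using that N1[of x] by simp
    then have "c = 0" using c k by simp
    then show "x = 0" using c by simp
  qed
  then obtain M where MN: "M ** N = mat 1" using matrix_left_invertible_ker by blast
  then have NM: "N ** M = mat 1" by (simp add: matrix_left_right_inverse)
  have "\<pi> *v Q = 0" unfolding ker by (rule exI[of _ 1]) simp 
  then have "N *v Q = axis 1 1"
    using N1[of Q] N23[of Q] k by (simp add: Finite_Cartesian_Product.vec_eq_iff forall_3 axis_def)
  then show ?thesis using MN NM N23 by (intro exI[of _ M] exI[of _ N]) simp
qed

lemma projection_from_matrix:
  fixes M N :: "'a::field ^ 3 ^ 3"
  assumes "M ** N = mat 1" "N ** M = mat 1" "N *v Q = axis 1 1"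
  shows "projection_from Q (\<chi> i. N $ (if i = 1 then 2 else 3))"
proof -
  let ?p = "\<chi> i::2. N $ (if i = 1 then 2 else 3)"
  have p: "(?p *v x) $ 1 = (N *v x) $ 2" "(?p *v x) $ 2 = (N *v x) $ 3" for x
    by (simp_all add: matrix_vector_mult_def)
  have MN: "M *v (N *v x) = x" for x by (simp add: matrix_vector_mul_assoc assms)
  have "?p *v x = 0 \<longleftrightarrow> (\<exists>c. x = c *s Q)" for x
  proof
    assume 0: "?p *v x = 0"
    have "(N *v x) $ 2 = 0" "(N *v x) $ 3 = 0" using p[of x] 0 by simp_all
    then have "N *v x = (N *v x) $ 1 *s axis 1 1"
      unfolding Finite_Cartesian_Product.vec_eq_iff forall_3 by (simp add: axis_def)
    also have "\<dots> = N *v ((N *v x) $ 1 *s Q)" by (simp add: assms(3) vector_scalar_commute)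
    finally have "M *v (N *v x) = M *v (N *v ((N *v x) $ 1 *s Q))" by simp
    then have "x = (N *v x) $ 1 *s Q" unfolding MN .
    then show "\<exists>c. x = c *s Q" by blast
  next
    assume "\<exists>c. x = c *s Q"
    then obtain c where "x = c *s Q" by blast
    then have "N *v x = c *s axis 1 1" by (simp add: assms(3) vector_scalar_commute)
    then show "?p *v x = 0" using p[of x] by (simp add: Finite_Cartesian_Product.vec_eq_iff forall_2 axis_def)
  qed
  then show ?thesis unfolding projection_from_def by blast
qed

text \<open>In coordinates with the centre as first basis vector, a map that kills the centre has
  zero first column. It depends only on the other two coordinates, and these are the entries of
  \<open>\<pi>\<close>.\<close>

lemma projection_from_factor:
  fixes \<pi> \<rho> :: "'a::field ^ 3 ^ 2"
  assumes "projection_from Q \<pi>" "projection_from Q \<rho>" "Q \<noteq> 0"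
  shows "\<exists>T. \<rho> = T ** \<pi>"
proof -
  obtain M N :: "'a ^ 3 ^ 3" where MN: "M ** N = mat 1" "N ** M = mat 1" "N *v Q = axis 1 1"
     and N: "\<And>x. (\<pi> *v x) $ 1 = (N *v x) $ 2" "\<And>x. (\<pi> *v x) $ 2 = (N *v x) $ 3"
    using projection_from_complete[OF assms(1,3)] by blast
  have "\<rho> *v Q = 0"
  proof -
    have "Q = 1 *s Q" by simp
    then have "Q \<in> range (\<lambda>c. c *s Q)" by blast
    then show ?thesis using assms(2) unfolding projection_from_def by blast
  qed
  define S where "S = \<rho> ** M"
  define T :: "'a ^ 2 ^ 2" where "T = (\<chi> i j. S $ i $ (if j = 1 then 2 else 3))"
  have "M *v axis 1 1 = Q" unfolding MN(3)[symmetric] by (simp only: matrix_vector_mul_assoc MN(1) matrix_vector_mul_lid)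
  then have "S *v axis 1 1 = 0" using \<open>\<rho> *v Q = 0\<close> by (simp add: S_def flip: matrix_vector_mul_assoc)
  then have S1: "S $ i $ 1 = 0" for i
    by (simp add: Finite_Cartesian_Product.vec_eq_iff matrix_vector_mult_def axis_def if_distrib cong: if_cong)
  have "\<rho> *v x = (T ** \<pi>) *v x" for x
  proof -
    have "\<rho> *v x = S *v (N *v x)" by (simp add: S_def matrix_vector_mul_assoc MN flip: matrix_mul_assoc)
    also have "\<dots> = T *v (\<pi> *v x)"
    proof -
      have "(T *v w) $ i = S $ i $ 2 * w $ 1 + S $ i $ 3 * w $ 2" for w i
        by (simp add: T_def matrix_vector_mult_def sum_2)
      then show ?thesis
        by (simp add: Finite_Cartesian_Product.vec_eq_iff matrix_vector_mult_def[of S] sum_3 S1 N)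
    qed
    finally show ?thesis by (simp add: matrix_vector_mul_assoc)
  qed
  then show ?thesis by (intro exI[of _ T]) (simp add: matrix_eq)
qed

context gen_pt begin

lemma eval3_eval2_lin_forms: "eval3 h (eval2 const3 a (lin_forms \<pi>)) \<xi> = eval2 h a (hmat h \<pi> *v \<xi>)"
  by (simp add: eval3_eval2[OF h] eval3_lin_forms_vec[OF h])

lemma homog3_eval2_lin_forms: "homog2 n a \<Longrightarrow> homog3 n (eval2 const3 a (lin_forms \<pi>))"
  using homog3_eval2[of n a 1 "lin_forms \<pi>"] by simp

lemma projection_subfield_carrier: "projection_subfield D Q \<subseteq> carrier (function_field D)"
proof
  fix x assume "x \<in> projection_subfield D Q"
  then obtain a b \<pi> n where *: "x = rat_fun D (eval2 const3 a (lin_forms \<pi>)) (eval2 const3 b (lin_forms \<pi>))"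
    "homog2 n a" "homog2 n b" "\<not> vanishes_on (eval2 const3 b (lin_forms \<pi>)) D" unfolding projection_subfield_def by blast
  have "eval3 h (eval2 const3 b (lin_forms \<pi>)) \<xi> \<noteq> 0" using * gen homog3_eval2_lin_forms by blast
  from fval_rat_fun(1)[OF homog3_eval2_lin_forms homog3_eval2_lin_forms this] *
  show "x \<in> carrier (function_field D)" by blast
qed

text \<open>\<open>projection_subfield\<close> ranges over all matrices of projections from
  \<open>Q\<close>; by the factorization through one fixed \<open>\<pi>\<close>, the functions
  obtained from this matrix are already all of them.\<close>

lemma projection_subfield_fval:
  assumes "projection_from Q \<pi>" "Q \<noteq> 0"
  shows "fval ` projection_subfield D Q = rat2 h (hmat h \<pi> *v \<xi>)"
proof (intro Set.set_eqI iffI)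
  fix w assume "w \<in> fval ` projection_subfield D Q"
  then obtain x where x: "x \<in> projection_subfield D Q" "w = fval x" by blast
  then obtain a b \<rho> n where *: "x = rat_fun D (eval2 const3 a (lin_forms \<rho>)) (eval2 const3 b (lin_forms \<rho>))"
    "projection_from Q \<rho>" "homog2 n a" "homog2 n b" "\<not> vanishes_on (eval2 const3 b (lin_forms \<rho>)) D" unfolding projection_subfield_def by blast
  have b: "eval3 h (eval2 const3 b (lin_forms \<rho>)) \<xi> \<noteq> 0" using * gen homog3_eval2_lin_forms by blast
  have "w = eval2 h a (hmat h \<rho> *v \<xi>) / eval2 h b (hmat h \<rho> *v \<xi>)"
    using fval_rat_fun(2)[OF homog3_eval2_lin_forms[OF *(3)] homog3_eval2_lin_forms[OF *(4)] b] x(2) *(1)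
    by (simp add: eval3_eval2_lin_forms)
  then have "w \<in> rat2 h (hmat h \<rho> *v \<xi>)" using rat2I[OF *(3,4), of h "hmat h \<rho> *v \<xi>"] b by (simp add: eval3_eval2_lin_forms)
  moreover obtain T where "\<rho> = T ** \<pi>" using projection_from_factor[OF assms(1) *(2) assms(2)] by blast
  then have "hmat h \<rho> *v \<xi> = hmat h T *v (hmat h \<pi> *v \<xi>)" by (simp add: hmat_mult[OF h] matrix_vector_mul_assoc)
  ultimately show "w \<in> rat2 h (hmat h \<pi> *v \<xi>)" using rat2_linear_image[OF h, of T "hmat h \<pi> *v \<xi>"] by auto
next
  fix w assume "w \<in> rat2 h (hmat h \<pi> *v \<xi>)"
  then obtain n a b where 1: "homog2 n a" "homog2 n b" "eval2 h b (hmat h \<pi> *v \<xi>) \<noteq> 0"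
    "w = eval2 h a (hmat h \<pi> *v \<xi>) / eval2 h b (hmat h \<pi> *v \<xi>)" by (rule rat2E)
  have b: "eval3 h (eval2 const3 b (lin_forms \<pi>)) \<xi> \<noteq> 0" using 1 by (simp add: eval3_eval2_lin_forms)
  then have nv: "\<not> vanishes_on (eval2 const3 b (lin_forms \<pi>)) D" using gen homog3_eval2_lin_forms[OF 1(2)] by blast
  have "w = fval (rat_fun D (eval2 const3 a (lin_forms \<pi>)) (eval2 const3 b (lin_forms \<pi>)))"
    using fval_rat_fun(2)[OF homog3_eval2_lin_forms[OF 1(1)] homog3_eval2_lin_forms[OF 1(2)] b] 1 by (simp add: eval3_eval2_lin_forms)
  moreover have "rat_fun D (eval2 const3 a (lin_forms \<pi>)) (eval2 const3 b (lin_forms \<pi>)) \<in> projection_subfield D Q"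
    unfolding projection_subfield_def using assms(1) 1 nv by blast
  ultimately show "w \<in> fval ` projection_subfield D Q" by blast
qed

end

section \<open>Birational transformations induced by field automorphisms\<close>

definition K_aut :: "('a::field \<Rightarrow> 'w::field) \<Rightarrow> 'w set \<Rightarrow> ('w \<Rightarrow> 'w) \<Rightarrow> bool" where
  "K_aut h S \<tau> \<longleftrightarrow> (\<forall>x\<in>S. \<tau> x \<in> S) \<and> (\<forall>x\<in>S. \<forall>y\<in>S. \<tau> (x + y) = \<tau> x + \<tau> y \<and> \<tau> (x * y) = \<tau> x * \<tau> y)
     \<and> (\<forall>c. \<tau> (h c) = h c)"

lemma K_autD:
  assumes "K_aut h S \<tau>"
  shows "x \<in> S \<Longrightarrow> \<tau> x \<in> S" "x \<in> S \<Longrightarrow> y \<in> S \<Longrightarrow> \<tau> (x + y) = \<tau> x + \<tau> y"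
    "x \<in> S \<Longrightarrow> y \<in> S \<Longrightarrow> \<tau> (x * y) = \<tau> x * \<tau> y" "\<tau> (h c) = h c"
  using assms unfolding K_aut_def by simp_all

context gen_pt begin

lemma K_aut_eval3:
  assumes \<tau>: "K_aut h (rat3 h \<xi>) \<tau>" and v: "\<And>i. v $ i \<in> rat3 h \<xi>"
  shows "eval3 h a v \<in> rat3 h \<xi> \<and> \<tau> (eval3 h a v) = eval3 h a (\<chi> i. \<tau> (v $ i))"
proof -
  interpret e: comm_ring_hom "\<lambda>a. eval3 h a w" for w by (rule comm_ring_hom_eval3[OF h])
  show ?thesis
  proof (induction a rule: form3_induct)
    case (const c) then show ?case by (simp add: h rat3_closed(1)[OF h] K_autD(4)[OF \<tau>])
  next
    case (var i) then show ?case by (simp add: h v)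
  next
    case (add a b) then show ?case by (simp add: e.hom_add rat3_closed(5)[OF h] K_autD(2)[OF \<tau>])
  next
    case (mult a b) then show ?case by (simp add: e.hom_mult rat3_closed(4)[OF h] K_autD(3)[OF \<tau>])
  qed
qed

lemma common_denominator:
  assumes "\<And>i. w $ i \<in> rat3 h \<xi>"
  shows "\<exists>\<phi> n \<beta>. \<beta> \<noteq> 0 \<and> (\<forall>i. homog3 n (\<phi> $ i)) \<and> (\<forall>i::3. eval3 h (\<phi> $ i) \<xi> = \<beta> * w $ i)"
proof -
  interpret e: comm_ring_hom "\<lambda>a. eval3 h a \<xi>" by (rule comm_ring_hom_eval3[OF h])
  obtain n1 a1 b1 where 1: "homog3 n1 a1" "homog3 n1 b1" "eval3 h b1 \<xi> \<noteq> 0" "w $ 1 = eval3 h a1 \<xi> / eval3 h b1 \<xi>"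
    using rat3E[OF assms[of 1]] by blast
  obtain n2 a2 b2 where 2: "homog3 n2 a2" "homog3 n2 b2" "eval3 h b2 \<xi> \<noteq> 0" "w $ 2 = eval3 h a2 \<xi> / eval3 h b2 \<xi>"
    using rat3E[OF assms[of 2]] by blast
  obtain n3 a3 b3 where 3: "homog3 n3 a3" "homog3 n3 b3" "eval3 h b3 \<xi> \<noteq> 0" "w $ 3 = eval3 h a3 \<xi> / eval3 h b3 \<xi>"
    using rat3E[OF assms[of 3]] by blast
  define \<phi> where "\<phi> = (\<chi> i::3. if i = 1 then a1 * b2 * b3 else if i = 2 then b1 * a2 * b3 else b1 * b2 * a3)"
  have hom: "homog3 (n1 + n2 + n3) (\<phi> $ i)" for i
    using exhaust_3[of i] by (auto simp: \<phi>_def intro!: homog3_mult 1 2 3)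
  have val: "eval3 h (\<phi> $ i) \<xi> = eval3 h (b1 * b2 * b3) \<xi> * w $ i" for i
    using exhaust_3[of i] 1 2 3 by (auto simp: \<phi>_def e.hom_mult)
  show ?thesis
    by (rule exI[of _ \<phi>], rule exI[of _ "n1 + n2 + n3"], rule exI[of _ "eval3 h (b1 * b2 * b3) \<xi>"])
       (use hom val 1 2 3 in \<open>simp add: e.hom_mult\<close>)
qed

definition pivot :: 3 where "pivot = (SOME i. \<xi> $ i \<noteq> 0)"

lemma pivot: "\<xi> $ pivot \<noteq> 0"
proof -
  have "\<exists>i. \<xi> $ i \<noteq> 0" using nz by (simp add: Finite_Cartesian_Product.vec_eq_iff)
  then show ?thesis unfolding pivot_def by (rule someI_ex)
qed

text \<open>An automorphism of \<open>rat3 h \<xi>\<close> acts on ratios of coordinates only.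
  Dividing by a nonzero coordinate puts all three coordinates into this field.\<close>

definition affine_pt :: "'w ^ 3" where "affine_pt = inverse (\<xi> $ pivot) *s \<xi>"

lemma affine_pt: "affine_pt $ i = \<xi> $ i / \<xi> $ pivot" "affine_pt $ pivot = 1"
  by (simp_all add: affine_pt_def pivot field_simps)

lemma affine_pt_rat3: "affine_pt $ i \<in> rat3 h \<xi>"
  using rat3I[of 1 "vars3 $ i" "vars3 $ pivot" h \<xi>] by (simp add: affine_pt h pivot)

lemma eval3_affine_pt: "homog3 n a \<Longrightarrow> eval3 h a affine_pt = eval3 h a \<xi> / (\<xi> $ pivot) ^ n"
  by (simp add: affine_pt_def homog3_scale[OF h] field_simps)

section \<open>Rational maps and their values at the generic point\<close>

lemma vanishes_on_cross:
  assumes "\<And>i. homog3 m (\<phi> $ i)" "\<And>i. homog3 n (\<psi> $ i)"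
  shows "(\<forall>i j. vanishes_on (\<phi> $ i * \<psi> $ j - \<phi> $ j * \<psi> $ i) D) \<longleftrightarrow>
    (\<forall>i j. eval3 h (\<phi> $ i) \<xi> * eval3 h (\<psi> $ j) \<xi> = eval3 h (\<phi> $ j) \<xi> * eval3 h (\<psi> $ i) \<xi>)"
proof -
  interpret e: comm_ring_hom "\<lambda>a. eval3 h a \<xi>" by (rule comm_ring_hom_eval3[OF h])
  have "homog3 (m + n) (\<phi> $ i * \<psi> $ j - \<phi> $ j * \<psi> $ i)" for i j
    using homog3_add[OF homog3_mult[OF assms(1)[of i] assms(2)[of j]] homog3_minus[OF homog3_mult[OF assms(1)[of j] assms(2)[of i]]]] by simp
  from gen[OF this] show ?thesis by (simp add: e.hom_minus e.hom_mult)
qed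

lemma rat_tripleI:
  assumes "\<And>i. homog3 m (\<phi> $ i)" "eval3 h (\<phi> $ k) \<xi> \<noteq> 0" shows "rat_triple D \<phi>"
proof -
  have "\<not> vanishes_on (\<phi> $ k) D" using gen[OF assms(1)[of k]] assms(2) by simp
  then show ?thesis unfolding rat_triple_def using assms(1) by blast
qed

lemma rat_tripleE:
  assumes "rat_triple D \<phi>" shows "\<exists>m k. (\<forall>i. homog3 m (\<phi> $ i)) \<and> eval3 h (\<phi> $ k) \<xi> \<noteq> 0"
proof -
  from assms obtain m k where *: "\<forall>i. homog3 m (\<phi> $ i)" "\<not> vanishes_on (\<phi> $ k) D" unfolding rat_triple_def by blast
  then have "eval3 h (\<phi> $ k) \<xi> \<noteq> 0" using gen[OF *(1)[rule_format, of k]] by simp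
  with * show ?thesis by blast
qed

text \<open>\<open>\<phi>\<close> represents the rational map with generic value \<open>w\<close>.\<close>

definition represents :: "'a form3 ^ 3 \<Rightarrow> 'w ^ 3 \<Rightarrow> bool" where
  "represents \<phi> w \<longleftrightarrow> (\<exists>n \<beta>. \<beta> \<noteq> 0 \<and> (\<forall>i. homog3 n (\<phi> $ i)) \<and> (\<forall>i. eval3 h (\<phi> $ i) \<xi> = \<beta> * w $ i))"

lemma rat_map_represents:
  assumes \<phi>: "represents \<phi> w" and w: "w \<noteq> 0" and \<psi>: "\<psi> \<in> rat_map D \<phi>"
  shows "represents \<psi> w"
proof -
  obtain n \<beta> where n: "\<beta> \<noteq> 0" "\<And>i. homog3 n (\<phi> $ i)" "\<And>i. eval3 h (\<phi> $ i) \<xi> = \<beta> * w $ i"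
    using \<phi> unfolding represents_def by blast
  have "rat_triple D \<psi>" and cr: "\<forall>i j. vanishes_on (\<phi> $ i * \<psi> $ j - \<phi> $ j * \<psi> $ i) D"
    using \<psi> unfolding rat_map_def by blast+
  from rat_tripleE[OF this(1)] obtain m k where m: "\<And>i. homog3 m (\<psi> $ i)" "eval3 h (\<psi> $ k) \<xi> \<noteq> 0" by blast
  have eq: "\<beta> * w $ i * eval3 h (\<psi> $ j) \<xi> = \<beta> * w $ j * eval3 h (\<psi> $ i) \<xi>" for i j
    using iffD1[OF vanishes_on_cross[OF n(2) m(1)] cr, rule_format, of i j] unfolding n(3) .
  obtain l where l: "w $ l \<noteq> 0" using w by (auto simp: Finite_Cartesian_Product.vec_eq_iff)
  have val: "eval3 h (\<psi> $ i) \<xi> = eval3 h (\<psi> $ l) \<xi> / w $ l * w $ i" for i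
    using eq[of l i] n(1) l by (simp add: field_simps)
  have "eval3 h (\<psi> $ l) \<xi> / w $ l \<noteq> 0" using val[of k] m(2) l by auto
  then show ?thesis unfolding represents_def using m(1) val by blast
qed

lemma represents_rat_map:
  assumes \<phi>: "represents \<phi> w" and w: "w \<noteq> 0" and \<psi>: "represents \<psi> w"
  shows "\<psi> \<in> rat_map D \<phi>" "rat_triple D \<psi>"
proof -
  obtain n \<beta> where n: "\<beta> \<noteq> 0" "\<And>i. homog3 n (\<phi> $ i)" "\<And>i. eval3 h (\<phi> $ i) \<xi> = \<beta> * w $ i"
    using \<phi> unfolding represents_def by blast
  obtain m \<gamma> where m: "\<gamma> \<noteq> 0" "\<And>i. homog3 m (\<psi> $ i)" "\<And>i. eval3 h (\<psi> $ i) \<xi> = \<gamma> * w $ i"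
    using \<psi> unfolding represents_def by blast
  obtain l where l: "w $ l \<noteq> 0" using w by (auto simp: Finite_Cartesian_Product.vec_eq_iff)
  show t: "rat_triple D \<psi>" by (rule rat_tripleI[OF m(2), of l]) (simp add: m l)
  have "\<forall>i j. vanishes_on (\<phi> $ i * \<psi> $ j - \<phi> $ j * \<psi> $ i) D"
    unfolding vanishes_on_cross[OF n(2) m(2)] by (simp add: n m)
  then show "\<psi> \<in> rat_map D \<phi>" unfolding rat_map_def using t by simp
qed

lemma represents_vars3: "represents vars3 affine_pt"
  unfolding represents_def
  by (rule exI[of _ 1], rule exI[of _ "\<xi> $ pivot"]) (simp add: pivot h affine_pt)

lemma represents_eval3:
  assumes "represents \<phi> w"
  shows "\<exists>\<beta> n. \<beta> \<noteq> 0 \<and> (\<forall>m a. homog3 m a \<longrightarrow>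
    eval3 h (eval3 const3 a \<phi>) \<xi> = \<beta> ^ m * eval3 h a w \<and> homog3 (n * m) (eval3 const3 a \<phi>))"
proof -
  obtain n \<beta> where n: "\<beta> \<noteq> 0" "\<And>i. homog3 n (\<phi> $ i)" "\<And>i. eval3 h (\<phi> $ i) \<xi> = \<beta> * w $ i"
    using assms unfolding represents_def by blast
  have "(\<chi> i. eval3 h (\<phi> $ i) \<xi>) = \<beta> *s w" by (simp add: n Finite_Cartesian_Product.vec_eq_iff)
  then have "homog3 m a \<Longrightarrow> eval3 h (eval3 const3 a \<phi>) \<xi> = \<beta> ^ m * eval3 h a w" for m a
    by (simp add: eval3_eval3[OF h] homog3_scale[OF h])
  then show ?thesis using n(1) homog3_eval3[OF _ n(2)]
    by (intro exI[of _ \<beta>] exI[of _ n]) simp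
qed

text \<open>The conjugate of the generic point. Its coordinates are again rational functions on
  \<open>D\<close>, so it is the generic value of a rational map; this map is the geometric
  counterpart of \<open>\<rho>\<close>.\<close>

definition conj_pt :: "('w \<Rightarrow> 'w) \<Rightarrow> 'w ^ 3" where "conj_pt \<rho> = (\<chi> i. \<rho> (affine_pt $ i))"

lemma conj_pt_eval3:
  assumes "K_aut h (rat3 h \<xi>) \<rho>" shows "eval3 h a (conj_pt \<rho>) = \<rho> (eval3 h a affine_pt)"
  using K_aut_eval3[OF assms affine_pt_rat3, of a] by (simp add: conj_pt_def)

lemma K_aut_1: "K_aut h (rat3 h \<xi>) \<rho> \<Longrightarrow> \<rho> 1 = 1" and K_aut_0: "K_aut h (rat3 h \<xi>) \<rho> \<Longrightarrow> \<rho> 0 = 0"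
proof -
  interpret h: comm_ring_hom h by (rule h)
  assume "K_aut h (rat3 h \<xi>) \<rho>"
  from K_autD(4)[OF this, of 1] K_autD(4)[OF this, of 0] show "\<rho> 1 = 1" "\<rho> 0 = 0" by (simp_all add: h.hom_one h.hom_zero)
qed

lemma conj_pt_nz: "K_aut h (rat3 h \<xi>) \<rho> \<Longrightarrow> conj_pt \<rho> \<noteq> 0"
proof
  assume "K_aut h (rat3 h \<xi>) \<rho>" "conj_pt \<rho> = 0"
  then have "conj_pt \<rho> $ pivot = 0" by simp
  then show False using K_aut_1[OF \<open>K_aut h (rat3 h \<xi>) \<rho>\<close>] by (simp add: conj_pt_def affine_pt(2))
qed

lemma represents_exists: "K_aut h (rat3 h \<xi>) \<rho> \<Longrightarrow> \<exists>\<phi>. represents \<phi> (conj_pt \<rho>)"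
proof -
  assume \<rho>: "K_aut h (rat3 h \<xi>) \<rho>"
  have "\<And>i. conj_pt \<rho> $ i \<in> rat3 h \<xi>" by (simp add: conj_pt_def K_autD(1)[OF \<rho>] affine_pt_rat3)
  from common_denominator[OF this] show ?thesis unfolding represents_def by blast
qed

text \<open>Write \<open>a\<close> for \<open>affine_pt\<close>. The composite sends the generic
  point to \<open>\<phi>\<close> at the conjugate of \<open>a\<close> under \<open>\<tau>\<close>.
  As \<open>\<tau>\<close> fixes the coefficients of \<open>\<phi>\<close>, this is
  \<open>\<tau>\<close> applied to \<open>\<phi>\<close> at \<open>a\<close>, that is, to a multiple
  of \<open>\<rho>\<close> of \<open>a\<close>, which gives back \<open>a\<close> up to a
  factor.\<close>

lemma represents_comp:
  assumes \<tau>: "K_aut h (rat3 h \<xi>) \<tau>" and \<rho>: "K_aut h (rat3 h \<xi>) \<rho>" and inv: "\<And>x. x \<in> rat3 h \<xi> \<Longrightarrow> \<tau> (\<rho> x) = x"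
    and inv': "\<And>x. x \<in> rat3 h \<xi> \<Longrightarrow> \<rho> (\<tau> x) = x"
    and \<phi>: "represents \<phi> (conj_pt \<rho>)" and \<psi>: "represents \<psi> (conj_pt \<tau>)"
  shows "comp_triple \<phi> \<psi> \<in> rat_map D vars3"
proof (rule represents_rat_map(1)[OF represents_vars3])
  show "affine_pt \<noteq> 0" using affine_pt(2) by auto
  obtain n \<beta> where n: "\<beta> \<noteq> 0" "\<And>i. homog3 n (\<phi> $ i)" "\<And>i. eval3 h (\<phi> $ i) \<xi> = \<beta> * conj_pt \<rho> $ i"
    using \<phi> unfolding represents_def by blast
  obtain \<gamma> k where \<gamma>: "\<gamma> \<noteq> 0" "\<forall>m a. homog3 m a \<longrightarrow>
    eval3 h (eval3 const3 a \<psi>) \<xi> = \<gamma> ^ m * eval3 h a (conj_pt \<tau>) \<and> homog3 (k * m) (eval3 const3 a \<psi>)"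
    using represents_eval3[OF \<psi>] by blast
  have c: "\<gamma> ^ n \<noteq> 0" "\<And>i. eval3 h (eval3 const3 (\<phi> $ i) \<psi>) \<xi> = \<gamma> ^ n * eval3 h (\<phi> $ i) (conj_pt \<tau>)"
    and n': "\<And>i. homog3 (k * n) (eval3 const3 (\<phi> $ i) \<psi>)"
    using \<gamma>(1) \<gamma>(2)[rule_format, OF n(2)] by simp_all
  \<comment> \<open>The factor between \<open>\<phi>\<close> at \<open>affine_pt\<close> and the
    conjugate point. It lies in the field because the pivot coordinate of the conjugate point is 1,
    so that it is itself a coordinate of \<open>\<phi>\<close> at \<open>affine_pt\<close>.\<close>
  define \<kappa> where "\<kappa> = \<beta> / (\<xi> $ pivot) ^ n"
  have ev: "eval3 h (\<phi> $ i) affine_pt = \<kappa> * \<rho> (affine_pt $ i)" for i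
    by (simp add: eval3_affine_pt[OF n(2)] n(3) \<kappa>_def conj_pt_def)
  have "\<kappa> = eval3 h (\<phi> $ pivot) affine_pt" by (simp add: ev affine_pt(2) K_aut_1[OF \<rho>])
  then have \<kappa>: "\<kappa> \<in> rat3 h \<xi>" using K_aut_eval3[OF \<tau> affine_pt_rat3] by simp
  have val: "eval3 h (\<phi> $ i) (conj_pt \<tau>) = \<tau> \<kappa> * affine_pt $ i" for i
    by (simp add: conj_pt_eval3[OF \<tau>] ev K_autD(3)[OF \<tau> \<kappa> K_autD(1)[OF \<rho> affine_pt_rat3]] inv affine_pt_rat3)
  have "\<tau> \<kappa> \<noteq> 0"
  proof
    assume "\<tau> \<kappa> = 0"
    then have "\<kappa> = 0" using inv'[OF \<kappa>] K_aut_0[OF \<rho>] by simp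
    then show False using n(1) pivot by (simp add: \<kappa>_def)
  qed
  then show "represents (comp_triple \<phi> \<psi>) affine_pt"
    unfolding represents_def comp_triple_def using n' c
    by (intro exI[of _ "k * n"] exI[of _ "\<gamma> ^ n * \<tau> \<kappa>"]) (simp add: val)
qed

text \<open>Applying \<open>\<rho>\<close> to the equation of the curve at its generic point shows
  that the conjugate point satisfies it too. Thus \<open>F\<close> composed with
  \<open>\<phi>\<close> vanishes at the generic point, hence on all of \<open>D\<close>.\<close>

lemma represents_self_map:
  assumes D: "D = zero_locus F" and F: "homog3 d F" and \<rho>: "K_aut h (rat3 h \<xi>) \<rho>" and \<phi>: "represents \<phi> (conj_pt \<rho>)"
  shows "self_map D \<phi>"
  unfolding self_map_def
proof (intro conjI ballI impI)
  show "rat_triple D \<phi>" by (rule represents_rat_map(2)[OF \<phi> conj_pt_nz[OF \<rho>] \<phi>])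
  fix x assume x: "x \<in> D" "forms_at \<phi> x \<noteq> 0"
  obtain \<gamma> k where \<gamma>: "\<forall>m a. homog3 m a \<longrightarrow>
    eval3 h (eval3 const3 a \<phi>) \<xi> = \<gamma> ^ m * eval3 h a (conj_pt \<rho>) \<and> homog3 (k * m) (eval3 const3 a \<phi>)"
    using represents_eval3[OF \<phi>] by blast
  have c: "eval3 h (eval3 const3 F \<phi>) \<xi> = \<gamma> ^ d * eval3 h F (conj_pt \<rho>)" and n: "homog3 (k * d) (eval3 const3 F \<phi>)"
    using \<gamma>[rule_format, OF F] by simp_all
  have "vanishes_on F D" unfolding D vanishes_on_def zero_locus_def by simp
  then have "eval3 h F \<xi> = 0" using gen[OF F] by simp
  then have "eval3 h F (conj_pt \<rho>) = 0" by (simp add: conj_pt_eval3[OF \<rho>] eval3_affine_pt[OF F] K_aut_0[OF \<rho>])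
  then have "vanishes_on (eval3 const3 F \<phi>) D" using gen[OF n] c by simp
  then have "form_at (eval3 const3 F \<phi>) x = 0" using x(1) by (simp add: vanishes_on_def)
  then have "form_at F (forms_at \<phi> x) = 0" by (simp add: eval3_eval3[OF comm_ring_hom_ident] forms_at_def)
  then show "forms_at \<phi> x \<in> D" using x(2) by (simp add: D zero_locus_def)
qed

lemma represents_Bir:
  assumes D: "D = zero_locus F" and F: "homog3 d F"
    and \<tau>: "K_aut h (rat3 h \<xi>) \<tau>" and \<rho>: "K_aut h (rat3 h \<xi>) \<rho>" and inv: "\<And>x. x \<in> rat3 h \<xi> \<Longrightarrow> \<tau> (\<rho> x) = x"
    and inv': "\<And>x. x \<in> rat3 h \<xi> \<Longrightarrow> \<rho> (\<tau> x) = x"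
    and \<phi>: "represents \<phi> (conj_pt \<rho>)"
  shows "rat_map D \<phi> \<in> carrier (Bir D)"
proof -
  obtain \<psi> where \<psi>: "represents \<psi> (conj_pt \<tau>)" using represents_exists[OF \<tau>] by blast
  have "self_map D \<phi>" "self_map D \<psi>" using represents_self_map[OF D F] \<rho> \<tau> \<phi> \<psi> by simp_all
  moreover have "comp_triple \<phi> \<psi> \<in> rat_map D vars3" by (rule represents_comp[OF \<tau> \<rho> inv inv' \<phi> \<psi>])
  moreover have "comp_triple \<psi> \<phi> \<in> rat_map D vars3" by (rule represents_comp[OF \<rho> \<tau> inv' inv \<psi> \<phi>])
  ultimately show ?thesis unfolding Bir_def by auto
qed

definition fconj :: "('a form3 fract set \<Rightarrow> 'a form3 fract set) \<Rightarrow> 'w \<Rightarrow> 'w" where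
  "fconj \<sigma> x = fval (\<sigma> (inv_into (carrier (function_field D)) fval x))"

lemma fconj_fval: "S \<in> carrier (function_field D) \<Longrightarrow> fconj \<sigma> (fval S) = fval (\<sigma> S)"
proof -
  have "inj_on fval (carrier (function_field D))" using fval_iso unfolding ring_iso_def bij_betw_def by blast
  then show "S \<in> carrier (function_field D) \<Longrightarrow> fconj \<sigma> (fval S) = fval (\<sigma> S)" by (simp add: fconj_def)
qed

lemma fval_hom:
  assumes "S \<in> carrier (function_field D)" "T \<in> carrier (function_field D)"
  shows "fval (S \<oplus>\<^bsub>function_field D\<^esub> T) = fval S + fval T" "fval (S \<otimes>\<^bsub>function_field D\<^esub> T) = fval S * fval T"
    "S \<oplus>\<^bsub>function_field D\<^esub> T \<in> carrier (function_field D)" "S \<otimes>\<^bsub>function_field D\<^esub> T \<in> carrier (function_field D)"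
proof -
  interpret r: ring_hom_ring "local_ring D" RT "rval h \<xi>" by (rule ring_hom_ring_rval)
  have "Ring.ring (function_field D)"
    unfolding function_field_def kernel_rval[symmetric]
    by (rule ideal.quotient_is_ring[OF r.kernel_is_ideal])
  then interpret E: Ring.ring "function_field D" .
  have "fval \<in> Ring.ring_hom (function_field D) (RT\<lparr>carrier := rat3 h \<xi>\<rparr>)" using fval_iso unfolding ring_iso_def by blast
  from ring_hom_add[OF this assms] ring_hom_mult[OF this assms]
  show "fval (S \<oplus>\<^bsub>function_field D\<^esub> T) = fval S + fval T" "fval (S \<otimes>\<^bsub>function_field D\<^esub> T) = fval S * fval T" by simp_all
  show "S \<oplus>\<^bsub>function_field D\<^esub> T \<in> carrier (function_field D)" "S \<otimes>\<^bsub>function_field D\<^esub> T \<in> carrier (function_field D)"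
    using assms by simp_all
qed

lemma const_rat_fun:
  "rat_fun D (const3 c) 1 \<in> carrier (function_field D)" "fval (rat_fun D (const3 c) 1) = h c"
proof -
  interpret e: comm_ring_hom "\<lambda>a. eval3 h a \<xi>" by (rule comm_ring_hom_eval3[OF h])
  show "rat_fun D (const3 c) 1 \<in> carrier (function_field D)" "fval (rat_fun D (const3 c) 1) = h c"
    using fval_rat_fun[of 0 "const3 c" 1] by (simp_all add: e.hom_one h)
qed

lemma K_aut_fconj:
  assumes \<sigma>: "\<sigma> \<in> ring_iso (function_field D) (function_field D)"
    and fx: "\<And>c. \<sigma> (rat_fun D (const3 c) 1) = rat_fun D (const3 c) 1"
  shows "K_aut h (rat3 h \<xi>) (fconj \<sigma>)"
  unfolding K_aut_def
proof (intro conjI ballI allI)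
  let ?E = "function_field D"
  have hom: "\<sigma> \<in> Ring.ring_hom ?E ?E" using \<sigma> unfolding ring_iso_def by blast
  show "fconj \<sigma> (h c) = h c" for c
    using fconj_fval[OF const_rat_fun(1), of \<sigma> c] by (simp add: fx const_rat_fun)
  fix x assume "x \<in> rat3 h \<xi>"
  then obtain S where S: "S \<in> carrier ?E" "x = fval S" using fval_carrier by blast
  show "fconj \<sigma> x \<in> rat3 h \<xi>" using ring_hom_closed[OF hom S(1)] fval_carrier by (auto simp: S fconj_fval)
  fix y assume "y \<in> rat3 h \<xi>"
  then obtain T where T: "T \<in> carrier ?E" "y = fval T" using fval_carrier by blast
  note ST = fval_hom[OF S(1) T(1)] and \<sigma>ST = fval_hom[OF ring_hom_closed[OF hom S(1)] ring_hom_closed[OF hom T(1)]]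
  show "fconj \<sigma> (x + y) = fconj \<sigma> x + fconj \<sigma> y"
    using fconj_fval[OF ST(3), of \<sigma>] by (simp add: S T ST(1) fconj_fval ring_hom_add[OF hom] \<sigma>ST)
  show "fconj \<sigma> (x * y) = fconj \<sigma> x * fconj \<sigma> y"
    using fconj_fval[OF ST(4), of \<sigma>] by (simp add: S T ST(2) fconj_fval ring_hom_mult[OF hom] \<sigma>ST)
qed

text \<open>\<open>extendable_galois_point\<close> speaks only about transformations that induce a
  given \<open>\<sigma>\<close>; it yields a linear map because such a transformation exists for
  each automorphism over the constants.\<close>

theorem exists_inducing:
  assumes D: "D = zero_locus F" and F: "homog3 d F"
    and \<sigma>: "\<sigma> \<in> ring_iso (function_field D) (function_field D)"
    and fx: "\<And>c. \<sigma> (rat_fun D (const3 c) 1) = rat_fun D (const3 c) 1"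
  shows "\<exists>\<Phi>. induces D \<sigma> \<Phi>"
proof -
  let ?E = "function_field D"
  interpret r: ring_hom_ring "local_ring D" RT "rval h \<xi>" by (rule ring_hom_ring_rval)
  have E: "Ring.ring ?E" unfolding function_field_def kernel_rval[symmetric]
    by (rule ideal.quotient_is_ring[OF r.kernel_is_ideal])
  define \<sigma>' where "\<sigma>' = inv_into (carrier ?E) \<sigma>"
  have \<sigma>': "\<sigma>' \<in> ring_iso ?E ?E" unfolding \<sigma>'_def by (rule ring_iso_set_sym[OF E \<sigma>])
  have bij: "bij_betw \<sigma> (carrier ?E) (carrier ?E)" using \<sigma> unfolding ring_iso_def by blast
  have ss: "\<sigma>' (\<sigma> S) = S" "\<sigma> (\<sigma>' S) = S" "\<sigma> S \<in> carrier ?E" "\<sigma>' S \<in> carrier ?E" if "S \<in> carrier ?E" for S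
    using that bij bij_betw_inv_into[OF bij] by (auto simp: \<sigma>'_def bij_betw_inv_into_left[OF bij] bij_betw_inv_into_right[OF bij] bij_betw_def)
  have fx': "\<sigma>' (rat_fun D (const3 c) 1) = rat_fun D (const3 c) 1" for c
    using ss(1)[OF const_rat_fun(1)[of c]] by (simp add: fx)
  let ?\<tau> = "fconj \<sigma>" and ?\<rho> = "fconj \<sigma>'"
  have \<tau>: "K_aut h (rat3 h \<xi>) ?\<tau>" by (rule K_aut_fconj[OF \<sigma> fx])
  have \<rho>: "K_aut h (rat3 h \<xi>) ?\<rho>" by (rule K_aut_fconj[OF \<sigma>' fx'])
  have inv: "?\<tau> (?\<rho> x) = x \<and> ?\<rho> (?\<tau> x) = x" if x: "x \<in> rat3 h \<xi>" for x
  proof -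
    obtain S where S: "S \<in> carrier ?E" "x = fval S" using x fval_carrier by blast
    show ?thesis using ss[OF S(1)] by (simp add: S fconj_fval)
  qed
  \<comment> \<open>The conjugate under the inverse of \<open>\<sigma>\<close> is taken, since
    \<open>induces\<close> makes \<open>\<sigma>\<close> the inverse of the pullback.\<close>
  obtain \<phi> where \<phi>: "represents \<phi> (conj_pt ?\<rho>)" using represents_exists[OF \<rho>] by blast
  have "induces D \<sigma> (rat_map D \<phi>)"
    unfolding induces_def
  proof (intro conjI ballI allI impI)
    show "rat_map D \<phi> \<in> carrier (Bir D)" by (rule represents_Bir[OF D F \<tau> \<rho> _ _ \<phi>]) (use inv in blast)+
    fix \<psi> n and a b :: "'a form3" assume \<psi>: "\<psi> \<in> rat_map D \<phi>" and ab: "homog3 n a \<and> homog3 n b \<and> \<not> vanishes_on b D"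
    have rep: "represents \<psi> (conj_pt ?\<rho>)" by (rule rat_map_represents[OF \<phi> conj_pt_nz[OF \<rho>] \<psi>])
    have a: "homog3 n a" and b: "homog3 n b" "eval3 h b \<xi> \<noteq> 0" using ab gen by blast+
    obtain \<gamma> k where \<gamma>: "\<gamma> \<noteq> 0" "\<forall>m a. homog3 m a \<longrightarrow>
      eval3 h (eval3 const3 a \<psi>) \<xi> = \<gamma> ^ m * eval3 h a (conj_pt ?\<rho>) \<and> homog3 (k * m) (eval3 const3 a \<psi>)"
      using represents_eval3[OF rep] by blast
    have c: "\<gamma> ^ n \<noteq> 0" "\<And>a. homog3 n a \<Longrightarrow> eval3 h (eval3 const3 a \<psi>) \<xi> = \<gamma> ^ n * eval3 h a (conj_pt ?\<rho>)"
      and m: "\<And>a. homog3 n a \<Longrightarrow> homog3 (k * n) (eval3 const3 a \<psi>)"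
      using \<gamma>(1) \<gamma>(2)[rule_format] by simp_all
    let ?S = "rat_fun D a b"
    have S: "?S \<in> carrier ?E" "fval ?S = eval3 h a \<xi> / eval3 h b \<xi>" using fval_rat_fun[OF a b] by simp_all
    have bn: "eval3 h b affine_pt \<noteq> 0" using b by (simp add: eval3_affine_pt[OF b(1)] pivot)
    have mem: "eval3 h b affine_pt \<in> rat3 h \<xi>" using K_aut_eval3[OF \<rho> affine_pt_rat3] by simp
    have "?\<rho> (eval3 h b affine_pt) \<noteq> 0"
    proof
      assume "?\<rho> (eval3 h b affine_pt) = 0"
      then have "eval3 h b affine_pt = 0" using inv[OF mem] K_aut_0[OF \<tau>] by simp
      then show False using bn by simp
    qed
    then have bn': "eval3 h b (conj_pt ?\<rho>) \<noteq> 0" by (simp add: conj_pt_eval3[OF \<rho>])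
    have "fval ?S * eval3 h b affine_pt = eval3 h a affine_pt"
      using b pivot by (simp add: S eval3_affine_pt[OF a] eval3_affine_pt[OF b(1)])
    moreover have "fval ?S \<in> rat3 h \<xi>" using S(1) fval_carrier by blast
    ultimately have "?\<rho> (fval ?S) * ?\<rho> (eval3 h b affine_pt) = ?\<rho> (eval3 h a affine_pt)"
      using K_autD(3)[OF \<rho> _ mem, of "fval ?S"] by simp
    then have "?\<rho> (fval ?S) = eval3 h a (conj_pt ?\<rho>) / eval3 h b (conj_pt ?\<rho>)"
      using bn' by (simp add: conj_pt_eval3[OF \<rho>] field_simps)
    then have "fval (\<sigma>' ?S) = eval3 h a (conj_pt ?\<rho>) / eval3 h b (conj_pt ?\<rho>)" by (simp add: fconj_fval[OF S(1)])
    moreover have "eval3 h (eval3 const3 b \<psi>) \<xi> \<noteq> 0" using c b bn' by simp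
    note T = fval_rat_fun[OF m[OF a] m[OF b(1)] this]
    have "fval (rat_fun D (eval3 const3 a \<psi>) (eval3 const3 b \<psi>)) = eval3 h a (conj_pt ?\<rho>) / eval3 h b (conj_pt ?\<rho>)"
      using T(2) \<gamma>(1) by (simp add: c(2)[OF a] c(2)[OF b(1)])
    ultimately have "rat_fun D (eval3 const3 a \<psi>) (eval3 const3 b \<psi>) = \<sigma>' ?S"
      using fval_inj[OF T(1) ss(4)[OF S(1)]] by simp
    then show "\<sigma> (rat_fun D (eval3 const3 a \<psi>) (eval3 const3 b \<psi>)) = rat_fun D a b" using ss(2)[OF S(1)] by simp
  qed
  then show ?thesis by blast
qed

end

instance fract :: ("{idom, ring_char_0}") field_char_0
proof
  show "inj (of_nat :: nat \<Rightarrow> 'a fract)"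
    by (rule injI) (simp add: of_nat_fract eq_fract)
qed

section \<open>The curve near an extendable Galois point\<close>

lemma inverse_matrix_exists:
  fixes M :: "'a::field ^ 3 ^ 3"
  assumes "\<And>v. M *v v = 0 \<Longrightarrow> v = 0"
  shows "\<exists>N. M ** N = mat 1 \<and> N ** M = mat 1"
proof -
  obtain N where "N ** M = mat 1" using assms matrix_left_invertible_ker by blast
  then show ?thesis by (intro exI[of _ N]) (simp add: matrix_left_right_inverse)
qed

text \<open>\<open>P\<close> is completed to a basis by the unit vectors with index other than
  \<open>k\<close>, where \<open>P $ k\<close> is nonzero; \<open>s\<close> enumerates these two
  indices.\<close>

lemma first_column_exists:
  fixes P :: "'a::field ^ 3"
  assumes "P \<noteq> 0"
  shows "\<exists>(M :: 'a ^ 3 ^ 3) N. M ** N = mat 1 \<and> N ** M = mat 1 \<and> M *v axis 1 1 = P"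
proof -
  from assms obtain k where k: "P $ k \<noteq> 0" by (auto simp: Finite_Cartesian_Product.vec_eq_iff)
  define s where "s j = (if j = 2 then (if k = 1 then 2 else 1) else (if k = 3 then 2 else 3 :: 3))" for j :: 3
  define M :: "'a ^ 3 ^ 3" where "M = (\<chi> i j. if j = 1 then P $ i else axis (s j) 1 $ i)"
  have s: "s 2 \<noteq> k" "s 3 \<noteq> k" "s 2 \<noteq> s 3" using exhaust_3[of k] by (auto simp: s_def)
  have Mv: "(M *v v) $ i = P $ i * v $ 1 + axis (s 2) 1 $ i * v $ 2 + axis (s 3) 1 $ i * v $ 3" for v i
    by (simp add: M_def matrix_vector_mult_def sum_3)
  have "v = 0" if 0: "M *v v = 0" for v
  proof -
    have 1: "v $ 1 = 0" using Mv[of v k] 0 k s by (simp add: axis_def)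
    have 2: "v $ 2 = 0" using Mv[of v "s 2"] 0 1 s by (simp add: axis_def)
    have "v $ 3 = 0" using Mv[of v "s 3"] 0 1 2 s by (simp add: axis_def)
    with 1 2 show "v = 0" unfolding Finite_Cartesian_Product.vec_eq_iff forall_3 by simp
  qed
  then obtain N where N: "M ** N = mat 1" "N ** M = mat 1" using inverse_matrix_exists[of M] by blast
  have "M *v axis 1 1 = P" unfolding Finite_Cartesian_Product.vec_eq_iff by (simp add: Mv) (simp add: axis_def)
  with N show ?thesis by (intro exI[of _ M] exI[of _ N]) simp
qed

lemma form_at_axis1:
  fixes H :: "'a::comm_ring_1 form3"
  assumes "homog3 m H"
  shows "form_at H (axis 1 1) = Polynomial.coeff (Polynomial.coeff (Polynomial.coeff H m) 0) 0"
proof -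
  have "form_at H (axis 1 1) = poly (map_poly (\<lambda>g. Polynomial.coeff (Polynomial.coeff g 0) 0) H) 1"
    by (simp add: eval3_def axis_def map_poly_idI poly_0_coeff_0 coeff_map_poly)
  also have "\<dots> = (\<Sum>i\<le>Polynomial.degree H. Polynomial.coeff (Polynomial.coeff (Polynomial.coeff H i) 0) 0)"
    by (subst poly_map_poly_sum) simp_all
  also have "\<dots> = (\<Sum>i\<le>Polynomial.degree H. if i = m then Polynomial.coeff (Polynomial.coeff (Polynomial.coeff H m) 0) 0 else 0)"
    using assms unfolding homog3_def by (intro sum.cong refl) force
  also have "\<dots> = Polynomial.coeff (Polynomial.coeff (Polynomial.coeff H m) 0) 0"
    by (simp add: coeff_eq_0)
  finally show ?thesis .
qed

lemma forms_at_gradient_subst_mat: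
  assumes "comm_ring_hom h"
  shows "eval3 h (gradient (subst_mat F M) $ i) v = (\<Sum>j\<in>UNIV. h (M $ j $ i) * eval3 h (gradient F $ j) (hmat h M *v v))"
proof -
  interpret e: comm_ring_hom "\<lambda>F. eval3 h F v" by (rule comm_ring_hom_eval3[OF assms])
  have "eval3 h (eval3 const3 G (lin_forms M)) v = eval3 h G (hmat h M *v v)" for G
    using eval3_subst_mat[OF assms] by (simp add: subst_mat_def)
  then show ?thesis
    by (simp add: subst_mat_def gradient_comp e.hom_sum e.hom_mult gradient_lin_forms assms mult.commute)
qed

lemma homog3_degree_le:
  assumes "homog3 d G" shows "Polynomial.degree G \<le> d"
proof (rule degree_le, intro allI impI)
  fix i assume "d < i"
  have "Polynomial.coeff (Polynomial.coeff (Polynomial.coeff G i) j) k = 0" for j k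
    using assms \<open>d < i\<close> unfolding homog3_def by (metis add.assoc le_add1 not_le)
  then show "Polynomial.coeff G i = 0" by (intro poly_eqI) simp
qed

lemma homog2_coeff:
  assumes "homog3 d G" "i \<le> d" shows "homog2 (d - i) (Polynomial.coeff G i)"
  unfolding homog2_def
proof (intro allI impI)
  fix j k assume "Polynomial.coeff (Polynomial.coeff (Polynomial.coeff G i) j) k \<noteq> 0"
  then have "i + j + k = d" using assms(1) unfolding homog3_def by simp
  then show "j + k = d - i" by simp
qed

text \<open>With \<open>P\<close> at \<open>(1 : 0 : 0)\<close>, the coefficient of
  \<open>X ^ d\<close> is the value of \<open>F\<close> at \<open>P\<close>. If it vanishes, the
  coefficient of \<open>X ^ (d - 1)\<close> is the linear form of the tangent at \<open>P\<close>,
  which is nonzero precisely at a smooth point.\<close>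

lemma degree_at_point:
  fixes F :: "'a::field_char_0 form3"
  assumes F: "homog3 d F" "d > 0" and M: "M ** N = mat 1" "M *v axis 1 1 = P"
  shows "P \<notin> zero_locus F \<Longrightarrow> Polynomial.degree (subst_mat F M) = d"
    and "P \<in> zero_locus F - sing_locus F \<Longrightarrow> Polynomial.degree (subst_mat F M) = d - 1"
proof -
  define G where "G = subst_mat F M"
  have G: "homog3 d G" unfolding G_def by (rule homog3_subst_mat[OF F(1)])
  note le = homog3_degree_le[OF G]
  have val: "form_at F P = Polynomial.coeff (Polynomial.coeff (Polynomial.coeff G d) 0) 0"
    unfolding form_at_axis1[OF G, symmetric] by (simp add: G_def form_at_subst_mat M)
  have NM: "N ** M = mat 1" using M(1) by (simp add: matrix_left_right_inverse)
  have "P \<noteq> 0"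
  proof
    assume "P = 0"
    then have "N *v (M *v axis 1 1) = 0" using M by simp
    then have "axis 1 1 = (0 :: 'a ^ 3)" by (simp add: matrix_vector_mul_assoc NM)
    then have "axis 1 1 $ (1::3) = (0 :: 'a)" by simp
    then show False by (simp add: axis_def)
  qed
  show "Polynomial.degree (subst_mat F M) = d" if "P \<notin> zero_locus F"
  proof -
    have "form_at F P \<noteq> 0" using that \<open>P \<noteq> 0\<close> by (simp add: zero_locus_def)
    then have "Polynomial.coeff G d \<noteq> 0" using val by auto
    then have "d \<le> Polynomial.degree G" by (rule le_degree)
    with le show ?thesis by (simp add: G_def)
  qed
  show "Polynomial.degree (subst_mat F M) = d - 1" if P: "P \<in> zero_locus F - sing_locus F"
  proof -
    have z: "Polynomial.coeff (Polynomial.coeff (Polynomial.coeff G d) 0) 0 = 0"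
      using P val by (simp add: zero_locus_def)
    have "Polynomial.coeff (Polynomial.coeff (Polynomial.coeff G d) j) k = 0" for j k
    proof (cases "j = 0 \<and> k = 0")
      case False
      then show ?thesis using G unfolding homog3_def by (metis add.assoc add_cancel_right_right add_is_0)
    qed (use z in simp)
    then have cd: "Polynomial.coeff G d = 0" by (intro poly_eqI) simp
    have "Polynomial.coeff G (d - 1) \<noteq> 0"
    proof
      assume c: "Polynomial.coeff G (d - 1) = 0"
      have "form_at (gradient G $ i) (axis 1 1) = 0" for i
        unfolding form_at_axis1[OF homog3_gradient[OF G F(2)]]
        using exhaust_3[of i] c cd F(2) by (auto simp: gradient_def coeff_pderiv coeff_map_poly)
      then have tr: "(\<Sum>j\<in>UNIV. M $ j $ i * form_at (gradient F $ j) P) = 0" for i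
        using forms_at_gradient_subst_mat[OF comm_ring_hom_ident, of F M i "axis 1 1"] by (simp add: G_def M)
      have "forms_at (gradient F) P v* M = 0"
        by (simp add: Finite_Cartesian_Product.vec_eq_iff vector_matrix_mult_def forms_at_def tr mult.commute)
      then have "(forms_at (gradient F) P v* M) v* N = 0" by simp
      then have "forms_at (gradient F) P = 0" by (simp add: vector_matrix_mul_assoc M)
      then show False using P by (simp add: sing_locus_def)
    qed
    then have "d - 1 \<le> Polynomial.degree G" by (rule le_degree)
    moreover have "Polynomial.degree G \<noteq> d"
    proof
      assume "Polynomial.degree G = d"
      then have "G = 0" using cd by (metis leading_coeff_0_iff)
      then show False using \<open>Polynomial.coeff G (d - 1) \<noteq> 0\<close> by simp
    qed
    ultimately show ?thesis using le unfolding G_def by linarith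
  qed
qed

lemma gpt_root_exists:
  fixes G :: "'a::field form3"
  assumes "Polynomial.degree G > 0" shows "\<exists>x. poly (map_poly emb G) x = 0"
proof -
  have "Polynomial.degree (map_poly emb G) = Polynomial.degree G" by (rule degree_map_poly) simp
  then show ?thesis using assms by (intro alg_closed_imp_poly_has_root) simp
qed

lemma gpt_nz: "gpt x \<noteq> 0"
proof
  assume "gpt x = 0"
  then have "gpt x $ 2 = 0" by simp
  then show False by (simp add: vars2_def)
qed

lemma gen_pt_curve:
  fixes F :: "'a::{alg_closed_field, field_char_0} form3"
  assumes F: "Factorial_Ring.irreducible F" and MN: "M ** N = mat 1"
    and deg: "Polynomial.degree (subst_mat F M) > 0" and x: "poly (map_poly emb (subst_mat F M)) x = 0"
  shows "gen_pt (zero_locus F) kemb (hmat kemb M *v gpt x)"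
proof (rule gen_pt.intro)
  show "comm_ring_hom (kemb :: 'a \<Rightarrow> 'a gen)" by (rule comm_ring_hom_kemb)
  show "hmat kemb M *v gpt x \<noteq> 0"
  proof
    assume "hmat kemb M *v gpt x = 0"
    then have "hmat kemb N *v (hmat kemb M *v gpt x) = 0" by simp
    moreover have "N ** M = mat 1" using MN by (simp add: matrix_left_right_inverse)
    ultimately show False using hmat_inverse[OF comm_ring_hom_kemb, of N M "gpt x"] gpt_nz[of x] by simp
  qed
  fix n b assume "homog3 n (b :: 'a form3)"
  show "vanishes_on b (zero_locus F) \<longleftrightarrow> eval3 kemb b (hmat kemb M *v gpt x) = 0"
    using generic_point_curve[OF F MN deg x] by simp
qed

text \<open>A root of an irreducible \<open>G\<close> of degree greater than one satisfies no linear
  equation over \<open>K(Y,Z)\<close>. This is the device for comparing coefficients of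
  \<open>x\<close>.\<close>

lemma gpt_linear_dvd:
  fixes G :: "'a::{alg_closed_field, field_char_0} form3"
  assumes G: "Factorial_Ring.irreducible G" "Polynomial.degree G > 1" "poly (map_poly emb G) x = 0"
    and 0: "emb b * x + emb a = 0"
  shows "a = 0 \<and> b = 0"
proof -
  interpret m: map_poly_comm_ring_hom "emb :: 'a poly poly \<Rightarrow> 'a gen"
    using comm_ring_hom_emb by (simp add: map_poly_comm_ring_hom_def)
  have "poly (map_poly emb [:a, b:]) x = emb a + x * emb b"
    using poly_map_pCons[OF comm_ring_hom_emb, of a "[:b:]" x] by (simp add: map_poly_const_poly)
  then have "poly (map_poly emb [:a, b:]) x = 0" using 0 by (simp add: algebra_simps)
  moreover have "Polynomial.degree G > 0" using G(2) by simp
  ultimately have dvd: "G dvd [:a, b:]" using gpt_zero_imp_dvd[OF G(1) _ G(3)] by simp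
  have "[:a, b:] = 0"
  proof (rule ccontr)
    assume "[:a, b:] \<noteq> 0"
    then have "Polynomial.degree G \<le> Polynomial.degree [:a, b:]" using dvd by (intro dvd_imp_degree_le) simp_all
    also have "\<dots> \<le> 1" by simp
    finally show False using G(2) by simp
  qed
  then show ?thesis by simp
qed

section \<open>Linear maps fixing every line through the Galois point\<close>

lemma linear_binary_form_eq_0:
  fixes \<beta> \<gamma> :: "'a::comm_ring_1"
  assumes "const2 \<beta> * vars2 $ 1 + const2 \<gamma> * vars2 $ 2 = 0" shows "\<beta> = 0 \<and> \<gamma> = 0"
proof -
  have eq: "const2 \<beta> * vars2 $ 1 + const2 \<gamma> * vars2 $ 2 = [:[:0, \<gamma>:], [:\<beta>:]:]"
    by (simp add: const2_def vars2_def)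
  show ?thesis using assms unfolding eq by simp
qed

lemma quadratic_binary_form_eq_0:
  fixes \<beta> \<gamma> \<delta> :: "'a::comm_ring_1"
  assumes "const2 \<beta> * (vars2 $ 1)\<^sup>2 + const2 \<gamma> * vars2 $ 1 * vars2 $ 2 + const2 \<delta> * (vars2 $ 2)\<^sup>2 = 0"
  shows "\<beta> = 0 \<and> \<gamma> = 0 \<and> \<delta> = 0"
proof -
  have eq: "const2 \<beta> * (vars2 $ 1)\<^sup>2 + const2 \<gamma> * vars2 $ 1 * vars2 $ 2 + const2 \<delta> * (vars2 $ 2)\<^sup>2
    = [:[:0, 0, \<delta>:], [:0, \<gamma>:], [:\<beta>:]:]"
    by (simp add: const2_def vars2_def power2_eq_square)
  show ?thesis using assms unfolding eq by simp
qed

text \<open>For \<open>\<alpha>\<close> nonzero and up to a scalar, these are the collineations that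
  fix every line through \<open>(1 : 0 : 0)\<close>, since they leave the ratio of the last two
  coordinates unchanged.\<close>

definition mat_row1 :: "'a::comm_ring_1 \<Rightarrow> 'a \<Rightarrow> 'a \<Rightarrow> 'a ^ 3 ^ 3" where
  "mat_row1 \<alpha> \<beta> \<gamma> = (\<chi> i. if i = 1 then (\<chi> j. if j = 1 then \<alpha> else if j = 2 then \<beta> else \<gamma>) else axis i 1)"

lemma mat_row1_mult:
  "(mat_row1 \<alpha> \<beta> \<gamma> *v v) $ 1 = \<alpha> * v $ 1 + \<beta> * v $ 2 + \<gamma> * v $ 3"
  "(mat_row1 \<alpha> \<beta> \<gamma> *v v) $ 2 = v $ 2" "(mat_row1 \<alpha> \<beta> \<gamma> *v v) $ 3 = v $ 3"
  by (simp_all add: mat_row1_def matrix_vector_mult_def sum_3 axis_def)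

lemma comm_ring_hom_pcompose: "comm_ring_hom (\<lambda>p. pcompose p (q :: 'a::comm_ring_1 poly))"
  by (rule comm_ring_hom_I) (simp_all add: pcompose_add pcompose_mult pcompose_1)

lemma subst_mat_row1:
  "subst_mat G (mat_row1 \<alpha> \<beta> \<gamma>) = pcompose G [:const2 \<beta> * vars2 $ 1 + const2 \<gamma> * vars2 $ 2, const2 \<alpha>:]"
proof (rule form3_hom_unique[OF comm_ring_hom_subst_mat comm_ring_hom_pcompose])
  show "subst_mat (const3 c) (mat_row1 \<alpha> \<beta> \<gamma>) = pcompose (const3 c) [:const2 \<beta> * vars2 $ 1 + const2 \<gamma> * vars2 $ 2, const2 \<alpha>:]" for c
    by (simp add: subst_mat_def comm_ring_hom_const3) (simp add: const3_def)
  show "subst_mat (vars3 $ i) (mat_row1 \<alpha> \<beta> \<gamma>) = pcompose (vars3 $ i) [:const2 \<beta> * vars2 $ 1 + const2 \<gamma> * vars2 $ 2, const2 \<alpha>:]" for i :: 3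
  proof -
    have l: "subst_mat (vars3 $ i) (mat_row1 \<alpha> \<beta> \<gamma>) = (\<Sum>j\<in>UNIV. const3 (mat_row1 \<alpha> \<beta> \<gamma> $ i $ j) * vars3 $ j)"
      by (simp add: subst_mat_def comm_ring_hom_const3 lin_forms_def)
    consider "i = 1" | "i = 2" | "i = 3" using exhaust_3[of i] by blast
    then show ?thesis unfolding l sum_3
      by cases (simp_all add: mat_row1_def axis_def, simp_all add: vars3_def vars2_def const3_def const2_def pcompose_pCons)
  qed
qed

lemma pcompose_scale_coeff:
  fixes F :: "'r::comm_ring_1 poly"
  shows "Polynomial.coeff (pcompose F [:0, e:]) i = e ^ i * Polynomial.coeff F i"
proof (induction F arbitrary: i)
  case 0 show ?case by simp
next
  case (pCons a F)
  have "pcompose (pCons a F) [:0, e:] = [:a:] + pCons 0 (smult e (pcompose F [:0, e:]))"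
    by (simp add: pcompose_pCons)
  then show ?case using pCons.IH by (cases i) (simp_all add: mult_ac)
qed

lemma prime_power_eq_1_dvd:
  fixes \<alpha> :: "'a::field"
  assumes p: "Factorial_Ring.prime (p::nat)" and "\<alpha> ^ p = 1" "\<alpha> ^ i = 1" "\<alpha> \<noteq> 1"
  shows "p dvd i"
proof (rule ccontr)
  assume "\<not> p dvd i"
  from prime_imp_coprime[OF p this] have g: "gcd i p = 1" by (simp add: gcd.commute coprime_iff_gcd_eq_1)
  have "i \<noteq> 0"
  proof
    assume "i = 0"
    then show False using \<open>\<not> p dvd i\<close> by simp
  qed
  from bezout_nat[OF this, of p] obtain u v where uv: "i * u = p * v + 1" unfolding g by blast
  have "\<alpha> ^ (i * u) = 1" using assms by (simp add: power_mult)
  moreover have "\<alpha> ^ (p * v + 1) = \<alpha>" using assms by (simp add: power_mult)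
  ultimately show False using uv assms by simp
qed

text \<open>The substituted polynomial vanishes at \<open>x\<close> and has the same degree, so it
  is \<open>e\<close> times \<open>G\<close>: the affine map permutes the roots of \<open>G\<close>.
  After its fixed point is moved to 0 it is multiplication by \<open>\<alpha>\<close>, and only
  coefficients with \<open>\<alpha> ^ i = \<alpha> ^ p\<close> survive. The constant one survives by
  irreducibility, so \<open>\<alpha>\<close> is a primitive \<open>p\<close>-th root of unity and
  \<open>i\<close> is 0 or \<open>p\<close>.\<close>

lemma semi_invariant_affine:
  fixes G :: "'a::{alg_closed_field, field_char_0} form3"
  assumes p: "Factorial_Ring.prime p" and G: "Factorial_Ring.irreducible G" "Polynomial.degree G = p" "p \<ge> 2"
    and x: "poly (map_poly emb G) x = 0"
    and inv: "poly (map_poly emb G) (kemb \<alpha> * x + emb (const2 \<beta> * vars2 $ 1 + const2 \<gamma> * vars2 $ 2)) = 0"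
    and nt: "\<alpha> \<noteq> 1 \<or> \<beta> \<noteq> 0 \<or> \<gamma> \<noteq> 0" and nz: "\<alpha> \<noteq> 0"
  shows "\<alpha> \<noteq> 1 \<and> (\<exists>c0 cp. subst_mat G (mat_row1 1 (- \<beta> / (\<alpha> - 1)) (- \<gamma> / (\<alpha> - 1))) = [:c0:] + Polynomial.monom cp p)"
proof -
  let ?l = "const2 \<beta> * vars2 $ 1 + const2 \<gamma> * vars2 $ 2 :: 'a form2"
  interpret emb: comm_ring_hom "emb :: 'a poly poly \<Rightarrow> 'a gen" by (rule comm_ring_hom_emb)
  interpret pe: comm_ring_hom "\<lambda>b. poly (map_poly emb b) x" by (rule comm_ring_hom_poly_map[OF comm_ring_hom_emb])
  have G0: "G \<noteq> 0" using G by auto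
  have dG: "Polynomial.degree G > 0" using G by simp
  define G1 where "G1 = pcompose G [:?l, const2 \<alpha>:]"
  have comp: "poly (map_poly emb (pcompose b [:s, t:])) y = poly (map_poly emb b) (emb t * y + emb s)" for b s t y
  proof (induction b)
    case 0 show ?case by simp
  next
    case (pCons a b)
    interpret q: comm_ring_hom "\<lambda>b. poly (map_poly emb b) y" by (rule comm_ring_hom_poly_map[OF comm_ring_hom_emb])
    have "poly (map_poly emb [:s, t:]) y = emb t * y + emb s"
      using poly_map_pCons[OF comm_ring_hom_emb, of s "[:t:]" y] by (simp add: map_poly_const_poly)
    then show ?case unfolding pcompose_pCons q.hom_add q.hom_mult pCons.IH poly_map_pCons[OF comm_ring_hom_emb]
      by (simp add: map_poly_const_poly)
  qed
  have "poly (map_poly emb G1) x = 0" unfolding G1_def comp using inv by (simp add: kemb_def)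
  then have "G dvd G1" by (rule gpt_zero_imp_dvd[OF G(1) dG x])
  then obtain q where q: "G1 = G * q" by (rule dvdE)
  have c\<alpha>: "const2 \<alpha> \<noteq> 0" using nz by (simp add: const2_def)
  have deg1: "Polynomial.degree G1 = p" unfolding G1_def degree_pcompose using G c\<alpha> by simp
  then have "G1 \<noteq> 0" using G by auto
  then have q0: "q \<noteq> 0" using q by auto
  have "Polynomial.degree q = 0" using arg_cong[OF q, of Polynomial.degree] degree_mult_eq[OF G0 q0] deg1 G by simp
  then obtain e where e: "q = [:e:]" by (rule degree_eq_zeroE)
  have G1e: "G1 = smult e G" using q e by simp
  have "Polynomial.lead_coeff G1 = Polynomial.lead_coeff G * const2 \<alpha> ^ p"
    unfolding G1_def using lead_coeff_comp[of "[:?l, const2 \<alpha>:]" G] c\<alpha> G by simp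
  moreover have "Polynomial.lead_coeff G1 = e * Polynomial.lead_coeff G" unfolding G1e by (simp add: lead_coeff_smult)
  ultimately have e_eq: "e = const2 \<alpha> ^ p" using G0 by (simp add: mult.commute)
  have iter: "poly (map_poly emb G) (kemb \<alpha> * y + emb ?l) = 0" if "poly (map_poly emb G) y = 0" for y
  proof -
    interpret q: comm_ring_hom "\<lambda>b. poly (map_poly emb b) y" by (rule comm_ring_hom_poly_map[OF comm_ring_hom_emb])
    have "poly (map_poly emb G1) y = poly (map_poly emb (G * q)) y" using q by simp
    also have "\<dots> = 0" using that by (simp add: q.hom_mult)
    finally show ?thesis unfolding G1_def comp by (simp add: kemb_def)
  qed
  have \<alpha>1: "\<alpha> \<noteq> 1"
  proof
    assume \<alpha>: "\<alpha> = 1"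
    then have l0: "?l \<noteq> 0" using nt linear_binary_form_eq_0[of \<beta> \<gamma>] by blast
    have one: "kemb (1::'a) = 1" using comm_ring_hom_kemb by (simp add: kemb_def emb.hom_one)
    \<comment> \<open>A translation is excluded by its infinitely many iterates: in characteristic
      zero they would all be different roots of \<open>G\<close>.\<close>
    have "poly (map_poly emb G) (x + of_nat n * emb ?l) = 0" for n
    proof (induction n)
      case 0 show ?case using x by simp
    next
      case (Suc n) then show ?case using iter[OF Suc.IH] by (simp add: \<alpha> one algebra_simps)
    qed
    then have "range (\<lambda>n. x + of_nat n * emb ?l) \<subseteq> {y. poly (map_poly emb G) y = 0}" by blast
    moreover have "map_poly emb G \<noteq> 0" using G0 by (simp add: map_poly_eq_0_iff)
    then have "finite {y. poly (map_poly emb G) y = 0}" by (rule poly_roots_finite)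
    ultimately have fin: "finite (range (\<lambda>n. x + of_nat n * emb ?l))" by (rule finite_subset)
    have "emb ?l \<noteq> 0" using l0 by simp
    then have "inj (\<lambda>n. x + of_nat n * emb ?l)" by (simp add: inj_on_def)
    from range_inj_infinite[OF this] show False using fin by simp
  qed
  \<comment> \<open>The fixed point of \<open>X \<mapsto> \<alpha> X + l\<close>, namely
    \<open>- l / (\<alpha> - 1)\<close>.\<close>
  define s where "s = const2 (- \<beta> / (\<alpha> - 1)) * vars2 $ 1 + const2 (- \<gamma> / (\<alpha> - 1)) * vars2 $ 2"
  define F1 where "F1 = pcompose G [:s, 1:]"
  have F1: "F1 = subst_mat G (mat_row1 1 (- \<beta> / (\<alpha> - 1)) (- \<gamma> / (\<alpha> - 1)))"
    by (simp add: F1_def s_def subst_mat_row1)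
  have fixs: "const2 \<alpha> * s + ?l = s"
  proof -
    interpret c: comm_ring_hom const2 by (rule comm_ring_hom_const2)
    have *: "\<alpha> * (- b / (\<alpha> - 1)) + b = - b / (\<alpha> - 1)" for b using \<alpha>1 by (simp add: field_simps)
    have "const2 \<alpha> * s + ?l = const2 (\<alpha> * (- \<beta> / (\<alpha> - 1)) + \<beta>) * vars2 $ 1 + const2 (\<alpha> * (- \<gamma> / (\<alpha> - 1)) + \<gamma>) * vars2 $ 2"
      unfolding s_def c.hom_add c.hom_mult by (simp only: algebra_simps)
    then show ?thesis unfolding * s_def .
  qed
  have "pcompose F1 [:0, const2 \<alpha>:] = pcompose G (pcompose [:s, 1:] [:0, const2 \<alpha>:])"
    by (simp only: F1_def pcompose_assoc)
  also have "pcompose [:s, 1:] [:0, const2 \<alpha>:] = pcompose [:?l, const2 \<alpha>:] [:s, 1:]"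
    using fixs by (simp add: pcompose_pCons add.commute)
  also have "pcompose G \<dots> = pcompose G1 [:s, 1:]" by (simp only: G1_def pcompose_assoc)
  also have "\<dots> = smult e F1" by (simp add: G1e F1_def pcompose_smult)
  finally have eqF: "pcompose F1 [:0, const2 \<alpha>:] = smult e F1" .
  have coeffs: "const2 \<alpha> ^ i * Polynomial.coeff F1 i = const2 \<alpha> ^ p * Polynomial.coeff F1 i" for i
    unfolding pcompose_scale_coeff[symmetric] eqF e_eq by simp
  have pw: "\<alpha> ^ i = \<alpha> ^ p" if "Polynomial.coeff F1 i \<noteq> 0" for i
  proof -
    interpret c: comm_ring_hom "const2 :: 'a \<Rightarrow> 'a form2" by (rule comm_ring_hom_const2)
    have "const2 (\<alpha> ^ i) = const2 (\<alpha> ^ p)" using that coeffs[of i] by (simp add: c.hom_power)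
    then show ?thesis by (simp add: const2_def)
  qed
  have "mat_row1 1 b c ** mat_row1 1 (- b) (- c) = (mat 1 :: 'a ^ 3 ^ 3)" for b c
    unfolding matrix_eq Finite_Cartesian_Product.vec_eq_iff forall_3
    by (simp add: matrix_vector_mul_assoc[symmetric] mat_row1_mult)
  from irreducible_subst_mat[OF G(1) this] have irr: "Factorial_Ring.irreducible F1" unfolding F1 .
  have degF1: "Polynomial.degree F1 = p" unfolding F1_def degree_pcompose using G by simp
  \<comment> \<open>Otherwise \<open>X\<close> divides the irreducible \<open>F1\<close>, whose
    degree is at least two.\<close>
  have "Polynomial.coeff F1 0 \<noteq> 0"
  proof
    assume "Polynomial.coeff F1 0 = 0"
    then have "[:0, 1:] dvd F1" using poly_eq_0_iff_dvd[of F1 0] by (simp add: poly_0_coeff_0)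
    then obtain q where q: "F1 = [:0, 1:] * q" by (rule dvdE)
    have "\<not> [:0, 1:: 'a form2:] dvd 1"
    proof
      assume "[:0, 1:: 'a form2:] dvd 1"
      from dvd_imp_degree_le[OF this] show False by simp
    qed
    with Factorial_Ring.irreducibleD[OF irr q] have "q dvd 1" by meson
    from dvd_imp_degree_le[OF this] have "Polynomial.degree q = 0" by simp
    moreover have "F1 \<noteq> 0"
    proof
      assume "F1 = 0"
      then show False using irr by simp
    qed
    then have "q \<noteq> 0" unfolding q by simp
    ultimately have "Polynomial.degree F1 = 1" unfolding q by (simp add: degree_pCons_eq)
    then show False using degF1 G(3) by simp
  qed
  from pw[OF this] have \<alpha>p: "\<alpha> ^ p = 1" by simp
  have "F1 = [:Polynomial.coeff F1 0:] + Polynomial.monom (Polynomial.coeff F1 p) p"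
  proof (rule poly_eqI)
    fix i
    show "Polynomial.coeff F1 i = Polynomial.coeff ([:Polynomial.coeff F1 0:] + Polynomial.monom (Polynomial.coeff F1 p) p) i"
    proof (cases "i = 0 \<or> i = p")
      case True
      then show ?thesis using G(3) by (elim disjE) (simp_all add: coeff_const_poly)
    next
      case False
      have "Polynomial.coeff F1 i = 0"
      proof (rule ccontr)
        assume ne: "Polynomial.coeff F1 i \<noteq> 0"
        then have "\<alpha> ^ i = 1" using pw \<alpha>p by simp
        from prime_power_eq_1_dvd[OF p \<alpha>p this \<alpha>1] have "p dvd i" .
        moreover have "i \<le> p" using le_degree[OF ne] degF1 by simp
        ultimately have "i = p" using False dvd_imp_le[of p i] by simp
        then show False using False by simp
      qed
      then show ?thesis using False by (simp add: coeff_const_poly)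
    qed
  qed
  then have "\<exists>c0 cp. F1 = [:c0:] + Polynomial.monom cp p" by (intro exI[of _ "Polynomial.coeff F1 0"] exI[of _ "Polynomial.coeff F1 p"])
  then show ?thesis using \<alpha>1 unfolding F1 by simp
qed

section \<open>The Galois group of an extendable point in coordinates\<close>

lemma galois_extension_fixed:
  assumes "galois_extension E k" "S \<in> carrier E" "\<And>\<sigma>. \<sigma> \<in> carrier (gal_group E k) \<Longrightarrow> \<sigma> S = S"
  shows "S \<in> k"
  using assms unfolding galois_extension_def by blast

lemma gal_groupD:
  assumes "\<sigma> \<in> carrier (gal_group E k)"
  shows "\<sigma> \<in> ring_iso E E" "\<sigma> \<in> extensional (carrier E)" "\<And>x. x \<in> k \<Longrightarrow> \<sigma> x = x"
  using assms unfolding gal_group_def by simp_all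

lemma gpt_coords: "hmat kemb N *v (hmat kemb M *v gpt x) = gpt x" if "N ** M = mat 1"
  by (rule hmat_inverse[OF comm_ring_hom_kemb that])

lemma map_row_mult:
  assumes "comm_ring_hom h"
  shows "eval3 h (lin_forms N $ i) v = (hmat h N *v v) $ i"
  using eval3_lin_forms_vec[OF assms, of N v] by (simp add: Finite_Cartesian_Product.vec_eq_iff)

text \<open>One nontrivial Galois automorphism is enough for the standard form. Its linear extension
  fixes the functions of the projection, so in the coordinates \<open>M\<close> it is a multiple of
  some \<open>mat_row1\<close>, and it permutes the roots of the equation of the curve.\<close>

theorem extendable_linear:
  fixes F :: "'a::{alg_closed_field, field_char_0} form3"
  assumes F: "Factorial_Ring.irreducible F" "homog3 d F" and P: "P \<noteq> 0"
    and ext: "extendable_galois_point (zero_locus F) P"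
    and MN: "M ** N = mat 1" "M *v axis 1 1 = P"
    and deg: "Polynomial.degree (subst_mat F M) \<ge> 2"
    and x: "poly (map_poly emb (subst_mat F M)) x = 0"
  shows "\<exists>\<sigma> A c \<alpha> \<beta> \<gamma>. \<sigma> \<in> carrier (galois_point_group (zero_locus F) P) \<and> invertible A \<and>
     induces (zero_locus F) \<sigma> (rat_map (zero_locus F) (lin_forms A)) \<and> c \<noteq> 0 \<and> \<alpha> \<noteq> 0 \<and>
     (\<alpha> \<noteq> 1 \<or> \<beta> \<noteq> 0 \<or> \<gamma> \<noteq> 0) \<and> (\<forall>v. A *v (M *v v) = c *s (M *v (mat_row1 \<alpha> \<beta> \<gamma> *v v))) \<and>
     poly (map_poly emb (subst_mat F M)) (kemb \<alpha> * x + emb (const2 \<beta> * vars2 $ 1 + const2 \<gamma> * vars2 $ 2)) = 0"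
proof -
  let ?D = "zero_locus F" let ?E = "function_field ?D" let ?k = "projection_subfield ?D P"
  define G where "G = subst_mat F M"
  define \<xi> where "\<xi> = hmat kemb M *v gpt x"
  have NM: "N ** M = mat 1" using MN(1) by (simp add: matrix_left_right_inverse)
  have irrG: "Factorial_Ring.irreducible G" unfolding G_def by (rule irreducible_subst_mat[OF F(1) MN(1)])
  have dG: "Polynomial.degree G > 1" "Polynomial.degree G > 0" using deg by (simp_all add: G_def)
  have xG: "poly (map_poly emb G) x = 0" using x by (simp add: G_def)
  interpret emb: comm_ring_hom "emb :: 'a poly poly \<Rightarrow> 'a gen" by (rule comm_ring_hom_emb)
  interpret kemb: comm_ring_hom "kemb :: 'a \<Rightarrow> 'a gen" by (rule comm_ring_hom_kemb)
  interpret g: gen_pt ?D kemb \<xi> unfolding \<xi>_def by (rule gen_pt_curve[OF F(1) MN(1)]) (use dG xG in \<open>simp_all add: G_def\<close>)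
  have N\<xi>: "hmat kemb N *v \<xi> = gpt x" unfolding \<xi>_def by (rule gpt_coords[OF NM])
  have NP: "N *v P = axis 1 1" unfolding MN(2)[symmetric] by (simp add: matrix_vector_mul_assoc NM)
  define \<pi> :: "'a ^ 3 ^ 2" where "\<pi> = (\<chi> i. N $ (if i = 1 then 2 else 3))"
  have \<pi>: "projection_from P \<pi>" unfolding \<pi>_def by (rule projection_from_matrix[OF MN(1) NM NP])
  have \<pi>\<xi>: "hmat kemb \<pi> *v \<xi> = (\<chi> i. emb (vars2 $ i))"
  proof -
    have "(hmat kemb \<pi> *v \<xi>) $ i = (hmat kemb N *v \<xi>) $ (if i = 1 then 2 else 3)" for i :: 2
      by (simp add: \<pi>_def hmat_def matrix_vector_mult_def)
    then show ?thesis unfolding N\<xi> Finite_Cartesian_Product.vec_eq_iff forall_2 by simp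
  qed
  have k: "g.fval ` ?k = rat2 kemb (\<chi> i. emb (vars2 $ i))"
    using g.projection_subfield_fval[OF \<pi> P] by (simp add: \<pi>\<xi>)
  have ink: "S \<in> ?k" if "S \<in> carrier ?E" "g.fval S \<in> rat2 kemb (\<chi> i. emb (vars2 $ i))" for S
  proof -
    have "g.fval S \<in> g.fval ` ?k" using that(2) k by simp
    then obtain T where T: "T \<in> ?k" "g.fval S = g.fval T" by (rule imageE)
    have "T \<in> carrier ?E" using T(1) g.projection_subfield_carrier by (rule subsetD[rotated])
    from g.fval_inj[OF that(1) this T(2)] show "S \<in> ?k" using T(1) by simp
  qed
  have gal: "galois_extension ?E ?k"
    and lin: "\<And>\<sigma> \<Phi>. \<sigma> \<in> carrier (gal_group ?E ?k) \<Longrightarrow> induces ?D \<sigma> \<Phi> \<Longrightarrow> \<exists>A. invertible A \<and> \<Phi> = rat_map ?D (lin_forms A)"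
    using ext unfolding extendable_galois_point_def galois_point_def by simp_all

  have Y: "emb (vars2 $ 1 :: 'a form2) \<noteq> 0" "emb (vars2 $ 2 :: 'a form2) \<noteq> 0" by (simp_all add: vars2_def)
  have V: "vars2 $ 1 \<noteq> (0 :: 'a form2)" by (simp add: vars2_def)
  have row: "eval3 kemb (lin_forms N $ 1) \<xi> = x" "eval3 kemb (lin_forms N $ 2) \<xi> = emb (vars2 $ 1)" "eval3 kemb (lin_forms N $ 3) \<xi> = emb (vars2 $ 2)"
    by (simp_all add: map_row_mult[OF comm_ring_hom_kemb] N\<xi>)
  \<comment> \<open>The function \<open>X / Y\<close> lies outside the projection subfield, so the
    Galois condition provides an automorphism that moves it.\<close>
  define S where "S = rat_fun ?D (lin_forms N $ 1) (lin_forms N $ 2)"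
  have S: "S \<in> carrier ?E" "g.fval S = x / emb (vars2 $ 1)"
    using g.fval_rat_fun[OF homog3_lin_forms homog3_lin_forms, of N 2 N 1] Y by (simp_all add: S_def row)
  have "S \<notin> ?k"
  proof
    assume "S \<in> ?k"
    then have "g.fval S \<in> rat2 kemb (\<chi> i. emb (vars2 $ i))" unfolding k[symmetric] by (rule imageI)
    then obtain n a b where ab: "eval2 kemb b (\<chi> i. emb (vars2 $ i)) \<noteq> 0"
      "g.fval S = eval2 kemb a (\<chi> i. emb (vars2 $ i)) / eval2 kemb b (\<chi> i. emb (vars2 $ i))" by (rule rat2E)
    then have "x / emb (vars2 $ 1) = emb a / emb b" "emb b \<noteq> 0" using S by (simp_all add: eval2_emb)
    then have "emb b * x + emb (- (a * vars2 $ 1)) = 0" using Y by (simp add: emb.hom_uminus emb.hom_mult field_simps)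
    from gpt_linear_dvd[OF irrG dG(1) xG this] have "b = 0" by simp
    then show False using \<open>emb b \<noteq> 0\<close> by simp
  qed
  have "\<exists>\<sigma>. \<sigma> \<in> carrier (gal_group ?E ?k) \<and> \<sigma> S \<noteq> S"
  proof (rule ccontr)
    assume n: "\<not> ?thesis"
    have "S \<in> ?k"
    proof (rule galois_extension_fixed[OF gal S(1)])
      fix \<sigma> assume "\<sigma> \<in> carrier (gal_group ?E ?k)"
      then show "\<sigma> S = S" using n by simp
    qed
    then show False using \<open>S \<notin> ?k\<close> by simp
  qed
  then obtain \<sigma> where \<sigma>: "\<sigma> \<in> carrier (gal_group ?E ?k)" "\<sigma> S \<noteq> S" by (elim exE conjE)
  note \<sigma>D = gal_groupD[OF \<sigma>(1)]
  have hom: "\<sigma> \<in> Ring.ring_hom ?E ?E" and bij: "bij_betw \<sigma> (carrier ?E) (carrier ?E)" using \<sigma>D(1) unfolding ring_iso_def by simp_all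
  have fx: "\<sigma> (rat_fun ?D (const3 c) 1) = rat_fun ?D (const3 c) 1" for c
  proof (rule \<sigma>D(3), rule ink)
    show "rat_fun ?D (const3 c) 1 \<in> carrier ?E" by (rule g.const_rat_fun)
    show "g.fval (rat_fun ?D (const3 c) 1) \<in> rat2 kemb (\<chi> i. emb (vars2 $ i))"
      unfolding g.const_rat_fun(2) by (rule rat2_closed(1)[OF comm_ring_hom_kemb])
  qed
  obtain \<Phi> where \<Phi>: "induces ?D \<sigma> \<Phi>" using g.exists_inducing[OF refl F(2) \<sigma>D(1) fx] by (rule exE)
  then obtain A where A: "invertible A" "\<Phi> = rat_map ?D (lin_forms A)" using lin[OF \<sigma>(1) \<Phi>] by (elim exE conjE)
  have ind: "induces ?D \<sigma> (rat_map ?D (lin_forms A))" using \<Phi> A by simp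
  obtain A' where A': "A ** A' = mat 1" "A' ** A = mat 1" using A(1) unfolding invertible_def by (elim exE conjE)

  define B where "B = N ** A ** M"
  have AM: "A *v (M *v v) = M *v (B *v v)" for v
  proof -
    have "M ** B = A ** M" unfolding B_def by (simp add: matrix_mul_assoc MN(1))
    then show ?thesis by (simp add: matrix_vector_mul_assoc)
  qed
  define \<eta> where "\<eta> = hmat kemb A *v \<xi>"
  have N\<eta>: "hmat kemb N *v \<eta> = hmat kemb B *v gpt x"
    unfolding \<eta>_def \<xi>_def B_def by (simp add: hmat_mult[OF comm_ring_hom_kemb] matrix_vector_mul_assoc matrix_mul_assoc)
  have "B ** (N ** A' ** M) = N ** A ** (M ** N) ** A' ** M" by (simp add: B_def matrix_mul_assoc)
  also have "\<dots> = N ** (A ** A') ** M" by (simp add: MN(1) matrix_mul_assoc)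
  also have "\<dots> = mat 1" by (simp add: A' NM)
  finally have Binv: "B ** (N ** A' ** M) = mat 1" .
  then have Binv': "(N ** A' ** M) ** B = mat 1" by (simp add: matrix_left_right_inverse)
  have \<eta>_nth: "(hmat kemb B *v gpt x) $ i = kemb (B $ i $ 1) * x + emb (const2 (B $ i $ 2) * vars2 $ 1 + const2 (B $ i $ 3) * vars2 $ 2)" for i
    by (simp add: matrix_vector_mult_def sum_3 hmat_def kemb_def emb.hom_add emb.hom_mult)
  have ev\<eta>: "eval3 kemb (subst_mat a A) \<xi> = eval3 kemb a \<eta>" for a
    by (simp add: eval3_subst_mat[OF comm_ring_hom_kemb] \<eta>_def)
  have "\<eta> \<noteq> 0"
  proof
    assume "\<eta> = 0"
    then have "hmat kemb A' *v (hmat kemb A *v \<xi>) = 0" by (simp add: \<eta>_def)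
    then show False using hmat_inverse[OF comm_ring_hom_kemb A'(2), of \<xi>] g.nz by simp
  qed
  then obtain j where "\<eta> $ j \<noteq> 0" by (auto simp: Finite_Cartesian_Product.vec_eq_iff)
  have self: "lin_forms A \<in> rat_map ?D (lin_forms A)"
  proof (rule g.represents_rat_map(1))
    show "g.represents (lin_forms A) \<eta>"
      unfolding g.represents_def by (rule exI[of _ "Suc 0"], rule exI[of _ 1]) (simp add: map_row_mult[OF comm_ring_hom_kemb] \<eta>_def)
    then show "g.represents (lin_forms A) \<eta>" .
    show "\<eta> \<noteq> 0" by fact
  qed
  have act: "\<sigma> (rat_fun ?D (subst_mat a A) (subst_mat b A)) = rat_fun ?D a b"
    if "homog3 n a" "homog3 n b" "eval3 kemb b \<xi> \<noteq> 0" for n a b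
  proof -
    have "\<not> vanishes_on b ?D" using g.gen[OF that(2)] that(3) by simp
    then show ?thesis using ind self that unfolding induces_def subst_mat_def by simp
  qed

  have row\<eta>: "eval3 kemb (subst_mat (lin_forms N $ i) A) \<xi> = (hmat kemb B *v gpt x) $ i" for i
    unfolding ev\<eta> map_row_mult[OF comm_ring_hom_kemb] N\<eta> ..
  have B_row: "(hmat kemb B *v gpt x) $ i \<noteq> 0" for i
  proof
    assume "(hmat kemb B *v gpt x) $ i = 0"
    then have "emb (const2 (B $ i $ 1)) * x + emb (const2 (B $ i $ 2) * vars2 $ 1 + const2 (B $ i $ 3) * vars2 $ 2) = 0"
      unfolding \<eta>_nth by (simp add: kemb_def)
    from gpt_linear_dvd[OF irrG dG(1) xG this] have "const2 (B $ i $ 1) = 0" "const2 (B $ i $ 2) * vars2 $ 1 + const2 (B $ i $ 3) * vars2 $ 2 = 0" by simp_all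
    then have "B $ i $ 1 = 0" "B $ i $ 2 = 0 \<and> B $ i $ 3 = 0" using linear_binary_form_eq_0[of "B $ i $ 2" "B $ i $ 3"] by (simp_all add: const2_def)
    then have "B $ i $ j = 0" for j using exhaust_3[of j] by auto
    then have "(B ** (N ** A' ** M)) $ i $ i = 0" unfolding matrix_matrix_mult_def by simp
    then show False unfolding Binv by (simp add: Finite_Cartesian_Product.mat_def)
  qed
  have hom1: "homog3 (Suc 0) (subst_mat (lin_forms N $ i) A)" for i by (rule homog3_subst_mat) simp

  \<comment> \<open>\<open>Z / Y\<close> is pulled back from the line and hence fixed by
    \<open>\<sigma>\<close>. This determines the last two rows of \<open>B\<close> up to a common
    factor.\<close>
  define Q where "Q = rat_fun ?D (lin_forms N $ 3) (lin_forms N $ 2)"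
  define Q' where "Q' = rat_fun ?D (subst_mat (lin_forms N $ 3) A) (subst_mat (lin_forms N $ 2) A)"
  have Q: "Q \<in> carrier ?E" "g.fval Q = emb (vars2 $ 2) / emb (vars2 $ 1)"
    using g.fval_rat_fun[OF homog3_lin_forms homog3_lin_forms, of N 2 N 3] Y by (simp_all add: Q_def row)
  have Q': "Q' \<in> carrier ?E" "g.fval Q' = (hmat kemb B *v gpt x) $ 3 / (hmat kemb B *v gpt x) $ 2"
    using g.fval_rat_fun[OF hom1 hom1, of 2 3] B_row by (simp_all add: Q'_def row\<eta>)
  have "Q \<in> ?k"
  proof (rule ink[OF Q(1)])
    show "g.fval Q \<in> rat2 kemb (\<chi> i. emb (vars2 $ i))"
      unfolding Q using rat2I[of 1 "vars2 $ 2" "vars2 $ 1" kemb "\<chi> i. emb (vars2 $ i)"] Y by (simp add: eval2_emb)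
  qed
  then have "\<sigma> Q = Q" by (rule \<sigma>D(3))
  moreover have "\<sigma> Q' = Q" unfolding Q'_def Q_def by (rule act[of "Suc 0"]) (simp_all add: row V)
  ultimately have "Q' = Q" using bij Q Q' unfolding bij_betw_def inj_on_def by simp
  then have "(hmat kemb B *v gpt x) $ 3 * emb (vars2 $ 1) = (hmat kemb B *v gpt x) $ 2 * emb (vars2 $ 2)"
    using Q(2) Q'(2) Y B_row[of 2] by (simp add: field_simps)
  \<comment> \<open>Cross multiplication gives an equation linear in \<open>x\<close>, whose two
    coefficients vanish separately because \<open>x\<close> has degree at least two over
    \<open>K(Y,Z)\<close>.\<close>
  then have "emb (const2 (B $ 3 $ 1) * vars2 $ 1 - const2 (B $ 2 $ 1) * vars2 $ 2) * x +
     emb ((const2 (B $ 3 $ 2) * vars2 $ 1 + const2 (B $ 3 $ 3) * vars2 $ 2) * vars2 $ 1 -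
      (const2 (B $ 2 $ 2) * vars2 $ 1 + const2 (B $ 2 $ 3) * vars2 $ 2) * vars2 $ 2) = 0"
    unfolding \<eta>_nth kemb_def emb.hom_minus emb.hom_mult emb.hom_add by (simp add: algebra_simps)
  from gpt_linear_dvd[OF irrG dG(1) xG this]
  have e1: "const2 (B $ 3 $ 1) * vars2 $ 1 - const2 (B $ 2 $ 1) * vars2 $ 2 = 0"
    and e2: "(const2 (B $ 3 $ 2) * vars2 $ 1 + const2 (B $ 3 $ 3) * vars2 $ 2) * vars2 $ 1 -
      (const2 (B $ 2 $ 2) * vars2 $ 1 + const2 (B $ 2 $ 3) * vars2 $ 2) * vars2 $ 2 = 0" by simp_all
  interpret c2: comm_ring_hom "const2 :: 'a \<Rightarrow> 'a form2" by (rule comm_ring_hom_const2)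
  have "const2 (B $ 3 $ 1) * vars2 $ 1 + const2 (- (B $ 2 $ 1)) * vars2 $ 2 = 0" using e1 by (simp add: c2.hom_uminus)
  from linear_binary_form_eq_0[OF this] have B1: "B $ 3 $ 1 = 0" "B $ 2 $ 1 = 0" by simp_all
  have "const2 (B $ 3 $ 2) * (vars2 $ 1)\<^sup>2 + const2 (B $ 3 $ 3 - B $ 2 $ 2) * vars2 $ 1 * vars2 $ 2 + const2 (- (B $ 2 $ 3)) * (vars2 $ 2)\<^sup>2 = 0"
    using e2 by (simp add: c2.hom_uminus c2.hom_minus algebra_simps power2_eq_square)
  from quadratic_binary_form_eq_0[OF this] have B2: "B $ 3 $ 2 = 0" "B $ 3 $ 3 = B $ 2 $ 2" "B $ 2 $ 3 = 0" by simp_all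

  define c where "c = B $ 2 $ 2"
  have c: "c \<noteq> 0"
  proof
    assume "c = 0"
    then have "B $ 2 $ j = 0" for j using exhaust_3[of j] B1 B2 by (auto simp: c_def)
    then have "(B ** (N ** A' ** M)) $ 2 $ 2 = 0" unfolding matrix_matrix_mult_def by simp
    then show False unfolding Binv by (simp add: Finite_Cartesian_Product.mat_def)
  qed
  have "B $ 1 $ 1 \<noteq> 0"
  proof
    assume "B $ 1 $ 1 = 0"
    then have "B $ i $ 1 = 0" for i using exhaust_3[of i] B1 by auto
    then have "((N ** A' ** M) ** B) $ 1 $ 1 = 0" unfolding matrix_matrix_mult_def by simp
    then show False unfolding Binv' by (simp add: Finite_Cartesian_Product.mat_def)
  qed
  define \<alpha> \<beta> \<gamma> where "\<alpha> = B $ 1 $ 1 / c" and "\<beta> = B $ 1 $ 2 / c" and "\<gamma> = B $ 1 $ 3 / c"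
  have \<alpha>: "\<alpha> \<noteq> 0" using \<open>B $ 1 $ 1 \<noteq> 0\<close> c by (simp add: \<alpha>_def)
  have Bv: "B *v v = c *s (mat_row1 \<alpha> \<beta> \<gamma> *v v)" for v
    unfolding Finite_Cartesian_Product.vec_eq_iff forall_3 vector_smult_component mat_row1_mult
    using c B1 B2 by (simp add: matrix_vector_mult_def sum_3 \<alpha>_def \<beta>_def \<gamma>_def c_def field_simps)
  have AMv: "A *v (M *v v) = c *s (M *v (mat_row1 \<alpha> \<beta> \<gamma> *v v))" for v
    unfolding AM Bv by (simp add: vector_scalar_commute)
  define y where "y = kemb \<alpha> * x + emb (const2 \<beta> * vars2 $ 1 + const2 \<gamma> * vars2 $ 2)"
  have B\<eta>: "hmat kemb B *v gpt x = kemb c *s gpt y"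
  proof -
    have "B $ 1 $ 1 = c * \<alpha>" "B $ 1 $ 2 = c * \<beta>" "B $ 1 $ 3 = c * \<gamma>" using c by (simp_all add: \<alpha>_def \<beta>_def \<gamma>_def)
    then show ?thesis
      unfolding Finite_Cartesian_Product.vec_eq_iff forall_3 vector_smult_component \<eta>_nth
      using B1 B2 by (simp add: y_def kemb_def c2.hom_mult c_def[symmetric] emb.hom_mult emb.hom_add algebra_simps)
  qed
  have M\<eta>: "\<eta> = hmat kemb M *v (kemb c *s gpt y)"
    unfolding B\<eta>[symmetric] N\<eta>[symmetric] by (rule hmat_inverse[OF comm_ring_hom_kemb MN(1), symmetric])
  \<comment> \<open>A denominator of degree \<open>d\<close> that vanishes neither at
    \<open>\<xi>\<close> nor at \<open>\<eta>\<close>. It turns \<open>F\<close> into a function,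
    which is zero; transporting this back by the injective \<open>\<sigma>\<close> gives the
    equation at \<open>\<eta>\<close>.\<close>
  define b where "b = (lin_forms N $ 2) ^ d"
  interpret e\<xi>: comm_ring_hom "\<lambda>a. eval3 kemb a \<xi>" by (rule comm_ring_hom_eval3[OF comm_ring_hom_kemb])
  interpret e\<eta>: comm_ring_hom "\<lambda>a. eval3 kemb a \<eta>" by (rule comm_ring_hom_eval3[OF comm_ring_hom_kemb])
  have b: "homog3 d b" "eval3 kemb b \<xi> \<noteq> 0" "eval3 kemb (subst_mat b A) \<xi> \<noteq> 0"
  proof -
    show "homog3 d b" unfolding b_def using homog3_power[of "Suc 0" "lin_forms N $ 2" d] by simp
    show "eval3 kemb b \<xi> \<noteq> 0" unfolding b_def e\<xi>.hom_power row using Y by simp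
    show "eval3 kemb (subst_mat b A) \<xi> \<noteq> 0" unfolding b_def ev\<eta> e\<eta>.hom_power using B_row[of 2] row\<eta>[of 2] by (simp add: ev\<eta>)
  qed
  have F0: "eval3 kemb F \<xi> = 0"
  proof -
    have "vanishes_on F ?D" by (simp add: vanishes_on_def zero_locus_def)
    then show ?thesis using g.gen[OF F(2)] by simp
  qed
  have "eval3 kemb F \<eta> = 0"
  proof -
    let ?S = "rat_fun ?D (subst_mat F A) (subst_mat b A)"
    note S1 = g.fval_rat_fun[OF homog3_subst_mat[OF F(2)] homog3_subst_mat[OF b(1)] b(3)]
    note S2 = g.fval_rat_fun[OF F(2) b(1,2)]
    note Z = g.fval_rat_fun[of 0 "const3 0" 1]
    have "\<sigma> ?S = rat_fun ?D F b" by (rule act[OF F(2) b(1,2)])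
    moreover have "rat_fun ?D F b = rat_fun ?D (const3 0) 1"
      using g.fval_inj[OF S2(1) g.const_rat_fun(1)] S2(2) g.const_rat_fun(2) F0 by simp
    ultimately have "\<sigma> ?S = \<sigma> (rat_fun ?D (const3 0) 1)" by (simp only: fx)
    from inj_onD[OF bij_betw_imp_inj_on[OF bij] this S1(1) g.const_rat_fun(1)]
    have "g.fval ?S = kemb 0" by (simp only: g.const_rat_fun(2))
    then have "g.fval ?S = 0" by simp
    then show ?thesis using S1(2) b(3) by (simp add: ev\<eta>)
  qed
  then have "eval3 kemb G (kemb c *s gpt y) = 0" unfolding M\<eta> G_def eval3_subst_mat[OF comm_ring_hom_kemb] .
  then have "eval3 kemb G (gpt y) = 0"
    using homog3_scale[OF comm_ring_hom_kemb homog3_subst_mat[OF F(2)], of M "kemb c" "gpt y"] c by (simp add: G_def)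
  then have Gy: "poly (map_poly emb G) y = 0" by (simp add: eval3_gpt)
  \<comment> \<open>If the collineation were trivial, \<open>\<sigma>\<close> would fix
    \<open>X / Y\<close>, against its choice.\<close>
  have nt: "\<alpha> \<noteq> 1 \<or> \<beta> \<noteq> 0 \<or> \<gamma> \<noteq> 0"
  proof (rule ccontr)
    assume "\<not> (\<alpha> \<noteq> 1 \<or> \<beta> \<noteq> 0 \<or> \<gamma> \<noteq> 0)"
    then have y: "y = x" by (simp add: y_def kemb.hom_one)
    define S' where "S' = rat_fun ?D (subst_mat (lin_forms N $ 1) A) (subst_mat (lin_forms N $ 2) A)"
    have "g.fval S' = (hmat kemb B *v gpt x) $ 1 / (hmat kemb B *v gpt x) $ 2" "S' \<in> carrier ?E"
      using g.fval_rat_fun[OF hom1 hom1, of 2 1] B_row by (simp_all add: S'_def row\<eta>)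
    then have "g.fval S' = g.fval S" unfolding B\<eta> S(2) using c by (simp add: y)
    then have "S' = S" using g.fval_inj[OF \<open>S' \<in> carrier ?E\<close> S(1)] by simp
    moreover have "\<sigma> S' = S" unfolding S'_def S_def by (rule act[of "Suc 0"]) (simp_all add: row V)
    ultimately show False using \<sigma>(2) by simp
  qed
  show ?thesis
    using \<sigma>(1) A(1) ind c \<alpha> nt AMv Gy unfolding G_def y_def
    by (intro exI[of _ \<sigma>] exI[of _ A] exI[of _ c] exI[of _ \<alpha>] exI[of _ \<beta>] exI[of _ \<gamma>] conjI) simp_all
qed

section \<open>Zeros of binary forms and the choice of the point at infinity\<close>

lemma binary_form_zero_exists:
  fixes a :: "'a::alg_closed_field form2"
  assumes "homog2 m a" "m > 0" shows "\<exists>w. w \<noteq> 0 \<and> eval2 (\<lambda>c. c) a w = 0"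
proof -
  define q where "q = map_poly (\<lambda>g. poly g 1) a"
  have ev: "eval2 (\<lambda>c. c) a w = poly (map_poly (\<lambda>g. poly g (w $ 2)) a) (w $ 1)" for w
    by (simp add: eval2_def map_poly_idI)
  show ?thesis
  proof (cases "Polynomial.degree q > 0")
    case True
    from alg_closed_imp_poly_has_root[OF this] obtain y where y: "poly q y = 0" by (elim exE)
    let ?w = "(\<chi> i::2. if i = 1 then y else 1)"
    have "?w $ 2 \<noteq> 0" by simp
    then have "?w \<noteq> 0" by (metis zero_index)
    moreover have "eval2 (\<lambda>c. c) a ?w = 0" using y by (simp add: ev q_def)
    ultimately show ?thesis by (intro exI[of _ ?w] conjI)
  next
    case False
    \<comment> \<open>When the dehomogenised form has degree zero, the remaining candidate is
      \<open>(1 : 0)\<close>. The value there is the coefficient of the pure power of the first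
      variable, which is zero.\<close>
    then have "Polynomial.coeff q m = 0" using assms(2) by (intro coeff_eq_0) simp
    then have "poly (Polynomial.coeff a m) 1 = 0" by (simp add: q_def coeff_map_poly)
    moreover have c: "Polynomial.coeff a m = [:Polynomial.coeff (Polynomial.coeff a m) 0:]"
    proof (rule poly_eqI)
      fix j show "Polynomial.coeff (Polynomial.coeff a m) j = Polynomial.coeff [:Polynomial.coeff (Polynomial.coeff a m) 0:] j"
      proof (cases "j = 0")
        case False
        then have "m + j \<noteq> m" by simp
        then have "Polynomial.coeff (Polynomial.coeff a m) j = 0" using assms(1) unfolding homog2_def by meson
        then show ?thesis using False by (simp add: coeff_const_poly)
      qed simp
    qed
    ultimately have cm: "Polynomial.coeff (Polynomial.coeff a m) 0 = 0" by (metis poly_pCons mult_zero_left poly_0 add_0_right mult_zero_right)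
    let ?w = "(\<chi> i. if i = 1 then 1 else 0) :: 'a ^ 2"
    have "?w $ 1 \<noteq> 0" by simp
    then have "?w \<noteq> 0" by (metis zero_index)
    moreover have "eval2 (\<lambda>c. c) a ?w = (\<Sum>i\<le>Polynomial.degree a. Polynomial.coeff (Polynomial.coeff a i) 0)"
      unfolding ev by (subst poly_map_poly_sum) (simp_all add: poly_0_coeff_0)
    moreover have "Polynomial.coeff (Polynomial.coeff a i) 0 = 0" for i
    proof (cases "i = m")
      case False
      then have "i + 0 \<noteq> m" by simp
      then show ?thesis using assms(1) unfolding homog2_def by meson
    qed (simp add: cm)
    ultimately show ?thesis by (intro exI[of _ ?w] conjI) simp_all
  qed
qed

text \<open>The last two coordinates are changed so that \<open>(0 : 1)\<close>, the point at
  infinity of \<open>Z / Y\<close>, goes to \<open>w\<close>. The first coordinate is untouched, so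
  the shape \<open>c0 + cp X ^ p\<close> survives and \<open>T\<close> commutes with scaling that
  coordinate.\<close>

lemma rotate_matrix:
  fixes w :: "'a::field ^ 2"
  assumes "w \<noteq> 0"
  shows "\<exists>(T :: 'a ^ 3 ^ 3) S l. T ** S = mat 1 \<and> S ** T = mat 1 \<and> T *v axis 1 1 = axis 1 1 \<and>
    (\<forall>\<alpha> v. mat_row1 \<alpha> 0 0 *v (T *v v) = T *v (mat_row1 \<alpha> 0 0 *v v)) \<and> (\<forall>i. homog2 (Suc 0) (l $ i)) \<and>
    (\<forall>a b p. subst_mat ([:a:] + Polynomial.monom b p) T = [:eval2 const2 a l:] + Polynomial.monom (eval2 const2 b l) p) \<and>
    (\<forall>a. eval2 (\<lambda>c. c) (eval2 const2 a l) (\<chi> i. if i = 1 then 0 else 1) = eval2 (\<lambda>c. c) a w)"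
proof -
  \<comment> \<open>A unit vector that is linearly independent of \<open>w\<close>.\<close>
  define t :: "'a ^ 2" where "t = (if w $ 2 \<noteq> 0 then (\<chi> i. if i = 1 then 1 else 0) else (\<chi> i. if i = 1 then 0 else 1))"
  define T :: "'a ^ 3 ^ 3" where "T = (\<chi> i j. if i = 1 then (if j = 1 then 1 else 0)
     else if j = 1 then 0 else (if j = 2 then t else w) $ (if i = 2 then 1 else 2))"
  define l :: "'a form2 ^ 2" where "l = (\<chi> i. const2 (t $ i) * vars2 $ 1 + const2 (w $ i) * vars2 $ 2)"
  have T: "(T *v v) $ 1 = v $ 1" "(T *v v) $ 2 = t $ 1 * v $ 2 + w $ 1 * v $ 3" "(T *v v) $ 3 = t $ 2 * v $ 2 + w $ 2 * v $ 3" for v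
    by (simp_all add: T_def matrix_vector_mult_def sum_3)
  have K: "v = 0" if 0: "T *v v = 0" for v
  proof -
    have 1: "v $ 1 = 0" "t $ 1 * v $ 2 + w $ 1 * v $ 3 = 0" "t $ 2 * v $ 2 + w $ 2 * v $ 3 = 0" using T[of v] 0 by simp_all
    have "v $ 2 = 0 \<and> v $ 3 = 0"
    proof (cases "w $ 2 = 0")
      case True
      then have "w $ 1 \<noteq> 0" using assms unfolding Finite_Cartesian_Product.vec_eq_iff forall_2 by simp
      then show ?thesis using 1 True by (simp add: t_def)
    next
      case False
      then show ?thesis using 1 by (simp add: t_def)
    qed
    with 1 show "v = 0" unfolding Finite_Cartesian_Product.vec_eq_iff forall_3 by simp
  qed
  have "\<exists>S. T ** S = mat 1 \<and> S ** T = mat 1" by (rule inverse_matrix_exists) (rule K)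
  then obtain S where S: "T ** S = mat 1" "S ** T = mat 1" by (elim exE conjE)
  have T1: "T *v axis 1 1 = axis 1 1"
    unfolding Finite_Cartesian_Product.vec_eq_iff forall_3 T by (simp add: axis_def)
  have comm: "mat_row1 \<alpha> 0 0 *v (T *v v) = T *v (mat_row1 \<alpha> 0 0 *v v)" for \<alpha> v
    unfolding Finite_Cartesian_Product.vec_eq_iff forall_3 T mat_row1_mult by simp
  have l: "homog2 (Suc 0) (l $ i)" for i
    unfolding l_def vec_lambda_beta by (intro homog2_add homog2_const_mult homog2_vars2)
  interpret s: comm_ring_hom "\<lambda>F. subst_mat F T" by (rule comm_ring_hom_subst_mat)
  have c: "subst_mat [:a:] T = [:eval2 const2 a l:]" for a
  proof (rule form2_hom_unique[OF comm_ring_hom_comp[OF comm_ring_hom_subst_mat comm_ring_hom_const_poly]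
        comm_ring_hom_comp[OF comm_ring_hom_const_poly comm_ring_hom_eval2[OF comm_ring_hom_const2]]])
    show "subst_mat [:const2 c:] T = [:eval2 const2 (const2 c) l:]" for c
    proof -
      have "[:const2 c:] = const3 c" by (simp add: const2_def const3_def)
      then show ?thesis by (simp add: subst_mat_def comm_ring_hom_const3 comm_ring_hom_const2)
    qed
    show "subst_mat [:vars2 $ i:] T = [:eval2 const2 (vars2 $ i) l:]" for i :: 2
    proof -
      have v: "[:vars2 $ i:] = vars3 $ (if i = 1 then 2 else 3 :: 3)"
        using exhaust_2[of i] by (auto simp: vars2_def vars3_def)
      have "subst_mat [:vars2 $ i:] T = lin_forms T $ (if i = 1 then 2 else 3)"
        unfolding v by (simp only: subst_mat_def eval3_vars3[OF comm_ring_hom_const3])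
      also have "\<dots> = [:l $ i:]"
        using exhaust_2[of i] by (auto simp: lin_forms_def sum_3 T_def l_def vars3_def vars2_def const3_def const2_def)
      finally show ?thesis by (simp add: comm_ring_hom_const2)
    qed
  qed
  have v1: "subst_mat (vars3 $ 1) T = vars3 $ 1"
    by (simp add: subst_mat_def comm_ring_hom_const3 lin_forms_def sum_3 T_def)
  have mon: "Polynomial.monom b p = [:b:] * (vars3 $ 1) ^ p" for b :: "'a form2" and p
    by (simp add: vars3_def monom_altdef)
  have sub: "subst_mat ([:a:] + Polynomial.monom b p) T = [:eval2 const2 a l:] + Polynomial.monom (eval2 const2 b l) p" for a b p
    unfolding mon s.hom_add s.hom_mult s.hom_power c v1 ..
  have ev: "eval2 (\<lambda>c. c) (eval2 const2 a l) (\<chi> i. if i = 1 then 0 else 1) = eval2 (\<lambda>c. c) a w" for a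
  proof -
    interpret e: comm_ring_hom "\<lambda>a. eval2 (\<lambda>c. c) a ((\<chi> i. if i = 1 then 0 else 1) :: 'a ^ 2)" by (rule comm_ring_hom_eval2[OF comm_ring_hom_ident])
    have "(\<chi> i. eval2 (\<lambda>c. c) (l $ i) (\<chi> i. if i = 1 then 0 else 1)) = w"
      by (simp add: Finite_Cartesian_Product.vec_eq_iff l_def e.hom_add e.hom_mult comm_ring_hom_ident)
    then show ?thesis by (simp add: eval2_eval2[OF comm_ring_hom_ident])
  qed
  show ?thesis using S T1 comm l sub ev
    by (intro exI[of _ T] exI[of _ S] exI[of _ l] conjI allI)
qed

lemma irreducible_no_root:
  fixes G :: "'r::idom poly"
  assumes irr: "Factorial_Ring.irreducible G" and deg: "Polynomial.degree G \<ge> 2" shows "poly G a \<noteq> 0"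
proof
  assume "poly G a = 0"
  then have "[:- a, 1:] dvd G" by (simp add: poly_eq_0_iff_dvd)
  then obtain q where q: "G = [:- a, 1:] * q" by (rule dvdE)
  have "\<not> [:- a, 1:] dvd 1"
  proof
    assume "[:- a, 1:] dvd 1"
    from dvd_imp_degree_le[OF this] show False by simp
  qed
  with Factorial_Ring.irreducibleD[OF irr q] have "q dvd 1" by meson
  from dvd_imp_degree_le[OF this] have "Polynomial.degree q = 0" by simp
  moreover have "Polynomial.degree G \<le> Polynomial.degree [:- a, 1:] + Polynomial.degree q"
    unfolding q by (rule degree_mult_le)
  ultimately show False using deg by simp
qed

lemma homog2_coeff_poly_1:
  fixes a :: "'a::comm_ring_1 form2"
  assumes "homog2 d a"
  shows "Polynomial.coeff (poly a 1) j = (if j \<le> d then Polynomial.coeff (Polynomial.coeff a (d - j)) j else 0)"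
proof -
  have "Polynomial.coeff (poly a 1) j = (\<Sum>i\<le>Polynomial.degree a. Polynomial.coeff (Polynomial.coeff a i) j)"
    by (subst poly_altdef) (simp add: Polynomial.coeff_sum)
  also have "\<dots> = (\<Sum>i\<le>Polynomial.degree a. if i = d - j then (if j \<le> d then Polynomial.coeff (Polynomial.coeff a (d - j)) j else 0) else 0)"
  proof (intro sum.cong refl)
    fix i
    show "Polynomial.coeff (Polynomial.coeff a i) j = (if i = d - j then (if j \<le> d then Polynomial.coeff (Polynomial.coeff a (d - j)) j else 0) else 0)"
    proof (cases "i + j = d")
      case False
      then have "Polynomial.coeff (Polynomial.coeff a i) j = 0" using assms unfolding homog2_def by meson
      then show ?thesis by auto
    qed auto
  qed
  also have "\<dots> = (if j \<le> d then Polynomial.coeff (Polynomial.coeff a (d - j)) j else 0)"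
    by (simp add: coeff_eq_0)
  finally show ?thesis .
qed

lemma eval2_at_01:
  fixes a :: "'a::comm_ring_1 form2"
  assumes "homog2 d a"
  shows "eval2 (\<lambda>c. c) a (\<chi> i. if i = 1 then 0 else 1) = Polynomial.coeff (Polynomial.coeff a 0) d"
proof -
  have "eval2 (\<lambda>c. c) a (\<chi> i. if i = 1 then 0 else 1) = poly (Polynomial.coeff a 0) 1"
    by (simp add: eval2_def map_poly_idI poly_0_coeff_0 coeff_map_poly)
  also have "\<dots> = (\<Sum>j\<le>Polynomial.degree (Polynomial.coeff a 0). if j = d then Polynomial.coeff (Polynomial.coeff a 0) d else 0)"
  proof (subst poly_altdef, intro sum.cong refl)
    fix j
    show "Polynomial.coeff (Polynomial.coeff a 0) j * 1 ^ j = (if j = d then Polynomial.coeff (Polynomial.coeff a 0) d else 0)"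
    proof (cases "j = d")
      case False
      then have "0 + j \<noteq> d" by simp
      then have "Polynomial.coeff (Polynomial.coeff a 0) j = 0" using assms unfolding homog2_def by meson
      then show ?thesis using False by simp
    qed simp
  qed
  also have "\<dots> = Polynomial.coeff (Polynomial.coeff a 0) d" by (simp add: coeff_eq_0)
  finally show ?thesis .
qed

lemma homog2_dvd_var:
  fixes a :: "'a::comm_ring_1 form2"
  assumes a: "homog2 d a" and 0: "eval2 (\<lambda>c. c) a (\<chi> i. if i = 1 then 0 else 1) = 0"
  shows "\<exists>b. a = vars2 $ 1 * b"
proof -
  have "Polynomial.coeff (Polynomial.coeff a 0) j = 0" for j
  proof (cases "j = d")
    case True then show ?thesis using eval2_at_01[OF a] 0 by simp
  next
    case False
    then have "0 + j \<noteq> d" by simp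
    then show ?thesis using a unfolding homog2_def by meson
  qed
  then have "Polynomial.coeff a 0 = 0" by (intro poly_eqI) simp
  moreover obtain e b where "a = pCons e b" by (cases a) 
  ultimately show ?thesis by (intro exI[of _ b]) (simp add: vars2_def)
qed

lemma var_not_unit: "\<not> [:vars2 $ 1 :: 'a::idom form2:] dvd 1"
proof
  assume "[:vars2 $ 1 :: 'a form2:] dvd 1"
  then obtain q where q: "1 = [:vars2 $ 1 :: 'a form2:] * q" by (rule dvdE)
  interpret e: comm_ring_hom "\<lambda>F. form_at F (0 :: 'a ^ 3)" by (rule comm_ring_hom_eval3[OF comm_ring_hom_ident])
  have "[:vars2 $ 1 :: 'a form2:] = vars3 $ 2" by (simp add: vars2_def vars3_def)
  then have "form_at 1 (0 :: 'a ^ 3) = 0" unfolding q by (simp add: e.hom_mult comm_ring_hom_ident)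
  then show False by (simp add: e.hom_one)
qed

text \<open>The freedom left in the last two coordinates serves to place a zero at infinity. For a
  point off the curve it is a zero of \<open>c0\<close>, which drops the degree of
  \<open>c0 (1, Z)\<close> below \<open>p\<close>. For a point on the curve it is the zero of the
  linear form \<open>cp\<close>, which makes \<open>cp (1, Z)\<close> constant and leaves
  \<open>c0 (1, Z)\<close> with degree \<open>p + 1\<close>. In both cases \<open>p\<close> does not
  divide the degree.\<close>

theorem standard_form:
  fixes F :: "'a::{alg_closed_field, field_char_0} form3"
  assumes F: "Factorial_Ring.irreducible F" "homog3 d F" "d \<ge> 3" and p: "Factorial_Ring.prime p" and P: "P \<noteq> 0"
    and ext: "extendable_galois_point (zero_locus F) P"
    and cond: "(P \<notin> zero_locus F \<and> d = p) \<or> (P \<in> zero_locus F - sing_locus F \<and> d - 1 = p)"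
  shows "\<exists>(M :: 'a ^ 3 ^ 3) (N :: 'a ^ 3 ^ 3) \<sigma> A c \<alpha> c0 cp \<kappa>. M ** N = mat 1 \<and> N ** M = mat 1 \<and> M *v axis 1 1 = P \<and>
     subst_mat F M = [:c0:] + Polynomial.monom cp p \<and>
     poly cp 1 = [:\<kappa>:] \<and> \<kappa> \<noteq> 0 \<and> \<not> p dvd Polynomial.degree (poly c0 1) \<and>
     \<sigma> \<in> carrier (galois_point_group (zero_locus F) P) \<and> invertible A \<and>
     induces (zero_locus F) \<sigma> (rat_map (zero_locus F) (lin_forms A)) \<and> c \<noteq> 0 \<and> \<alpha> \<noteq> 0 \<and> \<alpha> \<noteq> 1 \<and>
     (\<forall>v. A *v (M *v v) = c *s (M *v (mat_row1 \<alpha> 0 0 *v v)))"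
proof -
  obtain M0 N0 :: "'a ^ 3 ^ 3" where M0: "M0 ** N0 = mat 1" "N0 ** M0 = mat 1" "M0 *v axis 1 1 = P"
    using first_column_exists[OF P] by (elim exE conjE)
  have p2: "p \<ge> 2" using p by (rule prime_ge_2_nat)
  have dp: "d = p \<or> d = p + 1" using cond F(3) by linarith
  have d0: "d > 0" using F(3) by simp
  have degp: "Polynomial.degree (subst_mat F M) = p" if "M ** N = mat 1" "M *v axis 1 1 = P" for M N :: "'a ^ 3 ^ 3"
    using degree_at_point[OF F(2) d0 that] cond by (elim disjE conjE) simp_all
  define G where "G = subst_mat F M0"
  have degG: "Polynomial.degree G = p" unfolding G_def by (rule degp[OF M0(1,3)])
  have irrG: "Factorial_Ring.irreducible G" unfolding G_def by (rule irreducible_subst_mat[OF F(1) M0(1)])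
  have dG0: "Polynomial.degree G > 0" using degG p2 by simp
  from gpt_root_exists[OF this] obtain x where x: "poly (map_poly emb G) x = 0" by (elim exE)
  obtain \<sigma> A c \<alpha> \<beta> \<gamma> where \<sigma>: "\<sigma> \<in> carrier (galois_point_group (zero_locus F) P)" "invertible A"
     "induces (zero_locus F) \<sigma> (rat_map (zero_locus F) (lin_forms A))" "c \<noteq> 0" "\<alpha> \<noteq> 0"
     and nt: "\<alpha> \<noteq> 1 \<or> \<beta> \<noteq> 0 \<or> \<gamma> \<noteq> 0" and AM': "\<forall>v. A *v (M0 *v v) = c *s (M0 *v (mat_row1 \<alpha> \<beta> \<gamma> *v v))"
     and inv: "poly (map_poly emb G) (kemb \<alpha> * x + emb (const2 \<beta> * vars2 $ 1 + const2 \<gamma> * vars2 $ 2)) = 0"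
    using extendable_linear[OF F(1,2) P ext M0(1,3) p2[folded degG, unfolded G_def] x[unfolded G_def]] unfolding G_def[symmetric]
    by (elim exE conjE)
  note AM = AM'[rule_format]
  define u2 u3 where "u2 = - \<beta> / (\<alpha> - 1)" and "u3 = - \<gamma> / (\<alpha> - 1)"
  define U where "U = mat_row1 1 u2 u3"
  obtain a0 ap where \<alpha>1: "\<alpha> \<noteq> 1" and a: "subst_mat G U = [:a0:] + Polynomial.monom ap p"
    using semi_invariant_affine[OF p irrG degG p2 x inv nt \<sigma>(5)] unfolding U_def u2_def u3_def by (elim exE conjE)
  have homG: "homog3 d (subst_mat G U)" unfolding G_def by (intro homog3_subst_mat F(2))
  have a_eq: "Polynomial.coeff (subst_mat G U) 0 = a0" "Polynomial.coeff (subst_mat G U) p = ap"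
    unfolding a using p2 by (simp_all add: coeff_const_poly)
  have a0: "homog2 d a0" using homog2_coeff[OF homG, of 0] a_eq by simp
  have ap: "homog2 (d - p) ap" using homog2_coeff[OF homG, of p] a_eq dp by auto
  \<comment> \<open>The zero that goes to infinity: of the constant term \<open>a0\<close> if
    \<open>d = p\<close>, when \<open>ap\<close> is a constant, and of the linear form
    \<open>ap\<close> if \<open>d = p + 1\<close>.\<close>
  obtain w where w: "w \<noteq> 0" "d = p \<Longrightarrow> eval2 (\<lambda>c. c) a0 w = 0" "d = p + 1 \<Longrightarrow> eval2 (\<lambda>c. c) ap w = 0"
  proof (cases "d = p")
    case True
    then show ?thesis using binary_form_zero_exists[OF a0 d0] that by auto
  next
    case False
    then have "d - p > 0" using dp by simp
    then show ?thesis using binary_form_zero_exists[OF ap] that False by auto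
  qed
  obtain T S l where T: "T ** S = mat 1" "S ** T = mat 1" "T *v axis 1 1 = axis 1 1"
    and comm': "\<forall>\<alpha> v. mat_row1 \<alpha> 0 0 *v (T *v v) = T *v (mat_row1 \<alpha> 0 0 *v v)" and l': "\<forall>i. homog2 (Suc 0) (l $ i)"
    and sub': "\<forall>a b p. subst_mat ([:a:] + Polynomial.monom b p) T = [:eval2 const2 a l:] + Polynomial.monom (eval2 const2 b l) p"
    and ev': "\<forall>a. eval2 (\<lambda>c. c) (eval2 const2 a l) (\<chi> i. if i = 1 then 0 else 1) = eval2 (\<lambda>c. c) a w"
    using rotate_matrix[OF w(1)] by (elim exE conjE)
  note comm = comm'[rule_format] and l = l'[rule_format] and sub = sub'[rule_format] and ev = ev'[rule_format]
  define U' where "U' = mat_row1 1 (- u2) (- u3)"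
  have UU: "U ** U' = mat 1" "U' ** U = mat 1" unfolding U_def U'_def
    unfolding matrix_eq Finite_Cartesian_Product.vec_eq_iff forall_3
    by (simp_all add: matrix_vector_mul_assoc[symmetric] mat_row1_mult)
  define M where "M = M0 ** U ** T"
  define N where "N = S ** U' ** N0"
  have "M ** N = M0 ** (U ** (T ** S) ** U') ** N0" by (simp add: M_def N_def matrix_mul_assoc)
  then have MN: "M ** N = mat 1" by (simp add: T UU M0)
  then have NM: "N ** M = mat 1" by (simp add: matrix_left_right_inverse)
  have U1: "U *v axis 1 1 = axis 1 1" unfolding U_def Finite_Cartesian_Product.vec_eq_iff forall_3 mat_row1_mult by (simp add: axis_def)
  have MP: "M *v axis 1 1 = P" unfolding M_def by (simp add: matrix_vector_mul_assoc[symmetric] T U1 M0)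
  define c0 cp where "c0 = eval2 const2 a0 l" and "cp = eval2 const2 ap l"
  have FM: "subst_mat F M = [:c0:] + Polynomial.monom cp p"
    unfolding M_def subst_mat_subst_mat[symmetric] G_def[symmetric] a sub c0_def cp_def ..
  have hc0: "homog2 d c0" unfolding c0_def using homog2_eval2[OF a0 l] by simp
  have hcp: "homog2 (d - p) cp" unfolding cp_def using homog2_eval2[OF ap l] by simp
  have irr: "Factorial_Ring.irreducible (subst_mat F M)" by (rule irreducible_subst_mat[OF F(1) MN])
  have degM: "Polynomial.degree (subst_mat F M) = p" by (rule degp[OF MN MP])
  have cp0: "cp \<noteq> 0"
  proof
    assume "cp = 0"
    then have "Polynomial.degree (subst_mat F M) = 0" unfolding FM by simp
    then show False using degM p2 by simp
  qed
  define C where "C = poly c0 1"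
  have Cc: "Polynomial.coeff C j = (if j \<le> d then Polynomial.coeff (Polynomial.coeff c0 (d - j)) j else 0)" for j
    unfolding C_def by (rule homog2_coeff_poly_1[OF hc0])
  have degC: "Polynomial.degree C \<le> d" by (rule degree_le) (simp add: Cc)
  have main: "\<exists>\<kappa>. poly cp 1 = [:\<kappa>:] \<and> \<kappa> \<noteq> 0 \<and> \<not> p dvd Polynomial.degree C"
  proof (cases "d = p")
    case True
    define \<kappa> where "\<kappa> = Polynomial.coeff (Polynomial.coeff cp 0) 0"
    have "cp = const2 \<kappa>"
    proof (rule poly_eqI, rule poly_eqI)
      fix i j
      show "Polynomial.coeff (Polynomial.coeff cp i) j = Polynomial.coeff (Polynomial.coeff (const2 \<kappa>) i) j"
      proof (cases "i + j = d - p")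
        case True
        then have "i = 0" "j = 0" using \<open>d = p\<close> by simp_all
        then show ?thesis by (simp add: const2_def \<kappa>_def)
      next
        case False
        then have "Polynomial.coeff (Polynomial.coeff cp i) j = 0" using hcp unfolding homog2_def by meson
        moreover have "i \<noteq> 0 \<or> j \<noteq> 0" using False \<open>d = p\<close> by auto
        ultimately show ?thesis by (auto simp: const2_def coeff_const_poly)
      qed
    qed
    then have \<kappa>: "poly cp 1 = [:\<kappa>:]" "\<kappa> \<noteq> 0" using cp0 by (auto simp: const2_def)
    have "eval2 (\<lambda>c. c) c0 (\<chi> i. if i = 1 then 0 else 1) = 0" unfolding c0_def ev using w(2) True by simp
    then have "Polynomial.coeff C d = 0" unfolding Cc using eval2_at_01[OF hc0] by simp
    then have lt: "Polynomial.degree C < d"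
    proof -
      assume z: "Polynomial.coeff C d = 0"
      have "Polynomial.degree C \<noteq> d"
      proof
        assume dC: "Polynomial.degree C = d"
        then have "Polynomial.lead_coeff C = 0" using z by simp
        then have "C = 0" by (simp only: leading_coeff_0_iff)
        then show False using dC d0 by simp
      qed
      then show ?thesis using degC by simp
    qed
    \<comment> \<open>For constant \<open>C\<close> the form \<open>c0\<close> would be a multiple
      of \<open>Y ^ d\<close>, and \<open>k0 Y ^ p + \<kappa> X ^ p\<close> has the root
      \<open>\<mu> Y\<close> over an algebraically closed field, against irreducibility.\<close>
    have "Polynomial.degree C \<noteq> 0"
    proof
      assume d0C: "Polynomial.degree C = 0"
      define k0 where "k0 = Polynomial.coeff (Polynomial.coeff c0 d) 0"
      have c0_eq: "c0 = const2 k0 * (vars2 $ 1) ^ d"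
      proof (rule poly_eqI, rule poly_eqI)
        fix i j
        have m: "const2 k0 * (vars2 $ 1) ^ d = Polynomial.monom [:k0:] d" by (simp add: const2_def vars2_def monom_altdef)
        show "Polynomial.coeff (Polynomial.coeff c0 i) j = Polynomial.coeff (Polynomial.coeff (const2 k0 * (vars2 $ 1) ^ d) i) j"
        proof (cases "i + j = d")
          case True
          show ?thesis
          proof (cases "j = 0")
            case False
            have "Polynomial.coeff C j = 0" using d0C False by (intro coeff_eq_0) simp
            then have "Polynomial.coeff (Polynomial.coeff c0 (d - j)) j = 0" unfolding Cc using True by simp
            moreover have "d - j = i" using True by simp
            ultimately show ?thesis unfolding m using True False by simp
          next
            case j: True
            then have "i = d" using True by simp
            then show ?thesis unfolding m using j by (simp add: k0_def)
          qed
        next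
          case False
          then have "Polynomial.coeff (Polynomial.coeff c0 i) j = 0" using hc0 unfolding homog2_def by meson
          then show ?thesis unfolding m using False by (auto simp: coeff_const_poly)
        qed
      qed
      obtain \<mu> where \<mu>: "\<mu> ^ p = - k0 / \<kappa>" using nth_root_exists[of p "- k0 / \<kappa>"] p2 by auto
      interpret c2: comm_ring_hom "const2 :: 'a \<Rightarrow> 'a form2" by (rule comm_ring_hom_const2)
      have "poly (subst_mat F M) (const2 \<mu> * vars2 $ 1) = c0 + cp * (const2 \<mu> * vars2 $ 1) ^ p"
        unfolding FM by (simp add: poly_monom)
      also have "\<dots> = const2 (k0 + \<kappa> * \<mu> ^ p) * (vars2 $ 1) ^ p"
        unfolding c0_eq \<open>cp = const2 \<kappa>\<close> True by (simp add: c2.hom_add c2.hom_mult c2.hom_power power_mult_distrib algebra_simps)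
      also have "\<dots> = 0" using \<kappa>(2) by (simp add: \<mu>)
      finally show False using irreducible_no_root[OF irr] degM p2 by simp
    qed
    then have "\<not> p dvd Polynomial.degree C" using lt True by (auto dest: dvd_imp_le)
    then show ?thesis using \<kappa> by (intro exI[of _ \<kappa>] conjI)
  next
    case False
    then have d1: "d = p + 1" using dp by simp
    have "eval2 (\<lambda>c. c) cp (\<chi> i. if i = 1 then 0 else 1) = 0" unfolding cp_def ev using w(3) d1 by simp
    from homog2_dvd_var[OF hcp this] obtain b where b: "cp = vars2 $ 1 * b" by (elim exE)
    have z: "Polynomial.coeff (Polynomial.coeff cp 0) j = 0" for j using b by (simp add: vars2_def)
    define \<kappa> where "\<kappa> = Polynomial.coeff (Polynomial.coeff cp 1) 0"
    have cpj: "Polynomial.coeff (poly cp 1) j = (if j = 0 then \<kappa> else 0)" for j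
      unfolding homog2_coeff_poly_1[OF hcp] using d1 z[of j] by (auto simp: \<kappa>_def)
    have \<kappa>1: "poly cp 1 = [:\<kappa>:]" by (rule poly_eqI) (simp add: cpj coeff_const_poly)
    have "\<kappa> \<noteq> 0"
    proof
      assume "\<kappa> = 0"
      have "Polynomial.coeff (Polynomial.coeff cp i) j = 0" for i j
      proof (cases "i + j = 1")
        case True
        then consider "i = 0" | "i = 1" "j = 0" by linarith
        then show ?thesis using z \<open>\<kappa> = 0\<close> by cases (simp_all add: \<kappa>_def)
      next
        case False
        then have "i + j \<noteq> d - p" using d1 by simp
        then show ?thesis using hcp unfolding homog2_def by meson
      qed
      then have "cp = 0" by (intro poly_eqI) simp
      then show False using cp0 by simp
    qed
    \<comment> \<open>\<open>Y\<close> divides \<open>cp\<close> by the choice of coordinates. If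
      \<open>c0\<close> also vanished at infinity, \<open>Y\<close> would be a factor of the
      irreducible polynomial.\<close>
    have "Polynomial.coeff C d \<noteq> 0"
    proof
      assume "Polynomial.coeff C d = 0"
      then have "eval2 (\<lambda>c. c) c0 (\<chi> i. if i = 1 then 0 else 1) = 0" unfolding eval2_at_01[OF hc0] Cc by simp
      from homog2_dvd_var[OF hc0 this] obtain e where e: "c0 = vars2 $ 1 * e" by (elim exE)
      have fac: "subst_mat F M = [:vars2 $ 1:] * ([:e:] + Polynomial.monom b p)"
        unfolding FM e b by (simp add: algebra_simps smult_monom)
      with Factorial_Ring.irreducibleD[OF irr fac] var_not_unit have "[:e:] + Polynomial.monom b p dvd 1" by meson
      from dvd_imp_degree_le[OF this] have "Polynomial.degree ([:e:] + Polynomial.monom b p) = 0" by simp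
      then have "Polynomial.degree (subst_mat F M) \<le> 0" unfolding fac
        using degree_mult_le[of "[:vars2 $ 1:]" "[:e:] + Polynomial.monom b p"] by simp
      then show False using degM p2 by simp
    qed
    then have "Polynomial.degree C = d" using degC le_degree[of C d] by simp
    moreover have "\<not> p dvd p + 1" unfolding dvd_add_triv_left_iff using p2 by simp
    ultimately show ?thesis using \<kappa>1 \<open>\<kappa> \<noteq> 0\<close> d1 by (intro exI[of _ \<kappa>]) simp
  qed
  then obtain \<kappa> where \<kappa>: "poly cp 1 = [:\<kappa>:]" "\<kappa> \<noteq> 0" "\<not> p dvd Polynomial.degree (poly c0 1)" unfolding C_def by (elim exE conjE)
  \<comment> \<open>\<open>U\<close> moves the fixed point of the affine map to the origin and
    \<open>T\<close> commutes with scaling of the first coordinate, so in the final coordinates the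
    homology is diagonal up to the factor \<open>c\<close>.\<close>
  have AMv: "A *v (M *v v) = c *s (M *v (mat_row1 \<alpha> 0 0 *v v))" for v
  proof -
    have fix2: "\<alpha> * u2 + \<beta> = u2" "\<alpha> * u3 + \<gamma> = u3" using \<alpha>1 by (simp_all add: u2_def u3_def field_simps)
    have "mat_row1 \<alpha> \<beta> \<gamma> *v (U *v v) = U *v (mat_row1 \<alpha> 0 0 *v v)" for v
    proof -
      have "\<alpha> * (v $ 1 + u2 * v $ 2 + u3 * v $ 3) + \<beta> * v $ 2 + \<gamma> * v $ 3
         = \<alpha> * v $ 1 + (\<alpha> * u2 + \<beta>) * v $ 2 + (\<alpha> * u3 + \<gamma>) * v $ 3" by (simp add: algebra_simps)
      then show ?thesis unfolding Finite_Cartesian_Product.vec_eq_iff forall_3 U_def mat_row1_mult by (simp add: fix2)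
    qed
    then have "A *v (M0 *v (U *v (T *v v))) = c *s (M0 *v (U *v (T *v (mat_row1 \<alpha> 0 0 *v v))))"
      unfolding AM by (simp add: comm)
    then show ?thesis by (simp add: M_def matrix_vector_mul_assoc matrix_mul_assoc)
  qed
  show ?thesis
    using MN NM MP FM \<kappa> \<sigma> \<alpha>1 AMv
    by (intro exI[of _ M] exI[of _ N] exI[of _ \<sigma>] exI[of _ A] exI[of _ c] exI[of _ \<alpha>] exI[of _ c0] exI[of _ cp] exI[of _ \<kappa>] conjI allI)
qed

section \<open>The dual curve and the associated point\<close>

text \<open>The polar of \<open>s\<close>. At a smooth point of the curve it vanishes if and only if
  the tangent line passes through \<open>s\<close>; in the dual plane it cuts out the line with
  coordinates \<open>s\<close>.\<close>

definition dirform :: "'a::field form3 \<Rightarrow> 'a ^ 3 \<Rightarrow> 'a form3" where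
  "dirform F s = (\<Sum>i\<in>UNIV. const3 (s $ i) * gradient F $ i)"

lemma eval3_dirform:
  assumes "comm_ring_hom h" shows "eval3 h (dirform F s) v = (\<Sum>i\<in>UNIV. h (s $ i) * eval3 h (gradient F $ i) v)"
proof -
  interpret e: comm_ring_hom "\<lambda>F. eval3 h F v" by (rule comm_ring_hom_eval3[OF assms])
  show ?thesis by (simp add: dirform_def e.hom_sum e.hom_mult assms)
qed

lemma homog3_dirform: "homog3 d F \<Longrightarrow> d > 0 \<Longrightarrow> homog3 (d - 1) (dirform F s)"
  unfolding dirform_def by (intro homog3_sum homog3_const_mult homog3_gradient)

text \<open>With \<open>s\<close> as first basis vector, a zero derivative in characteristic zero
  means that \<open>F\<close> does not involve the first variable. It is then a binary form, which
  over an algebraically closed field has a linear factor.\<close>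

lemma dirform_nz:
  fixes F :: "'a::{alg_closed_field, field_char_0} form3"
  assumes F: "Factorial_Ring.irreducible F" "homog3 d F" "d \<ge> 2" and s: "s \<noteq> 0"
  shows "dirform F s \<noteq> 0"
proof
  assume 0: "dirform F s = 0"
  obtain M N :: "'a ^ 3 ^ 3" where M: "M ** N = mat 1" "N ** M = mat 1" "M *v axis 1 1 = s"
    using first_column_exists[OF s] by (elim exE conjE)
  have M1: "M $ j $ 1 = s $ j" for j unfolding M(3)[symmetric] by (simp add: matrix_vector_mult_def axis_def if_distrib cong: if_cong)
  interpret m: comm_ring_hom "\<lambda>F. subst_mat F M" by (rule comm_ring_hom_subst_mat)
  have "subst_mat (const3 c) M = const3 c" for c by (simp add: subst_mat_def comm_ring_hom_const3)
  then have "gradient (subst_mat F M) $ 1 = subst_mat (dirform F s) M"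
    unfolding dirform_def m.hom_sum m.hom_mult
    unfolding subst_mat_def gradient_comp gradient_lin_forms M1 by (simp add: mult.commute)
  then have "pderiv (subst_mat F M) = 0" unfolding 0 by (simp add: gradient_def m.hom_zero)
  then have "Polynomial.degree (subst_mat F M) = 0" by (simp add: pderiv_eq_0_iff)
  then obtain a where a: "subst_mat F M = [:a:]" by (rule degree_eq_zeroE)
  have "homog3 d [:a:]" unfolding a[symmetric] by (rule homog3_subst_mat[OF F(2)])
  from homog2_coeff[OF this, of 0] have ha: "homog2 d a" by simp
  have "d > 0" using F(3) by simp
  from binary_form_zero_exists[OF ha this] obtain w where w: "w \<noteq> 0" "eval2 (\<lambda>c. c) a w = 0" by (elim exE conjE)
  obtain T S :: "'a ^ 3 ^ 3" and l where T: "T ** S = mat 1" and l': "\<forall>i. homog2 (Suc 0) (l $ i)"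
    and sub: "\<forall>a b p. subst_mat ([:a:] + Polynomial.monom b p) T = [:eval2 const2 a l:] + Polynomial.monom (eval2 const2 b l) p"
    and ev: "\<forall>a. eval2 (\<lambda>c. c) (eval2 const2 a l) (\<chi> i. if i = 1 then 0 else 1) = eval2 (\<lambda>c. c) a w"
    using rotate_matrix[OF w(1)] by (elim exE conjE)
  interpret e2: comm_ring_hom "\<lambda>a. eval2 const2 a l" by (rule comm_ring_hom_eval2[OF comm_ring_hom_const2])
  define b where "b = eval2 const2 a l"
  have sT: "subst_mat (subst_mat F M) T = [:b:]" using sub[rule_format, of a 0 0] by (simp add: a b_def e2.hom_zero)
  have irr: "Factorial_Ring.irreducible [:b:]" unfolding sT[symmetric]
    by (rule irreducible_subst_mat[OF irreducible_subst_mat[OF F(1) M(1)] T])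
  have hb: "homog2 d b" unfolding b_def using homog2_eval2[OF ha l'[rule_format]] by simp
  have "eval2 (\<lambda>c. c) b (\<chi> i. if i = 1 then 0 else 1) = 0" unfolding b_def ev[rule_format] by (rule w(2))
  from homog2_dvd_var[OF hb this] obtain e where e: "b = vars2 $ 1 * e" by (elim exE)
  have "[:b:] = [:vars2 $ 1:] * [:e:]" by (simp add: e)
  with Factorial_Ring.irreducibleD[OF irr this] var_not_unit have "[:e:] dvd 1" by meson
  then obtain q where q: "1 = [:e:] * q" by (rule dvdE)
  interpret z: comm_ring_hom "\<lambda>F. form_at F (0 :: 'a ^ 3)" by (rule comm_ring_hom_eval3[OF comm_ring_hom_ident])
  have "form_at 1 (0 :: 'a ^ 3) = form_at [:e:] (0 :: 'a ^ 3) * form_at q (0 :: 'a ^ 3)" unfolding q by (rule z.hom_mult)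
  then have "form_at [:e:] (0 :: 'a ^ 3) \<noteq> 0" by (auto simp: z.hom_one)
  moreover have "form_at [:e:] (0 :: 'a ^ 3) = Polynomial.coeff (Polynomial.coeff e 0) 0"
    by (simp add: eval3_def map_poly_const_poly map_poly_idI poly_0_coeff_0 coeff_map_poly)
  moreover have "Polynomial.coeff (Polynomial.coeff b 1) 0 = Polynomial.coeff (Polynomial.coeff e 0) 0"
    by (simp add: e vars2_def)
  \<comment> \<open>The cofactor of the linear factor is a unit and so has a nonzero constant term.
    This leaves a term of degree one in \<open>b\<close>, while the degree of \<open>b\<close> is at
    least two.\<close>
  ultimately have "Polynomial.coeff (Polynomial.coeff b 1) 0 \<noteq> 0" by simp
  then have "1 + 0 = d" using hb unfolding homog2_def by meson
  then show False using F(3) by simp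
qed

lemma not_dvd_dirform:
  fixes F :: "'a::{alg_closed_field, field_char_0} form3"
  assumes F: "Factorial_Ring.irreducible F" "homog3 d F" "d \<ge> 2" and s: "s \<noteq> 0"
  shows "\<not> F dvd dirform F s"
proof
  assume dvd: "F dvd dirform F s"
  have d: "d > 0" using F(3) by simp
  have "d \<le> d - 1" by (rule homog3_dvd(1)[OF F(2) homog3_dirform[OF F(2) d] dvd dirform_nz[OF F s]])
  then show False using d by simp
qed

section \<open>A generic point of the dual curve\<close>

definition grad_at :: "('a \<Rightarrow> 'w) \<Rightarrow> 'a::field form3 \<Rightarrow> 'w::field ^ 3 \<Rightarrow> 'w ^ 3" where
  "grad_at h F v = (\<chi> i. eval3 h (gradient F $ i) v)"

text \<open>The tangent at the generic point of the curve is generic for the dual curve: forms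
  vanishing on the image of the dual map are those whose composite with the gradient vanishes on the
  curve. The gradient is nonzero at the generic point because polars are not divisible by
  \<open>F\<close>.\<close>

lemma gen_pt_dual:
  fixes F :: "'a::{alg_closed_field, field_char_0} form3"
  assumes F: "Factorial_Ring.irreducible F" "homog3 d F" "d \<ge> 2" and MN: "M ** N = mat 1"
    and deg: "Polynomial.degree (subst_mat F M) > 0" and x: "poly (map_poly emb (subst_mat F M)) x = 0"
  shows "gen_pt (dual_curve F) kemb (grad_at kemb F (hmat kemb M *v gpt x))"
proof (rule gen_pt.intro)
  let ?\<xi> = "hmat kemb M *v gpt x"
  note gen = generic_point_curve[OF F(1) MN deg x]
  have d: "d > 0" using F(3) by simp
  show "comm_ring_hom (kemb :: 'a \<Rightarrow> 'a gen)" by (rule comm_ring_hom_kemb)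
  show nz: "grad_at kemb F ?\<xi> \<noteq> 0"
  proof
    assume 0: "grad_at kemb F ?\<xi> = 0"
    have z: "eval3 kemb (gradient F $ i) ?\<xi> = 0" for i
    proof -
      have "grad_at kemb F ?\<xi> $ i = 0" unfolding 0 by simp
      then show ?thesis by (simp add: grad_at_def)
    qed
    have "eval3 kemb (dirform F (axis 1 1)) ?\<xi> = 0" unfolding eval3_dirform[OF comm_ring_hom_kemb] z by simp
    then have "F dvd dirform F (axis 1 1)" unfolding gen(1) .
    moreover have "axis 1 1 \<noteq> (0 :: 'a ^ 3)"
    proof
      assume "axis 1 1 = (0 :: 'a ^ 3)"
      then have "axis 1 1 $ (1::3) = (0 :: 'a)" by simp
      then show False by (simp add: axis_def)
    qed
    ultimately show False using not_dvd_dirform[OF F] by simp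
  qed
  fix n b assume b: "homog3 n (b :: 'a form3)"
  let ?C = "zero_locus F"
  let ?S = "forms_at (gradient F) ` (?C - sing_locus F)"
  define b' where "b' = eval3 const3 b (gradient F)"
  interpret e: comm_ring_hom "\<lambda>a. eval3 kemb a ?\<xi>" by (rule comm_ring_hom_eval3[OF comm_ring_hom_kemb])
  have val: "form_at b' y = form_at b (forms_at (gradient F) y)" for y
    by (simp add: b'_def eval3_eval3[OF comm_ring_hom_ident] forms_at_def)
  have gval: "eval3 kemb b' ?\<xi> = eval3 kemb b (grad_at kemb F ?\<xi>)"
    by (simp add: b'_def eval3_eval3[OF comm_ring_hom_kemb] grad_at_def)
  have Sn: "y \<noteq> 0" if "y \<in> ?S" for y using that by (auto simp: sing_locus_def)
  have "?S \<subseteq> dual_curve F" unfolding dual_curve_def zariski_closure_def using Sn by (auto simp: vanishes_on_def)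
  then have 1: "vanishes_on b (dual_curve F) \<longleftrightarrow> vanishes_on b ?S"
    unfolding dual_curve_def zariski_closure_def using b by (auto simp: vanishes_on_def)
  \<comment> \<open>Multiplication by the partial derivatives absorbs the singular points, where
    nothing is known about \<open>b'\<close>; at a smooth point one of these factors can be
    cancelled.\<close>
  have 2: "vanishes_on b ?S \<longleftrightarrow> (\<forall>i. vanishes_on (b' * gradient F $ i) ?C)"
  proof (intro iffI allI)
    fix i assume v: "vanishes_on b ?S"
    show "vanishes_on (b' * gradient F $ i) ?C" unfolding vanishes_on_def
    proof
      fix y assume y: "y \<in> ?C"
      interpret y: comm_ring_hom "\<lambda>a. form_at a y" by (rule comm_ring_hom_eval3[OF comm_ring_hom_ident])
      show "form_at (b' * gradient F $ i) y = 0"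
      proof (cases "y \<in> sing_locus F")
        case True
        then have "forms_at (gradient F) y $ i = 0" by (simp add: sing_locus_def)
        then show ?thesis by (simp add: y.hom_mult forms_at_def)
      next
        case False
        then have "form_at b' y = 0" using v y unfolding val vanishes_on_def by blast
        then show ?thesis by (simp add: y.hom_mult)
      qed
    qed
  next
    assume v: "\<forall>i. vanishes_on (b' * gradient F $ i) ?C"
    show "vanishes_on b ?S" unfolding vanishes_on_def
    proof (rule ballI, elim imageE)
      fix w y assume y: "y \<in> ?C - sing_locus F" and w: "w = forms_at (gradient F) y"
      interpret y: comm_ring_hom "\<lambda>a. form_at a y" by (rule comm_ring_hom_eval3[OF comm_ring_hom_ident])
      have "forms_at (gradient F) y \<noteq> 0" using y by (auto simp: sing_locus_def)
      then obtain i where i: "form_at (gradient F $ i) y \<noteq> 0" by (auto simp: forms_at_def Finite_Cartesian_Product.vec_eq_iff)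
      have "form_at (b' * gradient F $ i) y = 0" using v y unfolding vanishes_on_def by blast
      then show "form_at b w = 0" using i by (simp add: y.hom_mult val w)
    qed
  qed
  have 3: "(\<forall>i. vanishes_on (b' * gradient F $ i) ?C) \<longleftrightarrow> eval3 kemb b (grad_at kemb F ?\<xi>) = 0"
    unfolding gen(2) gen(1)[symmetric] e.hom_mult gval
  proof -
    obtain i where "grad_at kemb F ?\<xi> $ i \<noteq> 0" using nz by (auto simp: Finite_Cartesian_Product.vec_eq_iff)
    then have "eval3 kemb (gradient F $ i) ?\<xi> \<noteq> 0" by (simp add: grad_at_def)
    then show "(\<forall>i. eval3 kemb b (grad_at kemb F ?\<xi>) * eval3 kemb (gradient F $ i) ?\<xi> = 0) \<longleftrightarrow> eval3 kemb b (grad_at kemb F ?\<xi>) = 0"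
      by auto
  qed
  show "vanishes_on b (dual_curve F) \<longleftrightarrow> eval3 kemb b (grad_at kemb F ?\<xi>) = 0" using 1 2 3 by simp
qed

section \<open>Locating the centre of a homology\<close>

lemma prime_elem_dvd_prod:
  assumes "prime_elem p" "finite S" "p dvd (\<Prod>s\<in>S. g s)" shows "\<exists>s\<in>S. p dvd g s"
  using assms(2,3)
proof (induction S rule: finite_induct)
  case empty
  then show ?case using assms(1) by (simp add: prime_elem_not_unit)
next
  case (insert s S)
  then have "p dvd g s \<or> p dvd (\<Prod>s\<in>S. g s)" using prime_elem_dvd_multD[OF assms(1)] by simp
  then show ?case using insert.IH by (elim disjE) auto
qed

text \<open>For two distinct projective points this is the coordinate vector of the line joining
  them; for equal points it is zero.\<close>

definition cross :: "'a::comm_ring ^ 3 \<Rightarrow> 'a ^ 3 \<Rightarrow> 'a ^ 3" where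
  "cross u v = (\<chi> i. if i = 1 then u $ 2 * v $ 3 - u $ 3 * v $ 2
     else if i = 2 then u $ 3 * v $ 1 - u $ 1 * v $ 3 else u $ 1 * v $ 2 - u $ 2 * v $ 1)"

lemma cross_nth [simp]: "cross u v $ 1 = u $ 2 * v $ 3 - u $ 3 * v $ 2" "cross u v $ 2 = u $ 3 * v $ 1 - u $ 1 * v $ 3"
  "cross u v $ 3 = u $ 1 * v $ 2 - u $ 2 * v $ 1"
  by (simp_all add: cross_def)

lemma cross_eq_0_imp_proj_eq:
  fixes u v :: "'a::field ^ 3"
  assumes "cross u v = 0" "u \<noteq> 0" "v \<noteq> 0" shows "proj_eq u v"
proof -
  have e: "u $ 2 * v $ 3 = u $ 3 * v $ 2" "u $ 3 * v $ 1 = u $ 1 * v $ 3" "u $ 1 * v $ 2 = u $ 2 * v $ 1"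
    using cross_nth[of u v] unfolding assms(1) by simp_all
  from assms(3) obtain k where k: "v $ k \<noteq> 0" by (auto simp: Finite_Cartesian_Product.vec_eq_iff)
  have kk: "u $ i * v $ k = u $ k * v $ i" for i
    using exhaust_3[of i] exhaust_3[of k] e by (elim disjE) (simp_all add: mult.commute)
  then have u: "u $ i = (u $ k / v $ k) * v $ i" for i using k by (simp add: field_simps)
  have "u = (u $ k / v $ k) *s v"
    unfolding Finite_Cartesian_Product.vec_eq_iff vector_smult_component by (rule allI, rule u)
  moreover have "u $ k \<noteq> 0"
  proof
    assume "u $ k = 0"
    then have "u $ i = 0" for i by (subst u) simp
    then have "u = 0" unfolding Finite_Cartesian_Product.vec_eq_iff by simp
    then show False using assms(2) by simp
  qed
  ultimately show ?thesis unfolding proj_eq_def using k by (intro exI[of _ "u $ k / v $ k"]) simp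
qed

text \<open>
  A general line through \<open>R\<close> meets the dual curve outside of the fixed locus of the homology
  \<open>B\<close>, whose centre is \<open>L\<close>, and the line joining such a point to its image passes through \<open>L\<close>.
\<close>

lemma homology_centre:
  fixes F :: "'a::{alg_closed_field, field_char_0} form3"
  assumes F: "Factorial_Ring.irreducible F" "homog3 d F" "d \<ge> 2" and MN: "M ** N = mat 1"
    and deg: "Polynomial.degree (subst_mat F M) > 0"
    and B: "\<And>v. B *v v = c *s (v + (k * (\<Sum>i\<in>UNIV. v $ i * P $ i)) *s L)" and ck: "c \<noteq> 0" "k \<noteq> 0" and inj: "\<And>v. B *v v = 0 \<Longrightarrow> v = 0"
    and P: "P \<noteq> 0" and L: "L \<noteq> 0" and R: "R \<noteq> 0"
    and pres: "rat_map (dual_curve F) (lin_forms B) \<in> carrier (line_preserving (dual_curve F) R)"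
  shows "proj_eq R L"
proof (rule ccontr)
  assume np: "\<not> proj_eq R L"
  let ?D = "dual_curve F"
  obtain x where x: "poly (map_poly emb (subst_mat F M)) x = 0" using gpt_root_exists[OF deg] by (elim exE)
  note gen = generic_point_curve[OF F(1) MN deg x]
  interpret g: gen_pt ?D kemb "grad_at kemb F (hmat kemb M *v gpt x)" by (rule gen_pt_dual[OF F MN deg x])
  let ?\<xi> = "grad_at kemb F (hmat kemb M *v gpt x)"
  have RL: "cross R L \<noteq> 0" using cross_eq_0_imp_proj_eq[OF _ R L] np by auto
  have self: "lin_forms B \<in> rat_map ?D (lin_forms B)"
  proof (rule g.represents_rat_map(1))
    have "\<exists>N. N ** B = mat 1" using inj matrix_left_invertible_ker[of B] by blast
    then obtain B' where B': "B' ** B = mat 1" by (elim exE)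
    show "hmat kemb B *v ?\<xi> \<noteq> 0"
    proof
      assume "hmat kemb B *v ?\<xi> = 0"
      then have "hmat kemb B' *v (hmat kemb B *v ?\<xi>) = 0" by simp
      then show False using hmat_inverse[OF comm_ring_hom_kemb B', of ?\<xi>] g.nz by simp
    qed
    show r: "g.represents (lin_forms B) (hmat kemb B *v ?\<xi>)"
      unfolding g.represents_def by (rule exI[of _ "Suc 0"], rule exI[of _ 1]) (simp add: map_row_mult[OF comm_ring_hom_kemb])
    show "g.represents (lin_forms B) (hmat kemb B *v ?\<xi>)" by (rule r)
  qed
  from pres obtain S where S: "finite S"
    and SP: "\<And>u y \<phi>. u \<noteq> 0 \<Longrightarrow> on_line R u \<Longrightarrow> (\<forall>s\<in>S. \<not> proj_eq u s) \<Longrightarrow> y \<in> ?D \<Longrightarrow> on_line y u \<Longrightarrow> \<not> proj_eq y R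
       \<Longrightarrow> \<phi> \<in> rat_map ?D (lin_forms B) \<Longrightarrow> forms_at \<phi> y \<noteq> 0 \<Longrightarrow> on_line (forms_at \<phi> y) u"
    unfolding line_preserving_def by auto
  \<comment> \<open>A point \<open>\<gamma>\<close> of the dual curve is needed off finitely many
    lines: \<open>P\<close> is the axis of the homology, \<open>cross R L\<close> joins
    \<open>R\<close> to the centre, and the others are the exceptional lines of
    \<open>line_preserving\<close>, without the zero vector, whose polar would be zero. Each
    corresponds to a polar, and \<open>F\<close> does not divide their product.\<close>
  define S' where "S' = insert P (insert (cross R L) {s \<in> S. s \<noteq> 0})"
  have finS: "finite S'" unfolding S'_def using S by simp
  define Q where "Q = (\<Prod>s\<in>S'. dirform F s)"
  have Snz: "s \<noteq> 0" if "s \<in> S'" for s using that P RL unfolding S'_def by auto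
  have prime: "prime_elem F" using F(1) by simp
  have "\<not> F dvd Q"
  proof
    assume "F dvd Q"
    then have "\<exists>s\<in>S'. F dvd dirform F s" unfolding Q_def by (rule prime_elem_dvd_prod[OF prime finS])
    then obtain s where "s \<in> S'" "F dvd dirform F s" by (elim bexE)
    then show False using not_dvd_dirform[OF F Snz] by simp
  qed
  then have "\<not> vanishes_on Q (zero_locus F)" using gen(2) by simp
  then have "\<exists>y\<in>zero_locus F. form_at Q y \<noteq> 0" unfolding vanishes_on_def by simp
  then obtain y where y: "y \<in> zero_locus F" "form_at Q y \<noteq> 0" by (elim bexE)
  define \<gamma> where "\<gamma> = forms_at (gradient F) y"
  interpret y: comm_ring_hom "\<lambda>a. form_at a y" by (rule comm_ring_hom_eval3[OF comm_ring_hom_ident])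
  have dot: "(\<Sum>i\<in>UNIV. s $ i * \<gamma> $ i) \<noteq> 0" if "s \<in> S'" for s
  proof -
    have "form_at Q y = (\<Prod>s\<in>S'. form_at (dirform F s) y)" unfolding Q_def by (rule y.hom_prod)
    then have "form_at (dirform F s) y \<noteq> 0" using y(2) finS that by (simp add: prod_zero_iff)
    then show ?thesis by (simp add: eval3_dirform[OF comm_ring_hom_ident] \<gamma>_def forms_at_def)
  qed
  have \<gamma>P: "(\<Sum>i\<in>UNIV. P $ i * \<gamma> $ i) \<noteq> 0" and \<gamma>RL: "(\<Sum>i\<in>UNIV. cross R L $ i * \<gamma> $ i) \<noteq> 0"
    by (rule dot, simp add: S'_def)+
  have "\<gamma> \<noteq> 0" using \<gamma>P by auto
  then have "y \<notin> sing_locus F" by (simp add: sing_locus_def \<gamma>_def)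
  then have mem: "\<gamma> \<in> forms_at (gradient F) ` (zero_locus F - sing_locus F)" unfolding \<gamma>_def using y(1) by (intro imageI DiffI)
  have \<gamma>D: "\<gamma> \<in> ?D"
    unfolding dual_curve_def zariski_closure_def
  proof (intro CollectI conjI allI impI)
    show "\<gamma> \<noteq> 0" by fact
    fix n G assume "vanishes_on G (forms_at (gradient F) ` (zero_locus F - sing_locus F))"
    then show "form_at G \<gamma> = 0" unfolding vanishes_on_def using mem by (rule bspec)
  qed
  \<comment> \<open>The line joining \<open>\<gamma>\<close> to \<open>R\<close>. It differs from
    every exceptional line because those do not pass through \<open>\<gamma>\<close>.\<close>
  define u where "u = cross \<gamma> R"
  have uL: "(\<Sum>i\<in>UNIV. u $ i * L $ i) = (\<Sum>i\<in>UNIV. cross R L $ i * \<gamma> $ i)"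
    by (simp add: sum_3 u_def algebra_simps)
  have unz: "u \<noteq> 0"
  proof
    assume "u = 0"
    then have "(\<Sum>i\<in>UNIV. u $ i * L $ i) = 0" by simp
    then show False using uL \<gamma>RL by simp
  qed
  have Ru: "on_line R u" "on_line \<gamma> u" by (simp_all add: on_line_def sum_3 u_def algebra_simps)
  have nS: "\<forall>s\<in>S. \<not> proj_eq u s"
  proof (intro ballI notI)
    fix s assume s: "s \<in> S" "proj_eq u s"
    from s(2) obtain c where c: "c \<noteq> 0" "u = c *s s" unfolding proj_eq_def by (elim exE conjE)
    have "s \<noteq> 0" using unz c by auto
    then have "s \<in> S'" using s(1) by (simp add: S'_def)
    have "(\<Sum>i\<in>UNIV. u $ i * \<gamma> $ i) = c * (\<Sum>i\<in>UNIV. s $ i * \<gamma> $ i)" by (simp add: c sum_distrib_left mult.assoc)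
    then show False using Ru(2) dot[OF \<open>s \<in> S'\<close>] c(1) by (simp add: on_line_def)
  qed
  have nR: "\<not> proj_eq \<gamma> R"
  proof
    assume "proj_eq \<gamma> R"
    then obtain c where c: "\<gamma> = c *s R" unfolding proj_eq_def by (elim exE conjE)
    have "u = 0" unfolding u_def c Finite_Cartesian_Product.vec_eq_iff forall_3 by simp
    then show False using unz by simp
  qed
  have FB: "forms_at (lin_forms B) \<gamma> = B *v \<gamma>"
    unfolding forms_at_def using eval3_lin_forms_vec[OF comm_ring_hom_ident, of B \<gamma>] by simp
  have "B *v \<gamma> \<noteq> 0" using inj[of \<gamma>] \<open>\<gamma> \<noteq> 0\<close> by (intro notI) simp
  then have "on_line (B *v \<gamma>) u" using SP[OF unz Ru(1) nS \<gamma>D Ru(2) nR self] unfolding FB by simp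
  \<comment> \<open>The image of \<open>\<gamma>\<close> is \<open>\<gamma>\<close> plus a multiple
    of \<open>L\<close>, nonzero as \<open>\<gamma>\<close> is off the axis. If both points lie on
    \<open>u\<close>, so does \<open>L\<close>, against the choice of \<open>\<gamma>\<close> off
    the line through \<open>R\<close> and \<open>L\<close>.\<close>
  then have "(\<Sum>i\<in>UNIV. u $ i * (c * (\<gamma> $ i + k * (\<Sum>i\<in>UNIV. \<gamma> $ i * P $ i) * L $ i))) = 0"
    unfolding on_line_def B by simp
  moreover have "(\<Sum>i\<in>UNIV. u $ i * (c * (\<gamma> $ i + K * L $ i))) = c * ((\<Sum>i\<in>UNIV. u $ i * \<gamma> $ i) + K * (\<Sum>i\<in>UNIV. u $ i * L $ i))" for K
    by (simp add: sum_3 algebra_simps)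
  ultimately have "k * (\<Sum>i\<in>UNIV. \<gamma> $ i * P $ i) * (\<Sum>i\<in>UNIV. u $ i * L $ i) = 0"
    using Ru(2) ck(1) by (simp add: on_line_def)
  then show False using ck(2) \<gamma>P \<gamma>RL uL by (simp add: mult.commute)
qed

text \<open>In the coordinates \<open>M\<close>, \<open>A\<close> is a homology with centre
  \<open>P\<close> and axis \<open>X = 0\<close>. On the dual plane centre and axis change roles:
  the centre is the line \<open>X = 0\<close>, that is the first row of \<open>N\<close>, and the
  axis consists of the lines through \<open>P\<close>.\<close>

theorem associated_point_axis:
  fixes F :: "'a::{alg_closed_field, field_char_0} form3" and M N A :: "'a ^ 3 ^ 3"
  assumes F: "Factorial_Ring.irreducible F" "homog3 d F" "d \<ge> 2" and MN: "M ** N = mat 1" and MP: "M *v axis 1 1 = P"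
    and deg: "Polynomial.degree (subst_mat F M) > 0"
    and \<sigma>: "\<sigma> \<in> carrier (galois_point_group (zero_locus F) P)" and A: "invertible A"
    and ind: "induces (zero_locus F) \<sigma> (rat_map (zero_locus F) (lin_forms A))"
    and c: "c \<noteq> 0" "\<alpha> \<noteq> 0" "\<alpha> \<noteq> 1" and AM: "\<And>v. A *v (M *v v) = c *s (M *v (mat_row1 \<alpha> 0 0 *v v))"
    and R: "associated_point F P R"
  shows "proj_eq R (Finite_Cartesian_Product.transpose N *v axis 1 1)"
proof -
  let ?t = "Finite_Cartesian_Product.transpose :: 'a ^ 3 ^ 3 \<Rightarrow> 'a ^ 3 ^ 3"
  define B where "B = ?t (matrix_inv A)"
  have NM: "N ** M = mat 1" using MN by (simp add: matrix_left_right_inverse)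
  from R obtain h where R0: "R \<noteq> 0" and h: "h \<in> hom (galois_point_group (zero_locus F) P) (line_preserving (dual_curve F) R)"
    and hA: "\<forall>\<sigma>\<in>carrier (galois_point_group (zero_locus F) P). \<forall>A. invertible A \<and>
           induces (zero_locus F) \<sigma> (rat_map (zero_locus F) (lin_forms A)) \<longrightarrow>
           h \<sigma> = rat_map (dual_curve F) (lin_forms (?t (matrix_inv A)))"
    unfolding associated_point_def by (elim conjE bexE)
  have "h \<sigma> = rat_map (dual_curve F) (lin_forms B)" using hA[rule_format, OF \<sigma>, of A] A ind unfolding B_def by simp
  moreover have "h \<sigma> \<in> carrier (line_preserving (dual_curve F) R)" using h \<sigma> unfolding hom_def by blast
  ultimately have pres: "rat_map (dual_curve F) (lin_forms B) \<in> carrier (line_preserving (dual_curve F) R)" by simp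
  define L where "L = ?t N *v axis 1 1"
  define A1 where "A1 = M ** mat_row1 (inverse \<alpha>) 0 0 ** N"
  have AA1: "A *v (A1 *v v) = c *s v" for v
  proof -
    have "mat_row1 \<alpha> 0 0 *v (mat_row1 (inverse \<alpha>) 0 0 *v w) = w" for w
      unfolding Finite_Cartesian_Product.vec_eq_iff forall_3 mat_row1_mult using c by simp
    then have "A *v (M *v (mat_row1 (inverse \<alpha>) 0 0 *v (N *v v))) = c *s (M *v (N *v v))" unfolding AM by simp
    then show ?thesis by (simp add: A1_def matrix_vector_mul_assoc MN matrix_mul_assoc)
  qed
  have inv: "matrix_inv A ** A = mat 1" "A ** matrix_inv A = mat 1"
  proof -
    have "A ** matrix_inv A = mat 1 \<and> matrix_inv A ** A = mat 1"
      unfolding matrix_inv_def using A unfolding invertible_def by (rule someI_ex)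
    then show "matrix_inv A ** A = mat 1" "A ** matrix_inv A = mat 1" by simp_all
  qed
  have iA: "matrix_inv A *v v = inverse c *s (A1 *v v)" for v
  proof -
    have "matrix_inv A *v (A *v (A1 *v v)) = A1 *v v"
      unfolding matrix_vector_mul_assoc[of "matrix_inv A" A] inv by simp
    then have "c *s (matrix_inv A *v v) = A1 *v v" unfolding AA1 by (simp add: vector_scalar_commute)
    then have "inverse c *s (c *s (matrix_inv A *v v)) = inverse c *s (A1 *v v)" by simp
    then show ?thesis using c by (simp add: vector_smult_assoc)
  qed
  \<comment> \<open>The inverse of \<open>A\<close> is a scalar times the identity plus a matrix of
    rank one, the product of the first column of \<open>M\<close> and the first row of
    \<open>N\<close>. Transposing it exhibits the centre and the axis on the dual plane.\<close>
  have entry: "matrix_inv A $ i $ j = inverse c * (mat 1 $ i $ j + (inverse \<alpha> - 1) * M $ i $ 1 * N $ 1 $ j)" for i j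
  proof -
    have col: "(T *v axis j 1) $ i = T $ i $ j" for T :: "'a ^ 3 ^ 3"
      by (simp add: matrix_vector_mult_def axis_def if_distrib cong: if_cong)
    have "mat_row1 (inverse \<alpha>) 0 0 *v w = w + ((inverse \<alpha> - 1) * w $ 1) *s axis 1 1" for w :: "'a ^ 3"
      unfolding Finite_Cartesian_Product.vec_eq_iff forall_3 mat_row1_mult by (simp add: axis_def algebra_simps)
    then have "A1 *v axis j 1 = M *v (N *v axis j 1) + ((inverse \<alpha> - 1) * (N *v axis j 1) $ 1) *s (M *v axis 1 1)"
      unfolding A1_def by (simp add: matrix_vector_mul_assoc[symmetric] matrix_vector_right_distrib vector_scalar_commute)
    then have "(A1 *v axis j 1) $ i = axis j 1 $ i + (inverse \<alpha> - 1) * (N *v axis j 1) $ 1 * (M *v axis 1 1) $ i"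
      by (simp add: matrix_vector_mul_assoc MN)
    moreover have "(N *v axis j 1) $ 1 = N $ 1 $ j" "(M *v axis 1 1) $ i = M $ i $ 1"
      by (simp_all add: matrix_vector_mult_def axis_def if_distrib cong: if_cong)
    moreover have "axis j 1 $ i = (mat 1 :: 'a ^ 3 ^ 3) $ i $ j" by (simp add: axis_def Finite_Cartesian_Product.mat_def)
    ultimately show ?thesis using col[of "matrix_inv A"] unfolding iA by (simp add: mult.commute mult.left_commute)
  qed
  have Lj: "L $ j = N $ 1 $ j" for j
    by (simp add: L_def Finite_Cartesian_Product.transpose_def matrix_vector_mult_def axis_def if_distrib cong: if_cong)
  have Pi: "P $ i = M $ i $ 1" for i unfolding MP[symmetric]
    by (simp add: matrix_vector_mult_def axis_def if_distrib cong: if_cong)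
  have Bv: "B *v v = inverse c *s (v + ((inverse \<alpha> - 1) * (\<Sum>i\<in>UNIV. v $ i * P $ i)) *s L)" for v
  proof -
    have "(B *v v) $ j = inverse c * (v $ j + (inverse \<alpha> - 1) * (\<Sum>i\<in>UNIV. v $ i * P $ i) * L $ j)" for j
    proof -
      have "(B *v v) $ j = (\<Sum>i\<in>UNIV. inverse c * (mat 1 $ i $ j + (inverse \<alpha> - 1) * P $ i * L $ j) * v $ i)"
        by (simp add: B_def Finite_Cartesian_Product.transpose_def matrix_vector_mult_def entry Lj Pi)
      also have "\<dots> = (\<Sum>i\<in>UNIV. inverse c * (if i = j then v $ i else 0) + inverse c * (inverse \<alpha> - 1) * L $ j * (v $ i * P $ i))"
        by (rule sum.cong) (auto simp: Finite_Cartesian_Product.mat_def algebra_simps)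
      also have "\<dots> = inverse c * v $ j + inverse c * (inverse \<alpha> - 1) * L $ j * (\<Sum>i\<in>UNIV. v $ i * P $ i)"
        by (simp add: sum.distrib sum_distrib_left[symmetric])
      finally show ?thesis by (simp add: algebra_simps)
    qed
    then show ?thesis unfolding Finite_Cartesian_Product.vec_eq_iff by simp
  qed
  have "B ** ?t A = mat 1" unfolding B_def matrix_transpose_mul[symmetric] inv by (simp add: transpose_mat)
  then have "?t A ** B = mat 1" by (simp add: matrix_left_right_inverse)
  then have inj: "v = 0" if "B *v v = 0" for v
  proof -
    have "?t A *v (B *v v) = v" by (simp add: matrix_vector_mul_assoc \<open>?t A ** B = mat 1\<close>)
    then show ?thesis unfolding that by simp
  qed
  have P0: "P \<noteq> 0"
  proof
    assume "P = 0"
    then have "N *v (M *v axis 1 1) = 0" using MP by simp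
    then have "axis 1 1 = (0 :: 'a ^ 3)" by (simp add: matrix_vector_mul_assoc NM)
    then have "axis 1 1 $ (1::3) = (0 :: 'a)" by simp
    then show False by (simp add: axis_def)
  qed
  have L0: "L \<noteq> 0"
  proof
    assume "L = 0"
    then have "(N ** M) $ 1 $ 1 = 0" unfolding matrix_matrix_mult_def using Lj by simp
    then show False unfolding NM by (simp add: Finite_Cartesian_Product.mat_def)
  qed
  have "inverse \<alpha> - 1 \<noteq> 0" using c by (simp add: field_simps)
  from homology_centre[OF F MN deg Bv _ this inj P0 L0 R0 pres] c show ?thesis unfolding L_def by simp
qed

section \<open>Rational functions of one variable\<close>

lemma subfield_RT_closed:
  fixes k :: "'w::field set"
  assumes "subfield k RT"
  shows "0 \<in> k" "1 \<in> k" "x \<in> k \<Longrightarrow> - x \<in> k" "x \<in> k \<Longrightarrow> y \<in> k \<Longrightarrow> x + y \<in> k" "x \<in> k \<Longrightarrow> y \<in> k \<Longrightarrow> x * y \<in> k"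
    "x \<in> k \<Longrightarrow> inverse x \<in> k" "x \<in> k \<Longrightarrow> y \<in> k \<Longrightarrow> x - y \<in> k" "x \<in> k \<Longrightarrow> y \<in> k \<Longrightarrow> x / y \<in> k" "x \<in> k \<Longrightarrow> x ^ n \<in> k"
    "of_nat n \<in> k"
proof -
  interpret R: Ring.field "RT :: 'w ring" by (rule field_RT)
  note s = subringE[OF subfieldE(1)[OF assms]]
  show 0: "0 \<in> k" "1 \<in> k" using s(2,3) by simp_all
  show m: "x \<in> k \<Longrightarrow> - x \<in> k" for x using s(5)[of x] by simp
  show a: "x \<in> k \<Longrightarrow> y \<in> k \<Longrightarrow> x + y \<in> k" for x y using s(7)[of x y] by simp
  show t: "x \<in> k \<Longrightarrow> y \<in> k \<Longrightarrow> x * y \<in> k" for x y using s(6)[of x y] by simp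
  show i: "x \<in> k \<Longrightarrow> inverse x \<in> k" for x
  proof (cases "x = 0")
    case False
    assume "x \<in> k"
    then show ?thesis using R.subfield_m_inv(1)[OF assms, of x] False by (simp add: RT_inv)
  qed (simp add: 0)
  show "x \<in> k \<Longrightarrow> y \<in> k \<Longrightarrow> x - y \<in> k" using a[of x "- y"] m[of y] by simp
  show "x \<in> k \<Longrightarrow> y \<in> k \<Longrightarrow> x / y \<in> k" using t[of x "inverse y"] i[of y] by (simp add: divide_inverse)
  show "x \<in> k \<Longrightarrow> x ^ n \<in> k" by (induction n) (simp_all add: 0 t)
  show "of_nat n \<in> k" by (induction n) (simp_all add: 0 a)
qed

definition pev :: "('a::comm_ring_1 \<Rightarrow> 'w::comm_ring_1) \<Rightarrow> 'w \<Rightarrow> 'a poly \<Rightarrow> 'w" where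
  "pev h z q = poly (map_poly h q) z"

lemma comm_ring_hom_pev: "comm_ring_hom h \<Longrightarrow> comm_ring_hom (pev h z)"
  unfolding pev_def by (rule comm_ring_hom_poly_map)

lemma pev_pCons: "comm_ring_hom h \<Longrightarrow> pev h z (pCons a q) = h a + z * pev h z q"
  unfolding pev_def by (rule poly_map_pCons)

lemma pev_0 [simp]: "pev h z 0 = 0"
  by (simp add: pev_def)

lemma pev_smult: "comm_ring_hom h \<Longrightarrow> pev h z (Polynomial.smult c q) = h c * pev h z q"
proof -
  assume h: "comm_ring_hom h"
  interpret e: comm_ring_hom "pev h z" by (rule comm_ring_hom_pev[OF h])
  have "pev h z ([:c:] * q) = h c * pev h z q" by (simp only: e.hom_mult pev_pCons[OF h]) simp
  then show ?thesis by simp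
qed

lemma pev_in_subfield:
  fixes h :: "'a::comm_ring_1 \<Rightarrow> 'w::field"
  assumes h: "comm_ring_hom h" and S: "subfield S RT" "range h \<subseteq> S" "v \<in> S" shows "pev h v q \<in> S"
proof (induction q)
  case (pCons a q)
  then show ?case using S by (auto simp: pev_pCons[OF h] intro!: subfield_RT_closed[OF S(1)])
qed (simp add: subfield_RT_closed[OF S(1)])

definition rat1 :: "('a::field \<Rightarrow> 'w::field) \<Rightarrow> 'w \<Rightarrow> 'w set" where
  "rat1 h z = {pev h z A / pev h z B | A B. pev h z B \<noteq> 0}"

lemma rat1I: "pev h z B \<noteq> 0 \<Longrightarrow> pev h z A / pev h z B \<in> rat1 h z"
  unfolding rat1_def by blast

lemma rat1E:
  assumes "w \<in> rat1 h z" obtains A B where "pev h z B \<noteq> 0" "w = pev h z A / pev h z B"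
  using assms unfolding rat1_def by (elim CollectE exE conjE) 

lemma rat1_basic:
  assumes h: "comm_ring_hom h" shows "h c \<in> rat1 h z" "z \<in> rat1 h z"
proof -
  interpret e: comm_ring_hom "pev h z" by (rule comm_ring_hom_pev[OF h])
  interpret h: comm_ring_hom h by (rule h)
  show "h c \<in> rat1 h z" using rat1I[of h z "1" "[:c:]"] by (simp add: e.hom_one pev_pCons[OF h])
  show "z \<in> rat1 h z" using rat1I[of h z "1" "[:0,1:]"] by (simp add: e.hom_one pev_pCons[OF h] h.hom_one h.hom_zero)
qed

lemma subfield_rat1:
  fixes h :: "'a::field \<Rightarrow> 'w::field"
  assumes h: "comm_ring_hom h" shows "subfield (rat1 h z) RT"
proof -
  interpret e: comm_ring_hom "pev h z" by (rule comm_ring_hom_pev[OF h])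
  show ?thesis
  proof (rule subfield_RT)
    show "1 \<in> rat1 h z" using rat1I[of h z 1 1] by (simp add: e.hom_one)
  next
    fix x assume "x \<in> rat1 h z"
    then obtain A B where 1: "pev h z B \<noteq> 0" "x = pev h z A / pev h z B" by (rule rat1E)
    show "- x \<in> rat1 h z" using rat1I[OF 1(1), of "- A"] by (simp add: e.hom_uminus 1(2))
    show "inverse x \<in> rat1 h z" if "x \<noteq> 0"
    proof -
      have "pev h z A \<noteq> 0" using that 1 by auto
      from rat1I[OF this, of B] show ?thesis by (simp add: 1(2))
    qed
    fix y assume "y \<in> rat1 h z"
    then obtain A' B' where 2: "pev h z B' \<noteq> 0" "y = pev h z A' / pev h z B'" by (rule rat1E)
    have nz: "pev h z (B * B') \<noteq> 0" using 1 2 by (simp add: e.hom_mult)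
    show "x * y \<in> rat1 h z" using rat1I[OF nz, of "A * A'"] by (simp add: e.hom_mult 1(2) 2(2))
    show "x + y \<in> rat1 h z" using rat1I[OF nz, of "A * B' + A' * B"] 1(1) 2(1)
      by (simp add: e.hom_mult e.hom_add 1(2) 2(2) add_frac_eq)
  qed
qed

lemma rat1_subset:
  assumes h: "comm_ring_hom h" and S: "subfield S RT" "range h \<subseteq> S" "v \<in> S" shows "rat1 h v \<subseteq> S"
proof
  fix w assume "w \<in> rat1 h v"
  then obtain A B where 1: "pev h v B \<noteq> 0" "w = pev h v A / pev h v B" by (rule rat1E)
  show "w \<in> S" unfolding 1(2) by (intro subfield_RT_closed(8)[OF S(1)] pev_in_subfield[OF h S])
qed

section \<open>The logarithmic derivative of a polynomial\<close>

lemma root_factorization: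
  fixes g :: "'a::alg_closed_field poly"
  assumes "g \<noteq> 0"
  shows "\<exists>R e. finite R \<and> (\<forall>r\<in>R. e r > (0::nat)) \<and> g = Polynomial.smult (Polynomial.lead_coeff g) (\<Prod>r\<in>R. [:-r, 1:] ^ e r) \<and> (\<Sum>r\<in>R. e r) = Polynomial.degree g"
proof -
  from alg_closed_imp_factorization[OF assms] obtain A
    where A: "size A = Polynomial.degree g" "g = Polynomial.smult (Polynomial.lead_coeff g) (\<Prod>x\<in>#A. [:-x, 1:])" by (elim exE conjE)
  show ?thesis
  proof (rule exI[of _ "set_mset A"], rule exI[of _ "count A"], intro conjI)
    show "g = Polynomial.smult (Polynomial.lead_coeff g) (\<Prod>r\<in>set_mset A. [:-r, 1:] ^ count A r)"
      using A(2) unfolding image_prod_mset_multiplicity .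
    show "(\<Sum>r\<in>set_mset A. count A r) = Polynomial.degree g" using A(1) by (simp add: size_multiset_overloaded_eq)
  qed simp_all
qed

text \<open>The roots of \<open>f\<close> are split off one at a time: each is a root of
  \<open>c * g\<close> and none of \<open>g\<close>, hence one of \<open>c\<close>.\<close>

lemma dvd_if_no_common_root:
  fixes f g c :: "'a::alg_closed_field poly"
  assumes "f \<noteq> 0" "\<forall>x. poly f x = 0 \<longrightarrow> poly g x \<noteq> 0" "f dvd c * g" shows "f dvd c"
  using assms
proof (induction "Polynomial.degree f" arbitrary: f c)
  case 0
  then obtain a where a: "f = [:a:]" by (metis degree_eq_zeroE)
  then have "f dvd 1" using 0(2) by (simp add: is_unit_const_poly_iff dvd_field_iff)
  then show ?case by (rule dvd_trans) simp
next
  case (Suc n)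
  obtain x where x: "poly f x = 0" using alg_closed_imp_poly_has_root[of f] Suc(2) by auto
  then obtain f' where f': "f = [:-x, 1:] * f'" using poly_eq_0_iff_dvd[of f x] by (elim iffD1[elim_format] dvdE)
  from Suc(5) obtain w where "c * g = f * w" by (rule dvdE)
  then have "poly (c * g) x = poly (f * w) x" by (simp only:)
  then have "poly (c * g) x = 0" using x by simp
  then have "poly c x = 0" using Suc(4) x by simp
  then obtain c' where c': "c = [:-x, 1:] * c'" using poly_eq_0_iff_dvd[of c x] by (elim iffD1[elim_format] dvdE)
  have nz: "f' \<noteq> 0" using Suc(3) f' by auto
  have "Suc n = Suc (Polynomial.degree f')" using Suc(2) nz unfolding f' by (subst (asm) degree_mult_eq) auto
  then have "n = Polynomial.degree f'" by simp
  moreover have "\<forall>y. poly f' y = 0 \<longrightarrow> poly g y \<noteq> 0" using Suc(4) by (simp add: f')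
  moreover have "[:-x, 1:] * f' dvd [:-x, 1:] * (c' * g)" using Suc(5) unfolding f' c' by (simp only: mult.assoc)
  then have "f' dvd c' * g" by (subst (asm) dvd_mult_cancel_left) auto
  ultimately have "f' dvd c'" using Suc(1) nz by blast
  then show ?case unfolding f' c' by (rule mult_dvd_mono[OF dvd_refl])
qed

text \<open>The logarithmic derivative is the sum of the fractions \<open>e r / (X - r)\<close>.
  Over the common denominator it is in lowest terms: at a root \<open>x\<close> only one summand of
  the numerator survives, and it is nonzero in characteristic zero.\<close>

lemma log_derivative:
  fixes g :: "'a::{alg_closed_field, field_char_0} poly"
  assumes g: "g = Polynomial.smult C (\<Prod>r\<in>R. [:-r, 1:] ^ e r)" and R: "finite R" "\<And>r. r \<in> R \<Longrightarrow> e r > (0::nat)"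
  shows "(\<Prod>r\<in>R. [:-r, 1:]) * pderiv g = g * (\<Sum>r\<in>R. Polynomial.smult (of_nat (e r)) (\<Prod>s\<in>R - {r}. [:-s, 1:]))" (is "?D * _ = g * (\<Sum>r\<in>R. ?N r)")
    and "poly (\<Prod>r\<in>R. [:-r, 1:]) x = 0 \<Longrightarrow> poly (\<Sum>r\<in>R. Polynomial.smult (of_nat (e r)) (\<Prod>s\<in>R - {r}. [:-s, 1:])) x \<noteq> 0"
proof -
  let ?f = "\<lambda>r. [:-r, 1:] ^ e r"
  have "?D * (prod ?f (R - {r}) * pderiv (?f r)) = prod ?f R * ?N r" if r: "r \<in> R" for r
  proof -
    obtain n where n: "e r = Suc n" using R(2)[OF r] by (cases "e r") auto
    have 1: "?D = [:-r, 1:] * (\<Prod>s\<in>R - {r}. [:-s, 1:])" "prod ?f R = ?f r * prod ?f (R - {r})"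
      using R(1) r by (simp_all only: prod.remove)
    have 2: "pderiv (?f r) = Polynomial.smult (of_nat (e r)) ([:-r, 1:] ^ n)"
      unfolding n pderiv_power_Suc by (simp add: pderiv_pCons)
    show ?thesis unfolding 1 2 unfolding n by (simp only: mult_smult_left mult_smult_right power_Suc mult.assoc mult.left_commute mult.commute)
  qed
  then have "?D * (\<Sum>r\<in>R. prod ?f (R - {r}) * pderiv (?f r)) = prod ?f R * (\<Sum>r\<in>R. ?N r)"
    unfolding sum_distrib_left by (rule sum.cong[OF refl])
  then show "?D * pderiv g = g * (\<Sum>r\<in>R. ?N r)"
    unfolding g pderiv_smult pderiv_prod mult_smult_left mult_smult_right by (simp only:)
  assume "poly ?D x = 0"
  then have x: "x \<in> R" using R(1) by (auto simp: poly_prod)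
  have "poly (\<Sum>r\<in>R. ?N r) x = (\<Sum>r\<in>R. if r = x then of_nat (e x) * (\<Prod>s\<in>R - {x}. x - s) else 0)"
    unfolding poly_sum
  proof (rule sum.cong[OF refl])
    fix r assume r: "r \<in> R"
    show "poly (?N r) x = (if r = x then of_nat (e x) * (\<Prod>s\<in>R - {x}. x - s) else 0)"
    proof (cases "r = x")
      case False
      then have "(\<Prod>s\<in>R - {r}. x - s) = 0" using x R(1) by (intro prod_zero) auto
      then show ?thesis using False by (simp add: poly_prod)
    qed (simp add: poly_prod)
  qed
  also have "\<dots> = of_nat (e x) * (\<Prod>s\<in>R - {x}. x - s)" using R(1) x by simp
  also have "\<dots> \<noteq> 0" using R x by (auto simp: prod_zero_iff)
  finally show "poly (\<Sum>r\<in>R. ?N r) x \<noteq> 0" .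
qed

text \<open>
  If \<open>v = f1 / f2\<close> is in lowest terms, a polynomial in \<open>v\<close> whose coefficients have degree at most
  two in \<open>z\<close> can only vanish when \<open>f1\<close> divides its lowest coefficient.
\<close>

lemma quadratic_bound:
  fixes h :: "'a::{alg_closed_field, field_char_0} \<Rightarrow> 'w::field_char_0"
  assumes h: "comm_ring_hom h" and tr0: "\<forall>q. pev h z q = 0 \<longrightarrow> q = 0"
    and f: "\<forall>x. poly f1 x = 0 \<longrightarrow> poly f2 x \<noteq> 0" "f2 \<noteq> 0" and v: "v = pev h z f1 / pev h z f2"
    and a: "pev h v a0 + pev h v a1 * z + pev h v a2 * z\<^sup>2 = 0" "a0 \<noteq> 0 \<or> a1 \<noteq> 0 \<or> a2 \<noteq> 0"
  shows "Polynomial.degree f1 \<le> 2"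
proof -
  note tr = tr0[rule_format]
  interpret e: comm_ring_hom "pev h z" by (rule comm_ring_hom_pev[OF h])
  interpret h: comm_ring_hom h by (rule h)
  \<comment> \<open>The relation is reordered by powers of \<open>v\<close>; the coefficient of
    \<open>v ^ k\<close> is then a polynomial in \<open>z\<close> of degree at most two.\<close>
  define c where "c k = [: Polynomial.coeff a0 k, Polynomial.coeff a1 k, Polynomial.coeff a2 k :]" for k
  define m where "m = max (Polynomial.degree a0) (max (Polynomial.degree a1) (Polynomial.degree a2))"
  have f2: "pev h z f2 \<noteq> 0" using tr f(2) by auto
  have ex: "pev h v q = (\<Sum>k\<le>m. h (Polynomial.coeff q k) * v ^ k)" if "Polynomial.degree q \<le> m" for q
  proof -
    have "pev h v q = (\<Sum>k\<le>m. Polynomial.coeff (map_poly h q) k * v ^ k)"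
      unfolding pev_def poly_altdef
    proof (rule sum.mono_neutral_left)
      show "\<forall>i\<in>{..m} - {..Polynomial.degree (map_poly h q)}. Polynomial.coeff (map_poly h q) i * v ^ i = 0"
      proof
        fix i assume "i \<in> {..m} - {..Polynomial.degree (map_poly h q)}"
        then have "Polynomial.degree (map_poly h q) < i" by simp
        then have "Polynomial.coeff (map_poly h q) i = 0" by (rule coeff_eq_0)
        then show "Polynomial.coeff (map_poly h q) i * v ^ i = 0" by (simp only: mult_zero_left)
      qed
    qed (use that degree_map_poly_le[of h q] in auto)
    also have "\<dots> = (\<Sum>k\<le>m. h (Polynomial.coeff q k) * v ^ k)" by (simp add: coeff_map_poly)
    finally show ?thesis .
  qed
  have cz: "pev h z (c k) = h (Polynomial.coeff a0 k) + h (Polynomial.coeff a1 k) * z + h (Polynomial.coeff a2 k) * z\<^sup>2" for k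
    by (simp add: c_def pev_pCons[OF h] algebra_simps power2_eq_square)
  have "pev h z (\<Sum>k\<le>m. c k * f1 ^ k * f2 ^ (m - k)) = (\<Sum>k\<le>m. pev h z (c k) * v ^ k * pev h z f2 ^ m)"
    unfolding e.hom_sum
  proof (rule sum.cong[OF refl])
    fix k assume "k \<in> {..m}"
    then have "pev h z f2 ^ m = pev h z f2 ^ k * pev h z f2 ^ (m - k)" by (simp flip: power_add)
    then show "pev h z (c k * f1 ^ k * f2 ^ (m - k)) = pev h z (c k) * v ^ k * pev h z f2 ^ m"
      using f2 by (simp add: e.hom_mult e.hom_power v power_divide)
  qed
  also have "\<dots> = (\<Sum>k\<le>m. pev h z (c k) * v ^ k) * pev h z f2 ^ m" by (simp add: sum_distrib_right)
  also have "(\<Sum>k\<le>m. pev h z (c k) * v ^ k) = pev h v a0 + pev h v a1 * z + pev h v a2 * z\<^sup>2"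
    by (simp add: ex m_def cz sum.distrib sum_distrib_left algebra_simps)
  finally have z0: "(\<Sum>k\<le>m. c k * f1 ^ k * f2 ^ (m - k)) = 0" using a(1) tr by simp
  have "\<exists>k. c k \<noteq> 0"
  proof (rule ccontr)
    assume "\<not> ?thesis"
    then have "Polynomial.coeff a0 k = 0 \<and> Polynomial.coeff a1 k = 0 \<and> Polynomial.coeff a2 k = 0" for k by (simp add: c_def)
    then have "a0 = 0" "a1 = 0" "a2 = 0" by (simp_all add: poly_eq_iff)
    then show False using a(2) by simp
  qed
  define k where "k = (LEAST k. c k \<noteq> 0)"
  have k: "c k \<noteq> 0" unfolding k_def by (rule LeastI_ex) fact
  have lt: "c i = 0" if "i < k" for i using not_less_Least[of i "\<lambda>k. c k \<noteq> 0"] that unfolding k_def by simp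
  have km: "k \<le> m"
  proof (rule ccontr)
    assume "\<not> k \<le> m"
    then have "c k = 0" by (simp add: c_def m_def coeff_eq_0)
    then show False using k by simp
  qed
  show ?thesis
  proof (cases "f1 = 0")
    case False
    have "(\<Sum>i\<le>m. c i * f1 ^ i * f2 ^ (m - i)) = (\<Sum>i\<in>{k..m}. c i * f1 ^ i * f2 ^ (m - i))"
      by (rule sum.mono_neutral_right) (use lt in auto)
    also have "\<dots> = c k * f1 ^ k * f2 ^ (m - k) + (\<Sum>i\<in>{Suc k..m}. c i * f1 ^ i * f2 ^ (m - i))"
      using km by (rule sum.atLeast_Suc_atMost)
    finally have "c k * f1 ^ k * f2 ^ (m - k) = - (\<Sum>i\<in>{Suc k..m}. c i * f1 ^ i * f2 ^ (m - i))"
      using z0 by (simp add: add_eq_0_iff2)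
    \<comment> \<open>After clearing denominators, every term beyond the first nonzero one carries a
      further factor \<open>f1\<close>, so \<open>f1\<close> divides
      \<open>c k * f2 ^ (m - k)\<close>.\<close>
    moreover have "f1 ^ Suc k dvd (\<Sum>i\<in>{Suc k..m}. c i * f1 ^ i * f2 ^ (m - i))"
      by (intro dvd_sum dvd_mult2 dvd_mult le_imp_power_dvd) simp
    ultimately have "f1 ^ k * f1 dvd f1 ^ k * (c k * f2 ^ (m - k))" by (simp add: mult.commute mult.left_commute)
    then have "f1 dvd c k * f2 ^ (m - k)" using False by simp
    moreover have "\<forall>x. poly f1 x = 0 \<longrightarrow> poly (f2 ^ (m - k)) x \<noteq> 0" using f(1) by simp
    ultimately have "f1 dvd c k" using dvd_if_no_common_root[OF False] by blast
    then have "Polynomial.degree f1 \<le> Polynomial.degree (c k)" using k by (rule dvd_imp_degree_le)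
    also have "\<dots> \<le> 2" by (simp add: c_def)
    finally show ?thesis .
  qed simp
qed

text \<open>With the logarithmic derivative \<open>N / D\<close> of \<open>g\<close>,
  \<open>v\<close> is \<open>(p D - X N) / N\<close> in lowest terms. Its numerator has degree at
  least the number of roots of \<open>g\<close>, so the quadratic relation allows at most two
  roots.\<close>

lemma two_roots:
  fixes h :: "'a::{alg_closed_field, field_char_0} \<Rightarrow> 'w::field_char_0"
  assumes h: "comm_ring_hom h" and tr0: "\<forall>q. pev h z q = 0 \<longrightarrow> q = 0"
    and p: "p > 0" "\<not> p dvd Polynomial.degree g"
    and v: "v = of_nat p * pev h z g / pev h z (pderiv g) - z"
    and dep: "\<alpha> \<in> rat1 h v" "\<beta> \<in> rat1 h v" "\<gamma> \<in> rat1 h v" "\<alpha> \<noteq> 0 \<or> \<beta> \<noteq> 0 \<or> \<gamma> \<noteq> 0" "\<alpha> + \<beta> * z + \<gamma> * z\<^sup>2 = 0"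
    and z: "z \<notin> rat1 h v"
  shows "\<exists>C a b a1 a2. C \<noteq> 0 \<and> a > 0 \<and> b > 0 \<and> a1 \<noteq> a2 \<and> g = Polynomial.smult C ([:-a1, 1:] ^ a * [:-a2, 1:] ^ b)"
proof -
  note tr = tr0[rule_format]
  interpret e: comm_ring_hom "pev h z" by (rule comm_ring_hom_pev[OF h])
  interpret ev: comm_ring_hom "pev h v" by (rule comm_ring_hom_pev[OF h])
  interpret h: comm_ring_hom h by (rule h)
  define n where "n = Polynomial.degree g"
  have n0: "n > 0" using p(2) unfolding n_def by (intro Nat.gr0I) simp
  then have g0: "g \<noteq> 0" unfolding n_def by auto
  from root_factorization[OF g0] obtain R e where R: "finite R" "\<forall>r\<in>R. e r > (0::nat)"
    and g: "g = Polynomial.smult (Polynomial.lead_coeff g) (\<Prod>r\<in>R. [:-r, 1:] ^ e r)" and se: "(\<Sum>r\<in>R. e r) = n" unfolding n_def by (elim exE conjE)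
  define D where "D = (\<Prod>r\<in>R. [:-r, 1:])"
  define N where "N = (\<Sum>r\<in>R. Polynomial.smult (of_nat (e r)) (\<Prod>s\<in>R - {r}. [:-s, 1:]))"
  have DN: "D * pderiv g = g * N" unfolding D_def N_def by (rule log_derivative(1)[OF g R(1) R(2)[rule_format]])
  have cop: "poly N y \<noteq> 0" if "poly D y = 0" for y
    using log_derivative(2)[OF g R(1) R(2)[rule_format]] that unfolding D_def N_def by simp
  have D0: "D \<noteq> 0" unfolding D_def using R(1) by (simp add: prod_zero_iff)
  have degD: "Polynomial.degree D = card R" unfolding D_def by (simp add: degree_prod_sum_eq)
  have lcD: "Polynomial.lead_coeff D = 1" unfolding D_def lead_coeff_prod by simp
  have pg: "pderiv g \<noteq> 0" using n0 by (simp add: pderiv_eq_0_iff n_def)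
  then have N0: "N \<noteq> 0" using DN D0 by auto
  have "card R + (n - 1) = n + Polynomial.degree N"
    using arg_cong[OF DN, of Polynomial.degree] D0 pg g0 N0 by (simp add: degree_mult_eq degD degree_pderiv n_def)
  then have degN: "card R = Suc (Polynomial.degree N)" using n0 by simp
  have lcpg: "Polynomial.lead_coeff (pderiv g) = of_nat n * Polynomial.lead_coeff g"
    using n0 unfolding degree_pderiv coeff_pderiv n_def by simp
  have lcN: "Polynomial.lead_coeff N = of_nat n"
    using arg_cong[OF DN, of Polynomial.lead_coeff] g0 unfolding lead_coeff_mult lcpg lcD by simp
  define f1 where "f1 = Polynomial.smult (of_nat p) D - [:0, 1:] * N"
  have pgz: "pev h z (pderiv g) \<noteq> 0" and Nz: "pev h z N \<noteq> 0" and Dz: "pev h z D \<noteq> 0" using tr pg N0 D0 by auto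
  have "pev h z g / pev h z (pderiv g) = pev h z D / pev h z N"
    using arg_cong[OF DN, of "pev h z"] pgz Nz by (simp add: e.hom_mult frac_eq_eq mult.commute)
  then have "v = of_nat p * pev h z D / pev h z N - z" unfolding v by (metis times_divide_eq_right)
  then have vf: "v = pev h z f1 / pev h z N"
    using Nz by (simp add: f1_def e.hom_minus h.hom_of_nat h.hom_zero h.hom_one pev_smult[OF h] pev_pCons[OF h] diff_divide_distrib)
  have c1: "\<forall>y. poly f1 y = 0 \<longrightarrow> poly N y \<noteq> 0"
  proof (intro allI impI notI)
    fix y assume y: "poly f1 y = 0" "poly N y = 0"
    then have "poly D y = 0" using p(1) by (simp add: f1_def)
    then show False using cop y(2) by blast
  qed
  \<comment> \<open>Both \<open>p D\<close> and \<open>X N\<close> have degree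
    \<open>card R\<close>. Their leading terms do not cancel, because \<open>p\<close> does not
    divide \<open>n\<close> and hence differs from it.\<close>
  have "Polynomial.coeff f1 (card R) = of_nat p - of_nat n"
    using lcD lcN by (simp add: f1_def degD degN coeff_pCons)
  moreover have "(of_nat p :: 'a) \<noteq> of_nat n" using p(2) unfolding n_def of_nat_eq_iff by auto
  ultimately have "Polynomial.coeff f1 (card R) \<noteq> 0" by simp
  then have m_le: "card R \<le> Polynomial.degree f1" by (rule le_degree)
  from dep(1) obtain A0 B0 where 0: "pev h v B0 \<noteq> 0" "\<alpha> = pev h v A0 / pev h v B0" by (rule rat1E)
  from dep(2) obtain A1 B1 where 1: "pev h v B1 \<noteq> 0" "\<beta> = pev h v A1 / pev h v B1" by (rule rat1E)
  from dep(3) obtain A2 B2 where 2: "pev h v B2 \<noteq> 0" "\<gamma> = pev h v A2 / pev h v B2" by (rule rat1E)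
  have "pev h v (A0 * B1 * B2) + pev h v (A1 * B0 * B2) * z + pev h v (A2 * B0 * B1) * z\<^sup>2 = (\<alpha> + \<beta> * z + \<gamma> * z\<^sup>2) * (pev h v B0 * pev h v B1 * pev h v B2)"
    using 0(1) 1(1) 2(1) unfolding 0(2) 1(2) 2(2) ev.hom_mult by (simp add: field_simps)
  then have q: "pev h v (A0 * B1 * B2) + pev h v (A1 * B0 * B2) * z + pev h v (A2 * B0 * B1) * z\<^sup>2 = 0" unfolding dep(5) by simp
  have "B0 \<noteq> 0" "B1 \<noteq> 0" "B2 \<noteq> 0" using 0(1) 1(1) 2(1) by auto
  moreover have "A0 \<noteq> 0 \<or> A1 \<noteq> 0 \<or> A2 \<noteq> 0" using dep(4) 0(2) 1(2) 2(2) by auto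
  ultimately have "A0 * B1 * B2 \<noteq> 0 \<or> A1 * B0 * B2 \<noteq> 0 \<or> A2 * B0 * B1 \<noteq> 0" by simp
  from quadratic_bound[OF h tr0 c1 N0 vf q this] m_le have le2: "card R \<le> 2" by simp
  have "card R \<noteq> 0" using R(1) se n0 by auto
  \<comment> \<open>With a single root \<open>v\<close> is an affine function of \<open>z\<close>
    with nonzero slope, so that \<open>z\<close> would already lie in \<open>K(v)\<close>.\<close>
  moreover have "card R \<noteq> 1"
  proof
    assume "card R = 1"
    then obtain r where r: "R = {r}" by (rule card_1_singletonE)
    have er: "e r = n" using se unfolding r by simp
    have "N = [:of_nat n:]" "D = [:-r, 1:]" unfolding N_def D_def r by (simp_all add: er)
    then have "v = (of_nat p * (z - h r) - z * of_nat n) / of_nat n"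
      unfolding vf f1_def by (simp add: e.hom_minus pev_smult[OF h] pev_pCons[OF h] h.hom_of_nat h.hom_uminus h.hom_one h.hom_zero h.hom_mult h.hom_minus algebra_simps)
    then have "z * (of_nat p - of_nat n) = of_nat n * v + of_nat p * h r" using n0 by (simp add: field_simps)
    moreover have pn: "(of_nat p :: 'w) - of_nat n \<noteq> 0" using p(2) unfolding n_def right_minus_eq of_nat_eq_iff by auto
    ultimately have "z = (of_nat n * v + of_nat p * h r) / (of_nat p - of_nat n)" by (simp add: nonzero_eq_divide_eq)
    also have "\<dots> \<in> rat1 h v" by (intro subfield_RT_closed[OF subfield_rat1[OF h]] rat1_basic[OF h])
    finally show False using z by simp
  qed
  ultimately have "card R = 2" using le2 by linarith
  then obtain r s where rs: "R = {r, s}" "r \<noteq> s" unfolding card_2_iff by (elim exE conjE)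
  have "g = Polynomial.smult (Polynomial.lead_coeff g) ([:-r, 1:] ^ e r * [:-s, 1:] ^ e s)"
    by (subst g) (simp add: rs)
  then show ?thesis using R(2) rs g0
    by (intro exI[of _ "Polynomial.lead_coeff g"] exI[of _ "e r"] exI[of _ "e s"] exI[of _ r] exI[of _ s]) simp
qed

section \<open>The quadratic conjugation\<close>

lemma prime_dvd_order:
  assumes "Factorial_Ring.prime (p::nat)" "\<not> p dvd a" "a * m + p * i = p * j" shows "p dvd m"
proof -
  have "p dvd a * m + p * i" unfolding assms(3) by simp
  then have "p dvd a * m" unfolding dvd_add_left_iff[OF dvd_triv_left] .
  then show ?thesis using prime_dvd_multD[OF assms(1)] assms(2) by blast
qed

text \<open>
  The exponents of \<open>q\<close> and of its conjugate are read off from the order at infinity and from the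
  order at the pole \<open>- a / (a + b)\<close> of \<open>z2\<close>.
\<close>

lemma conjugate_independent:
  fixes h :: "'a::field_char_0 \<Rightarrow> 'w::field_char_0"
  assumes h: "comm_ring_hom h" and tr0: "\<forall>q. pev h z q = 0 \<longrightarrow> q = 0"
    and p: "Factorial_Ring.prime (p::nat)" "\<not> p dvd a + b" "a > 0" "b > 0"
    and c: "(c :: 'w) = of_nat p - of_nat a - of_nat b"
    and z2: "z2 = - (of_nat a / c) * (c * z + of_nat p - of_nat a) / ((of_nat p - c) * z + of_nat a)"
    and s: "s \<in> rat1 h z" and eq: "(z ^ a * (1 + z) ^ b) ^ m * (z2 ^ a * (1 + z2) ^ b) ^ n = s ^ p"
  shows "p dvd m \<and> p dvd n"
proof -
  note tr = tr0[rule_format]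
  interpret e: comm_ring_hom "pev h z" by (rule comm_ring_hom_pev[OF h])
  interpret h: comm_ring_hom h by (rule h)
  define A :: 'a where "A = of_nat a"
  define B :: 'a where "B = of_nat b"
  define P :: 'a where "P = of_nat p"
  define k where "k = P - A - B"
  have "p \<noteq> a + b" using p(2) by auto
  then have "(of_nat p :: 'a) \<noteq> of_nat (a + b)" unfolding of_nat_eq_iff .
  then have k0: "k \<noteq> 0" by (simp add: k_def P_def A_def B_def algebra_simps)
  have A0: "A \<noteq> 0" and B0: "B \<noteq> 0" and P0: "P \<noteq> 0" using p prime_gt_0_nat[OF p(1)] by (simp_all add: A_def B_def P_def)
  have AB: "A + B \<noteq> 0" using p(3) by (simp add: A_def B_def of_nat_add[symmetric] del: of_nat_add)
  have hk: "h k = c" by (simp add: k_def c P_def A_def B_def h.hom_minus h.hom_of_nat)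
  define N1 where "N1 = [: - A * (P - A), - A * k :]"
  define N2 where "N2 = [: - B * A, B * k :]"
  define E where "E = [: k * A, k * (A + B) :]"
  have h0: "h 1 = 1" "h 0 = 0" by (simp_all add: h.hom_one h.hom_zero)
  have nz: "N1 \<noteq> 0" "N2 \<noteq> 0" "E \<noteq> 0" by (simp_all add: N1_def N2_def E_def A0 B0 k0 AB)
  have Enz: "pev h z E \<noteq> 0" using tr nz by auto
  have pE: "pev h z E = c * ((of_nat p - c) * z + of_nat a)"
    by (simp add: E_def pev_pCons[OF h] h.hom_mult h.hom_add hk) (simp add: A_def B_def c h.hom_of_nat algebra_simps)
  have pN1: "pev h z N1 = - of_nat a * (c * z + of_nat p - of_nat a)"
    by (simp add: N1_def pev_pCons[OF h] h.hom_mult h.hom_minus h.hom_uminus hk) (simp add: A_def P_def h.hom_of_nat algebra_simps)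
  have c0: "c \<noteq> 0" and d0: "(of_nat p - c) * z + of_nat a \<noteq> 0" using Enz unfolding pE by auto
  have "- (x / y) * u / w = - x * u / (y * w)" for x y u w :: 'w by simp
  then have z2E: "z2 = pev h z N1 / pev h z E" unfolding z2 pE pN1 .
  have "E + N1 = N2" by (simp add: E_def N1_def N2_def k_def algebra_simps)
  then have z2E': "1 + z2 = pev h z N2 / pev h z E" unfolding z2E using Enz by (simp add: e.hom_add[symmetric] field_simps) 
  from s obtain S T where T: "pev h z T \<noteq> 0" and S: "s = pev h z S / pev h z T" by (rule rat1E)
  \<comment> \<open>The two sides of \<open>eq\<close> multiplied by
    \<open>E ^ ((a + b) * n)\<close> and by the \<open>p\<close>-th power of the denominator of
    \<open>s\<close>, which turns them into polynomials.\<close>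
  define l where "l = ([:0,1:] ^ a * [:1,1:] ^ b) ^ m * (N1 ^ a * N2 ^ b) ^ n * T ^ p"
  define r where "r = S ^ p * (E ^ (a + b)) ^ n"
  have "pev h z l = (z ^ a * (1 + z) ^ b) ^ m * (pev h z N1 ^ a * pev h z N2 ^ b) ^ n * pev h z T ^ p"
    by (simp add: l_def e.hom_mult e.hom_power pev_pCons[OF h] h0)
  also have "pev h z N1 ^ a * pev h z N2 ^ b = (z2 ^ a * (1 + z2) ^ b) * pev h z E ^ (a + b)"
    unfolding z2E' unfolding z2E using Enz by (simp add: power_divide power_add)
  finally have "pev h z l = (z ^ a * (1 + z) ^ b) ^ m * (z2 ^ a * (1 + z2) ^ b) ^ n * (pev h z E ^ (a + b)) ^ n * pev h z T ^ p"
    by (simp add: power_mult_distrib mult.assoc)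
  also have "\<dots> = pev h z r" unfolding eq r_def using T by (simp add: S e.hom_mult e.hom_power power_divide)
  finally have "pev h z (l - r) = 0" by (simp add: e.hom_minus)
  then have lr: "l = r" using tr by fastforce
  have Tnz: "T \<noteq> 0" using T by auto
  have l0: "l \<noteq> 0" using nz Tnz by (simp add: l_def)
  have Snz: "S \<noteq> 0" using l0 prime_gt_0_nat[OF p(1)] unfolding lr r_def by (intro notI) simp
  have dN: "Polynomial.degree N1 = 1" "Polynomial.degree N2 = 1" "Polynomial.degree E = 1" by (simp_all add: N1_def N2_def E_def A0 B0 k0 AB)
  \<comment> \<open>Since \<open>N1\<close>, \<open>N2\<close> and \<open>E\<close> all have degree
    one, \<open>n\<close> contributes equally to both sides, and the comparison of degrees sees only
    \<open>m\<close>.\<close>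
  have "Polynomial.degree l = (a + b) * m + (a + b) * n + p * Polynomial.degree T"
    using nz Tnz by (simp add: l_def degree_mult_eq degree_power_eq dN algebra_simps)
  moreover have "Polynomial.degree r = p * Polynomial.degree S + (a + b) * n"
    using nz Snz by (simp add: r_def degree_mult_eq degree_power_eq dN algebra_simps)
  ultimately have "(a + b) * m + p * Polynomial.degree T = p * Polynomial.degree S" using lr by simp
  from prime_dvd_order[OF p(1,2) this] have m: "p dvd m" .
  define \<rho> where "\<rho> = - A / (A + B)"
  have op: "order \<rho> (q ^ i) = i * order \<rho> q" if "q \<noteq> 0" for q i
    by (induction i) (simp_all add: order_mult that order_0I)
  \<comment> \<open>As \<open>E + N1 = N2\<close> and \<open>E\<close> vanishes at
    \<open>\<rho>\<close>, the two values must agree; the point is that the common value is nonzero,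
    so only \<open>E\<close> contributes to the order besides \<open>S\<close> and
    \<open>T\<close>.\<close>
  have "poly N1 \<rho> = - A * (P * B) / (A + B)" "poly N2 \<rho> = - A * (P * B) / (A + B)"
    using AB by (simp_all add: N1_def N2_def \<rho>_def k_def field_simps)
  then have "order \<rho> N1 = 0" "order \<rho> N2 = 0" using A0 B0 P0 AB by (simp_all add: order_0I)
  moreover have "order \<rho> [:0,1:] = 0" "order \<rho> [:1,1:] = 0" using A0 B0 AB by (simp_all add: order_0I \<rho>_def field_simps)
  ultimately have "order \<rho> l = p * order \<rho> T" using nz Tnz l0 by (simp add: l_def order_mult op)
  moreover have "E = Polynomial.smult (k * (A + B)) ([:- \<rho>, 1:] ^ 1)" using AB by (simp add: E_def \<rho>_def)
  then have "order \<rho> E = 1" using order_smult[of "k * (A + B)" \<rho> "[:- \<rho>, 1:] ^ 1"] order_power_n_n[of \<rho> 1] k0 AB by simp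
  then have "order \<rho> r = p * order \<rho> S + (a + b) * n" using nz Snz l0 unfolding lr by (simp add: r_def order_mult op algebra_simps)
  ultimately have "(a + b) * n + p * order \<rho> S = p * order \<rho> T" using lr by simp
  from prime_dvd_order[OF p(1,2) this] m show ?thesis by simp
qed

text \<open>For \<open>z\<close> quadratic over \<open>k\<close> with conjugate \<open>z2\<close>,
  this is the graph of the nontrivial automorphism of \<open>k(z)\<close>. As a relation it needs no
  choice of how an element is written.\<close>

definition conj_pairs :: "'w::field set \<Rightarrow> 'w \<Rightarrow> 'w \<Rightarrow> ('w \<times> 'w) set" where
  "conj_pairs k z z2 = {(\<alpha> + \<beta> * z, \<alpha> + \<beta> * z2) | \<alpha> \<beta>. \<alpha> \<in> k \<and> \<beta> \<in> k}"

lemma conj_pairsI: "\<alpha> \<in> k \<Longrightarrow> \<beta> \<in> k \<Longrightarrow> x = \<alpha> + \<beta> * z \<Longrightarrow> y = \<alpha> + \<beta> * z2 \<Longrightarrow> (x, y) \<in> conj_pairs k z z2"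
  unfolding conj_pairs_def by blast

lemma conj_pairsE:
  assumes "(x, y) \<in> conj_pairs k z z2" obtains \<alpha> \<beta> where "\<alpha> \<in> k" "\<beta> \<in> k" "x = \<alpha> + \<beta> * z" "y = \<alpha> + \<beta> * z2"
  using assms unfolding conj_pairs_def by blast

lemma conj_pairs_closed:
  fixes k :: "'w::field set"
  assumes k: "subfield k RT" and z: "z + z2 \<in> k" "z * z2 \<in> k"
  shows "c \<in> k \<Longrightarrow> (c, c) \<in> conj_pairs k z z2" "(z, z2) \<in> conj_pairs k z z2"
    "(x, y) \<in> conj_pairs k z z2 \<Longrightarrow> (x', y') \<in> conj_pairs k z z2 \<Longrightarrow> (x + x', y + y') \<in> conj_pairs k z z2"
    "(x, y) \<in> conj_pairs k z z2 \<Longrightarrow> (x', y') \<in> conj_pairs k z z2 \<Longrightarrow> (x * x', y * y') \<in> conj_pairs k z z2"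
    "(x, y) \<in> conj_pairs k z z2 \<Longrightarrow> (x ^ n, y ^ n) \<in> conj_pairs k z z2"
proof -
  note c = subfield_RT_closed[OF k]
  show const: "c \<in> k \<Longrightarrow> (c, c) \<in> conj_pairs k z z2" for c by (rule conj_pairsI[of c _ 0]) (simp_all add: c)
  show "(z, z2) \<in> conj_pairs k z z2" by (rule conj_pairsI[of 0 _ 1]) (simp_all add: c)
  show "(x + x', y + y') \<in> conj_pairs k z z2" if 1: "(x, y) \<in> conj_pairs k z z2" and 2: "(x', y') \<in> conj_pairs k z z2"
  proof -
    from 1 obtain \<alpha> \<beta> where 1: "\<alpha> \<in> k" "\<beta> \<in> k" "x = \<alpha> + \<beta> * z" "y = \<alpha> + \<beta> * z2" by (rule conj_pairsE)
    from 2 obtain \<alpha>' \<beta>' where 2: "\<alpha>' \<in> k" "\<beta>' \<in> k" "x' = \<alpha>' + \<beta>' * z" "y' = \<alpha>' + \<beta>' * z2" by (rule conj_pairsE)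
    show ?thesis by (rule conj_pairsI[of "\<alpha> + \<alpha>'" _ "\<beta> + \<beta>'"]) (simp_all add: 1 2 c algebra_simps)
  qed
  show mult: "(x * x', y * y') \<in> conj_pairs k z z2" if 1: "(x, y) \<in> conj_pairs k z z2" and 2: "(x', y') \<in> conj_pairs k z z2" for x y x' y'
  proof -
    from 1 obtain \<alpha> \<beta> where 1: "\<alpha> \<in> k" "\<beta> \<in> k" "x = \<alpha> + \<beta> * z" "y = \<alpha> + \<beta> * z2" by (rule conj_pairsE)
    from 2 obtain \<alpha>' \<beta>' where 2: "\<alpha>' \<in> k" "\<beta>' \<in> k" "x' = \<alpha>' + \<beta>' * z" "y' = \<alpha>' + \<beta>' * z2" by (rule conj_pairsE)
    have sq: "z * z = (z + z2) * z - z * z2" "z2 * z2 = (z + z2) * z2 - z * z2" by (simp_all add: algebra_simps)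
    show ?thesis
    proof (rule conj_pairsI[of "\<alpha> * \<alpha>' - \<beta> * \<beta>' * (z * z2)" _ "\<alpha> * \<beta>' + \<beta> * \<alpha>' + \<beta> * \<beta>' * (z + z2)"])
      have "x * x' = \<alpha> * \<alpha>' + (\<alpha> * \<beta>' + \<beta> * \<alpha>') * z + \<beta> * \<beta>' * (z * z)" unfolding 1 2 by (simp add: algebra_simps)
      then show "x * x' = \<alpha> * \<alpha>' - \<beta> * \<beta>' * (z * z2) + (\<alpha> * \<beta>' + \<beta> * \<alpha>' + \<beta> * \<beta>' * (z + z2)) * z"
        unfolding sq by (simp add: algebra_simps)
      have "y * y' = \<alpha> * \<alpha>' + (\<alpha> * \<beta>' + \<beta> * \<alpha>') * z2 + \<beta> * \<beta>' * (z2 * z2)" unfolding 1 2 by (simp add: algebra_simps)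
      then show "y * y' = \<alpha> * \<alpha>' - \<beta> * \<beta>' * (z * z2) + (\<alpha> * \<beta>' + \<beta> * \<alpha>' + \<beta> * \<beta>' * (z + z2)) * z2"
        unfolding sq by (simp add: algebra_simps)
    qed (intro c 1 2 z)+
  qed
  show "(x ^ n, y ^ n) \<in> conj_pairs k z z2" if "(x, y) \<in> conj_pairs k z z2"
    by (induction n) (simp_all add: const c mult that)
qed

text \<open>
  Here \<open>E = k(x, z)\<close> with \<open>z\<close> quadratic over \<open>k\<close>, and \<open>x ^ p = q\<close> lies in \<open>k(z)\<close>; \<open>z2\<close> and \<open>q2\<close> are
  the conjugates of \<open>z\<close> and \<open>q\<close> over \<open>k\<close>.  The last condition says that \<open>q\<close> and \<open>q2\<close> are independent
  modulo \<open>p\<close>-th powers of \<open>k(z)\<close>.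
\<close>

definition galois_datum :: "nat \<Rightarrow> 'w::field set \<Rightarrow> 'w set \<Rightarrow> 'w \<Rightarrow> 'w \<Rightarrow> 'w \<Rightarrow> 'w \<Rightarrow> 'w \<Rightarrow> bool" where
  "galois_datum p k E z z2 x q q2 \<longleftrightarrow> z \<notin> k \<and> z + z2 \<in> k \<and> z * z2 \<in> k \<and> x \<in> E \<and> z \<in> E \<and> x ^ p = q \<and> q \<noteq> 0 \<and>
     (q, q2) \<in> conj_pairs k z z2 \<and> (\<forall>S. subfield S RT \<longrightarrow> k \<subseteq> S \<longrightarrow> z \<in> S \<longrightarrow> x \<in> S \<longrightarrow> E \<subseteq> S) \<and>
     (\<forall>m n s s2. (s, s2) \<in> conj_pairs k z z2 \<longrightarrow> q ^ m * q2 ^ n = s ^ p \<longrightarrow> p dvd m \<and> p dvd n)"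

text \<open>
  \<open>g\<close> has exactly two roots, which an affine change of \<open>z\<close> moves to \<open>0\<close> and \<open>-1\<close>.  The \<open>p\<close>-th power
  of \<open>u\<close> lies in \<open>k(z)\<close> but not in \<open>k\<close>, since otherwise \<open>q2 / q\<close> would be a \<open>p\<close>-th power; hence \<open>z\<close>
  and \<open>x\<close> are in \<open>k(u)\<close>.
\<close>

theorem galois_datum_exists:
  fixes h :: "'a::{alg_closed_field, field_char_0} \<Rightarrow> 'w::field_char_0"
  assumes h: "comm_ring_hom h" and tr0: "\<forall>q. pev h z q = 0 \<longrightarrow> q = 0"
    and p: "Factorial_Ring.prime p" "\<not> p dvd Polynomial.degree g" and x: "x ^ p = pev h z g"
    and v: "v = of_nat p * pev h z g / pev h z (pderiv g) - z" and u: "u = - (v + z) / x"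
    and dep: "\<alpha> \<in> rat1 h v" "\<beta> \<in> rat1 h v" "\<gamma> \<in> rat1 h v" "\<alpha> \<noteq> 0 \<or> \<beta> \<noteq> 0 \<or> \<gamma> \<noteq> 0" "\<alpha> + \<beta> * z + \<gamma> * z\<^sup>2 = 0"
    and z: "z \<notin> rat1 h v"
    and E: "subfield E RT" "rat1 h v \<subseteq> E" "u \<in> E" "\<And>S. subfield S RT \<Longrightarrow> rat1 h v \<subseteq> S \<Longrightarrow> u \<in> S \<Longrightarrow> E \<subseteq> S"
  shows "\<exists>z z2 x q q2. galois_datum p (rat1 h v) E z z2 x q q2"
proof -
  note tr = tr0[rule_format]
  interpret h: comm_ring_hom h by (rule h)
  interpret e: comm_ring_hom "pev h z" by (rule comm_ring_hom_pev[OF h])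
  have p0: "p > 0" by (rule prime_gt_0_nat[OF p(1)])
  let ?k = "rat1 h v"
  note k = subfield_rat1[OF h, of v]
  note kc = subfield_RT_closed[OF k] and Ec = subfield_RT_closed[OF E(1)]
  from two_roots[OF h tr0 p0 p(2) v dep z] obtain C a b a1 a2 where C: "C \<noteq> 0" and ab: "a > 0" "b > 0" and "a1 \<noteq> a2"
    and g: "g = Polynomial.smult C ([:-a1, 1:] ^ a * [:-a2, 1:] ^ b)" by (elim exE conjE)
  have deg: "Polynomial.degree g = a + b" unfolding g using C by (simp add: degree_mult_eq degree_power_eq)
  define \<delta> where "\<delta> = a1 - a2"
  have \<delta>: "\<delta> \<noteq> 0" using \<open>a1 \<noteq> a2\<close> by (simp add: \<delta>_def)
  have hnz: "h y \<noteq> 0" if "y \<noteq> 0" for y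
  proof
    assume "h y = 0"
    then have "pev h z [:y:] = 0" by (simp add: pev_pCons[OF h])
    then show False using tr[of "[:y:]"] that by simp
  qed
  have h\<delta>: "h \<delta> \<noteq> 0" by (rule hnz[OF \<delta>])
  define z' where "z' = (z - h a1) / h \<delta>"
  have zz': "z = h a1 + h \<delta> * z'" using h\<delta> by (simp add: z'_def)
  define Q where "Q = z' ^ a * (1 + z') ^ b"
  have gz: "pev h z g = h (C * \<delta> ^ (a + b)) * Q"
  proof -
    have "z - h a1 = h \<delta> * z'" "z - h a2 = h \<delta> * (1 + z')"
      unfolding zz' by (simp_all add: \<delta>_def h.hom_minus algebra_simps)
    moreover have "pev h z g = h C * ((z - h a1) ^ a * (z - h a2) ^ b)"
      by (simp add: g pev_smult[OF h] e.hom_mult e.hom_power pev_pCons[OF h] h.hom_one h.hom_uminus)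
    ultimately show ?thesis by (simp add: Q_def h.hom_mult h.hom_power power_mult_distrib power_add mult_ac)
  qed
  have tr': "q = 0" if "pev h z' q = 0" for q
  proof -
    define l where "l = [:- a1 / \<delta>, 1 / \<delta>:]"
    have lz: "pev h z l = z'"
    proof -
      have "h \<delta> * h (1 / \<delta>) = 1" "h \<delta> * h (- a1 / \<delta>) = - h a1"
        unfolding h.hom_mult[symmetric] using \<delta> by (simp_all add: h.hom_one h.hom_uminus)
      moreover have "h \<delta> * pev h z l = h \<delta> * h (- a1 / \<delta>) + h \<delta> * h (1 / \<delta>) * z"
        by (simp only: l_def pev_pCons[OF h] pev_0) (simp add: algebra_simps)
      ultimately have "h \<delta> * pev h z l = z - h a1" by simp
      then show ?thesis unfolding z'_def using h\<delta> by (simp add: field_simps)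
    qed
    have "pev h z (pcompose q l) = pev h z' q"
    proof (induction q)
      case (pCons c q)
      then show ?case by (simp add: pcompose_pCons e.hom_add e.hom_mult pev_pCons[OF h] lz)
    qed (simp add: pcompose_0)
    then have "pcompose q l = 0" using that tr by simp
    then show ?thesis by (rule pcompose_eq_0) (use \<delta> in \<open>simp add: l_def\<close>)
  qed
  have tr0': "\<forall>q. pev h z' q = 0 \<longrightarrow> q = 0" using tr' by blast
  have z'k: "z' \<notin> ?k"
  proof
    assume "z' \<in> ?k"
    then have "z \<in> ?k" unfolding zz' by (intro kc rat1_basic[OF h])
    then show False using z by simp
  qed
  have ofk: "of_nat n \<in> ?k" for n by (rule kc)
  \<comment> \<open>A nontrivial linear equation for \<open>z'\<close> over \<open>?k\<close> is
    impossible, so any conclusion would follow; this one can be played against \<open>z'\<close>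
    being nonzero.\<close>
  have lin0: "z' = 0" if "y * z' = w" "y \<noteq> 0" "y \<in> ?k" "w \<in> ?k" for y w
  proof -
    have "z' = w / y" using that by (simp add: field_simps)
    then have "z' \<in> ?k" using kc(8)[of w y] that by simp
    then show ?thesis using z'k by simp
  qed
  define A :: 'w where "A = of_nat a"
  define B :: 'w where "B = of_nat b"
  define P :: 'w where "P = of_nat p"
  define c where "c = P - A - B"
  \<comment> \<open>The affine change that takes \<open>z\<close> to \<open>z'\<close>, applied to
    \<open>- v\<close>.\<close>
  define t where "t = (- v - h a1) / h \<delta>"
  have A0: "A \<noteq> 0" and P0: "P \<noteq> 0" and AB: "A + B \<noteq> 0" using ab p0 by (simp_all add: A_def B_def P_def of_nat_add[symmetric] del: of_nat_add)
  have "p \<noteq> a + b" using p(2) unfolding deg by auto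
  then have "(of_nat p :: 'w) \<noteq> of_nat (a + b)" unfolding of_nat_eq_iff .
  then have c0: "c \<noteq> 0" by (simp add: c_def P_def A_def B_def algebra_simps)
  have kABP: "A \<in> ?k" "B \<in> ?k" "P \<in> ?k" unfolding A_def B_def P_def by (rule ofk)+
  then have ck: "c \<in> ?k" unfolding c_def by (intro kc)
  have tk: "t \<in> ?k" unfolding t_def by (intro kc rat1_basic[OF h])
  have z'0: "z' \<noteq> 0" and z'1: "1 + z' \<noteq> 0"
  proof -
    show "z' \<noteq> 0" using z'k kc(1) by auto
    show "1 + z' \<noteq> 0" using lin0[of 1 "-1"] \<open>z' \<noteq> 0\<close> kc by (auto simp: add_eq_0_iff)
  qed
  have d0: "(A + B) * z' + A \<noteq> 0"
  proof
    assume "(A + B) * z' + A = 0"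
    then have "(A + B) * z' = - A" by (simp only: eq_neg_iff_add_eq_0)
    then show False using lin0[of "A + B" "- A"] AB kABP kc z'0 by auto
  qed
  have Q0: "Q \<noteq> 0" using z'0 z'1 by (simp add: Q_def)
  have gnz: "pev h z g \<noteq> 0" unfolding gz using C \<delta> Q0 hnz by simp
  have t_eq: "t = z' - P * z' * (1 + z') / ((A + B) * z' + A)"
  proof -
    have "([:-a1, 1:] * [:-a2, 1:]) * pderiv g = g * (Polynomial.smult (of_nat a) [:-a2, 1:] + Polynomial.smult (of_nat b) [:-a1, 1:])"
    proof -
      obtain a' b' where a': "a = Suc a'" "b = Suc b'" using ab by (cases a; cases b) auto
      have "S * T * (Polynomial.smult C (S ^ Suc a' * Polynomial.smult (of_nat b) (T ^ b') + T ^ Suc b' * Polynomial.smult (of_nat a) (S ^ a')))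
        = Polynomial.smult C (S ^ Suc a' * T ^ Suc b') * (Polynomial.smult (of_nat a) T + Polynomial.smult (of_nat b) S)" for S T
        by (simp add: algebra_simps smult_add_right)
      moreover have "pderiv ([:-y, 1:] ^ Suc n) = Polynomial.smult (of_nat (Suc n)) ([:-y, 1:] ^ n)" for y :: 'a and n
        unfolding pderiv_power_Suc by (simp add: pderiv_pCons)
      ultimately show ?thesis unfolding g pderiv_smult pderiv_mult a' by (simp only:)
    qed
    from arg_cong[OF this, of "pev h z"]
    have "(z - h a1) * (z - h a2) * pev h z (pderiv g) = pev h z g * (A * (z - h a2) + B * (z - h a1))"
      by (simp only: e.hom_mult e.hom_add pev_smult[OF h] pev_pCons[OF h]) (simp add: h.hom_one h.hom_uminus h.hom_of_nat A_def B_def)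
    moreover have zs: "z - h a1 = h \<delta> * z'" "z - h a2 = h \<delta> * (1 + z')"
      unfolding zz' by (simp_all add: \<delta>_def h.hom_minus algebra_simps)
    ultimately have "h \<delta> * (h \<delta> * (z' * (1 + z') * pev h z (pderiv g))) = h \<delta> * (pev h z g * ((A + B) * z' + A))"
      by (simp add: algebra_simps)
    then have 1: "h \<delta> * (z' * (1 + z') * pev h z (pderiv g)) = pev h z g * ((A + B) * z' + A)" using h\<delta> by simp
    have pg0: "pev h z (pderiv g) \<noteq> 0"
    proof
      assume "pev h z (pderiv g) = 0"
      then show False using 1 gnz d0 by simp
    qed
    have 2: "pev h z g / pev h z (pderiv g) = h \<delta> * (z' * (1 + z') / ((A + B) * z' + A))"
      using 1 pg0 d0 by (simp add: field_simps)
    have "h \<delta> * t = - v - h a1" using h\<delta> by (simp add: t_def)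
    also have "v = P * (pev h z g / pev h z (pderiv g)) - z" unfolding v P_def by simp
    also have "- (P * (pev h z g / pev h z (pderiv g)) - z) - h a1 = h \<delta> * (z' - P * z' * (1 + z') / ((A + B) * z' + A))"
      unfolding 2 using zs(1) by (simp add: algebra_simps)
    finally show ?thesis using h\<delta> by simp
  qed
  have td: "t * ((A + B) * z' + A) = z' * ((A + B) * z' + A) - P * z' * (1 + z')"
    unfolding t_eq left_diff_distrib using d0 by simp
  \<comment> \<open>The other root of \<open>c T^2 + (P - A + t (A + B)) T + t A\<close>, the
    equation of \<open>z'\<close> over \<open>?k\<close>. Its product with \<open>z'\<close> is
    \<open>t A / c\<close>; eliminating \<open>t\<close> gives this expression in \<open>z'\<close>
    alone.\<close>
  define z2 where "z2 = - (A / c) * (c * z' + P - A) / ((P - c) * z' + A)"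
  have Pc: "P - c = A + B" by (simp add: c_def)
  have z2d: "c * ((A + B) * z' + A) * z2 = - A * (c * z' + P - A)"
  proof -
    have "c * y * (- (A / c) * w / y) = - A * w" if "y \<noteq> 0" for w y using c0 that by simp
    from this[OF d0] show ?thesis unfolding z2_def Pc .
  qed
  have prod: "z' * z2 = t * A / c"
  proof -
    have "(c * ((A + B) * z' + A)) * (z' * z2) = z' * (c * ((A + B) * z' + A) * z2)" by (simp add: mult_ac)
    also have "\<dots> = A * (t * ((A + B) * z' + A))" unfolding z2d td unfolding c_def by (simp add: algebra_simps)
    finally have "((A + B) * z' + A) * (c * (z' * z2)) = ((A + B) * z' + A) * (t * A)" by (simp add: mult_ac)
    then have "c * (z' * z2) = t * A" using d0 by (simp only: mult_cancel_left) simp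
    then show ?thesis using c0 by (simp add: field_simps)
  qed
  have sum: "z' + z2 = - (P - A + t * (A + B)) / c"
  proof -
    have "((A + B) * z' + A) * (c * (z' + z2)) = c * z' * ((A + B) * z' + A) + c * ((A + B) * z' + A) * z2" by (simp add: algebra_simps)
    also have "\<dots> = - (P - A) * ((A + B) * z' + A) - (A + B) * (t * ((A + B) * z' + A))"
      unfolding z2d td unfolding c_def by (simp add: algebra_simps)
    also have "\<dots> = ((A + B) * z' + A) * (- (P - A + t * (A + B)))" by (simp add: algebra_simps)
    finally have "c * (z' + z2) = - (P - A + t * (A + B))" using d0 by (simp only: mult_cancel_left) simp
    then show ?thesis using c0 by (simp add: nonzero_eq_divide_eq mult.commute)
  qed
  have zk: "z' + z2 \<in> ?k" "z' * z2 \<in> ?k" unfolding prod sum by (intro kc tk kABP ck)+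
  note cp = conj_pairs_closed[OF k zk]
  define Q2 where "Q2 = z2 ^ a * (1 + z2) ^ b"
  have QQ: "(Q, Q2) \<in> conj_pairs ?k z' z2" unfolding Q_def Q2_def by (intro cp kc)
  have vz': "?k \<subseteq> rat1 h z'"
  proof (rule rat1_subset[OF h subfield_rat1[OF h]])
    note zc = subfield_RT_closed[OF subfield_rat1[OF h, of z']]
    have "t \<in> rat1 h z'" unfolding t_eq A_def B_def P_def by (intro zc rat1_basic[OF h])
    moreover have "v = - (h \<delta> * t) - h a1" using h\<delta> by (simp add: t_def)
    ultimately show "v \<in> rat1 h z'" by (simp add: zc rat1_basic[OF h])
    show "range h \<subseteq> rat1 h z'" using rat1_basic[OF h] by blast
  qed
  have indep: "p dvd m \<and> p dvd n" if "s \<in> rat1 h z'" "Q ^ m * Q2 ^ n = s ^ p" for m n s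
    by (rule conjugate_independent[OF h tr0' p(1) p(2)[unfolded deg] ab c_def[unfolded A_def B_def P_def] z2_def[unfolded A_def B_def P_def] that(1) that(2)[unfolded Q_def Q2_def]])
  have pairs: "s \<in> rat1 h z'" if "(s, s2) \<in> conj_pairs ?k z' z2" for s s2
  proof -
    from that obtain \<alpha> \<beta> where "\<alpha> \<in> ?k" "\<beta> \<in> ?k" "s = \<alpha> + \<beta> * z'" by (rule conj_pairsE)
    then show ?thesis using vz' rat1_basic[OF h] by (auto intro!: subfield_RT_closed[OF subfield_rat1[OF h]])
  qed
  \<comment> \<open>A \<open>p\<close>-th root of the constant in front of \<open>Q\<close>.
    Dividing \<open>x\<close> by it makes the \<open>p\<close>-th power equal to \<open>Q\<close>
    itself.\<close>
  obtain \<mu> where \<mu>: "\<mu> ^ p = C * \<delta> ^ (a + b)" using nth_root_exists[of p "C * \<delta> ^ (a + b)"] p0 by auto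
  have \<mu>0: "\<mu> \<noteq> 0"
  proof
    assume "\<mu> = 0"
    then show False using \<mu> C \<delta> p0 by (simp add: power_0_left)
  qed
  have h\<mu>: "h \<mu> \<noteq> 0" by (rule hnz[OF \<mu>0])
  define x' where "x' = x / h \<mu>"
  have x'p: "x' ^ p = Q"
    unfolding x'_def power_divide x gz h.hom_power[symmetric] \<mu> using hnz[of "C * \<delta> ^ (a + b)"] C \<delta> by simp
  have x'0: "x' \<noteq> 0" using x'p Q0 p0 by (auto simp: power_0_left)
  \<comment> \<open>A constant multiple of \<open>u\<close>. Its \<open>p\<close>-th power times
    \<open>Q\<close> is the power \<open>(t - z') ^ p\<close>, and both \<open>Q\<close> and this
    power are linear in \<open>z'\<close> over \<open>?k\<close>; the resulting equation can be
    solved for \<open>z'\<close> unless its coefficient vanishes.\<close>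
  define w where "w = (t - z') / x'"
  have wu: "w = h \<mu> / h \<delta> * u"
    unfolding w_def u t_def x'_def z'_def using h\<mu> h\<delta> by (simp add: field_simps)
  have hk: "h y \<in> ?k" for y by (rule rat1_basic[OF h])
  have hE: "h y \<in> E" for y using hk E(2) by blast
  have wE: "w \<in> E" unfolding wu by (intro Ec hE E(3))
  have tE: "t \<in> E" using tk E(2) by blast
  have tz: "t - z' \<noteq> 0" unfolding t_eq using z'0 z'1 d0 P0 by simp
  have w0: "w \<noteq> 0" unfolding w_def using tz x'0 by simp
  have wp: "(t - z') ^ p = w ^ p * Q" using x'0 by (simp add: w_def x'p[symmetric] power_divide)
  have z'E: "z' \<in> E"
  proof -
    have "(t + (-1) * z', t + (-1) * z2) \<in> conj_pairs ?k z' z2" by (intro cp tk kc)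
    then have "((t - z') ^ p, (t - z2) ^ p) \<in> conj_pairs ?k z' z2" using cp(5)[of "t - z'" "t - z2" p] by simp
    then obtain \<alpha>1 \<beta>1 where 1: "\<alpha>1 \<in> ?k" "\<beta>1 \<in> ?k" "(t - z') ^ p = \<alpha>1 + \<beta>1 * z'" "(t - z2) ^ p = \<alpha>1 + \<beta>1 * z2" by (rule conj_pairsE)
    from QQ obtain \<alpha>2 \<beta>2 where 2: "\<alpha>2 \<in> ?k" "\<beta>2 \<in> ?k" "Q = \<alpha>2 + \<beta>2 * z'" "Q2 = \<alpha>2 + \<beta>2 * z2" by (rule conj_pairsE)
    have rel: "(\<beta>1 - w ^ p * \<beta>2) * z' = w ^ p * \<alpha>2 - \<alpha>1" using wp unfolding 1(3) 2(3) by (simp add: algebra_simps)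
    have "\<beta>1 - w ^ p * \<beta>2 \<noteq> 0"
    proof
      assume b: "\<beta>1 - w ^ p * \<beta>2 = 0"
      then have "\<alpha>1 = w ^ p * \<alpha>2" using rel by simp
      then have w2: "(t - z2) ^ p = w ^ p * Q2" unfolding 1(4) 2(4) using b by (simp add: algebra_simps)
      \<comment> \<open>A \<open>p\<close>-th power equal to \<open>Q ^ (p - 1) * Q2\<close>. This
        writes the quotient of \<open>Q2\<close> by \<open>Q\<close>, up to the power
        \<open>Q ^ p\<close>, with natural exponents; the exponent 1 of \<open>Q2\<close> then
        contradicts independence.\<close>
      define s where "s = Q * (t - z2) / (t - z')"
      have "s ^ p = Q ^ p * (t - z2) ^ p / (t - z') ^ p" by (simp add: s_def power_mult_distrib power_divide)
      also have "\<dots> = Q ^ (p - 1) * Q2 ^ 1"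
        unfolding w2 wp using w0 Q0 p0 by (cases p) simp_all
      finally have "Q ^ (p - 1) * Q2 ^ 1 = s ^ p" by (rule sym)
      moreover have "s \<in> rat1 h z'"
      proof -
        note zc = subfield_RT_closed[OF subfield_rat1[OF h, of z']]
        have "z2 \<in> rat1 h z'" by (rule pairs[of z2 z']) (rule conj_pairsI[of "z' + z2" _ "-1"], use zk kc in auto)
        moreover have "t \<in> rat1 h z'" using tk vz' by blast
        moreover have "z' \<in> rat1 h z'" by (rule rat1_basic[OF h])
        ultimately show ?thesis unfolding s_def Q_def by (intro zc)
      qed
      ultimately have "p dvd 1" using indep by blast
      then show False using p(1) by (simp add: prime_nat_iff)
    qed
    then have "z' = (w ^ p * \<alpha>2 - \<alpha>1) / (\<beta>1 - w ^ p * \<beta>2)" using rel by (simp add: field_simps)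
    also have "\<dots> \<in> E" using 1(1,2) 2(1,2) E(2) by (intro Ec wE) blast+
    finally show ?thesis .
  qed
  have "x' = (t - z') / w" unfolding w_def using x'0 tz by simp
  also have "\<dots> \<in> E" by (intro Ec tE z'E wE)
  finally have x'E: "x' \<in> E" .
  have gen: "E \<subseteq> S" if S: "subfield S RT" "?k \<subseteq> S" "z' \<in> S" "x' \<in> S" for S
  proof (rule E(4)[OF S(1,2)])
    note sc = subfield_RT_closed[OF S(1)]
    have "u = h \<delta> / h \<mu> * ((t - z') / x')" using wu h\<mu> h\<delta> unfolding w_def by simp
    also have "\<dots> \<in> S" using hk tk S(2) by (intro sc S(3,4)) blast+
    finally show "u \<in> S" .
  qed
  have "galois_datum p ?k E z' z2 x' Q Q2"
    unfolding galois_datum_def using z'k zk x'E z'E x'p Q0 QQ gen indep pairs by blast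
  then show ?thesis by (intro exI)
qed

section \<open>Galois groups of abstract fields\<close>

lemma gal_group_mult:
  assumes "\<sigma> \<in> carrier (gal_group E K)" "\<tau> \<in> carrier (gal_group E K)" "a \<in> carrier E"
  shows "(\<sigma> \<otimes>\<^bsub>gal_group E K\<^esub> \<tau>) a = \<sigma> (\<tau> a)"
proof -
  have "\<sigma> \<in> Bij (carrier E)" "\<tau> \<in> Bij (carrier E)"
    using assms(1,2) unfolding gal_group_def Bij_def by (auto simp: ring_iso_def)
  then show ?thesis using assms(3) by (simp add: gal_group_def BijGroup_def compose_def)
qed

lemma gal_group_one: "a \<in> carrier E \<Longrightarrow> \<one>\<^bsub>gal_group E K\<^esub> a = a"
  by (simp add: gal_group_def BijGroup_def)

lemma gal_group_eqI:
  assumes "\<sigma> \<in> carrier (gal_group E K)" "\<tau> \<in> carrier (gal_group E K)" "\<And>a. a \<in> carrier E \<Longrightarrow> \<sigma> a = \<tau> a"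
  shows "\<sigma> = \<tau>"
  by (rule extensionalityI[OF gal_groupD(2)[OF assms(1)] gal_groupD(2)[OF assms(2)] assms(3)])

lemma group_gal_group:
  assumes "Ring.ring E" "K \<subseteq> carrier E"
  shows "group (gal_group E K)"
proof -
  interpret E: Ring.ring E by fact
  interpret B: group "BijGroup (carrier E)" by (rule group_BijGroup)
  let ?H = "{\<sigma> \<in> ring_iso E E \<inter> extensional (carrier E). \<forall>x\<in>K. \<sigma> x = x}"
  have sub: "?H \<subseteq> Bij (carrier E)" unfolding Bij_def by (auto simp: ring_iso_def)
  have "subgroup ?H (BijGroup (carrier E))"
  proof (rule B.subgroupI)
    show "?H \<subseteq> carrier (BijGroup (carrier E))" using sub by (simp add: BijGroup_def)
    have "(\<lambda>x\<in>carrier E. x) \<in> ?H"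
      using assms(2) E.ring_iso_restrict[OF ring_iso_set_refl, of "\<lambda>x\<in>carrier E. x"] by auto
    then show "?H \<noteq> {}" by blast
  next
    fix \<sigma> assume \<sigma>: "\<sigma> \<in> ?H"
    then have s: "\<sigma> \<in> ring_iso E E" and fx: "\<forall>x\<in>K. \<sigma> x = x" by auto
    have bij: "bij_betw \<sigma> (carrier E) (carrier E)" using s by (simp add: ring_iso_def)
    have inv: "inv\<^bsub>BijGroup (carrier E)\<^esub> \<sigma> = (\<lambda>x\<in>carrier E. inv_into (carrier E) \<sigma> x)"
      using \<sigma> sub by (intro inv_BijGroup) blast
    let ?i = "inv_into (carrier E) \<sigma>"
    have inj: "inj_on \<sigma> (carrier E)" and im: "\<sigma> ` carrier E = carrier E" using bij by (simp_all add: bij_betw_def)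
    have i: "?i a \<in> carrier E" "\<sigma> (?i a) = a" if "a \<in> carrier E" for a
      using that im inv_into_into[of a \<sigma> "carrier E"] f_inv_into_f[of a \<sigma> "carrier E"] by simp_all
    note sm = ring_iso_memE[OF s]
    have "?i \<in> ring_iso E E"
    proof (rule ring_iso_memI)
      fix a b assume ab: "a \<in> carrier E" "b \<in> carrier E"
      show "?i a \<in> carrier E" by (rule i(1)[OF ab(1)])
      show "?i (a \<otimes>\<^bsub>E\<^esub> b) = ?i a \<otimes>\<^bsub>E\<^esub> ?i b" by (rule inv_into_f_eq[OF inj]) (simp_all add: ab i sm)
      show "?i (a \<oplus>\<^bsub>E\<^esub> b) = ?i a \<oplus>\<^bsub>E\<^esub> ?i b" by (rule inv_into_f_eq[OF inj]) (simp_all add: ab i sm)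
    next
      show "?i \<one>\<^bsub>E\<^esub> = \<one>\<^bsub>E\<^esub>" by (rule inv_into_f_eq[OF inj]) (simp_all add: sm)
      show "bij_betw ?i (carrier E) (carrier E)" by (rule bij_betw_inv_into[OF bij])
    qed
    then have "(\<lambda>x\<in>carrier E. inv_into (carrier E) \<sigma> x) \<in> ring_iso E E"
      by (rule E.ring_iso_restrict) simp
    moreover have "inv_into (carrier E) \<sigma> x = x" if "x \<in> K" for x
    proof (rule inv_into_f_eq)
      show "inj_on \<sigma> (carrier E)" using bij by (simp add: bij_betw_def)
      show "x \<in> carrier E" using that assms(2) by blast
      show "\<sigma> x = x" using that fx by blast
    qed
    ultimately show "inv\<^bsub>BijGroup (carrier E)\<^esub> \<sigma> \<in> ?H" unfolding inv using assms(2) by auto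
  next
    fix \<sigma> \<tau> assume \<sigma>: "\<sigma> \<in> ?H" and \<tau>: "\<tau> \<in> ?H"
    have m: "\<sigma> \<otimes>\<^bsub>BijGroup (carrier E)\<^esub> \<tau> = compose (carrier E) \<sigma> \<tau>"
      using \<sigma> \<tau> sub by (auto simp: BijGroup_def)
    have "compose (carrier E) \<sigma> \<tau> \<in> ring_iso E E"
      by (rule E.ring_iso_restrict[OF ring_iso_set_trans[of \<tau> E E \<sigma> E]]) (use \<sigma> \<tau> in \<open>auto simp: compose_def\<close>)
    then show "\<sigma> \<otimes>\<^bsub>BijGroup (carrier E)\<^esub> \<tau> \<in> ?H"
      unfolding m using \<sigma> \<tau> assms(2) by (auto simp: compose_def)
  qed
  from subgroup.subgroup_is_group[OF this group_BijGroup] show ?thesis unfolding gal_group_def .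
qed

text \<open>A basis of \<open>E\<close> taken in \<open>R\<close> lies in \<open>M\<close>, and the
  spans of its parts are the same computed in either ring.\<close>

lemma (in Ring.ring) dimension_subring:
  assumes K: "subfield K R" "K \<subseteq> M" and M: "subring M R" and d: "dimension n K E" "E \<subseteq> M"
  shows "ring.dimension (R\<lparr>carrier := M\<rparr>) n K E"
  using d
proof -
  interpret M: Ring.ring "R\<lparr>carrier := M\<rparr>" by (rule subring_is_ring[OF M])
  have *: "M.dimension (length Vs) K (Span K Vs)" if "independent K Vs" "set Vs \<subseteq> M" for Vs
    using that
  proof (induction Vs rule: list.induct)
    case Nil
    then show ?case using M.zero_dim[of K] by simp
  next
    case (Cons u Us)
    note b = independent_backwards[OF Cons(2)]
    have "M.dimension (Suc (length Us)) K (M.line_extension K u (Span K Us))"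
      by (rule M.Suc_dim) (use Cons b in auto)
    then show ?case by (simp add: line_extension_consistent[OF M])
  qed
  obtain Vs where Vs: "set Vs \<subseteq> carrier R" "independent K Vs" "length Vs = n" "Span K Vs = E"
    using exists_base[OF K(1) d(1)] by blast
  have "set Vs \<subseteq> E" using Span_base_incl[OF K(1) Vs(1)] Vs(4) by simp
  then show ?thesis using *[OF Vs(2)] d(2) Vs(3,4) by auto
qed

lemma (in Ring.field) roots_of_unity:
  assumes n: "n > 0" and S: "S \<subseteq> carrier R" "\<And>s. s \<in> S \<Longrightarrow> s [^] (n::nat) = \<one>" "finite S" shows "card S \<le> n"
proof -
  obtain m where m: "n = Suc m" using n by (cases n) auto
  \<comment> \<open>The coefficient list of \<open>X ^ n - 1\<close>, leading coefficient
    first.\<close>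
  define f where "f = \<one> # replicate m \<zero> @ [\<ominus> \<one>]"
  have f: "f \<in> carrier (poly_ring R)" unfolding f_def sym[OF univ_poly_carrier] polynomial_def by auto
  have ev: "eval f s = \<zero>" if s: "s \<in> carrier R" "s [^] n = \<one>" for s
  proof -
    have "eval (replicate m \<zero> @ [\<ominus> \<one>]) s = \<ominus> \<one>" using eval_replicate[of "[\<ominus> \<one>]" s m] s(1) by simp
    then have "eval f s = s [^] n \<oplus> \<ominus> \<one>" using s(1) by (simp add: f_def m)
    then show ?thesis unfolding s(2) by (simp add: r_neg)
  qed
  have "S \<subseteq> set_mset (roots f)"
  proof
    fix s assume "s \<in> S"
    then have "is_root f s" unfolding is_root_def using ev S by (auto simp: f_def)
    then show "s \<in># roots f" using roots_mem_iff_is_root[OF f] by simp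
  qed
  then have "card S \<le> card (set_mset (roots f))" by (rule card_mono[rotated]) simp
  also have "\<dots> \<le> size (roots f)" using size_mset_mono[OF mset_set_set_mset_msubset[of "roots f"]] by simp
  also have "\<dots> \<le> n" using size_roots_le_degree[OF f] by (simp add: f_def m)
  finally show ?thesis .
qed

text \<open>The setting of Kummer theory: \<open>k\<close> contains a primitive \<open>p\<close>-th
  root of unity, so an automorphism that fixes a nonzero \<open>p\<close>-th power changes its roots
  by powers of \<open>\<zeta>\<close>. About \<open>L\<close> only the Galois property over
  \<open>k\<close> and the minimality \<open>min\<close> over \<open>E\<close> are available;
  \<open>j\<close> embeds the concrete field \<open>E\<close>.\<close>

locale dihedral_galois =
  fixes L :: "'b ring" (structure) and k E :: "'w::field_char_0 set" and j :: "'w \<Rightarrow> 'b" and p :: nat and z z2 x q q2 \<zeta> :: 'w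
  assumes kE: "subfield k RT" "subfield E RT" "k \<subseteq> E" and j: "j \<in> Ring.ring_hom (RT\<lparr>carrier := E\<rparr>) L"
    and gal: "galois_extension L (j ` k)"
    and min: "\<And>M. subfield M L \<Longrightarrow> j ` E \<subseteq> M \<Longrightarrow> galois_extension (L\<lparr>carrier := M\<rparr>) (j ` k) \<Longrightarrow> M = carrier L"
    and datum: "galois_datum p k E z z2 x q q2"
    and \<zeta>: "\<zeta> \<in> k" "\<zeta> ^ p = 1" "\<zeta> \<noteq> 1" and p: "Factorial_Ring.prime p" "odd p"
begin

abbreviation Gal where "Gal \<equiv> gal_group L (j ` k)"

lemma fieldL: "Ring.field L" and subK: "subfield (j ` k) L" and finL: "ring.finite_dimension L (j ` k) (carrier L)"
  and fixed: "{x \<in> carrier L. \<forall>\<sigma>\<in>carrier Gal. \<sigma> x = x} = j ` k"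
  using gal unfolding galois_extension_def by auto

sublocale L: Ring.field L by (rule fieldL)

sublocale Gal: group Gal by (rule group_gal_group[OF L.ring_axioms subfieldE(3)[OF subK]])

lemma data: "z \<notin> k" "z + z2 \<in> k" "z * z2 \<in> k" "x \<in> E" "z \<in> E" "x ^ p = q" "q \<noteq> 0" "(q, q2) \<in> conj_pairs k z z2"
  "subfield S RT \<Longrightarrow> k \<subseteq> S \<Longrightarrow> z \<in> S \<Longrightarrow> x \<in> S \<Longrightarrow> E \<subseteq> S"
  "(s, s2) \<in> conj_pairs k z z2 \<Longrightarrow> q ^ m * q2 ^ n = s ^ p \<Longrightarrow> p dvd m \<and> p dvd n"
  using datum unfolding galois_datum_def by blast+

lemmas kc = subfield_RT_closed[OF kE(1)] and Ec = subfield_RT_closed[OF kE(2)]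

lemma kinE: "s \<in> k \<Longrightarrow> s \<in> E" using kE(3) by blast

lemma z2E: "z2 \<in> E"
  using Ec(7)[OF kinE[OF data(2)] data(5)] by simp

lemma z_neq: "z \<noteq> z2"
proof
  assume "z = z2"
  then have "z = (z + z2) / of_nat 2" by simp
  also have "\<dots> \<in> k" by (intro kc data)
  finally show False using data(1) by simp
qed

lemma pairs_E: "(s, s2) \<in> conj_pairs k z z2 \<Longrightarrow> s \<in> E \<and> s2 \<in> E"
proof -
  assume "(s, s2) \<in> conj_pairs k z z2"
  then obtain \<alpha> \<beta> where 1: "\<alpha> \<in> k" "\<beta> \<in> k" and 2: "s = \<alpha> + \<beta> * z" "s2 = \<alpha> + \<beta> * z2" by (rule conj_pairsE)
  show ?thesis unfolding 2 by (intro conjI Ec kinE[OF 1(1)] kinE[OF 1(2)] data z2E)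
qed

lemma p0: "p > 0" by (rule prime_gt_0_nat[OF p(1)])

lemma j_closed: "s \<in> E \<Longrightarrow> j s \<in> carrier L" and j_mult: "s \<in> E \<Longrightarrow> t \<in> E \<Longrightarrow> j (s * t) = j s \<otimes> j t"
  and j_add: "s \<in> E \<Longrightarrow> t \<in> E \<Longrightarrow> j (s + t) = j s \<oplus> j t" and j_1: "j 1 = \<one>"
  using ring_hom_memE[OF j] by simp_all

lemma j_0: "j 0 = \<zero>"
proof -
  have "j 0 \<oplus> j 0 = j 0 \<oplus> \<zero>" using j_add[of 0 0] Ec(1) j_closed by simp
  then show ?thesis using j_closed[OF Ec(1)] by (simp only: L.add.l_cancel L.zero_closed)
qed

lemma j_eq_0: "s \<in> E \<Longrightarrow> j s = \<zero> \<Longrightarrow> s = 0"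
proof (rule ccontr)
  assume s: "s \<in> E" "j s = \<zero>" "s \<noteq> 0"
  then have "j (s * inverse s) = \<zero>" using j_mult[of s "inverse s"] Ec j_closed by simp
  then show False using s(3) j_1 L.one_not_zero by simp
qed

lemma j_minus: "s \<in> E \<Longrightarrow> j (- s) = \<ominus> j s"
proof -
  assume s: "s \<in> E"
  then have "j (- s) \<oplus> j s = \<zero>" using j_add[of "- s" s] Ec j_0 by simp
  then show ?thesis using L.minus_equality[of "j (- s)" "j s"] s Ec j_closed by simp
qed

lemma j_inj: "s \<in> E \<Longrightarrow> t \<in> E \<Longrightarrow> j s = j t \<Longrightarrow> s = t"
proof -
  assume s: "s \<in> E" "t \<in> E" "j s = j t"
  have "j (s + - t) = \<zero>" using s j_add[of s "- t"] j_minus[of t] Ec j_closed by (simp add: L.r_neg)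
  moreover have "s + - t \<in> E" by (intro Ec s)
  ultimately have "s + - t = 0" by (intro j_eq_0)
  then show ?thesis by simp
qed

lemma j_pow: "s \<in> E \<Longrightarrow> j (s ^ n) = j s [^] n"
  by (induction n) (simp_all add: j_1 j_mult Ec power_Suc2 del: power_Suc)

lemma gal_iso: "\<sigma> \<in> carrier Gal \<Longrightarrow> \<sigma> \<in> ring_iso L L" by (rule gal_groupD(1))

lemma gal_closed: "\<sigma> \<in> carrier Gal \<Longrightarrow> a \<in> carrier L \<Longrightarrow> \<sigma> a \<in> carrier L"
  by (rule ring_iso_memE(1)[OF gal_iso])

lemma gal_mult: "\<sigma> \<in> carrier Gal \<Longrightarrow> a \<in> carrier L \<Longrightarrow> b \<in> carrier L \<Longrightarrow> \<sigma> (a \<otimes> b) = \<sigma> a \<otimes> \<sigma> b"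
  by (rule ring_iso_memE(2)[OF gal_iso])

lemma gal_add: "\<sigma> \<in> carrier Gal \<Longrightarrow> a \<in> carrier L \<Longrightarrow> b \<in> carrier L \<Longrightarrow> \<sigma> (a \<oplus> b) = \<sigma> a \<oplus> \<sigma> b"
  by (rule ring_iso_memE(3)[OF gal_iso])

lemma gal_one: "\<sigma> \<in> carrier Gal \<Longrightarrow> \<sigma> \<one> = \<one>"
  by (rule ring_iso_memE(4)[OF gal_iso])

lemma gal_bij: "\<sigma> \<in> carrier Gal \<Longrightarrow> bij_betw \<sigma> (carrier L) (carrier L)"
  by (rule ring_iso_memE(5)[OF gal_iso])

lemma gal_fix: "\<sigma> \<in> carrier Gal \<Longrightarrow> s \<in> k \<Longrightarrow> \<sigma> (j s) = j s"
  by (rule gal_groupD(3)) auto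

lemma gal_zero: "\<sigma> \<in> carrier Gal \<Longrightarrow> \<sigma> \<zero> = \<zero>"
  using gal_fix[OF _ kc(1)] by (simp add: j_0)

lemma gal_minus: "\<sigma> \<in> carrier Gal \<Longrightarrow> a \<in> carrier L \<Longrightarrow> \<sigma> (\<ominus> a) = \<ominus> \<sigma> a"
proof -
  assume \<sigma>: "\<sigma> \<in> carrier Gal" and a: "a \<in> carrier L"
  have "\<sigma> (\<ominus> a) \<oplus> \<sigma> a = \<zero>" using gal_add[OF \<sigma>, of "\<ominus> a" a] a gal_zero[OF \<sigma>] by (simp add: L.l_neg)
  then show ?thesis using L.minus_equality[of "\<sigma> (\<ominus> a)" "\<sigma> a"] a gal_closed[OF \<sigma>] by simp
qed

lemma gal_pow: "\<sigma> \<in> carrier Gal \<Longrightarrow> a \<in> carrier L \<Longrightarrow> \<sigma> (a [^] (n::nat)) = \<sigma> a [^] n"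
  by (induction n) (simp_all add: gal_one gal_mult)

lemma gal_inj: "\<sigma> \<in> carrier Gal \<Longrightarrow> a \<in> carrier L \<Longrightarrow> b \<in> carrier L \<Longrightarrow> \<sigma> a = \<sigma> b \<Longrightarrow> a = b"
  using gal_bij unfolding bij_betw_def inj_on_def by blast

lemma gal_inv: "\<sigma> \<in> carrier Gal \<Longrightarrow> a \<in> carrier L \<Longrightarrow> a \<noteq> \<zero> \<Longrightarrow> \<sigma> (inv a) = inv (\<sigma> a)"
proof -
  assume \<sigma>: "\<sigma> \<in> carrier Gal" and a: "a \<in> carrier L" "a \<noteq> \<zero>"
  have u: "a \<in> Units L" using a by (simp add: L.field_Units)
  have "\<sigma> a \<otimes> \<sigma> (inv a) = \<one>" using gal_mult[OF \<sigma>, of a "inv a"] u a gal_one[OF \<sigma>] by simp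
  then have "inv (\<sigma> a) = \<sigma> (inv a)" using u a gal_closed[OF \<sigma>] by (intro L.comm_inv_char) simp_all
  then show ?thesis by simp
qed

lemma app: "\<sigma> \<in> carrier Gal \<Longrightarrow> \<tau> \<in> carrier Gal \<Longrightarrow> a \<in> carrier L \<Longrightarrow> (\<sigma> \<otimes>\<^bsub>Gal\<^esub> \<tau>) a = \<sigma> (\<tau> a)"
  by (rule gal_group_mult)

lemma inv_app: "\<sigma> \<in> carrier Gal \<Longrightarrow> a \<in> carrier L \<Longrightarrow> \<sigma> ((inv\<^bsub>Gal\<^esub> \<sigma>) a) = a" "\<sigma> \<in> carrier Gal \<Longrightarrow> a \<in> carrier L \<Longrightarrow> (inv\<^bsub>Gal\<^esub> \<sigma>) (\<sigma> a) = a"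
  using app[of \<sigma> "inv\<^bsub>Gal\<^esub> \<sigma>" a] app[of "inv\<^bsub>Gal\<^esub> \<sigma>" \<sigma> a] gal_group_one[of a L "j ` k"] by simp_all

lemma zL: "j z \<in> carrier L" "j z2 \<in> carrier L" "j x \<in> carrier L" by (intro j_closed data z2E)+

text \<open>An automorphism over \<open>k\<close> fixes the coefficients of the quadratic equation
  with roots \<open>z\<close> and \<open>z2\<close>, so it permutes these roots.\<close>

lemma z_image:
  assumes \<sigma>: "\<sigma> \<in> carrier Gal" shows "\<sigma> (j z) = j z \<or> \<sigma> (j z) = j z2"
proof -
  define w where "w = \<sigma> (j z)"
  have w: "w \<in> carrier L" unfolding w_def by (rule gal_closed[OF \<sigma> zL(1)])
  have "z * z + z * z2 = (z + z2) * z" by (simp add: algebra_simps)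
  then have "j (z * z + z * z2) = j ((z + z2) * z)" by simp
  then have "j z \<otimes> j z \<oplus> j (z * z2) = j (z + z2) \<otimes> j z"
    by (simp only: j_add[OF Ec(5)[OF data(5) data(5)] kinE[OF data(3)]] j_mult[OF data(5) data(5)] j_mult[OF kinE[OF data(2)] data(5)])
  from arg_cong[OF this, of \<sigma>] have "w \<otimes> w \<oplus> j (z * z2) = j (z + z2) \<otimes> w"
    using zL kinE[OF data(2)] kinE[OF data(3)] j_closed by (simp add: gal_add[OF \<sigma>] gal_mult[OF \<sigma>] gal_fix[OF \<sigma>] data w_def)
  then have "w \<otimes> w \<oplus> j z \<otimes> j z2 = (j z \<oplus> j z2) \<otimes> w" by (simp add: j_mult j_add data z2E)
  moreover have "(w \<ominus> j z) \<otimes> (w \<ominus> j z2) = (w \<otimes> w \<oplus> j z \<otimes> j z2) \<ominus> ((j z \<oplus> j z2) \<otimes> w)" using w zL by algebra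
  ultimately have "(w \<ominus> j z) \<otimes> (w \<ominus> j z2) = \<zero>" using w zL by (simp add: L.r_right_minus_eq)
  then have "w \<ominus> j z = \<zero> \<or> w \<ominus> j z2 = \<zero>" using w zL by (simp add: L.integral_iff)
  then show ?thesis unfolding w_def[symmetric] using w zL by (simp add: L.r_right_minus_eq)
qed

lemma pair_image:
  assumes \<sigma>: "\<sigma> \<in> carrier Gal" and s: "(s, s2) \<in> conj_pairs k z z2"
  shows "\<sigma> (j z) = j z \<Longrightarrow> \<sigma> (j s) = j s" "\<sigma> (j z) = j z2 \<Longrightarrow> \<sigma> (j s) = j s2"
proof -
  from s obtain \<alpha> \<beta> where 1: "\<alpha> \<in> k" "\<beta> \<in> k" "s = \<alpha> + \<beta> * z" "s2 = \<alpha> + \<beta> * z2" by (rule conj_pairsE)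
  have js: "j s = j \<alpha> \<oplus> j \<beta> \<otimes> j z" "j s2 = j \<alpha> \<oplus> j \<beta> \<otimes> j z2"
    unfolding 1(3,4) by (simp_all add: j_add j_mult Ec kinE 1 data z2E)
  have "\<sigma> (j s) = j \<alpha> \<oplus> j \<beta> \<otimes> \<sigma> (j z)" unfolding js
    using zL 1 by (simp add: gal_add[OF \<sigma>] gal_mult[OF \<sigma>] gal_fix[OF \<sigma>] j_closed kinE)
  then show "\<sigma> (j z) = j z \<Longrightarrow> \<sigma> (j s) = j s" "\<sigma> (j z) = j z2 \<Longrightarrow> \<sigma> (j s) = j s2" by (simp_all add: js)
qed

lemma pair_swap: "(s, s2) \<in> conj_pairs k z z2 \<Longrightarrow> (s2, s) \<in> conj_pairs k z z2"
proof -
  assume "(s, s2) \<in> conj_pairs k z z2"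
  then obtain \<alpha> \<beta> where 1: "\<alpha> \<in> k" "\<beta> \<in> k" "s = \<alpha> + \<beta> * z" "s2 = \<alpha> + \<beta> * z2" by (rule conj_pairsE)
  show ?thesis
  proof (rule conj_pairsI[of "\<alpha> + \<beta> * (z + z2)" _ "- \<beta>"])
    show "\<alpha> + \<beta> * (z + z2) \<in> k" "- \<beta> \<in> k" by (intro kc 1 data)+
  qed (simp_all add: 1(3,4) algebra_simps)
qed

lemma z_pair: "(z, z2) \<in> conj_pairs k z z2" by (rule conj_pairs_closed(2)[OF kE(1) data(2,3)])

lemma z2_image:
  assumes "\<sigma> \<in> carrier Gal" shows "\<sigma> (j z) = j z \<Longrightarrow> \<sigma> (j z2) = j z2" "\<sigma> (j z) = j z2 \<Longrightarrow> \<sigma> (j z2) = j z"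
  using pair_image[OF assms pair_swap[OF z_pair]] by simp_all

section \<open>Powers of the root of unity and uniqueness of radicals\<close>

definition sc :: "nat \<Rightarrow> 'b" where "sc i = j (\<zeta> ^ i)"

lemma zpow: "\<zeta> ^ i \<in> k" by (rule kc(9)[OF \<zeta>(1)])

lemma sc_closed: "sc i \<in> carrier L" unfolding sc_def by (rule j_closed[OF kinE[OF zpow]])

lemma sc_add: "sc (i + l) = sc i \<otimes> sc l" unfolding sc_def power_add by (rule j_mult) (rule kinE[OF zpow])+

lemma gal_sc: "\<sigma> \<in> carrier Gal \<Longrightarrow> \<sigma> (sc i) = sc i" unfolding sc_def by (rule gal_fix[OF _ zpow])

lemma sc_0: "sc 0 = \<one>" by (simp add: sc_def j_1)

lemma zeta_mod: "\<zeta> ^ i = \<zeta> ^ (i mod p)"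
proof -
  have "\<zeta> ^ i = \<zeta> ^ (p * (i div p) + i mod p)" by simp
  also have "\<dots> = \<zeta> ^ (i mod p)" unfolding power_add power_mult \<zeta>(2) by simp
  finally show ?thesis .
qed

lemma sc_mod: "i mod p = l mod p \<Longrightarrow> sc i = sc l"
  unfolding sc_def by (subst zeta_mod, subst (2) zeta_mod) simp

lemma zeta_inj: "\<zeta> ^ i = \<zeta> ^ l \<Longrightarrow> i < p \<Longrightarrow> l < p \<Longrightarrow> i = l"
proof (induction i l rule: linorder_wlog)
  case (le i l)
  have \<zeta>0: "\<zeta> \<noteq> 0" using \<zeta>(2) p0 by (auto simp: power_0_left)
  have "i + (l - i) = l" using le by simp
  then have "\<zeta> ^ i * \<zeta> ^ (l - i) = \<zeta> ^ i * 1" unfolding power_add[symmetric] using le by simp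
  then have "\<zeta> ^ (l - i) = 1" using \<zeta>0 by simp
  then have "p dvd l - i" using prime_power_eq_1_dvd[OF p(1) \<zeta>(2)] \<zeta>(3) by simp
  then have "l - i = 0" using le by (meson dvd_imp_le less_imp_diff_less not_le neq0_conv)
  then show ?case using le by simp
qed simp

lemma sc_eq_iff: "sc i = sc l \<longleftrightarrow> i mod p = l mod p"
proof
  assume "sc i = sc l"
  then have "\<zeta> ^ i = \<zeta> ^ l" unfolding sc_def by (intro j_inj kinE zpow)
  then have "\<zeta> ^ (i mod p) = \<zeta> ^ (l mod p)" using zeta_mod by metis
  then show "i mod p = l mod p" by (rule zeta_inj) (use p0 in auto)
qed (rule sc_mod)

lemma sc_eq_1: "sc i = \<one> \<longleftrightarrow> p dvd i"
  using sc_eq_iff[of i 0] by (auto simp: sc_0)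

text \<open>The quotient of two \<open>p\<close>-th roots of one nonzero element is a
  \<open>p\<close>-th root of unity. The powers of \<open>\<zeta>\<close> are already
  \<open>p\<close> of them, and a field contains no more.\<close>

lemma root_unique:
  assumes w: "w \<in> carrier L" "v \<in> carrier L" "v \<noteq> \<zero>" "w [^] p = v [^] p" shows "\<exists>i. w = sc i \<otimes> v"
proof (rule ccontr)
  assume no: "\<not> ?thesis"
  have v: "v \<in> Units L" using w by (simp add: L.field_Units)
  define u where "u = w \<otimes> inv v"
  have u: "u \<in> carrier L" "u \<otimes> v = w" using w v by (simp_all add: u_def L.m_assoc)
  have vp: "v [^] p \<in> carrier L" "v [^] p \<in> Units L" using w v by (simp_all add: L.Units_pow_closed)
  have "u [^] p \<otimes> v [^] p = w [^] p" using u w by (simp flip: L.nat_pow_distrib)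
  then have "u [^] p \<otimes> v [^] p = \<one> \<otimes> v [^] p" using vp w(4) by simp
  moreover have "v [^] p \<noteq> \<zero>" using vp(2) by (simp add: L.field_Units)
  ultimately have "u [^] p = \<one>" 
    using L.m_rcancel[OF _ vp(1) L.nat_pow_closed[OF u(1)] L.one_closed] by blast
  have "u \<noteq> sc i" for i using no u by auto
  define S where "S = insert u (sc ` {..<p})"
  have "sc i [^] p = \<one>" for i
  proof -
    have "(\<zeta> ^ i) ^ p = 1" by (simp add: power_mult[symmetric] mult.commute[of i]) (simp add: power_mult \<zeta>)
    then show ?thesis unfolding sc_def by (simp flip: j_pow[OF kinE[OF zpow]] add: j_1)
  qed
  then have "card S \<le> p" using \<open>u [^] p = \<one>\<close> u sc_closed p0 unfolding S_def by (intro L.roots_of_unity) auto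
  moreover have "inj_on sc {..<p}" by (rule inj_onI) (simp add: sc_eq_iff)
  then have "card (sc ` {..<p}) = p" by (simp add: card_image)
  then have "card S = Suc p" unfolding S_def using \<open>\<And>i. u \<noteq> sc i\<close> by (subst card_insert_disjoint) auto
  ultimately show False by simp
qed

lemma x_pow: "j x [^] p = j q" using j_pow[OF data(4), of p] by (simp add: data)

lemma x_nz: "x \<noteq> 0" using data(6,7) p0 by (auto simp: power_0_left)

lemma jx_nz: "j x \<noteq> \<zero>" using j_eq_0[OF data(4)] x_nz by blast

lemma exists_swap: "\<exists>\<tau>\<in>carrier Gal. \<tau> (j z) = j z2"
proof (rule ccontr)
  assume "\<not> ?thesis"
  then have "\<forall>\<sigma>\<in>carrier Gal. \<sigma> (j z) = j z" using z_image by blast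
  then have "j z \<in> j ` k" using fixed zL(1) by blast
  then obtain s where s: "s \<in> k" "j z = j s" by (elim imageE)
  have "z = s" by (rule j_inj[OF data(5) kinE[OF s(1)] s(2)])
  then show False using s(1) data(1) by simp
qed

end

section \<open>The conjugate radical and the action on the two radicals\<close>

locale dihedral_galois_swap = dihedral_galois L k E j p z z2 x q q2 \<zeta>
  for L :: "'b ring" (structure) and k E :: "'w::field_char_0 set" and j :: "'w \<Rightarrow> 'b" and p :: nat and z z2 x q q2 \<zeta> :: 'w +
  fixes \<tau>0 :: "'b \<Rightarrow> 'b"
  assumes \<tau>0: "\<tau>0 \<in> carrier Gal" "\<tau>0 (j z) = j z2"
begin

text \<open>A \<open>p\<close>-th root of \<open>q2\<close> in \<open>L\<close>. It is obtained as a
  conjugate of \<open>x\<close> and therefore costs no adjunction.\<close>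

definition "y = \<tau>0 (j x)"

lemma y_closed: "y \<in> carrier L" unfolding y_def by (rule gal_closed[OF \<tau>0(1) zL(3)])

lemma y_nz: "y \<noteq> \<zero>"
proof
  assume "y = \<zero>"
  then have "\<tau>0 (j x) = \<tau>0 \<zero>" unfolding y_def gal_zero[OF \<tau>0(1)] .
  then show False using gal_inj[OF \<tau>0(1) zL(3) L.zero_closed] jx_nz by blast
qed

lemma y_pow: "y [^] p = j q2"
  unfolding y_def gal_pow[OF \<tau>0(1) zL(3), symmetric] x_pow by (rule pair_image(2)[OF \<tau>0(1) data(8) \<tau>0(2)])

lemma x_image:
  assumes \<sigma>: "\<sigma> \<in> carrier Gal"
  shows "\<sigma> (j z) = j z \<Longrightarrow> \<exists>i. \<sigma> (j x) = sc i \<otimes> j x" "\<sigma> (j z) = j z2 \<Longrightarrow> \<exists>i. \<sigma> (j x) = sc i \<otimes> y"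
proof -
  have p: "\<sigma> (j x) [^] p = \<sigma> (j q)" unfolding x_pow[symmetric] by (rule gal_pow[OF \<sigma> zL(3), symmetric])
  show "\<exists>i. \<sigma> (j x) = sc i \<otimes> j x" if "\<sigma> (j z) = j z"
    by (rule root_unique[OF gal_closed[OF \<sigma> zL(3)] zL(3) jx_nz]) (simp only: p x_pow pair_image(1)[OF \<sigma> data(8) that])
  show "\<exists>i. \<sigma> (j x) = sc i \<otimes> y" if "\<sigma> (j z) = j z2"
    by (rule root_unique[OF gal_closed[OF \<sigma> zL(3)] y_closed y_nz]) (simp only: p y_pow pair_image(2)[OF \<sigma> data(8) that])
qed

lemma y_image:
  assumes \<sigma>: "\<sigma> \<in> carrier Gal"
  shows "\<sigma> (j z) = j z \<Longrightarrow> \<exists>i. \<sigma> y = sc i \<otimes> y" "\<sigma> (j z) = j z2 \<Longrightarrow> \<exists>i. \<sigma> y = sc i \<otimes> j x"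
proof -
  have \<sigma>\<tau>: "\<sigma> \<otimes>\<^bsub>Gal\<^esub> \<tau>0 \<in> carrier Gal" using \<sigma> \<tau>0(1) by simp
  have y: "(\<sigma> \<otimes>\<^bsub>Gal\<^esub> \<tau>0) (j x) = \<sigma> y" "(\<sigma> \<otimes>\<^bsub>Gal\<^esub> \<tau>0) (j z) = \<sigma> (j z2)"
    unfolding y_def \<tau>0(2)[symmetric] by (rule app[OF \<sigma> \<tau>0(1)], rule zL)+
  show "\<exists>i. \<sigma> y = sc i \<otimes> y" if "\<sigma> (j z) = j z"
    using x_image(2)[OF \<sigma>\<tau>] unfolding y z2_image(1)[OF \<sigma> that] by simp
  show "\<exists>i. \<sigma> y = sc i \<otimes> j x" if "\<sigma> (j z) = j z2"
    using x_image(1)[OF \<sigma>\<tau>] unfolding y z2_image(2)[OF \<sigma> that] by simp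
qed

definition fixes_gens :: "('b \<Rightarrow> 'b) \<Rightarrow> bool" where
  "fixes_gens n \<longleftrightarrow> n \<in> carrier Gal \<and> n (j z) = j z \<and> n (j x) = j x \<and> n y = y"

text \<open>This plays the part of the field generated by \<open>k\<close>, \<open>z\<close>,
  \<open>x\<close> and \<open>y\<close>. Defined as a fixed field, it is stable under the Galois
  group by conjugation, without any description of its elements.\<close>

definition "M = {a \<in> carrier L. \<forall>n. fixes_gens n \<longrightarrow> n a = a}"

lemma subfield_M: "subfield M L"
proof (rule L.subfieldI'[OF L.subringI])
  show "M \<subseteq> carrier L" unfolding M_def by blast
  show "\<one> \<in> M" unfolding M_def fixes_gens_def using gal_one by simp
  fix a b assume a: "a \<in> M" and b: "b \<in> M"
  then have c: "a \<in> carrier L" "b \<in> carrier L" and f: "fixes_gens n \<Longrightarrow> n a = a" "fixes_gens n \<Longrightarrow> n b = b" for n unfolding M_def by blast+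
  have g: "fixes_gens n \<Longrightarrow> n \<in> carrier Gal" for n unfolding fixes_gens_def by simp
  have n: "n (\<ominus> a) = \<ominus> a" "n (a \<otimes> b) = a \<otimes> b" "n (a \<oplus> b) = a \<oplus> b" if "fixes_gens n" for n
    by (simp_all only: gal_minus[OF g[OF that] c(1)] gal_mult[OF g[OF that] c] gal_add[OF g[OF that] c] f[OF that])
  show "\<ominus> a \<in> M" "a \<otimes> b \<in> M" "a \<oplus> b \<in> M" unfolding M_def using c n by blast+
next
  fix a assume "a \<in> M - {\<zero>}"
  then have c: "a \<in> carrier L" "a \<noteq> \<zero>" and f: "fixes_gens n \<Longrightarrow> n a = a" for n unfolding M_def by blast+
  have "inv a \<in> carrier L" using c by (simp add: L.field_Units)
  moreover have "n (inv a) = inv a" if "fixes_gens n" for n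
    using gal_inv[of n a] that f[OF that] c unfolding fixes_gens_def by simp
  ultimately show "inv a \<in> M" unfolding M_def by blast
qed

text \<open>The elements of \<open>E\<close> with image in \<open>M\<close> form a field that
  contains \<open>k\<close>, \<open>z\<close> and \<open>x\<close>; by the generation clause of
  \<open>galois_datum\<close> this is all of \<open>E\<close>.\<close>

lemma E_in_M: "j ` E \<subseteq> M"
proof -
  define T where "T = {e \<in> E. j e \<in> M}"
  note s = subringE[OF subfieldE(1)[OF subfield_M]]
  have M: "j x \<in> M" "j z \<in> M" "a \<in> k \<Longrightarrow> j a \<in> M" for a
    unfolding M_def fixes_gens_def using zL by (auto intro: j_closed kinE gal_fix)
  have "subfield T RT"
  proof (rule subfield_RT)
    show "1 \<in> T" unfolding T_def using Ec s(3) by (simp add: j_1)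
    fix a assume a: "a \<in> T"
    then have a': "a \<in> E" "j a \<in> M" unfolding T_def by simp_all
    show "- a \<in> T" unfolding T_def using Ec(3)[OF a'(1)] s(5)[OF a'(2)] by (simp add: j_minus[OF a'(1)])
    show "inverse a \<in> T" if "a \<noteq> 0"
    proof -
      have i: "inverse a \<in> E" by (rule Ec(6)[OF a'(1)])
      have "j a \<noteq> \<zero>" using j_eq_0[OF a'(1)] that by blast
      moreover have "j a \<otimes> j (inverse a) = \<one>" using j_mult[OF a'(1) i] that by (simp add: j_1)
      then have "inv (j a) = j (inverse a)" by (intro L.comm_inv_char) (simp_all add: j_closed a' i)
      ultimately show ?thesis unfolding T_def using i L.subfield_m_inv(1)[OF subfield_M, of "j a"] a'(2) by simp
    qed
    fix b assume "b \<in> T"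
    then have b': "b \<in> E" "j b \<in> M" unfolding T_def by simp_all
    show "a * b \<in> T" unfolding T_def using Ec(5)[OF a'(1) b'(1)] s(6)[OF a'(2) b'(2)] by (simp add: j_mult[OF a'(1) b'(1)])
    show "a + b \<in> T" unfolding T_def using Ec(4)[OF a'(1) b'(1)] s(7)[OF a'(2) b'(2)] by (simp add: j_add[OF a'(1) b'(1)])
  qed
  then have "E \<subseteq> T" by (rule data(9)) (use M data kinE in \<open>auto simp: T_def\<close>)
  then show ?thesis unfolding T_def by blast
qed

lemma y_in_M: "y \<in> M" unfolding M_def fixes_gens_def using y_closed by simp

lemma M_closed: "a \<in> M \<Longrightarrow> b \<in> M \<Longrightarrow> a \<otimes> b \<in> M" "a \<in> M \<Longrightarrow> a \<in> carrier L"
  using subringE(6)[OF subfieldE(1)[OF subfield_M]] subfieldE(3)[OF subfield_M] by blast+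

text \<open>Each generator goes under \<open>\<sigma>\<close> to a power of \<open>\<zeta>\<close>
  times a generator, or to one of \<open>z\<close>, \<open>z2\<close>. So if \<open>n\<close> fixes
  the generators, its conjugate by \<open>\<sigma>\<close> fixes them too, and hence fixes
  \<open>a\<close>.\<close>

lemma M_stable:
  assumes \<sigma>: "\<sigma> \<in> carrier Gal" and a: "a \<in> M" shows "\<sigma> a \<in> M"
proof -
  have aL: "a \<in> carrier L" by (rule M_closed(2)[OF a])
  have scM: "sc i \<in> M" for i using E_in_M kinE[OF zpow] unfolding sc_def by blast
  have xM: "j x \<in> M" "j z \<in> M" "j z2 \<in> M" using E_in_M data z2E by blast+
  have zM: "\<sigma> (j z) \<in> M" using z_image[OF \<sigma>] xM by auto
  have "\<exists>i w. w \<in> M \<and> \<sigma> (j x) = sc i \<otimes> w" "\<exists>i w. w \<in> M \<and> \<sigma> y = sc i \<otimes> w"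
    using z_image[OF \<sigma>] x_image[OF \<sigma>] y_image[OF \<sigma>] xM y_in_M by blast+
  then have gM: "\<sigma> (j x) \<in> M" "\<sigma> y \<in> M" using M_closed(1) scM by auto
  have "n (\<sigma> a) = \<sigma> a" if n: "fixes_gens n" for n
  proof -
    have nG: "n \<in> carrier Gal" using n unfolding fixes_gens_def by simp
    define m where "m = inv\<^bsub>Gal\<^esub> \<sigma> \<otimes>\<^bsub>Gal\<^esub> (n \<otimes>\<^bsub>Gal\<^esub> \<sigma>)"
    have mG: "m \<in> carrier Gal" unfolding m_def using \<sigma> nG by simp
    have m: "m b = (inv\<^bsub>Gal\<^esub> \<sigma>) (n (\<sigma> b))" if "b \<in> carrier L" for b
      unfolding m_def using \<sigma> nG that by (simp add: app)
    have "m b = b" if "b \<in> carrier L" "\<sigma> b \<in> M" for b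
    proof -
      have "n (\<sigma> b) = \<sigma> b" using that(2) n unfolding M_def by blast
      then show ?thesis unfolding m[OF that(1)] using inv_app(2)[OF \<sigma> that(1)] by simp
    qed
    then have "fixes_gens m" unfolding fixes_gens_def using mG zL y_closed zM gM by simp
    then have "m a = a" using a unfolding M_def by blast
    then have "\<sigma> (m a) = \<sigma> a" by simp
    then show ?thesis unfolding m[OF aL] using inv_app(1)[OF \<sigma>] gal_closed[OF nG gal_closed[OF \<sigma> aL]] by simp
  qed
  then show ?thesis unfolding M_def using gal_closed[OF \<sigma> aL] by blast
qed

text \<open>By stability, every automorphism of \<open>L\<close> restricts to \<open>M\<close>. An
  element of \<open>M\<close> fixed by all automorphisms of \<open>M\<close> is therefore fixed by
  those of \<open>L\<close> and lies in \<open>k\<close>.\<close>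

lemma galois_M: "galois_extension (L\<lparr>carrier := M\<rparr>) (j ` k)"
proof -
  have KM: "j ` k \<subseteq> M" using E_in_M kE(3) by blast
  have sM: "subring M L" by (rule subfieldE(1)[OF subfield_M])
  have fM: "Ring.field (L\<lparr>carrier := M\<rparr>)" by (rule L.subfield_iff(2)[OF subfield_M])
  interpret LM: Ring.field "L\<lparr>carrier := M\<rparr>" by (rule fM)
  have "Ring.field (L\<lparr>carrier := j ` k\<rparr>)" by (rule L.subfield_iff(2)[OF subK])
  then have K: "subfield (j ` k) (L\<lparr>carrier := M\<rparr>)" by (intro LM.subfield_iff(1)) (simp_all add: KM)
  have "subalgebra (j ` k) M L"
  proof (rule subalgebra.intro[OF subring.axioms(1)[OF sM]], unfold_locales)
    fix a b assume "a \<in> j ` k" "b \<in> M"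
    then show "a \<otimes> b \<in> M" using KM M_closed(1) by blast
  qed
  then have "L.finite_dimension (j ` k) M"
    by (rule L.subalbegra_incl_imp_finite_dimension[OF subK finL]) (rule subfieldE(3)[OF subfield_M])
  then obtain n where "L.dimension n (j ` k) M" unfolding L.finite_dimension_def by (elim exE)
  then have "LM.dimension n (j ` k) M" by (rule L.dimension_subring[OF subK KM sM _ subset_refl])
  then have fd: "LM.finite_dimension (j ` k) (carrier (L\<lparr>carrier := M\<rparr>))" by (intro LM.finite_dimensionI) simp
  have "{a \<in> M. \<forall>\<sigma>\<in>carrier (gal_group (L\<lparr>carrier := M\<rparr>) (j ` k)). \<sigma> a = a} = j ` k"
  proof (intro Set.set_eqI iffI)
    fix a assume a: "a \<in> {a \<in> M. \<forall>\<sigma>\<in>carrier (gal_group (L\<lparr>carrier := M\<rparr>) (j ` k)). \<sigma> a = a}"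
    then have aM: "a \<in> M" by simp
    have "\<sigma> a = a" if \<sigma>: "\<sigma> \<in> carrier Gal" for \<sigma>
    proof -
      define \<rho> where "\<rho> = restrict \<sigma> M"
      have "\<rho> \<in> ring_iso (L\<lparr>carrier := M\<rparr>) (L\<lparr>carrier := M\<rparr>)"
      proof (rule ring_iso_memI)
        show "bij_betw \<rho> (carrier (L\<lparr>carrier := M\<rparr>)) (carrier (L\<lparr>carrier := M\<rparr>))"
        proof (rule bij_betw_imageI)
          show "inj_on \<rho> (carrier (L\<lparr>carrier := M\<rparr>))"
            by (rule inj_onI) (use gal_inj[OF \<sigma>] M_closed(2) in \<open>simp add: \<rho>_def\<close>)
          show "\<rho> ` carrier (L\<lparr>carrier := M\<rparr>) = carrier (L\<lparr>carrier := M\<rparr>)"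
          proof (intro Set.set_eqI iffI)
            fix b assume b: "b \<in> carrier (L\<lparr>carrier := M\<rparr>)"
            define c where "c = (inv\<^bsub>Gal\<^esub> \<sigma>) b"
            have "c \<in> M" unfolding c_def using M_stable[of "inv\<^bsub>Gal\<^esub> \<sigma>" b] \<sigma> b by simp
            moreover have "\<sigma> c = b" unfolding c_def using inv_app(1)[OF \<sigma>] b M_closed(2) by simp
            ultimately show "b \<in> \<rho> ` carrier (L\<lparr>carrier := M\<rparr>)" by (intro image_eqI[of _ _ c]) (simp_all add: \<rho>_def)
          qed (auto simp: \<rho>_def intro: M_stable[OF \<sigma>])
        qed
      qed (use \<sigma> M_stable[OF \<sigma>] M_closed subringE(3,7)[OF sM] gal_one[OF \<sigma>] in \<open>auto simp: \<rho>_def gal_mult[OF \<sigma>] gal_add[OF \<sigma>]\<close>)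
      then have "\<rho> \<in> carrier (gal_group (L\<lparr>carrier := M\<rparr>) (j ` k))"
        unfolding gal_group_def using KM gal_fix[OF \<sigma>] by (auto simp: \<rho>_def)
      then have "\<rho> a = a" using a by blast
      then show ?thesis using aM by (simp add: \<rho>_def)
    qed
    then show "a \<in> j ` k" using fixed M_closed(2)[OF aM] by blast
  next
    fix a assume "a \<in> j ` k"
    then show "a \<in> {a \<in> M. \<forall>\<sigma>\<in>carrier (gal_group (L\<lparr>carrier := M\<rparr>) (j ` k)). \<sigma> a = a}"
      using KM gal_groupD(3)[of _ "L\<lparr>carrier := M\<rparr>" "j ` k"] by blast
  qed
  then show ?thesis unfolding galois_extension_def using fM K fd by simp
qed

text \<open>By minimality of the Galois closure, \<open>M\<close> is all of \<open>L\<close>.\<close>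

lemma faithful:
  assumes "\<sigma> \<in> carrier Gal" "\<tau> \<in> carrier Gal" "\<sigma> (j z) = \<tau> (j z)" "\<sigma> (j x) = \<tau> (j x)" "\<sigma> y = \<tau> y"
  shows "\<sigma> = \<tau>"
proof -
  define n where "n = inv\<^bsub>Gal\<^esub> \<tau> \<otimes>\<^bsub>Gal\<^esub> \<sigma>"
  have nG: "n \<in> carrier Gal" unfolding n_def using assms by simp
  have n: "n a = (inv\<^bsub>Gal\<^esub> \<tau>) (\<sigma> a)" if "a \<in> carrier L" for a unfolding n_def using assms that by (simp add: app)
  have "n a = a" if "a \<in> carrier L" "\<sigma> a = \<tau> a" for a unfolding n[OF that(1)] that(2) by (rule inv_app(2)[OF assms(2) that(1)])
  then have fn: "fixes_gens n" unfolding fixes_gens_def using nG zL y_closed assms by simp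
  have full: "M = carrier L" by (rule min[OF subfield_M E_in_M galois_M])
  show ?thesis
  proof (rule gal_group_eqI[OF assms(1,2)])
    fix a assume a: "a \<in> carrier L"
    then have "n a = a" using fn full unfolding M_def by blast
    then have "\<tau> (n a) = \<tau> a" by simp
    then show "\<sigma> a = \<tau> a" unfolding n[OF a] using inv_app(1)[OF assms(2) gal_closed[OF assms(1) a]] by simp
  qed
qed

text \<open>The stabilizer of \<open>z\<close> acts diagonally on the two radicals. The exponents
  matter only modulo \<open>p\<close>, so they are attached by a relation.\<close>

definition act :: "('b \<Rightarrow> 'b) \<Rightarrow> nat \<Rightarrow> nat \<Rightarrow> bool" where
  "act \<sigma> i l \<longleftrightarrow> \<sigma> \<in> carrier Gal \<and> \<sigma> (j z) = j z \<and> \<sigma> (j x) = sc i \<otimes> j x \<and> \<sigma> y = sc l \<otimes> y"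

lemma actD:
  assumes "act \<sigma> i l"
  shows "\<sigma> \<in> carrier Gal" "\<sigma> (j z) = j z" "\<sigma> (j x) = sc i \<otimes> j x" "\<sigma> y = sc l \<otimes> y" "\<sigma> (j z2) = j z2"
  using assms z2_image(1)[of \<sigma>] unfolding act_def by simp_all

lemma act_exists: "\<sigma> \<in> carrier Gal \<Longrightarrow> \<sigma> (j z) = j z \<Longrightarrow> \<exists>i l. act \<sigma> i l"
  using x_image(1)[of \<sigma>] y_image(1)[of \<sigma>] unfolding act_def by blast

lemma gal_sc_mult: "\<sigma> \<in> carrier Gal \<Longrightarrow> w \<in> carrier L \<Longrightarrow> \<sigma> (sc i \<otimes> w) = sc i \<otimes> \<sigma> w"
  by (simp add: gal_mult sc_closed gal_sc)

lemma sc_mult: "w \<in> carrier L \<Longrightarrow> sc i \<otimes> (sc l \<otimes> w) = sc (i + l) \<otimes> w"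
  by (simp add: sc_add sc_closed L.m_assoc)

lemma act_mult:
  assumes \<sigma>: "act \<sigma> i l" and \<rho>: "act \<rho> m n" shows "act (\<sigma> \<otimes>\<^bsub>Gal\<^esub> \<rho>) (i + m) (l + n)"
proof -
  note s = actD[OF \<sigma>] and r = actD[OF \<rho>]
  show ?thesis unfolding act_def
    using zL y_closed s(1) r(1) by (simp add: app r s gal_sc_mult sc_mult add.commute)
qed

lemma act_one: "act \<one>\<^bsub>Gal\<^esub> 0 0"
  unfolding act_def using zL y_closed by (simp add: gal_group_one sc_0)

lemma act_pow: "act \<sigma> i l \<Longrightarrow> act (\<sigma> [^]\<^bsub>Gal\<^esub> (n::nat)) (n * i) (n * l)"
proof (induction n)
  case 0
  then show ?case using act_one by simp
next
  case (Suc n)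
  from act_mult[OF Suc.IH[OF Suc.prems] Suc.prems] show ?case by (simp add: add.commute)
qed

lemma act_eq:
  assumes "act \<sigma> i l" "act \<rho> m n" "i mod p = m mod p" "l mod p = n mod p" shows "\<sigma> = \<rho>"
  using actD[OF assms(1)] actD[OF assms(2)] sc_mod[OF assms(3)] sc_mod[OF assms(4)] by (intro faithful) simp_all

lemma act_cong: "act \<sigma> i l \<Longrightarrow> i mod p = m mod p \<Longrightarrow> l mod p = n mod p \<Longrightarrow> act \<sigma> m n"
  unfolding act_def using sc_mod[of i m] sc_mod[of l n] by simp

lemma act_unique:
  assumes "act \<sigma> i l" "act \<sigma> m n" shows "i mod p = m mod p" "l mod p = n mod p"
proof -
  have "sc i \<otimes> j x = sc m \<otimes> j x" "sc l \<otimes> y = sc n \<otimes> y" using actD[OF assms(1)] actD[OF assms(2)] by simp_all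
  then have "sc i = sc m" "sc l = sc n"
    using L.m_rcancel[OF jx_nz zL(3) sc_closed sc_closed] L.m_rcancel[OF y_nz y_closed sc_closed sc_closed] by simp_all
  then show "i mod p = m mod p" "l mod p = n mod p" unfolding sc_eq_iff .
qed

lemma sc_pow: "sc i [^] (n::nat) = sc (i * n)"
  unfolding sc_def by (simp add: j_pow[OF kinE[OF zpow], symmetric] power_mult)

lemma act_monomial:
  assumes "act \<sigma> i l"
  shows "\<sigma> (j x [^] (m::nat) \<otimes> y [^] (n::nat)) = sc (i * m + l * n) \<otimes> (j x [^] m \<otimes> y [^] n)"
proof -
  note s = actD[OF assms]
  have c: "j x [^] m \<in> carrier L" "y [^] n \<in> carrier L" using zL y_closed by simp_all
  have "\<sigma> (j x [^] m \<otimes> y [^] n) = (sc (i * m) \<otimes> j x [^] m) \<otimes> (sc (l * n) \<otimes> y [^] n)"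
    using zL y_closed c s by (simp add: gal_mult[OF s(1)] gal_pow[OF s(1)] L.nat_pow_distrib sc_closed sc_pow)
  also have "\<dots> = sc (i * m + l * n) \<otimes> (j x [^] m \<otimes> y [^] n)"
    unfolding sc_add using c sc_closed by algebra
  finally show ?thesis .
qed

text \<open>This identifies the fixed field of the stabilizer with \<open>k(z)\<close> explicitly.
  With \<open>w'\<close> the conjugate of \<open>w\<close>, both \<open>w + w'\<close> and
  \<open>(w - w') / (z - z2)\<close> are fixed by the whole group: elements exchanging
  \<open>z\<close> and \<open>z2\<close> also exchange \<open>w\<close> and \<open>w'\<close>. Both
  lie in \<open>k\<close>, and \<open>w\<close> is recovered from them.\<close>

lemma fixed_by_stabilizer:
  assumes w: "w \<in> carrier L" and fx0: "\<forall>\<sigma>\<in>carrier Gal. \<sigma> (j z) = j z \<longrightarrow> \<sigma> w = w"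
  shows "\<exists>s s2. (s, s2) \<in> conj_pairs k z z2 \<and> w = j s"
proof -
  note fx = fx0[rule_format]
  define w' where "w' = \<tau>0 w"
  have w': "w' \<in> carrier L" unfolding w'_def by (rule gal_closed[OF \<tau>0(1) w])
  have it: "inv\<^bsub>Gal\<^esub> \<tau>0 \<in> carrier Gal" using \<tau>0(1) by simp
  have itz: "(inv\<^bsub>Gal\<^esub> \<tau>0) (j z2) = j z" using inv_app(2)[OF \<tau>0(1) zL(1)] \<tau>0(2) by simp
  have sw: "\<sigma> w = w \<and> \<sigma> w' = w'" if \<sigma>: "\<sigma> \<in> carrier Gal" "\<sigma> (j z) = j z" for \<sigma>
  proof -
    define \<rho> where "\<rho> = inv\<^bsub>Gal\<^esub> \<tau>0 \<otimes>\<^bsub>Gal\<^esub> (\<sigma> \<otimes>\<^bsub>Gal\<^esub> \<tau>0)"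
    have \<rho>: "\<rho> \<in> carrier Gal" "\<And>a. a \<in> carrier L \<Longrightarrow> \<rho> a = (inv\<^bsub>Gal\<^esub> \<tau>0) (\<sigma> (\<tau>0 a))"
      unfolding \<rho>_def using \<sigma> \<tau>0(1) it by (simp_all add: app)
    have "\<rho> (j z) = j z" using \<rho>(2)[OF zL(1)] \<tau>0(2) z2_image(1)[OF \<sigma>] itz by simp
    then have "\<rho> w = w" by (rule fx[OF \<rho>(1)])
    then have "\<tau>0 (\<rho> w) = w'" unfolding w'_def by simp
    then have "\<sigma> w' = w'" unfolding \<rho>(2)[OF w] w'_def[symmetric] using inv_app(1)[OF \<tau>0(1) gal_closed[OF \<sigma>(1) w']] by simp
    then show ?thesis using fx[OF \<sigma>] by simp
  qed
  have sw2: "\<sigma> w = w' \<and> \<sigma> w' = w" if \<sigma>: "\<sigma> \<in> carrier Gal" "\<sigma> (j z) = j z2" for \<sigma>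
  proof
    define \<rho> where "\<rho> = inv\<^bsub>Gal\<^esub> \<tau>0 \<otimes>\<^bsub>Gal\<^esub> \<sigma>"
    have \<rho>: "\<rho> \<in> carrier Gal" "\<And>a. a \<in> carrier L \<Longrightarrow> \<rho> a = (inv\<^bsub>Gal\<^esub> \<tau>0) (\<sigma> a)"
      unfolding \<rho>_def using \<sigma> \<tau>0(1) it by (simp_all add: app)
    have "\<rho> w = w" by (rule fx[OF \<rho>(1)]) (simp add: \<rho>(2)[OF zL(1)] \<sigma>(2) itz)
    then have "\<tau>0 (\<rho> w) = w'" unfolding w'_def by simp
    then show "\<sigma> w = w'" unfolding \<rho>(2)[OF w] using inv_app(1)[OF \<tau>0(1) gal_closed[OF \<sigma>(1) w]] by simp
    have "\<sigma> \<otimes>\<^bsub>Gal\<^esub> \<tau>0 \<in> carrier Gal" using \<sigma> \<tau>0 by simp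
    moreover have "(\<sigma> \<otimes>\<^bsub>Gal\<^esub> \<tau>0) (j z) = j z" unfolding app[OF \<sigma>(1) \<tau>0(1) zL(1)] \<tau>0(2) by (rule z2_image(2)[OF \<sigma>])
    ultimately have "(\<sigma> \<otimes>\<^bsub>Gal\<^esub> \<tau>0) w = w" by (rule fx)
    then show "\<sigma> w' = w" unfolding app[OF \<sigma>(1) \<tau>0(1) w] w'_def .
  qed
  define d where "d = j z \<ominus> j z2"
  have d: "d \<in> carrier L" "d \<noteq> \<zero>"
    using zL j_inj[OF data(5) z2E] z_neq by (auto simp: d_def)
  have inv_d: "inv d \<in> carrier L" "inv d \<otimes> d = \<one>" using d by (simp_all add: L.field_Units)
  define b where "b = (w \<ominus> w') \<otimes> inv d"
  have cl: "w \<oplus> w' \<in> carrier L" "b \<in> carrier L" unfolding b_def using w w' inv_d by simp_all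
  have "\<sigma> (w \<oplus> w') = w \<oplus> w' \<and> \<sigma> b = b" if \<sigma>: "\<sigma> \<in> carrier Gal" for \<sigma>
  proof (rule disjE[OF z_image[OF \<sigma>]])
    assume z: "\<sigma> (j z) = j z"
    have "\<sigma> d = d" unfolding d_def L.minus_eq using zL by (simp add: gal_add[OF \<sigma>] gal_minus[OF \<sigma>] z z2_image(1)[OF \<sigma> z])
    then have "\<sigma> (inv d) = inv d" using gal_inv[OF \<sigma> d] by simp
    then show ?thesis unfolding b_def L.minus_eq using w w' inv_d sw[OF \<sigma> z] by (simp add: gal_add[OF \<sigma>] gal_mult[OF \<sigma>] gal_minus[OF \<sigma>])
  next
    assume z: "\<sigma> (j z) = j z2"
    have "\<sigma> d = j z2 \<ominus> j z" unfolding d_def L.minus_eq using zL by (simp add: gal_add[OF \<sigma>] gal_minus[OF \<sigma>] z z2_image(2)[OF \<sigma> z])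
    also have "\<dots> = \<ominus> d" unfolding d_def using zL by algebra
    finally have "\<sigma> (inv d) = inv (\<ominus> d)" using gal_inv[OF \<sigma> d] by simp
    also have "\<dots> = \<ominus> (inv d)"
    proof (rule L.comm_inv_char)
      have "(\<ominus> d) \<otimes> (\<ominus> (inv d)) = inv d \<otimes> d" using d(1) inv_d(1) by algebra
      then show "(\<ominus> d) \<otimes> (\<ominus> (inv d)) = \<one>" using inv_d(2) by simp
    qed (use d inv_d in simp_all)
    finally have "\<sigma> (inv d) = \<ominus> (inv d)" .
    then have "\<sigma> b = (w' \<ominus> w) \<otimes> (\<ominus> (inv d))"
      unfolding b_def L.minus_eq using w w' inv_d sw2[OF \<sigma> z] by (simp add: gal_add[OF \<sigma>] gal_mult[OF \<sigma>] gal_minus[OF \<sigma>])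
    also have "\<dots> = b" unfolding b_def using w w' inv_d(1) by algebra
    finally show ?thesis using w w' sw2[OF \<sigma> z] by (simp add: gal_add[OF \<sigma>] L.a_comm)
  qed
  then have "w \<oplus> w' \<in> j ` k" "b \<in> j ` k" using fixed cl by blast+
  then obtain \<alpha> where \<alpha>: "w \<oplus> w' = j \<alpha>" "\<alpha> \<in> k" by (elim imageE)
  from \<open>b \<in> j ` k\<close> obtain \<beta> where \<beta>: "b = j \<beta>" "\<beta> \<in> k" by (rule imageE)
  \<comment> \<open>\<open>w\<close> is half the sum of \<open>w + w'\<close> and
    \<open>w - w'\<close>, and the latter is \<open>\<beta> (z - z2)\<close>.\<close>
  define s where "s = (\<alpha> + \<beta> * (z - z2)) / 2"
  have zz: "z - z2 \<in> E" by (rule Ec(7)[OF data(5) z2E])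
  have half: "(1 / 2 :: 'w) \<in> E" using Ec(8)[OF Ec(2) Ec(10)[of 2]] by simp
  have "b \<otimes> d = w \<ominus> w'" unfolding b_def using w w' d inv_d by (simp add: L.m_assoc)
  moreover have "j (z - z2) = d" using j_add[OF data(5) Ec(3)[OF z2E]] j_minus[OF z2E] by (simp add: d_def L.minus_eq)
  ultimately have "j (\<alpha> + \<beta> * (z - z2)) = (w \<oplus> w') \<oplus> (w \<ominus> w')"
    using \<alpha> \<beta> by (simp add: j_add j_mult Ec(5) kinE zz)
  also have "\<dots> = w \<oplus> w" using w w' by algebra
  finally have "j (\<alpha> + \<beta> * (z - z2)) = w \<oplus> w" .
  moreover have "j (1 / 2 * (\<alpha> + \<beta> * (z - z2))) = j (1/2) \<otimes> j (\<alpha> + \<beta> * (z - z2))"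
    by (rule j_mult[OF half]) (intro Ec kinE \<alpha> \<beta> zz)
  ultimately have "j s = j (1/2) \<otimes> w \<oplus> j (1/2) \<otimes> w" unfolding s_def using w half j_closed by (simp add: L.r_distr)
  also have "\<dots> = j (1/2 + 1/2) \<otimes> w" unfolding j_add[OF half half] using w half j_closed by (simp add: L.l_distr)
  finally have js: "w = j s" using w by (simp add: j_1)
  have "1 / 2 \<in> k" using kc(8)[OF kc(2) kc(10)[of 2]] by simp
  then have "1 / 2 * (\<alpha> - \<beta> * (z + z2)) \<in> k" by (intro kc(5) kc(7)[OF \<alpha>(2) kc(5)[OF \<beta>(2) data(2)]])
  then have "(s, 1 / 2 * (\<alpha> - \<beta> * (z + z2)) + \<beta> * z2) \<in> conj_pairs k z z2"
    by (rule conj_pairsI[OF _ \<beta>(2)]) (simp_all add: s_def field_simps)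
  then show ?thesis using js by blast
qed

text \<open>
  If the character \<open>(m, n)\<close> kills the stabilizer of \<open>z\<close>, then \<open>x ^ m * y ^ n\<close> lies in \<open>k(z)\<close>, so
  \<open>q ^ m * q2 ^ n\<close> is a \<open>p\<close>-th power there.
\<close>

lemma characters_independent:
  assumes "\<And>\<sigma> i l. act \<sigma> i l \<Longrightarrow> p dvd i * m + l * n" shows "p dvd m \<and> p dvd n"
proof -
  define w where "w = j x [^] m \<otimes> y [^] n"
  have w: "w \<in> carrier L" unfolding w_def using zL y_closed by simp
  have "\<sigma> w = w" if \<sigma>: "\<sigma> \<in> carrier Gal" "\<sigma> (j z) = j z" for \<sigma>
  proof -
    from act_exists[OF \<sigma>] obtain i l where a: "act \<sigma> i l" by (elim exE)
    then have "sc (i * m + l * n) = \<one>" using assms sc_eq_1 by blast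
    then show ?thesis using act_monomial[OF a, of m n] w unfolding w_def by simp
  qed
  then have "\<forall>\<sigma>\<in>carrier Gal. \<sigma> (j z) = j z \<longrightarrow> \<sigma> w = w" by blast
  from fixed_by_stabilizer[OF w this] obtain s s2 where s: "(s, s2) \<in> conj_pairs k z z2" and ws: "w = j s" by (elim exE conjE)
  have sE: "s \<in> E" "q \<in> E" "q2 \<in> E" using pairs_E[OF s] pairs_E[OF data(8)] by simp_all
  have "w [^] p = (j x [^] p) [^] m \<otimes> (y [^] p) [^] n"
    unfolding w_def using zL y_closed by (simp add: L.nat_pow_distrib L.nat_pow_pow mult.commute)
  also have "\<dots> = j (q ^ m * q2 ^ n)" unfolding x_pow y_pow using sE by (simp add: j_mult j_pow Ec(9))
  finally have "j (s ^ p) = j (q ^ m * q2 ^ n)" unfolding ws using sE by (simp add: j_pow)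
  then have "s ^ p = q ^ m * q2 ^ n" by (rule j_inj[rotated -1]) (intro Ec sE)+
  then show ?thesis using data(10)[OF s, of m n] by simp
qed

text \<open>Linear algebra modulo \<open>p\<close>: the exponent pairs form a group annihilated by
  no nontrivial character, so they fill \<open>(Z/p)^2\<close>. Throughout, \<open>p - 1\<close>
  serves as the natural number representing -1.\<close>

lemma exists_act_x: "\<exists>\<sigma>. act \<sigma> 1 0"
proof -
  have np1: "\<not> p dvd 1" using p(1) by (simp add: prime_nat_iff)
  have "\<exists>\<sigma> i l. act \<sigma> i l \<and> \<not> p dvd i * 0 + l * 1" using characters_independent[of 0 1] np1 by blast
  then obtain \<sigma> i l where \<sigma>: "act \<sigma> i l" "\<not> p dvd l" by auto
  \<comment> \<open>The character \<open>(l, - i)\<close> annihilates the pair \<open>(i, l)\<close>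
    of \<open>\<sigma>\<close>, so a pair \<open>(a, b)\<close> on which it is nonzero is
    independent of \<open>(i, l)\<close>. Eliminating the second exponent leaves
    \<open>a l - b i\<close> in the first, up to multiples of \<open>p\<close>.\<close>
  have "\<exists>\<rho> a b. act \<rho> a b \<and> \<not> p dvd a * l + b * ((p - 1) * i)" using characters_independent[of l "(p - 1) * i"] \<sigma>(2) by blast
  then obtain \<rho> a b where \<rho>: "act \<rho> a b" "\<not> p dvd a * l + b * ((p - 1) * i)" by (elim exE conjE)
  define e where "e = l * a + (p - 1) * b * i"
  have e: "\<not> p dvd e" using \<rho>(2) by (simp add: e_def algebra_simps)
  define \<eta> where "\<eta> = \<rho> [^]\<^bsub>Gal\<^esub> l \<otimes>\<^bsub>Gal\<^esub> \<sigma> [^]\<^bsub>Gal\<^esub> ((p - 1) * b)"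
  have "act \<eta> e (l * b + (p - 1) * b * l)"
    unfolding \<eta>_def e_def by (rule act_mult[OF act_pow[OF \<rho>(1)] act_pow[OF \<sigma>(1)]])
  moreover have "l * b + (p - 1) * b * l = p * (b * l)" using p0 by (cases p) (simp_all add: algebra_simps)
  ultimately have \<eta>: "act \<eta> e (p * (b * l))" by simp
  have "gcd e p \<noteq> p" using e gcd_dvd1[of e p] by (intro notI) simp
  then have "gcd e p = 1" using p(1) gcd_dvd2[of e p] unfolding prime_nat_iff by blast
  moreover have "e \<noteq> 0" using e by (intro notI) simp
  ultimately obtain f g where "e * f = p * g + 1" using bezout_nat[of e p] by auto
  then have "f * e mod p = (p * g + 1) mod p" by (simp only: mult.commute)
  then have f: "f * e mod p = 1 mod p" by (simp only: mod_mult_self4)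
  have "act (\<eta> [^]\<^bsub>Gal\<^esub> f) (f * e) (f * (p * (b * l)))" by (rule act_pow[OF \<eta>])
  then have "act (\<eta> [^]\<^bsub>Gal\<^esub> f) 1 0" by (rule act_cong) (use f in \<open>simp_all add: mult.left_commute\<close>)
  then show ?thesis by blast
qed

text \<open>Conjugation by \<open>\<tau>0\<close> exchanges the two radicals up to roots of unity
  and so moves the action from \<open>x\<close> to \<open>y\<close>.\<close>

lemma exists_act_y: "\<exists>\<sigma>. act \<sigma> 0 1"
proof -
  obtain \<sigma> where "act \<sigma> 1 0" using exists_act_x by blast
  note s = actD[OF this]
  have it: "inv\<^bsub>Gal\<^esub> \<tau>0 \<in> carrier Gal" using \<tau>0(1) by simp
  define \<rho> where "\<rho> = \<tau>0 \<otimes>\<^bsub>Gal\<^esub> (\<sigma> \<otimes>\<^bsub>Gal\<^esub> inv\<^bsub>Gal\<^esub> \<tau>0)"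
  have \<rho>: "\<rho> \<in> carrier Gal" "\<And>a. a \<in> carrier L \<Longrightarrow> \<rho> a = \<tau>0 (\<sigma> ((inv\<^bsub>Gal\<^esub> \<tau>0) a))"
    unfolding \<rho>_def using s(1) \<tau>0(1) it by (simp_all add: app gal_closed)
  have itz: "(inv\<^bsub>Gal\<^esub> \<tau>0) (j z) = j z2" using inv_app(2)[OF \<tau>0(1) zL(2)] z2_image(2)[OF \<tau>0] by simp
  have \<tau>y: "(inv\<^bsub>Gal\<^esub> \<tau>0) y = j x" unfolding y_def by (rule inv_app(2)[OF \<tau>0(1) zL(3)])
  obtain i where i: "(inv\<^bsub>Gal\<^esub> \<tau>0) (j x) = sc i \<otimes> y" using x_image(2)[OF it itz] by blast
  have "\<sigma> (sc i \<otimes> y) = sc i \<otimes> y" using gal_sc_mult[OF s(1) y_closed] s(4) y_closed by (simp add: sc_0)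
  then have "\<rho> (j x) = j x" unfolding \<rho>(2)[OF zL(3)] i using inv_app(1)[OF \<tau>0(1) zL(3)] i by simp
  moreover have "\<rho> y = sc 1 \<otimes> y" 
  proof -
    have "\<rho> y = \<tau>0 (sc 1 \<otimes> j x)" unfolding \<rho>(2)[OF y_closed] \<tau>y s(3) ..
    also have "\<dots> = sc 1 \<otimes> y" unfolding y_def by (rule gal_sc_mult[OF \<tau>0(1) zL(3)])
    finally show ?thesis .
  qed
  moreover have "\<rho> (j z) = j z" unfolding \<rho>(2)[OF zL(1)] itz s(5) by (rule z2_image(2)[OF \<tau>0])
  ultimately have "act \<rho> 0 1" unfolding act_def using \<rho>(1) zL by (simp add: sc_0)
  then show ?thesis by blast
qed

text \<open>\<open>\<tau>0\<close> sends \<open>x\<close> to \<open>y\<close> by definition, but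
  \<open>y\<close> to \<open>x\<close> only up to a root of unity \<open>\<zeta> ^ m\<close>.
  Composing it with an element that multiplies \<open>y\<close> by the inverse of this root removes
  the factor.\<close>

lemma exists_involution: "\<exists>\<tau>\<in>carrier Gal. \<tau> (j z) = j z2 \<and> \<tau> (j x) = y \<and> \<tau> y = j x"
proof -
  obtain \<sigma> where \<sigma>: "act \<sigma> 0 1" using exists_act_y by blast
  obtain m where m: "\<tau>0 y = sc m \<otimes> j x" using y_image(2)[OF \<tau>0] by blast
  define \<rho> where "\<rho> = \<sigma> [^]\<^bsub>Gal\<^esub> ((p - 1) * m)"
  have "act \<rho> ((p - 1) * m * 0) ((p - 1) * m * 1)" unfolding \<rho>_def by (rule act_pow[OF \<sigma>])
  note r = actD[OF this]
  define \<tau> where "\<tau> = \<tau>0 \<otimes>\<^bsub>Gal\<^esub> \<rho>"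
  have \<tau>: "\<tau> \<in> carrier Gal" "\<And>a. a \<in> carrier L \<Longrightarrow> \<tau> a = \<tau>0 (\<rho> a)"
    unfolding \<tau>_def using r(1) \<tau>0(1) by (simp_all add: app)
  have "\<tau> (j z) = j z2" using \<tau>(2)[OF zL(1)] r(2) \<tau>0(2) by simp
  moreover have "\<tau> (j x) = y" using \<tau>(2)[OF zL(3)] r(3) zL by (simp add: sc_0 y_def)
  moreover have "\<tau> y = j x"
  proof -
    have "\<tau> y = sc ((p - 1) * m + m) \<otimes> j x"
      using \<tau>(2)[OF y_closed] r(4) gal_sc_mult[OF \<tau>0(1) y_closed] m sc_mult[OF zL(3)] by simp
    moreover have "(p - 1) * m + m = p * m" using p0 by (cases p) simp_all
    ultimately show ?thesis using sc_eq_1[of "p * m"] zL by simp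
  qed
  ultimately show ?thesis using \<tau>(1) by blast
qed

end

section \<open>Groups with a central rotation\<close>

lemma (in group) pow_mod_order:
  assumes "x \<in> carrier G" "x [^] (p::nat) = \<one>" shows "x [^] (i mod int p) = x [^] (i::int)"
proof -
  have "x [^] i = x [^] (int p * (i div int p) + i mod int p)" by simp
  also have "\<dots> = (x [^] int p) [^] (i div int p) \<otimes> x [^] (i mod int p)"
    using assms(1) by (simp only: int_pow_mult int_pow_pow)
  also have "\<dots> = x [^] (i mod int p)" using assms by (simp add: int_pow_int)
  finally show ?thesis by simp
qed

text \<open>Recognition by generators: \<open>c\<close> is central, and \<open>r\<close> and
  \<open>t\<close> satisfy the dihedral relations. The hypothesis \<open>inj\<close> makes the
  normal forms in \<open>c\<close> and \<open>r\<close> unique, \<open>nt\<close> keeps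
  \<open>t\<close> outside of them, and \<open>surj\<close> provides a normal form for each
  element.\<close>

lemma (in group) iso_cyclic_times_dihedral:
  assumes c: "c \<in> carrier G" and r: "r \<in> carrier G" and t: "t \<in> carrier G" and p: "p > 0"
    and ord: "c [^] (p::nat) = \<one>" "r [^] p = \<one>" "t \<otimes> t = \<one>"
    and comm: "c \<otimes> r = r \<otimes> c" "c \<otimes> t = t \<otimes> c" "r \<otimes> (t \<otimes> r) = t"
    and inj: "\<And>(a::nat) (b::nat). c [^] a \<otimes> r [^] b = \<one> \<Longrightarrow> p dvd a \<and> p dvd b" and nt: "\<And>(a::nat) (b::nat). c [^] a \<otimes> r [^] b \<noteq> t"
    and surj: "\<And>g. g \<in> carrier G \<Longrightarrow> \<exists>(a::nat) (b::nat). g = c [^] a \<otimes> r [^] b \<or> g = c [^] a \<otimes> r [^] b \<otimes> t"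
  shows "G \<cong> integer_mod_group p \<times>\<times> dihedral_group p"
proof -
  define T where "T s = (if s then t else \<one>)" for s
  have T: "T s \<in> carrier G" "T s \<otimes> T u = T (s \<noteq> u)" for s u using t ord by (auto simp: T_def)
  define R where "R a b = c [^] (a::int) \<otimes> r [^] (b::int)" for a b
  have R: "R a b \<in> carrier G" for a b unfolding R_def using c r by simp
  \<comment> \<open>The model uses integer exponents and the hypotheses natural ones; since both
    orders divide \<open>p\<close>, every exponent can be replaced by its residue.\<close>
  have nat: "c [^] (a::int) = c [^] (nat (a mod int p))" "r [^] a = r [^] (nat (a mod int p))" for a
    using pow_mod_order[OF c ord(1), of a] pow_mod_order[OF r ord(2), of a] int_pow_int[of G c "nat (a mod int p)"] int_pow_int[of G r "nat (a mod int p)"] p by simp_all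
  have comm_pow: "v \<otimes> u [^] (n::nat) = u [^] n \<otimes> v" if "u \<otimes> v = v \<otimes> u" "u \<in> carrier G" "v \<in> carrier G" for u v n
    by (rule group_commutes_pow[OF that, symmetric])
  have cr: "c [^] (a::int) \<otimes> r [^] (b::int) = r [^] b \<otimes> c [^] a" for a b
    unfolding nat using c r by (intro comm_pow comm_pow[symmetric] comm(1)[symmetric]) simp_all
  have Rm: "R a b \<otimes> R a' b' = R (a + a') (b + b')" for a b a' b'
  proof -
    have "R a b \<otimes> R a' b' = c [^] a \<otimes> (r [^] b \<otimes> c [^] a') \<otimes> r [^] b'" unfolding R_def using c r by (simp add: m_assoc)
    also have "r [^] b \<otimes> c [^] a' = c [^] a' \<otimes> r [^] b" by (simp add: cr)
    also have "c [^] a \<otimes> (c [^] a' \<otimes> r [^] b) \<otimes> r [^] b' = (c [^] a \<otimes> c [^] a') \<otimes> (r [^] b \<otimes> r [^] b')" using c r by (simp add: m_assoc)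
    finally show ?thesis unfolding R_def using c r by (simp add: int_pow_mult)
  qed
  have R0: "R 0 0 = \<one>" by (simp add: R_def)
  have Rmod: "R (a mod int p) (b mod int p) = R a b" for a b
    unfolding R_def by (simp add: pow_mod_order[OF c ord(1)] pow_mod_order[OF r ord(2)])
  have Rinj: "int p dvd a \<and> int p dvd b" if "R a b = \<one>" for a b
  proof -
    have "c [^] (int (nat (a mod int p))) \<otimes> r [^] (int (nat (b mod int p))) = \<one>"
      using that p unfolding Rmod[of a b, symmetric] by (simp add: R_def)
    then have "p dvd nat (a mod int p)" "p dvd nat (b mod int p)" using inj unfolding int_pow_int by blast+
    moreover have "nat (e mod int p) = 0" if "p dvd nat (e mod int p)" for e
    proof (rule ccontr)
      assume "nat (e mod int p) \<noteq> 0"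
      then have "p \<le> nat (e mod int p)" using that by (intro dvd_imp_le) simp_all
      moreover have "nat (e mod int p) < p" using p by (simp add: nat_less_iff)
      ultimately show False by simp
    qed
    ultimately have "nat (a mod int p) = 0" "nat (b mod int p) = 0" by blast+
    moreover have "a mod int p \<ge> 0" "b mod int p \<ge> 0" using p by simp_all
    ultimately show ?thesis by (simp add: dvd_eq_mod_eq_0)
  qed
  have Rnt: "R a b \<noteq> t" for a b
  proof -
    have "R a b = c [^] (int (nat (a mod int p))) \<otimes> r [^] (int (nat (b mod int p)))"
      using p unfolding Rmod[of a b, symmetric] by (simp add: R_def)
    then show ?thesis using nt unfolding int_pow_int by simp
  qed
  have tc: "t \<otimes> c [^] (a::int) = c [^] a \<otimes> t" for a
    unfolding nat by (rule comm_pow[OF comm(2) c t])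
  have tr1: "t \<otimes> r = inv r \<otimes> t"
  proof -
    have "inv r \<otimes> (r \<otimes> (t \<otimes> r)) = inv r \<otimes> t" using comm(3) by simp
    then show ?thesis using r t by (simp add: m_assoc[symmetric])
  qed
  have trn: "t \<otimes> r [^] (n::nat) = inv (r [^] n) \<otimes> t" for n
  proof (induction n)
    case (Suc n)
    have "t \<otimes> r [^] Suc n = (t \<otimes> r) \<otimes> r [^] n" using t r by (simp only: nat_pow_Suc2 m_assoc nat_pow_closed)
    also have "\<dots> = inv r \<otimes> (t \<otimes> r [^] n)" unfolding tr1 using t r by (simp add: m_assoc)
    also have "\<dots> = inv r \<otimes> inv (r [^] n) \<otimes> t" unfolding Suc using t r by (simp add: m_assoc)
    also have "inv r \<otimes> inv (r [^] n) = inv (r [^] Suc n)" using r by (simp add: inv_mult_group)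
    finally show ?case .
  qed (use t in simp)
  \<comment> \<open>Nonnegative \<open>b\<close> suffices, since the carrier of the dihedral group
    consists of the residues from 0 to \<open>p - 1\<close>.\<close>
  have TR: "T s \<otimes> R a b = R a (if s then - b else b) \<otimes> T s" if b: "b \<ge> 0" for s a b
  proof (cases s)
    case True
    obtain n where n: "b = int n" using b by (rule nonneg_int_cases)
    have "t \<otimes> R a b = (t \<otimes> c [^] a) \<otimes> r [^] b" unfolding R_def using t c r by (simp add: m_assoc)
    also have "\<dots> = c [^] a \<otimes> (t \<otimes> r [^] n)" unfolding tc n using t c r by (simp add: m_assoc int_pow_int)
    also have "\<dots> = R a (- b) \<otimes> t" unfolding trn R_def n using t c r by (simp add: m_assoc int_pow_neg int_pow_int)
    finally show ?thesis using True by (simp add: T_def)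
  next
    case False
    then show ?thesis using R[of a b] by (simp add: T_def)
  qed
  define \<phi> where "\<phi> = (\<lambda>(a, i, s). R a i \<otimes> T s)"
  let ?P = "integer_mod_group p \<times>\<times> dihedral_group p"
  have cP: "carrier ?P = {0..<int p} \<times> ({0..<int p} \<times> UNIV)"
    using p by (simp add: carrier_integer_mod_group dihedral_group_def)
  have mP: "(a, i, s) \<otimes>\<^bsub>?P\<^esub> (a', i', s') = ((a + a') mod int p, (if s then i - i' else i + i') mod int p, s \<noteq> s')" for a i s a' i' s'
    by (simp add: dihedral_group_def)
  have hom: "\<phi> (u \<otimes>\<^bsub>?P\<^esub> v) = \<phi> u \<otimes> \<phi> v" if uv: "u \<in> carrier ?P" "v \<in> carrier ?P" for u v
  proof -
    obtain a i s where u: "u = (a, i, s)" by (cases u) auto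
    obtain a' i' s' where v: "v = (a', i', s')" by (cases v) auto
    have i': "i' \<ge> 0" using uv(2) unfolding cP v by simp
    have "\<phi> u \<otimes> \<phi> v = R a i \<otimes> (T s \<otimes> R a' i') \<otimes> T s'" unfolding \<phi>_def u v using R T by (simp add: m_assoc)
    also have "\<dots> = (R a i \<otimes> R a' (if s then - i' else i')) \<otimes> (T s \<otimes> T s')" unfolding TR[OF i'] using R T by (simp add: m_assoc)
    also have "\<dots> = R (a + a') (if s then i - i' else i + i') \<otimes> T (s \<noteq> s')" unfolding Rm T by simp
    also have "\<dots> = \<phi> (u \<otimes>\<^bsub>?P\<^esub> v)" unfolding u v mP \<phi>_def by (simp add: Rmod)
    finally show ?thesis by simp
  qed
  have bij: "bij_betw \<phi> (carrier ?P) (carrier G)"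
  proof (rule bij_betw_imageI)
    show "inj_on \<phi> (carrier ?P)"
    proof (rule inj_onI)
      fix u v assume uv: "u \<in> carrier ?P" "v \<in> carrier ?P" and eq: "\<phi> u = \<phi> v"
      obtain a i s where u: "u = (a, i, s)" by (cases u) auto
      obtain a' i' s' where v: "v = (a', i', s')" by (cases v) auto
      have "R a i \<otimes> T s = R a' i' \<otimes> T s'" using eq unfolding \<phi>_def u v by simp
      then have "R (- a') (- i') \<otimes> (R a i \<otimes> T s) \<otimes> T s = R (- a') (- i') \<otimes> (R a' i' \<otimes> T s') \<otimes> T s" by simp
      then have "(R (- a') (- i') \<otimes> R a i) \<otimes> (T s \<otimes> T s) = (R (- a') (- i') \<otimes> R a' i') \<otimes> (T s' \<otimes> T s)" using R T(1) by (simp add: m_assoc)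
      then have e: "R (a - a') (i - i') = T (s' \<noteq> s)" unfolding Rm T(2) using R R0 T(1) by (simp add: T_def[of False])
      then have ss: "s' = s" using Rnt by (cases "s' = s") (auto simp: T_def)
      then have "int p dvd a - a' \<and> int p dvd i - i'" using Rinj e by (simp add: T_def)
      then have "a mod int p = a' mod int p" "i mod int p = i' mod int p" by (simp_all add: mod_eq_dvd_iff)
      then show "u = v" using uv ss unfolding u v cP by simp
    qed
    show "\<phi> ` carrier ?P = carrier G"
    proof (intro Set.set_eqI iffI)
      fix g assume "g \<in> \<phi> ` carrier ?P"
      then show "g \<in> carrier G" using R T by (auto simp: \<phi>_def)
    next
      fix g assume "g \<in> carrier G"
      from surj[OF this] obtain a b :: nat where "g = c [^] a \<otimes> r [^] b \<or> g = c [^] a \<otimes> r [^] b \<otimes> t" by (elim exE)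
      then have "g = R (int a) (int b) \<otimes> T False \<or> g = R (int a) (int b) \<otimes> T True"
        using c r by (simp add: R_def T_def int_pow_int)
      then have "\<exists>s. g = R (int a) (int b) \<otimes> T s" by (elim disjE) (rule exI, assumption)+
      then obtain s where "g = R (int a) (int b) \<otimes> T s" by (elim exE)
      then have "g = \<phi> (int a mod int p, int b mod int p, s)" by (simp add: \<phi>_def Rmod)
      moreover have "(int a mod int p, int b mod int p, s) \<in> carrier ?P" unfolding cP using p by simp
      ultimately show "g \<in> \<phi> ` carrier ?P" by blast
    qed
  qed
  let ?i = "inv_into (carrier ?P) \<phi>"
  have "?i \<in> iso G ?P"
    unfolding Group.iso_def
  proof (intro CollectI conjI homI)
    show "bij_betw ?i (carrier G) (carrier ?P)" by (rule bij_betw_inv_into[OF bij])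
    fix g h assume g: "g \<in> carrier G" and h: "h \<in> carrier G"
    have ig: "?i g \<in> carrier ?P" "\<phi> (?i g) = g" "?i h \<in> carrier ?P" "\<phi> (?i h) = h"
      using g h bij unfolding bij_betw_def by (auto intro: inv_into_into f_inv_into_f)
    then show "?i g \<in> carrier ?P" by simp
    show "?i (g \<otimes> h) = ?i g \<otimes>\<^bsub>?P\<^esub> ?i h"
    proof (rule inv_into_f_eq)
      show "inj_on \<phi> (carrier ?P)" using bij by (rule bij_betw_imp_inj_on)
      show "\<phi> (?i g \<otimes>\<^bsub>?P\<^esub> ?i h) = g \<otimes> h" using hom ig by simp
      obtain a i s a' i' s' where e: "?i g = (a, i, s)" "?i h = (a', i', s')" by (cases "?i g"; cases "?i h") auto
      show "?i g \<otimes>\<^bsub>?P\<^esub> ?i h \<in> carrier ?P" unfolding e mP unfolding cP using p by simp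
    qed
  qed
  then show ?thesis by (rule is_isoI)
qed

text \<open>\<open>c\<close> is the diagonal and \<open>r\<close> the antidiagonal of the two Kummer
  factors. The involution exchanging the factors commutes with \<open>c\<close> and inverts
  \<open>r\<close>; halving modulo the odd \<open>p\<close> expresses every exponent pair through
  \<open>c\<close> and \<open>r\<close>.\<close>

theorem (in dihedral_galois) gal_iso_dihedral: "Gal \<cong> integer_mod_group p \<times>\<times> dihedral_group p"
proof -
  from exists_swap obtain \<tau>0 where \<tau>0: "\<tau>0 \<in> carrier Gal" "\<tau>0 (j z) = j z2" by (rule bexE)
  interpret dihedral_galois_swap L k E j p z z2 x q q2 \<zeta> \<tau>0 by unfold_locales (rule \<tau>0)+
  obtain s1 where s1: "act s1 1 0" using exists_act_x by (elim exE)
  obtain s2 where s2: "act s2 0 1" using exists_act_y by (elim exE)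
  obtain t where t: "t \<in> carrier Gal" "t (j z) = j z2" "t (j x) = y" "t y = j x" using exists_involution by (elim bexE conjE)
  define c where "c = s1 \<otimes>\<^bsub>Gal\<^esub> s2"
  define r where "r = s1 \<otimes>\<^bsub>Gal\<^esub> s2 [^]\<^bsub>Gal\<^esub> (p - 1)"
  have c: "act c 1 1" unfolding c_def using act_mult[OF s1 s2] by simp
  have r: "act r 1 (p - 1)" unfolding r_def using act_mult[OF s1 act_pow[OF s2, of "p - 1"]] by simp
  note cD = actD[OF c] and rD = actD[OF r]
  have cr: "act (c [^]\<^bsub>Gal\<^esub> a \<otimes>\<^bsub>Gal\<^esub> r [^]\<^bsub>Gal\<^esub> b) (a + b) (a + b * (p - 1))" for a b :: nat
    using act_mult[OF act_pow[OF c, of a] act_pow[OF r, of b]] by simp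
  obtain n where pn: "p = 2 * n + 1" using p(2) by (rule oddE)
  have g1: "\<exists>(a::nat) (b::nat). g = c [^]\<^bsub>Gal\<^esub> a \<otimes>\<^bsub>Gal\<^esub> r [^]\<^bsub>Gal\<^esub> b" if g: "g \<in> carrier Gal" "g (j z) = j z" for g
  proof -
    from act_exists[OF g] obtain i l where a: "act g i l" by (elim exE)
    \<comment> \<open>As \<open>p = 2 n + 1\<close>, the number \<open>n + 1\<close> is the inverse
      of 2 modulo \<open>p\<close>. So \<open>u\<close> and \<open>v\<close> are half the sum and
      half the difference of the exponents \<open>i\<close> and \<open>l\<close>.\<close>
    define u where "u = (i + l) * (n + 1)"
    define v where "v = (i + l * (p - 1)) * (n + 1)"
    have "u + v = i + p * (i + l * (n + 1))" by (simp add: u_def v_def pn algebra_simps)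
    then have 1: "i mod p = (u + v) mod p" by simp
    have "u + v * (p - 1) = l + p * (i * (n + 1) + l * (2 * n * n + n))" by (simp add: u_def v_def pn algebra_simps)
    then have 2: "l mod p = (u + v * (p - 1)) mod p" by simp
    have "g = c [^]\<^bsub>Gal\<^esub> u \<otimes>\<^bsub>Gal\<^esub> r [^]\<^bsub>Gal\<^esub> v" by (rule act_eq[OF a cr 1 2])
    then show ?thesis by blast
  qed
  show ?thesis
  proof (rule Gal.iso_cyclic_times_dihedral[OF cD(1) rD(1) t(1) p0])
    show "c [^]\<^bsub>Gal\<^esub> p = \<one>\<^bsub>Gal\<^esub>" by (rule act_eq[OF act_pow[OF c] act_one]) simp_all
    show "r [^]\<^bsub>Gal\<^esub> p = \<one>\<^bsub>Gal\<^esub>" by (rule act_eq[OF act_pow[OF r] act_one]) simp_all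
    show tt: "t \<otimes>\<^bsub>Gal\<^esub> t = \<one>\<^bsub>Gal\<^esub>"
      by (rule faithful) (use t zL y_closed in \<open>simp_all add: app gal_group_one z2_image(2)[OF t(1,2)]\<close>)
    show "c \<otimes>\<^bsub>Gal\<^esub> r = r \<otimes>\<^bsub>Gal\<^esub> c" by (rule act_eq[OF act_mult[OF c r] act_mult[OF r c]]) simp_all
    show "c \<otimes>\<^bsub>Gal\<^esub> t = t \<otimes>\<^bsub>Gal\<^esub> c"
      by (rule faithful) (use t cD zL y_closed in \<open>simp_all add: app gal_sc_mult\<close>)
    show "r \<otimes>\<^bsub>Gal\<^esub> (t \<otimes>\<^bsub>Gal\<^esub> r) = t"
    proof (rule faithful)
      have "sc p = \<one>" unfolding sc_eq_1 by simp
      then show "(r \<otimes>\<^bsub>Gal\<^esub> (t \<otimes>\<^bsub>Gal\<^esub> r)) (j x) = t (j x)" "(r \<otimes>\<^bsub>Gal\<^esub> (t \<otimes>\<^bsub>Gal\<^esub> r)) y = t y"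
        using t rD zL y_closed p0 by (simp_all add: app gal_sc_mult sc_mult)
    qed (use t rD zL in \<open>simp_all add: app\<close>)
    show "p dvd a \<and> p dvd b" if "c [^]\<^bsub>Gal\<^esub> a \<otimes>\<^bsub>Gal\<^esub> r [^]\<^bsub>Gal\<^esub> b = \<one>\<^bsub>Gal\<^esub>" for a b :: nat
    proof -
      from act_unique[OF cr[of a b, unfolded that] act_one] have d: "p dvd a + b" "p dvd a + b * (p - 1)" by (simp_all add: dvd_eq_mod_eq_0)
      then have "p dvd (a + b) + (a + b * (p - 1))" by (rule dvd_add)
      also have "(a + b) + (a + b * (p - 1)) = 2 * a + p * b" using p0 by (cases p) simp_all
      finally have "p dvd 2 * a" by (simp add: dvd_add_left_iff)
      moreover have "\<not> p dvd 2"
      proof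
        assume "p dvd 2"
        then have "p \<le> 2" by (rule dvd_imp_le) simp
        then show False using prime_ge_2_nat[OF p(1)] p(2) by (cases "p = 2") simp_all
      qed
      ultimately have a: "p dvd a" using prime_dvd_multD[OF p(1), of 2 a] by simp
      then show ?thesis using d(1) by (simp add: dvd_add_right_iff)
    qed
    show "c [^]\<^bsub>Gal\<^esub> a \<otimes>\<^bsub>Gal\<^esub> r [^]\<^bsub>Gal\<^esub> b \<noteq> t" for a b :: nat
    proof
      assume "c [^]\<^bsub>Gal\<^esub> a \<otimes>\<^bsub>Gal\<^esub> r [^]\<^bsub>Gal\<^esub> b = t"
      then have "t (j z) = j z" using actD(2)[OF cr[of a b]] by simp
      then show False using t(2) j_inj[OF data(5) z2E] z_neq by simp
    qed
    fix g assume g: "g \<in> carrier Gal"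
    show "\<exists>(a::nat) (b::nat). g = c [^]\<^bsub>Gal\<^esub> a \<otimes>\<^bsub>Gal\<^esub> r [^]\<^bsub>Gal\<^esub> b \<or> g = c [^]\<^bsub>Gal\<^esub> a \<otimes>\<^bsub>Gal\<^esub> r [^]\<^bsub>Gal\<^esub> b \<otimes>\<^bsub>Gal\<^esub> t"
    proof (rule disjE[OF z_image[OF g]])
      assume "g (j z) = j z"
      then show ?thesis using g1[OF g] by blast
    next
      assume z: "g (j z) = j z2"
      have gt: "g \<otimes>\<^bsub>Gal\<^esub> t \<in> carrier Gal" using g t by simp
      have "(g \<otimes>\<^bsub>Gal\<^esub> t) (j z) = j z" unfolding app[OF g t(1) zL(1)] t(2) by (rule z2_image(2)[OF g z])
      from g1[OF gt this] obtain a b :: nat where "g \<otimes>\<^bsub>Gal\<^esub> t = c [^]\<^bsub>Gal\<^esub> a \<otimes>\<^bsub>Gal\<^esub> r [^]\<^bsub>Gal\<^esub> b" by (elim exE)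
      then have e1: "(g \<otimes>\<^bsub>Gal\<^esub> t) \<otimes>\<^bsub>Gal\<^esub> t = c [^]\<^bsub>Gal\<^esub> a \<otimes>\<^bsub>Gal\<^esub> r [^]\<^bsub>Gal\<^esub> b \<otimes>\<^bsub>Gal\<^esub> t" by simp
      have e2: "(g \<otimes>\<^bsub>Gal\<^esub> t) \<otimes>\<^bsub>Gal\<^esub> t = g"
      proof -
        have "t \<otimes>\<^bsub>Gal\<^esub> t = \<one>\<^bsub>Gal\<^esub>"
          by (rule faithful) (use t zL y_closed in \<open>simp_all add: app gal_group_one z2_image(2)[OF t(1,2)]\<close>)
        then show ?thesis using g t by (simp add: Gal.m_assoc)
      qed
      show ?thesis by (intro exI disjI2) (rule trans[OF sym[OF e2] e1])
    qed
  qed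
qed

section \<open>Degree two morphisms of the line\<close>

lemma eval2_poly_1:
  assumes h: "comm_ring_hom h" shows "poly (map_poly h g) 1 = h (poly g 1)"
proof -
  interpret h: comm_ring_hom h by (rule h)
  show ?thesis by (induction g) (simp_all add: poly_map_pCons[OF h] h.hom_add h.hom_mult h.hom_zero)
qed

text \<open>Dehomogenisation: numerator and denominator have equal degree, so the powers of the
  second coordinate cancel.\<close>

lemma rat2_eq_rat1:
  fixes h :: "'a::field \<Rightarrow> 'w::field"
  assumes h: "comm_ring_hom h" and w: "w $ 2 \<noteq> 0" shows "rat2 h w = rat1 h (w $ 1 / w $ 2)"
proof
  interpret h: comm_ring_hom h by (rule h)
  let ?v = "w $ 1 / w $ 2"
  define d where "d a = map_poly (\<lambda>g. poly g 1) a" for a :: "'a form2"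
  define u where "u = (\<chi> i::2. if i = 1 then ?v else 1)"
  have wu: "w = w $ 2 *s u" unfolding Finite_Cartesian_Product.vec_eq_iff forall_2 u_def using w by simp
  have "eval2 h a u = pev h ?v (d a)" for a
  proof -
    have "map_poly (\<lambda>g. poly (map_poly h g) (u $ 2)) a = map_poly h (d a)"
      unfolding d_def by (subst map_poly_map_poly) (simp_all add: h.hom_zero u_def eval2_poly_1[OF h] o_def)
    then show ?thesis unfolding eval2_def pev_def by (simp add: u_def)
  qed
  then have ev: "eval2 h a w = w $ 2 ^ n * pev h ?v (d a)" if "homog2 n a" for n a
    by (subst wu) (simp add: homog2_scale[OF h that])
  show "rat2 h w \<subseteq> rat1 h ?v"
  proof
    fix y assume "y \<in> rat2 h w"
    then obtain n a b where 1: "homog2 n a" "homog2 n b" "eval2 h b w \<noteq> 0" "y = eval2 h a w / eval2 h b w" by (rule rat2E)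
    have "y = pev h ?v (d a) / pev h ?v (d b)" unfolding 1(4) ev[OF 1(1)] ev[OF 1(2)] using w by simp
    moreover have "pev h ?v (d b) \<noteq> 0" using 1(3) unfolding ev[OF 1(2)] by simp
    ultimately show "y \<in> rat1 h ?v" using rat1I by simp
  qed
  have "eval2 h (vars2 $ 1) w / eval2 h (vars2 $ 2) w \<in> rat2 h w"
    by (rule rat2I[of "Suc 0"]) (simp_all add: h w)
  then show "rat1 h ?v \<subseteq> rat2 h w"
    using rat2_closed(1)[OF h] by (intro rat1_subset[OF h subfield_rat2[OF h]]) (auto simp: h)
qed

lemma rat2_scale:
  fixes h :: "'a::field \<Rightarrow> 'w::field"
  assumes h: "comm_ring_hom h" and c: "c \<noteq> 0" shows "rat2 h (c *s w) = rat2 h w"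
proof -
  have sub: "rat2 h (c *s w) \<subseteq> rat2 h w" if c: "c \<noteq> 0" for c and w :: "'w ^ 2"
  proof
    fix y assume "y \<in> rat2 h (c *s w)"
    then obtain n a b where 1: "homog2 n a" "homog2 n b" "eval2 h b (c *s w) \<noteq> 0" "y = eval2 h a (c *s w) / eval2 h b (c *s w)" by (rule rat2E)
    note s = homog2_scale[OF h 1(1)] homog2_scale[OF h 1(2)]
    have "eval2 h b w \<noteq> 0" using 1(3) unfolding s by simp
    moreover have "y = eval2 h a w / eval2 h b w" unfolding 1(4) s using c by simp
    ultimately show "y \<in> rat2 h w" using rat2I[OF 1(1,2)] by simp
  qed
  have "inverse c *s (c *s w) = w" using c by (simp add: vector_smult_assoc)
  then show ?thesis using sub[OF c, of w] sub[of "inverse c" "c *s w"] c by (intro Set.equalityI) simp_all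
qed

section \<open>The function field of the line as a field of values\<close>

definition fract_val :: "('x::idom \<Rightarrow> 'w::field) \<Rightarrow> 'x fract \<Rightarrow> 'w" where
  "fract_val e q = (THE v. \<exists>a b. b \<noteq> 0 \<and> q = Fract a b \<and> v = e a / e b)"

context
  fixes e :: "'x::idom \<Rightarrow> 'w::field"
  assumes e: "comm_ring_hom e" and inj0: "\<forall>a. e a = 0 \<longrightarrow> a = 0"
begin

lemmas inj = inj0[rule_format]

interpretation e: comm_ring_hom e by (rule e)

lemma fract_val_Fract: "b \<noteq> 0 \<Longrightarrow> fract_val e (Fract a b) = e a / e b"
  unfolding fract_val_def
proof (rule the_equality)
  fix v assume b: "b \<noteq> 0" and "\<exists>a' b'. b' \<noteq> 0 \<and> Fract a b = Fract a' b' \<and> v = e a' / e b'"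
  then obtain a' b' where 1: "b' \<noteq> 0" "Fract a b = Fract a' b'" "v = e a' / e b'" by (elim exE conjE)
  then have "a * b' = a' * b" using b by (simp add: eq_fract)
  then have "e a * e b' = e a' * e b" by (simp add: e.hom_mult[symmetric])
  moreover have "e b \<noteq> 0" "e b' \<noteq> 0" using inj b 1 by auto
  ultimately show "v = e a / e b" unfolding 1(3) by (simp add: frac_eq_eq)
qed blast

lemma comm_ring_hom_fract_val: "comm_ring_hom (fract_val e)"
proof (rule comm_ring_hom_I)
  fix q r :: "'x fract"
  obtain a b where q: "q = Fract a b" "b \<noteq> 0" by (cases q) auto
  obtain c d where r: "r = Fract c d" "d \<noteq> 0" by (cases r) auto
  have nz: "e b \<noteq> 0" "e d \<noteq> 0" using inj q r by auto
  show "fract_val e (q + r) = fract_val e q + fract_val e r" "fract_val e (q * r) = fract_val e q * fract_val e r"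
    using q r nz by (simp_all add: fract_val_Fract e.hom_add e.hom_mult add_frac_eq)
next
  show "fract_val e 1 = 1" unfolding One_fract_def by (simp add: fract_val_Fract e.hom_one)
qed

lemma fract_val_eq_0: "fract_val e q = 0 \<Longrightarrow> q = 0"
proof -
  obtain a b where q: "q = Fract a b" "b \<noteq> 0" by (cases q) auto
  moreover have "e b \<noteq> 0" using inj q by auto
  moreover assume "fract_val e q = 0"
  ultimately have "a = 0" using inj by (simp add: fract_val_Fract)
  then show ?thesis unfolding q by (simp add: fract_collapse)
qed

end

lemma subfield_preimage:
  fixes \<theta> :: "'x::field \<Rightarrow> 'w::field"
  assumes \<theta>: "comm_ring_hom \<theta>" and S: "subfield S RT" shows "subfield {q. \<theta> q \<in> S} RT"
proof -
  interpret t: comm_ring_hom \<theta> by (rule \<theta>)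
  note c = subfield_RT_closed[OF S]
  show ?thesis
  proof (rule subfield_RT)
    fix x assume x: "x \<in> {q. \<theta> q \<in> S}" "x \<noteq> 0"
    have "\<theta> x * \<theta> (inverse x) = 1" using x by (simp add: t.hom_mult[symmetric] t.hom_one)
    then have "\<theta> (inverse x) = inverse (\<theta> x)" by (rule inverse_unique[symmetric])
    then show "inverse x \<in> {q. \<theta> q \<in> S}" using x c by simp
  qed (simp_all add: t.hom_one t.hom_uminus t.hom_mult t.hom_add c)
qed

text \<open>Evaluation \<open>\<theta>\<close> at the generic \<open>w\<close> identifies
  \<open>line_field\<close> with \<open>rat2 h w\<close> and the pullback field with
  \<open>k\<close>. In dimension two the powers 1, \<open>z\<close>, \<open>z\<^sup>2\<close> are
  dependent, and \<open>z\<close> in \<open>k\<close> would make the dimension one, as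
  \<open>z\<close> generates the field.\<close>

lemma line_morphism_degree_two:
  fixes h :: "'a::field \<Rightarrow> 'w::field" and f :: "'a form2 ^ 2"
  assumes h: "comm_ring_hom h" and gen0: "\<forall>b. eval2 h b w = 0 \<longrightarrow> b = 0"
    and f: "\<And>i. homog2 n (f $ i)" and deg: "line_morphism_degree f 2"
    and z: "z \<in> rat2 h w" "rat2 h w \<subseteq> rat1 h z"
    and k: "k = rat2 h (\<chi> i. eval2 h (f $ i) w)"
  shows "z \<notin> k \<and> (\<exists>\<alpha> \<beta> \<gamma>. \<alpha> \<in> k \<and> \<beta> \<in> k \<and> \<gamma> \<in> k \<and> (\<alpha> \<noteq> 0 \<or> \<beta> \<noteq> 0 \<or> \<gamma> \<noteq> 0) \<and> \<alpha> + \<beta> * z + \<gamma> * z\<^sup>2 = 0)"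
proof -
  let ?e = "\<lambda>a. eval2 h a w"
  let ?fw = "\<chi> i. eval2 h (f $ i) w"
  define \<theta> where "\<theta> = fract_val ?e"
  have e: "comm_ring_hom ?e" by (rule comm_ring_hom_eval2[OF h])
  note gen = gen0[rule_format]
  have \<theta>: "comm_ring_hom \<theta>" unfolding \<theta>_def by (rule comm_ring_hom_fract_val[OF e gen0])
  have \<theta>F: "\<theta> (Fract a b) = ?e a / ?e b" if "b \<noteq> 0" for a b unfolding \<theta>_def by (rule fract_val_Fract[OF e gen0 that])
  have \<theta>0: "q = 0" if "\<theta> q = 0" for q using that unfolding \<theta>_def by (rule fract_val_eq_0[OF e gen0])
  interpret e: comm_ring_hom ?e by (rule e)
  interpret t: comm_ring_hom \<theta> by (rule \<theta>)
  have \<theta>inj: "q = r" if "\<theta> q = \<theta> r" for q r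
  proof -
    have "q - r = 0" by (rule \<theta>0) (simp add: t.hom_minus that)
    then show ?thesis by simp
  qed
  have enz: "?e b \<noteq> 0 \<longleftrightarrow> b \<noteq> 0" for b using gen[of b] e.hom_zero by blast
  define S where "S = {q. \<theta> q \<in> rat2 h w}"
  define T where "T = {q. \<theta> q \<in> k}"
  have sk: "subfield k RT" unfolding k by (rule subfield_rat2[OF h])
  have sS: "subfield S RT" and sT: "subfield T RT"
    unfolding S_def T_def by (rule subfield_preimage[OF \<theta> subfield_rat2[OF h]], rule subfield_preimage[OF \<theta> sk])
  have ef: "?e (eval2 const2 a f) = eval2 h a ?fw" for a by (rule eval2_eval2[OF h])
  have cS: "{Fract a b | a b :: 'a form2. (\<exists>n. homog2 n a \<and> homog2 n b) \<and> b \<noteq> 0} = S"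
  proof (intro Set.set_eqI iffI)
    fix q assume "q \<in> {Fract a b | a b :: 'a form2. (\<exists>n. homog2 n a \<and> homog2 n b) \<and> b \<noteq> 0}"
    then obtain a b n where "q = Fract a b" "homog2 n a" "homog2 n b" "b \<noteq> 0" by (elim CollectE exE conjE)
    then show "q \<in> S" unfolding S_def using rat2I[of n a b h w] enz \<theta>F by simp
  next
    fix q assume "q \<in> S"
    then have "\<theta> q \<in> rat2 h w" unfolding S_def by simp
    then obtain n a b where 1: "homog2 n a" "homog2 n b" "?e b \<noteq> 0" "\<theta> q = ?e a / ?e b" by (rule rat2E)
    have b: "b \<noteq> 0" using 1(3) enz by simp
    have "q = Fract a b" by (rule \<theta>inj) (simp add: \<theta>F b 1(4))
    then show "q \<in> {Fract a b | a b :: 'a form2. (\<exists>n. homog2 n a \<and> homog2 n b) \<and> b \<noteq> 0}"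
      using 1(1,2) b by (intro CollectI exI conjI)
  qed
  have pT: "pullback_field f = T"
  proof (intro Set.set_eqI iffI)
    fix q assume "q \<in> pullback_field f"
    then obtain a b n where 1: "q = Fract (eval2 const2 a f) (eval2 const2 b f)" "homog2 n a" "homog2 n b" "eval2 const2 b f \<noteq> 0"
      unfolding pullback_field_def by (elim CollectE exE conjE)
    have "eval2 h b ?fw \<noteq> 0" using 1(4) enz[of "eval2 const2 b f"] unfolding ef by simp
    from rat2I[OF 1(2,3) this] show "q \<in> T" unfolding T_def k 1(1) using \<theta>F[OF 1(4)] ef by simp
  next
    fix q assume "q \<in> T"
    then have "\<theta> q \<in> rat2 h ?fw" unfolding T_def k by simp
    then obtain n a b where 1: "homog2 n a" "homog2 n b" "eval2 h b ?fw \<noteq> 0" "\<theta> q = eval2 h a ?fw / eval2 h b ?fw" by (rule rat2E)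
    have b: "eval2 const2 b f \<noteq> 0" using 1(3) enz[of "eval2 const2 b f"] unfolding ef by simp
    have "q = Fract (eval2 const2 a f) (eval2 const2 b f)" by (rule \<theta>inj) (simp add: \<theta>F[OF b] 1(4) ef)
    then show "q \<in> pullback_field f" unfolding pullback_field_def using 1(1,2) b by (intro CollectI exI conjI)
  qed
  have LF: "line_field = RT\<lparr>carrier := S\<rparr>" unfolding line_field_def cS ..
  have TS: "T \<subseteq> S"
  proof -
    have "eval2 h a ?fw / eval2 h b ?fw \<in> rat2 h w" if "homog2 m a" "homog2 m b" "eval2 h b ?fw \<noteq> 0" for m a b
      using rat2I[OF homog2_eval2[OF that(1) f] homog2_eval2[OF that(2) f], of h w] that(3) unfolding ef by simp
    then have "k \<subseteq> rat2 h w" unfolding k by (intro subsetI) (erule rat2E, simp)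
    then show ?thesis unfolding T_def S_def by blast
  qed
  interpret RT: Ring.ring "RT :: 'a form2 fract ring" by (rule ring_RT)
  have fS: "Ring.field (RT\<lparr>carrier := S\<rparr>)" by (rule RT.subfield_iff(2)[OF sS])
  interpret LF: Ring.field "RT\<lparr>carrier := S\<rparr>" by (rule fS)
  have sub: "subfield T (RT\<lparr>carrier := S\<rparr>)"
    using RT.subfield_iff(2)[OF sT] TS by (intro LF.subfield_iff(1)) simp_all
  have dim: "LF.dimension 2 T S" using deg unfolding line_morphism_degree_def LF pT by simp
  define \<zeta> where "\<zeta> = (SOME q. \<theta> q = z)"
  have "\<exists>q. \<theta> q = z"
  proof -
    from z(1) obtain n a b where "?e b \<noteq> 0" "z = ?e a / ?e b" by (rule rat2E)
    then have "\<theta> (Fract a b) = z" using enz \<theta>F by simp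
    then show ?thesis by blast
  qed
  then have \<zeta>: "\<theta> \<zeta> = z" unfolding \<zeta>_def by (rule someI_ex)
  note Sc = subfield_RT_closed[OF sS]
  have \<zeta>S: "\<zeta> \<in> S" unfolding S_def using \<zeta> z(1) by simp
  have znk: "z \<notin> k"
  proof
    assume zk: "z \<in> k"
    have "range h \<subseteq> k" unfolding k using rat2_closed(1)[OF h] by blast
    from z(2) rat1_subset[OF h sk this zk] have "rat2 h w \<subseteq> k" by (rule subset_trans)
    then have "S = T" using TS unfolding S_def T_def by blast
    then have "LF.dimension 1 T S" using LF.dimension_one[OF sub] by simp
    from LF.dimension_is_inj[OF sub dim this] show False by simp
  qed
  have "\<not> LF.independent T [1, \<zeta>, \<zeta> * \<zeta>]"
  proof
    assume "LF.independent T [1, \<zeta>, \<zeta> * \<zeta>]"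
    from LF.independent_length_le_dimension[OF sub dim this] show False using Sc \<zeta>S by simp
  qed
  moreover have "set [1, \<zeta>, \<zeta> * \<zeta>] \<subseteq> carrier (RT\<lparr>carrier := S\<rparr>)" using Sc(2) Sc(5)[OF \<zeta>S \<zeta>S] \<zeta>S by simp
  ultimately obtain Ks where "length Ks = length [1, \<zeta>, \<zeta> * \<zeta>]" "LF.combine Ks [1, \<zeta>, \<zeta> * \<zeta>] = \<zero>\<^bsub>RT\<lparr>carrier := S\<rparr>\<^esub>"
    "set Ks \<subseteq> T" "set Ks \<noteq> {\<zero>\<^bsub>RT\<lparr>carrier := S\<rparr>\<^esub>}"
    by (metis LF.dependent_imp_non_trivial_combine[OF sub])
  then have Ks: "length Ks = 3" "LF.combine Ks [1, \<zeta>, \<zeta> * \<zeta>] = 0" "set Ks \<subseteq> T" "set Ks \<noteq> {0}" by simp_all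
  obtain a b c where abc: "Ks = [a, b, c]" using Ks(1) by (auto simp: numeral_3_eq_3 length_Suc_conv)
  have sum0: "a + (b * \<zeta> + c * (\<zeta> * \<zeta>)) = 0" using Ks(2) unfolding abc by simp
  have "\<theta> a + \<theta> b * z + \<theta> c * z\<^sup>2 = 0"
    using arg_cong[OF sum0, of \<theta>] by (simp add: t.hom_add t.hom_mult t.hom_zero \<zeta> power2_eq_square add.assoc)
  moreover have "\<theta> a \<in> k" "\<theta> b \<in> k" "\<theta> c \<in> k" using Ks(3) unfolding abc T_def by simp_all
  moreover have "\<theta> a \<noteq> 0 \<or> \<theta> b \<noteq> 0 \<or> \<theta> c \<noteq> 0" using Ks(4) \<theta>0 unfolding abc by auto
  ultimately show ?thesis using znk by (intro conjI exI)
qed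

lemma eval3_in_subfield:
  fixes h :: "'a::field \<Rightarrow> 'w::field"
  assumes h: "comm_ring_hom h" and S: "subfield S RT" "range h \<subseteq> S" "\<And>i. v $ i \<in> S" shows "eval3 h a v \<in> S"
proof -
  interpret e: comm_ring_hom "\<lambda>a. eval3 h a v" by (rule comm_ring_hom_eval3[OF h])
  note c = subfield_RT_closed[OF S(1)]
  show ?thesis
  proof (induction a rule: form3_induct)
    case (const a)
    then show ?case using S(2) h by auto
  next
    case (var i)
    then show ?case using S(3) h by simp
  qed (simp_all add: e.hom_add e.hom_mult c)
qed

section \<open>The Galois projection and the induced map at a generic point\<close>

lemma horner_step:
  fixes y :: "'w::field"
  assumes "y \<noteq> 0" shows "a * y ^ Suc n + w * (y ^ n * t) = y ^ Suc n * (a + w / y * t)"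
  using assms by (simp add: field_simps)

text \<open>Multiplied by a power of \<open>Y\<close>, a polynomial in \<open>Z / Y\<close> becomes
  the image of a polynomial \<open>Q\<close> in \<open>Y\<close> and \<open>Z\<close>, and the
  original is recovered from \<open>Q\<close> by setting \<open>Y = 1\<close>.\<close>

lemma generic_ratio_transcendental:
  fixes q :: "'a::field poly"
  assumes "pev (kemb :: 'a \<Rightarrow> 'a gen) (emb (vars2 $ 2) / emb (vars2 $ 1)) q = 0" shows "q = 0"
proof -
  let ?y = "emb (vars2 $ 1) :: 'a gen" and ?w = "emb (vars2 $ 2) :: 'a gen"
  have "vars2 $ 1 \<noteq> (0 :: 'a form2)" by (simp add: vars2_def)
  then have y: "?y \<noteq> 0" by simp
  interpret k: comm_ring_hom "kemb :: 'a \<Rightarrow> 'a gen" by (rule comm_ring_hom_kemb)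
  interpret m: comm_ring_hom "emb :: 'a form2 \<Rightarrow> 'a gen" by (rule comm_ring_hom_emb)
  have "\<exists>Q n. emb Q = ?y ^ n * pev kemb (?w / ?y) q \<and> poly Q 1 = q"
  proof (induction q)
    case 0
    show ?case by (rule exI[of _ 0], rule exI[of _ 0]) simp
  next
    case (pCons c q)
    then obtain Q n where Q: "emb Q = ?y ^ n * pev kemb (?w / ?y) q" "poly Q 1 = q" by (elim exE conjE)
    have "emb (const2 c * (vars2 $ 1) ^ Suc n + vars2 $ 2 * Q) = ?y ^ Suc n * pev kemb (?w / ?y) (pCons c q)"
      unfolding m.hom_add m.hom_mult m.hom_power Q(1) pev_pCons[OF comm_ring_hom_kemb] kemb_def
      by (rule horner_step[OF y])
    moreover have "poly (const2 c * (vars2 $ 1) ^ Suc n + vars2 $ 2 * Q) 1 = pCons c q"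
    proof -
      have "poly (vars2 $ 1) 1 = (1 :: 'a poly)" "poly (vars2 $ 2) 1 = ([:0, 1:] :: 'a poly)" "poly (const2 c) 1 = [:c:]"
        by (simp_all add: vars2_def const2_def)
      then show ?thesis using Q(2) by simp
    qed
    ultimately show ?case by blast
  qed
  then obtain Q n where "emb Q = ?y ^ n * pev kemb (?w / ?y) q" "poly Q 1 = q" by (elim exE conjE)
  then have "emb Q = 0" unfolding assms by simp
  then show ?thesis using \<open>poly Q 1 = q\<close> by simp
qed

text \<open>For the projection \<open>\<pi>0\<close> onto the last two coordinates the generic value
  is \<open>(Y, Z)\<close>. Every other matrix differs from it by linear maps in both directions;
  for the first claim the surjectivity of \<open>\<pi>\<close> recovers \<open>b\<close> from its
  composite.\<close>

lemma projection_generic: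
  fixes M N :: "'a::field_char_0 ^ 3 ^ 3" and x :: "'a gen"
  assumes MN: "M ** N = mat 1" "N ** M = mat 1" "M *v axis 1 1 = P" and P: "P \<noteq> 0" and \<pi>: "projection_from P \<pi>"
    and w: "w = hmat kemb \<pi> *v (hmat kemb M *v gpt x)"
  shows "\<forall>b. eval2 kemb b w = 0 \<longrightarrow> b = 0"
    and "emb (vars2 $ 2) / emb (vars2 $ 1) \<in> rat2 kemb w"
    and "rat2 kemb w \<subseteq> rat1 kemb (emb (vars2 $ 2) / emb (vars2 $ 1) :: 'a gen)"
proof -
  note k = comm_ring_hom_kemb[where 'a = 'a]
  define \<pi>0 where "\<pi>0 = (\<chi> i::2. N $ (if i = 1 then 2 else 3))"
  have NP: "N *v P = axis 1 1" unfolding MN(3)[symmetric] by (simp add: matrix_vector_mul_assoc MN(2))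
  have p0: "projection_from P \<pi>0" unfolding \<pi>0_def by (rule projection_from_matrix[OF MN(1,2) NP])
  obtain S where S: "\<pi> = S ** \<pi>0" using projection_from_factor[OF p0 \<pi> P] by (elim exE)
  obtain T where T: "\<pi>0 = T ** \<pi>" using projection_from_factor[OF \<pi> p0 P] by (elim exE)
  define g where "g = hmat kemb \<pi>0 *v (hmat kemb M *v gpt x)"
  have gi: "g = (\<chi> i. emb (vars2 $ i))"
  proof -
    have row: "g $ i = (hmat kemb N *v (hmat kemb M *v gpt x)) $ (if i = 1 then 2 else 3)" for i
      unfolding g_def \<pi>0_def hmat_def matrix_vector_mult_def by simp
    show ?thesis unfolding Finite_Cartesian_Product.vec_eq_iff forall_2 row gpt_coords[OF MN(2)] by simp
  qed
  have wS: "w = hmat kemb S *v g" unfolding w g_def S hmat_mult[OF k] by (simp only: matrix_vector_mul_assoc matrix_mul_assoc)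
  have gT: "g = hmat kemb T *v w" unfolding w g_def T hmat_mult[OF k] by (simp only: matrix_vector_mul_assoc matrix_mul_assoc)
  have nz: "vars2 $ i \<noteq> (0 :: 'a form2)" for i using exhaust_2[of i] by (auto simp: vars2_def)
  have enz: "emb (vars2 $ i) \<noteq> (0 :: 'a gen)" for i using nz[of i] by simp
  let ?z = "emb (vars2 $ 2) / emb (vars2 $ 1) :: 'a gen"
  have "?z \<in> rat2 kemb g"
    using rat2I[of "Suc 0" "vars2 $ 2" "vars2 $ 1" kemb g] by (simp add: k gi nz)
  then show "?z \<in> rat2 kemb w" using rat2_linear_image[OF k, of T w] unfolding gT[symmetric] by (rule set_mp[rotated])
  have "rat2 kemb w \<subseteq> rat2 kemb g" unfolding wS by (rule rat2_linear_image[OF k])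
  also have "\<dots> = rat1 kemb (g $ 1 / g $ 2)" by (rule rat2_eq_rat1[OF k]) (simp add: gi nz)
  also have "\<dots> \<subseteq> rat1 kemb ?z"
  proof (rule rat1_subset[OF k subfield_rat1[OF k]])
    have gz: "g $ 1 / g $ 2 = inverse ?z" by (simp add: gi)
    show "g $ 1 / g $ 2 \<in> rat1 kemb ?z" unfolding gz by (rule subfield_RT_closed(6)[OF subfield_rat1[OF k] rat1_basic(2)[OF k]])
    show "range kemb \<subseteq> rat1 kemb ?z" using rat1_basic(1)[OF k] by (intro image_subsetI)
  qed
  finally show "rat2 kemb w \<subseteq> rat1 kemb ?z" .
  show "\<forall>b. eval2 kemb b w = 0 \<longrightarrow> b = 0"
  proof (intro allI impI, rule ccontr)
    fix b assume b: "eval2 kemb b w = 0" "b \<noteq> 0"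
    define l where "l = (\<chi> i. \<Sum>j\<in>UNIV. const2 (S $ i $ j) * vars2 $ j)"
    define b' where "b' = eval2 const2 b l"
    have lv: "(\<chi> i. eval2 h (l $ i) v) = hmat h S *v v" if h: "comm_ring_hom h" for h :: "'a \<Rightarrow> 'c::comm_ring_1" and v
    proof -
      interpret e: comm_ring_hom "\<lambda>a. eval2 h a v" by (rule comm_ring_hom_eval2[OF h])
      show ?thesis by (simp add: l_def e.hom_sum e.hom_mult h hmat_def matrix_vector_mult_def)
    qed
    have "emb b' = eval2 kemb b' g" unfolding gi by (rule eval2_emb[symmetric])
    also have "\<dots> = 0" unfolding b'_def eval2_eval2[OF k] lv[OF k] wS[symmetric] by (rule b(1))
    finally have b'0: "b' = 0" by simp
    obtain v where v: "eval2 (\<lambda>c. c) b v \<noteq> 0" using form2_nonzero_point[OF b(2)] by (elim exE)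
    obtain M1 N1 :: "'a ^ 3 ^ 3" where M1: "M1 ** N1 = mat 1" "N1 ** M1 = mat 1"
      and N1: "\<forall>x. (\<pi> *v x) $ 1 = (N1 *v x) $ 2 \<and> (\<pi> *v x) $ 2 = (N1 *v x) $ 3"
      using projection_from_complete[OF \<pi> P] by (elim exE conjE)
    define m where "m = M1 *v (\<chi> i. if i = 2 then v $ 1 else v $ 2)"
    have "N1 *v m = (\<chi> i. if i = 2 then v $ 1 else v $ 2)" by (simp add: m_def matrix_vector_mul_assoc M1)
    then have "\<pi> *v m = v" unfolding Finite_Cartesian_Product.vec_eq_iff forall_2 using N1 by simp
    then have vm: "S *v (\<pi>0 *v m) = v" unfolding S by (simp add: matrix_vector_mul_assoc)
    have "eval2 (\<lambda>c. c) b' (\<pi>0 *v m) = eval2 (\<lambda>c. c) b v"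
      unfolding b'_def eval2_eval2[OF comm_ring_hom_ident] lv[OF comm_ring_hom_ident] hmat_ident vm ..
    then show False using v unfolding b'0 by (simp add: eval2_def)
  qed
qed

text \<open>The equality of rational maps is given only at points where both sides are defined. It
  becomes a polynomial identity on the curve and can then be read at the generic point.\<close>

lemma induced_line_morphism_generic:
  fixes F :: "'a::{alg_closed_field, field_char_0} form3" and \<pi> \<rho> :: "'a ^ 3 ^ 2"
  assumes F: "Factorial_Ring.irreducible F" and MN: "M ** N = mat 1"
    and deg: "Polynomial.degree (subst_mat F M) > 0" and x: "poly (map_poly emb (subst_mat F M)) x = 0"
    and \<xi>: "\<xi> = hmat kemb M *v gpt x" and \<xi>': "\<xi>' = grad_at kemb F \<xi>"
    and nz: "hmat kemb \<pi> *v \<xi> \<noteq> 0"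
    and f: "\<forall>x \<in> zero_locus F - sing_locus F. \<pi> *v x \<noteq> 0 \<and> \<rho> *v forms_at (gradient F) x \<noteq> 0 \<longrightarrow>
          proj_eq (\<chi> i. eval2 (\<lambda>c. c) (f $ i) (\<pi> *v x)) (\<rho> *v forms_at (gradient F) x)"
  shows "eval2 kemb (f $ 1) (hmat kemb \<pi> *v \<xi>) * (hmat kemb \<rho> *v \<xi>') $ 2 = eval2 kemb (f $ 2) (hmat kemb \<pi> *v \<xi>) * (hmat kemb \<rho> *v \<xi>') $ 1"
proof -
  note k = comm_ring_hom_kemb[where 'a = 'a]
  define rg where "rg i = (\<Sum>j\<in>UNIV. const3 (\<rho> $ i $ j) * gradient F $ j)" for i :: 2
  define ff where "ff i = eval2 const3 (f $ i) (lin_forms \<pi>)" for i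
  have rg: "eval3 h (rg i) v = (hmat h \<rho> *v (\<chi> j. eval3 h (gradient F $ j) v)) $ i" if h: "comm_ring_hom h" for h :: "'a \<Rightarrow> 'c::comm_ring_1" and i v
  proof -
    interpret e: comm_ring_hom "\<lambda>a. eval3 h a v" by (rule comm_ring_hom_eval3[OF h])
    show ?thesis by (simp add: rg_def e.hom_sum e.hom_mult h hmat_def matrix_vector_mult_def)
  qed
  have ff: "eval3 h (ff i) v = eval2 h (f $ i) (hmat h \<pi> *v v)" if h: "comm_ring_hom h" for h :: "'a \<Rightarrow> 'c::comm_ring_1" and i v
    by (simp add: ff_def eval3_eval2[OF h] eval3_lin_forms_vec[OF h])
  obtain j where j: "(hmat kemb \<pi> *v \<xi>) $ j \<noteq> 0" using nz by (auto simp: Finite_Cartesian_Product.vec_eq_iff)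
  \<comment> \<open>The extra linear form takes care of points where the projection is undefined. It
    does not vanish at the generic point, so it can be cancelled there.\<close>
  define H where "H = (ff 1 * rg 2 - ff 2 * rg 1) * lin_forms \<pi> $ j"
  have "vanishes_on H (zero_locus F)"
    unfolding vanishes_on_def
  proof
    fix y assume y: "y \<in> zero_locus F"
    note i = comm_ring_hom_ident[where 'a = 'a]
    interpret y: comm_ring_hom "\<lambda>a. form_at a y" by (rule comm_ring_hom_eval3[OF i])
    have rgy: "form_at (rg i) y = (\<rho> *v forms_at (gradient F) y) $ i" for i using rg[OF i] by (simp add: forms_at_def)
    have ffy: "form_at (ff i) y = eval2 (\<lambda>c. c) (f $ i) (\<pi> *v y)" for i using ff[OF i] by simp
    have ly: "form_at (lin_forms \<pi> $ j) y = (\<pi> *v y) $ j" using eval3_lin_forms_vec[OF i, of \<pi> y] by (simp add: Finite_Cartesian_Product.vec_eq_iff)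
    show "form_at H y = 0"
    proof (cases "\<pi> *v y = 0 \<or> \<rho> *v forms_at (gradient F) y = 0")
      case True
      then show ?thesis by (elim disjE) (simp_all add: H_def y.hom_mult y.hom_minus rgy ly)
    next
      case False
      then have "forms_at (gradient F) y \<noteq> 0" by auto
      then have "y \<in> zero_locus F - sing_locus F" using y by (simp add: sing_locus_def)
      then have "proj_eq (\<chi> i. eval2 (\<lambda>c. c) (f $ i) (\<pi> *v y)) (\<rho> *v forms_at (gradient F) y)" using f False by simp
      then obtain c where c: "(\<chi> i. eval2 (\<lambda>c. c) (f $ i) (\<pi> *v y)) = c *s (\<rho> *v forms_at (gradient F) y)" unfolding proj_eq_def by (elim exE conjE)
      have "eval2 (\<lambda>c. c) (f $ i) (\<pi> *v y) = c * (\<rho> *v forms_at (gradient F) y) $ i" for i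
        using arg_cong[OF c, of "\<lambda>v. v $ i"] by simp
      then show ?thesis by (simp add: H_def y.hom_mult y.hom_minus rgy ffy)
    qed
  qed
  then have "eval3 kemb H \<xi> = 0" unfolding \<xi> generic_point_curve[OF F MN deg x] .
  interpret e: comm_ring_hom "\<lambda>a. eval3 kemb a \<xi>" by (rule comm_ring_hom_eval3[OF k])
  have "eval3 kemb (lin_forms \<pi> $ j) \<xi> = (hmat kemb \<pi> *v \<xi>) $ j" using eval3_lin_forms_vec[OF k, of \<pi> \<xi>] by (simp add: Finite_Cartesian_Product.vec_eq_iff)
  then have "eval3 kemb (ff 1 * rg 2 - ff 2 * rg 1) \<xi> = 0"
    using \<open>eval3 kemb H \<xi> = 0\<close> j unfolding H_def e.hom_mult by simp
  then show ?thesis unfolding e.hom_minus e.hom_mult rg[OF k] ff[OF k] \<xi>' grad_at_def by simp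
qed

section \<open>The curve and its tangents in the affine chart\<close>

lemma eval3_dehom:
  fixes h :: "'a::comm_ring_1 \<Rightarrow> 'w::comm_ring_1"
  assumes h: "comm_ring_hom h" and v: "v $ 2 = 1"
  shows "eval3 h ([:a:] + Polynomial.monom b n) v = pev h (v $ 3) (poly a 1) + pev h (v $ 3) (poly b 1) * v $ 1 ^ n"
proof -
  interpret e: comm_ring_hom "\<lambda>F. eval3 h F v" by (rule comm_ring_hom_eval3[OF h])
  have p: "comm_ring_hom (pev h (v $ 3))" by (rule comm_ring_hom_pev[OF h])
  interpret p: comm_ring_hom "pev h (v $ 3)" by (rule p)
  have c: "eval3 h [:a:] v = pev h (v $ 3) (poly a 1)" for a
  proof -
    have "poly (map_poly (pev h (v $ 3)) a) 1 = pev h (v $ 3) (poly a 1)" by (rule eval2_poly_1[OF p])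
    then show ?thesis by (simp add: eval3_def map_poly_const_poly pev_def[abs_def] v)
  qed
  have m: "Polynomial.monom b n = [:b:] * (vars3 $ 1) ^ n" by (simp add: vars3_def monom_altdef)
  show ?thesis unfolding m e.hom_add e.hom_mult e.hom_power c eval3_vars3[OF h] ..
qed

lemma poly_pderiv_coeffs_1: "poly (map_poly pderiv a) 1 = pderiv (poly a (1 :: 'a::idom poly))"
  by (induction a) (simp_all add: map_poly_pCons pderiv_add pderiv_mult)

text \<open>In the chart \<open>(x : 1 : z)\<close> the curve is \<open>x ^ p = g(z)\<close>. The
  tangent line, normalised to \<open>(u : v : 1)\<close> in the dual coordinates, has
  \<open>v\<close> as its projection from the associated point, and \<open>u\<close>,
  \<open>v\<close> generate the function field of the dual curve.\<close>

theorem dual_datum: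
  fixes F :: "'a::{alg_closed_field, field_char_0} form3" and M N :: "'a ^ 3 ^ 3" and R :: "'a ^ 3"
  assumes F: "Factorial_Ring.irreducible F" "homog3 d F" "d \<ge> 2" and p: "Factorial_Ring.prime p"
    and MN: "M ** N = mat 1" "N ** M = mat 1" "M *v axis 1 1 = P" and P: "P \<noteq> 0" and R: "proj_eq R (Finite_Cartesian_Product.transpose N *v axis 1 1)"
    and FM: "subst_mat F M = [:c0:] + Polynomial.monom cp p" and \<kappa>: "poly cp 1 = [:\<kappa>:]" "\<kappa> \<noteq> 0"
    and deg: "\<not> p dvd Polynomial.degree (poly c0 1)" and x0: "poly (map_poly emb (subst_mat F M)) x0 = 0"
    and f: "induced_line_morphism F P R f" "line_morphism_degree f 2"
    and \<xi>': "\<xi>' = grad_at kemb F (hmat kemb M *v gpt x0)"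
  shows "\<exists>\<rho> z z2 x q q2. projection_from R \<rho> \<and> galois_datum p (rat2 kemb (hmat kemb \<rho> *v \<xi>')) (rat3 kemb \<xi>') z z2 x q q2"
proof -
  let ?t = "Finite_Cartesian_Product.transpose :: 'a ^ 3 ^ 3 \<Rightarrow> 'a ^ 3 ^ 3"
  note k = comm_ring_hom_kemb[where 'a = 'a]
  interpret k: comm_ring_hom "kemb :: 'a \<Rightarrow> 'a gen" by (rule k)
  have p0: "p > 0" by (rule prime_gt_0_nat[OF p])
  have d0: "d > 0" using F(3) by simp
  have cp0: "cp \<noteq> 0" using \<kappa> by auto
  have degG: "Polynomial.degree (subst_mat F M) > 0"
  proof -
    have "Polynomial.coeff (subst_mat F M) p = cp" unfolding FM using p0 by (simp add: coeff_const_poly)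
    then have "p \<le> Polynomial.degree (subst_mat F M)" using cp0 by (intro le_degree) simp
    then show ?thesis using p0 by simp
  qed
  define \<xi> where "\<xi> = hmat kemb M *v gpt x0"
  define y where "y = (emb (vars2 $ 1) :: 'a gen)"
  define z where "z = emb (vars2 $ 2) / y"
  define x where "x = x0 / y"
  have y0: "y \<noteq> 0" by (simp add: y_def vars2_def)
  have tr: "\<forall>q. pev (kemb :: 'a \<Rightarrow> 'a gen) z q = 0 \<longrightarrow> q = 0" unfolding z_def y_def using generic_ratio_transcendental by (intro allI impI)
  interpret e: comm_ring_hom "pev kemb z" by (rule comm_ring_hom_pev[OF k])
  define pt where "pt = (\<chi> i::3. if i = 1 then x else if i = 2 then 1 else z)"
  have pt: "pt $ 1 = x" "pt $ 2 = 1" "pt $ 3 = z" by (simp_all add: pt_def)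
  have gpt_eq: "gpt x0 = y *s pt"
    unfolding Finite_Cartesian_Product.vec_eq_iff forall_3 using y0 by (simp add: pt x_def z_def y_def[symmetric])
  define C where "C = poly c0 1"
  define g where "g = Polynomial.smult (- (1 / \<kappa>)) C"
  have hG: "homog3 d (subst_mat F M)" by (rule homog3_subst_mat[OF F(2)])
  have Gpt: "eval3 kemb (subst_mat F M) pt = 0"
  proof -
    have "eval3 kemb (subst_mat F M) (gpt x0) = 0" unfolding eval3_gpt by (rule x0)
    then show ?thesis unfolding gpt_eq homog3_scale[OF k hG] using y0 by simp
  qed
  have hk: "kemb \<kappa> \<noteq> (0 :: 'a gen)" using \<kappa>(2) by simp
  have Cg: "pev kemb z C = - kemb \<kappa> * pev kemb z g" "pev kemb z (pderiv C) = - kemb \<kappa> * pev kemb z (pderiv g)"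
  proof -
    have "C = Polynomial.smult (- \<kappa>) g" using \<kappa>(2) by (simp add: g_def)
    then show "pev kemb z C = - kemb \<kappa> * pev kemb z g" "pev kemb z (pderiv C) = - kemb \<kappa> * pev kemb z (pderiv g)"
      by (simp_all add: pderiv_smult pderiv_minus pev_smult[OF k] k.hom_uminus e.hom_uminus)
  qed
  have \<kappa>z: "pev kemb z (poly cp 1) = kemb \<kappa>" unfolding \<kappa>(1) by (simp add: pev_pCons[OF k])
  have xp: "x ^ p = pev kemb z g"
  proof -
    have "pev kemb z C + kemb \<kappa> * x ^ p = 0"
      using Gpt unfolding FM eval3_dehom[OF k pt(2)] pt \<kappa>z C_def[symmetric] .
    then have "kemb \<kappa> * x ^ p = kemb \<kappa> * pev kemb z g" unfolding Cg by (simp add: add_eq_0_iff)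
    then show ?thesis using hk by simp
  qed
  have degg: "Polynomial.degree g = Polynomial.degree C" unfolding g_def using \<kappa>(2) by simp
  have ndeg: "\<not> p dvd Polynomial.degree g" unfolding degg C_def by (rule deg)
  then have dg: "Polynomial.degree g > 0" by (intro Nat.gr0I) simp
  have pg0: "pev kemb z (pderiv g) \<noteq> 0" and g0: "pev kemb z g \<noteq> 0"
  proof -
    have "pderiv g \<noteq> 0" "g \<noteq> 0" using dg by (auto simp: pderiv_eq_0_iff)
    then show "pev kemb z (pderiv g) \<noteq> 0" "pev kemb z g \<noteq> 0" using tr by blast+
  qed
  have xnz: "x \<noteq> 0" using xp g0 p0 by (auto simp: power_0_left)
  define \<gamma> where "\<gamma> = (\<chi> i. eval3 kemb (gradient (subst_mat F M) $ i) pt)"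
  have \<gamma>1: "\<gamma> $ 1 = of_nat p * kemb \<kappa> * x ^ (p - 1)"
  proof -
    have "gradient (subst_mat F M) $ 1 = [:0:] + Polynomial.monom (of_nat p * cp) (p - 1)"
      unfolding FM gradient_def by (simp add: pderiv_add pderiv_monom)
    moreover have "pev kemb z (poly (of_nat p * cp) 1) = of_nat p * kemb \<kappa>"
      by (simp add: e.hom_mult \<kappa>z e.hom_of_nat)
    ultimately show ?thesis unfolding \<gamma>_def using eval3_dehom[OF k pt(2), of 0 "of_nat p * cp" "p - 1"] by (simp add: pt)
  qed
  have \<gamma>3: "\<gamma> $ 3 = - kemb \<kappa> * pev kemb z (pderiv g)"
  proof -
    have "gradient (subst_mat F M) $ 3 = [:map_poly pderiv c0:] + Polynomial.monom (map_poly pderiv cp) p"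
      unfolding FM gradient_def using pderiv_map_poly2_add[of "[:c0:]" "Polynomial.monom cp p"] by (simp add: map_poly_const_poly map_poly_monom)
    then have "\<gamma> $ 3 = pev kemb z (pderiv C) + pev kemb z (pderiv (poly cp 1)) * x ^ p"
      unfolding \<gamma>_def by (simp add: eval3_dehom[OF k pt(2)] pt poly_pderiv_coeffs_1 C_def)
    then show ?thesis unfolding Cg \<kappa>(1) by (simp add: pderiv_pCons)
  qed
  \<comment> \<open>Euler's relation at a point of the curve supplies the second partial derivative
    from the other two.\<close>
  have euler: "x * \<gamma> $ 1 + \<gamma> $ 2 + z * \<gamma> $ 3 = 0"
  proof -
    interpret ev: comm_ring_hom "\<lambda>F. eval3 kemb F pt" by (rule comm_ring_hom_eval3[OF k])
    have "(\<Sum>i\<in>UNIV. pt $ i * \<gamma> $ i) = 0"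
      using arg_cong[OF euler3[OF hG], of "\<lambda>F. eval3 kemb F pt"] Gpt by (simp add: ev.hom_sum ev.hom_mult k \<gamma>_def)
    then show ?thesis by (simp add: sum_3 pt)
  qed
  have xx: "x * x ^ (p - 1) = pev kemb z g" using p0 xp by (cases p) simp_all
  have \<gamma>3nz: "\<gamma> $ 3 \<noteq> 0" unfolding \<gamma>3 using hk pg0 by simp
  \<comment> \<open>\<open>v\<close> is the negative of \<open>t\<close>; the Euler relation divided
    by \<open>\<gamma> $ 3\<close> becomes \<open>x u + v + z = 0\<close>.\<close>
  define v where "v = \<gamma> $ 2 / \<gamma> $ 3"
  define u where "u = \<gamma> $ 1 / \<gamma> $ 3"
  have xg: "x * \<gamma> $ 1 = kemb \<kappa> * (of_nat p * pev kemb z g)" unfolding \<gamma>1 xx[symmetric] by (simp add: mult_ac)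
  have uvz: "x * u + v + z = 0"
    using arg_cong[OF euler, of "\<lambda>a. a / \<gamma> $ 3"] \<gamma>3nz by (simp add: u_def v_def add_divide_distrib)
  have xu: "x * u = - (of_nat p * pev kemb z g / pev kemb z (pderiv g))"
    unfolding u_def times_divide_eq_right xg \<gamma>3 using hk pg0 by simp
  have v_eq: "v = of_nat p * pev kemb z g / pev kemb z (pderiv g) - z"
    using uvz unfolding xu by (simp add: algebra_simps)
  have u_eq: "u = - (v + z) / x"
  proof -
    have "x * u = - (v + z)" using uvz by (simp add: add_eq_0_iff2 add.assoc)
    then show ?thesis using xnz by (simp add: nonzero_eq_divide_eq mult.commute)
  qed
  have t\<xi>: "hmat kemb (?t M) *v \<xi>' = y ^ (d - 1) *s \<gamma>"
  proof -
    have "(hmat kemb (?t M) *v \<xi>') $ i = eval3 kemb (gradient (subst_mat F M) $ i) (gpt x0)" for i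
      unfolding forms_at_gradient_subst_mat[OF k] \<xi>' grad_at_def
      by (simp add: hmat_def Finite_Cartesian_Product.transpose_def matrix_vector_mult_def)
    then show ?thesis unfolding Finite_Cartesian_Product.vec_eq_iff gpt_eq homog3_scale[OF k homog3_gradient[OF hG d0]]
      by (simp add: \<gamma>_def)
  qed
  have tN: "?t N ** ?t M = mat 1" "?t M ** ?t N = mat 1" unfolding matrix_transpose_mul[symmetric] MN by (simp_all add: transpose_mat)
  define s where "s = y ^ (d - 1) * \<gamma> $ 3"
  have s0: "s \<noteq> 0" unfolding s_def using y0 \<gamma>3nz by simp
  define \<omega> where "\<omega> = (\<chi> i::3. if i = 1 then u else if i = 2 then v else 1)"
  have \<gamma>\<omega>: "y ^ (d - 1) *s \<gamma> = s *s \<omega>"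
    unfolding Finite_Cartesian_Product.vec_eq_iff forall_3 using \<gamma>3nz by (simp add: \<omega>_def s_def u_def v_def)
  define \<eta> where "\<eta> = hmat kemb (?t N) *v \<omega>"
  have \<xi>\<eta>: "\<xi>' = s *s \<eta>"
  proof -
    have "\<xi>' = hmat kemb (?t N) *v (hmat kemb (?t M) *v \<xi>')" by (rule hmat_inverse[OF k tN(1), symmetric])
    also have "\<dots> = s *s \<eta>" unfolding t\<xi> \<gamma>\<omega> \<eta>_def by (simp add: vector_scalar_commute)
    finally show ?thesis .
  qed
  \<comment> \<open>The last two rows of the transpose of \<open>M\<close> annihilate the first row
    of \<open>N\<close>, which represents the associated point. So this is the projection
    \<open>(V : W)\<close> in the adapted coordinates.\<close>
  define \<rho>0 where "\<rho>0 = (\<chi> i::2. ?t M $ (if i = 1 then 2 else 3))"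
  have rho0: "projection_from R \<rho>0" and R0: "R \<noteq> 0"
  proof -
    obtain c where c: "c \<noteq> 0" "R = c *s (?t N *v axis 1 1)" using R unfolding proj_eq_def by (elim exE conjE)
    have ax: "?t M *v (?t N *v axis 1 1) = axis 1 1" unfolding matrix_vector_mul_assoc tN(2) by simp
    have "projection_from (?t N *v axis 1 1) \<rho>0" unfolding \<rho>0_def by (rule projection_from_matrix[OF tN ax])
    moreover have "range (\<lambda>a. a *s (?t N *v axis 1 1)) = range (\<lambda>a. a *s R)"
    proof (intro Set.equalityI image_subsetI)
      fix a show "a *s (?t N *v axis 1 1) \<in> range (\<lambda>a. a *s R)"
        by (rule range_eqI[of _ _ "a / c"]) (simp add: c vector_smult_assoc)
      show "a *s R \<in> range (\<lambda>a. a *s (?t N *v axis 1 1))"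
        by (rule range_eqI[of _ _ "a * c"]) (simp add: c vector_smult_assoc)
    qed
    ultimately show "projection_from R \<rho>0" unfolding projection_from_def by simp
    show "R \<noteq> 0"
    proof
      assume "R = 0"
      have "?t N *v axis 1 1 = inverse c *s R" unfolding c(2) vector_smult_assoc using c(1) by simp
      then have "?t N *v axis 1 1 = 0" unfolding \<open>R = 0\<close> by simp
      then have "axis 1 1 = (0 :: 'a ^ 3)" using ax by simp
      then have "(axis 1 1 :: 'a ^ 3) $ 1 = 0" by simp
      then show False by (simp add: axis_def)
    qed
  qed
  have r0\<xi>: "(hmat kemb \<rho>0 *v \<xi>') $ 1 = s * v" "(hmat kemb \<rho>0 *v \<xi>') $ 2 = s"
  proof -
    have row: "(hmat kemb \<rho>0 *v \<xi>') $ i = (hmat kemb (?t M) *v \<xi>') $ (if i = 1 then 2 else 3)" for i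
      by (simp add: \<rho>0_def hmat_def matrix_vector_mult_def)
    show "(hmat kemb \<rho>0 *v \<xi>') $ 1 = s * v" "(hmat kemb \<rho>0 *v \<xi>') $ 2 = s"
      unfolding row t\<xi> \<gamma>\<omega> by (simp_all add: \<omega>_def)
  qed
  have k0: "rat2 kemb (hmat kemb \<rho>0 *v \<xi>') = rat1 kemb v"
    using rat2_eq_rat1[OF k, of "hmat kemb \<rho>0 *v \<xi>'"] s0 unfolding r0\<xi> by simp
  interpret gd: gen_pt "dual_curve F" kemb \<xi>' unfolding \<xi>' by (rule gen_pt_dual[OF F MN(1) degG x0])
  from f(1) obtain \<pi> \<rho> where \<pi>: "projection_from P \<pi>" and \<rho>: "projection_from R \<rho>"
    and fx: "\<forall>x \<in> zero_locus F - sing_locus F. \<pi> *v x \<noteq> 0 \<and> \<rho> *v forms_at (gradient F) x \<noteq> 0 \<longrightarrow>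
          proj_eq (\<chi> i. eval2 (\<lambda>c. c) (f $ i) (\<pi> *v x)) (\<rho> *v forms_at (gradient F) x)" and lm: "line_morphism f"
    unfolding induced_line_morphism_def by (elim exE conjE)
  define w where "w = hmat kemb \<pi> *v \<xi>"
  note pg = projection_generic[OF MN P \<pi> w_def[unfolded \<xi>_def]]
  \<comment> \<open>The projection occurring in \<open>induced_line_morphism\<close> need not be
    \<open>\<rho>0\<close>; both have the same pulled back field.\<close>
  have kr: "rat2 kemb (hmat kemb \<rho> *v \<xi>') = rat1 kemb v"
    unfolding k0[symmetric] gd.projection_subfield_fval[OF \<rho> R0, symmetric] by (rule gd.projection_subfield_fval[OF rho0 R0])
  from lm obtain n where fh: "\<forall>i. homog2 n (f $ i)" and fnz: "\<forall>v. v \<noteq> 0 \<longrightarrow> (\<exists>i. eval2 (\<lambda>c. c) (f $ i) v \<noteq> 0)"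
    unfolding line_morphism_def by (elim exE conjE)
  have wnz: "w \<noteq> 0"
  proof
    assume "w = 0"
    then have "eval2 kemb (vars2 $ 1) w = 0" by (simp add: k)
    then have "vars2 $ 1 = (0 :: 'a form2)" using pg(1) by blast
    then show False by (simp add: vars2_def)
  qed
  define fw where "fw = (\<chi> i. eval2 kemb (f $ i) w)"
  have cross: "fw $ 1 * (hmat kemb \<rho> *v \<xi>') $ 2 = fw $ 2 * (hmat kemb \<rho> *v \<xi>') $ 1"
    using induced_line_morphism_generic[OF F(1) MN(1) degG x0 refl \<xi>' wnz[unfolded w_def \<xi>_def] fx] by (simp add: fw_def w_def \<xi>_def)
  \<comment> \<open>By algebraic independence of the coordinates of \<open>w\<close>, both
    components of \<open>f\<close> would be zero forms, but a morphism has no common zero.\<close>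
  have fw0: "fw \<noteq> 0"
  proof
    assume fw: "fw = 0"
    have "f $ i = 0" for i
    proof -
      have "fw $ i = 0" using fw by simp
      then show ?thesis using pg(1) unfolding fw_def by simp
    qed
    moreover have "axis 1 1 \<noteq> (0 :: 'a ^ 2)" by (simp add: axis_eq_0_iff)
    from fnz[rule_format, OF this] obtain i where "eval2 (\<lambda>c. c) (f $ i) (axis 1 1) \<noteq> 0" by (elim exE)
    ultimately show False by (simp add: eval2_def)
  qed
  have rho\<xi>0: "hmat kemb \<rho> *v \<xi>' \<noteq> 0"
  proof
    assume 0: "hmat kemb \<rho> *v \<xi>' = 0"
    obtain T where T: "\<rho>0 = T ** \<rho>" using projection_from_factor[OF \<rho> rho0 R0] by (elim exE)
    have "hmat kemb \<rho>0 *v \<xi>' = hmat kemb T *v (hmat kemb \<rho> *v \<xi>')" unfolding T hmat_mult[OF k] by (simp add: matrix_vector_mul_assoc)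
    then have "(hmat kemb \<rho>0 *v \<xi>') $ 2 = 0" unfolding 0 by simp
    then show False unfolding r0\<xi> using s0 by simp
  qed
  \<comment> \<open>Two nonzero vectors with vanishing determinant are proportional. This identifies
    the field pulled back along \<open>f\<close> with that of the projection of the dual
    curve.\<close>
  have "\<exists>c. c \<noteq> 0 \<and> fw = c *s (hmat kemb \<rho> *v \<xi>')"
  proof -
    define a where "a = hmat kemb \<rho> *v \<xi>'"
    obtain i where i: "a $ i \<noteq> 0" using rho\<xi>0 unfolding a_def[symmetric] by (auto simp: Finite_Cartesian_Product.vec_eq_iff)
    have "fw $ 1 * a $ i = fw $ i * a $ 1" "fw $ 2 * a $ i = fw $ i * a $ 2"
      using cross exhaust_2[of i] unfolding a_def[symmetric] by (elim disjE; simp)+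
    then have "fw $ 1 = fw $ i / a $ i * a $ 1" "fw $ 2 = fw $ i / a $ i * a $ 2" using i by (simp_all add: field_simps)
    then have e: "fw = (fw $ i / a $ i) *s a" unfolding Finite_Cartesian_Product.vec_eq_iff forall_2 vector_smult_component by (rule conjI)
    moreover have "fw $ i / a $ i \<noteq> 0"
    proof
      assume z: "fw $ i / a $ i = 0"
      have "fw = 0 *s a" using e unfolding z .
      then have "fw = 0" by simp
      then show False using fw0 by simp
    qed
    ultimately show ?thesis unfolding a_def[symmetric] by (intro exI conjI)
  qed
  then obtain c where c: "c \<noteq> 0" "fw = c *s (hmat kemb \<rho> *v \<xi>')" by (elim exE conjE)
  have kf: "rat1 kemb v = rat2 kemb (\<chi> i. eval2 kemb (f $ i) w)"
    unfolding fw_def[symmetric] c(2) rat2_scale[OF k c(1)] kr ..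
  from line_morphism_degree_two[OF k pg(1) fh[rule_format] f(2) pg(2,3) kf]
  obtain \<alpha> \<beta> \<delta> where zk: "z \<notin> rat1 kemb v" and dep: "\<alpha> \<in> rat1 kemb v" "\<beta> \<in> rat1 kemb v" "\<delta> \<in> rat1 kemb v"
     "\<alpha> \<noteq> 0 \<or> \<beta> \<noteq> 0 \<or> \<delta> \<noteq> 0" "\<alpha> + \<beta> * z + \<delta> * z\<^sup>2 = 0"
    unfolding z_def y_def by (elim exE conjE)
  have uvE: "u \<in> rat3 kemb \<xi>'" "v \<in> rat3 kemb \<xi>'"
  proof -
    have lf: "eval3 kemb (lin_forms (?t M) $ i) \<xi>' = s * \<omega> $ i" for i
      using map_row_mult[OF k, of "?t M" i \<xi>'] unfolding t\<xi> \<gamma>\<omega> by simp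
    have "\<omega> $ i \<in> rat3 kemb \<xi>'" for i
      using rat3I[of "Suc 0" "lin_forms (?t M) $ i" "lin_forms (?t M) $ 3" kemb \<xi>'] s0 unfolding lf by (simp add: \<omega>_def)
    from this[of 1] this[of 2] show "u \<in> rat3 kemb \<xi>'" "v \<in> rat3 kemb \<xi>'" by (simp_all add: \<omega>_def)
  qed
  have kE: "rat1 kemb v \<subseteq> rat3 kemb \<xi>'"
    using rat3_closed(1)[OF k] by (intro rat1_subset[OF k subfield_rat3[OF k] _ uvE(2)] image_subsetI)
  have genE: "rat3 kemb \<xi>' \<subseteq> S" if S: "subfield S RT" "rat1 kemb v \<subseteq> S" "u \<in> S" for S
  proof
    note Sc = subfield_RT_closed[OF S(1)]
    have hS: "range kemb \<subseteq> S" by (intro image_subsetI set_mp[OF S(2)] rat1_basic(1)[OF k])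
    have vS: "v \<in> S" by (rule set_mp[OF S(2) rat1_basic(2)[OF k]])
    have \<omega>S: "\<omega> $ i \<in> S" for i using S(3) vS Sc(2) by (simp add: \<omega>_def)
    have hc: "kemb a \<in> S" for a by (rule set_mp[OF S(2) rat1_basic(1)[OF k]])
    have \<eta>S: "\<eta> $ i \<in> S" for i
      unfolding \<eta>_def matrix_vector_mult_def hmat_def sum_3 vec_lambda_beta by (intro Sc(4) Sc(5) \<omega>S hc)
    fix b assume "b \<in> rat3 kemb \<xi>'"
    then obtain n a1 a2 where 1: "homog3 n a1" "homog3 n a2" "eval3 kemb a2 \<xi>' \<noteq> 0" "b = eval3 kemb a1 \<xi>' / eval3 kemb a2 \<xi>'" by (rule rat3E)
    have "b = eval3 kemb a1 \<eta> / eval3 kemb a2 \<eta>"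
      unfolding 1(4) \<xi>\<eta> homog3_scale[OF k 1(1)] homog3_scale[OF k 1(2)] using s0 by simp
    also have "\<dots> \<in> S" by (intro Sc(8) eval3_in_subfield[OF k S(1) hS \<eta>S])
    finally show "b \<in> S" .
  qed
  have "\<exists>z z2 x q q2. galois_datum p (rat1 kemb v) (rat3 kemb \<xi>') z z2 x q q2"
    by (rule galois_datum_exists[OF k tr p ndeg xp v_eq u_eq dep zk subfield_rat3[OF k] kE uvE(1)]) (rule genE)
  then obtain z z2 x q q2 where "galois_datum p (rat1 kemb v) (rat3 kemb \<xi>') z z2 x q q2" by (elim exE)
  then have "galois_datum p (rat2 kemb (hmat kemb \<rho> *v \<xi>')) (rat3 kemb \<xi>') z z2 x q q2" unfolding kr .
  with \<rho> show ?thesis by (intro exI conjI)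
qed

section \<open>The Galois group of the projection of the dual curve\<close>

text \<open>A root of \<open>1 + X + ... + X ^ (p - 1)\<close>; it is not 1, where this sum has the
  nonzero value \<open>p\<close>.\<close>

lemma primitive_root_exists:
  assumes "Factorial_Ring.prime p" shows "\<exists>\<zeta> :: 'a::{alg_closed_field, field_char_0}. \<zeta> ^ p = 1 \<and> \<zeta> \<noteq> 1"
proof -
  have p2: "p \<ge> 2" by (rule prime_ge_2_nat[OF assms])
  obtain \<zeta> :: 'a where "(\<Sum>i\<le>p - 1. 1 * \<zeta> ^ i) = 0" using alg_closed[of "p - 1" "\<lambda>_. 1"] p2 by auto
  moreover have "{..p - 1} = {..<p}" using p2 by auto
  ultimately have s: "(\<Sum>i<p. \<zeta> ^ i) = 0" by simp
  have "\<zeta> ^ p - 1 = (\<zeta> - 1) * (\<Sum>i<p. \<zeta> ^ i)" by (rule power_diff_1_eq)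
  then have "\<zeta> ^ p = 1" unfolding s by simp
  moreover have "\<zeta> \<noteq> 1" using s p2 by auto
  ultimately show ?thesis by blast
qed

theorem theorem1p4:
  fixes F :: "'a::{alg_closed_field, field_char_0} form3"
    and P Pbar :: "'a ^ 3"
    and f :: "'a form2 ^ 2"
    and d p r :: nat
    and L :: "'b ring"
    and \<iota> :: "'a form3 fract set \<Rightarrow> 'b"
  assumes "Factorial_Ring.irreducible F" and "homog3 d F" and "d \<ge> 3"
    and "Factorial_Ring.prime p" and "odd p"
    and "P \<noteq> 0"
    and "extendable_galois_point (zero_locus F) P"
    and "(P \<notin> zero_locus F \<and> d = p) \<or> (P \<in> zero_locus F - sing_locus F \<and> d - 1 = p)"
    and "associated_point F P Pbar"
    and "induced_line_morphism F P Pbar f"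
    and "line_morphism_degree f r"
    and "r = 2"
    and "galois_closure (function_field (dual_curve F)) (projection_subfield (dual_curve F) Pbar) L \<iota>"
  shows "gal_group L (\<iota> ` projection_subfield (dual_curve F) Pbar)
    \<cong> integer_mod_group p \<times>\<times> dihedral_group p"
proof -
  let ?D = "dual_curve F"
  let ?FF = "function_field ?D" and ?k = "projection_subfield ?D Pbar"
  have d2: "d \<ge> 2" using assms(3) by simp
  have p0: "p > 0" by (rule prime_gt_0_nat[OF assms(4)])
  note k = comm_ring_hom_kemb[where 'a = 'a]
  interpret k: comm_ring_hom "kemb :: 'a \<Rightarrow> 'a gen" by (rule k)
  obtain M N :: "'a ^ 3 ^ 3" and \<sigma> A c \<alpha> c0 cp \<kappa> where MN: "M ** N = mat 1" "N ** M = mat 1" "M *v axis 1 1 = P"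
    and FM: "subst_mat F M = [:c0:] + Polynomial.monom cp p" and \<kappa>: "poly cp 1 = [:\<kappa>:]" "\<kappa> \<noteq> 0"
    and deg: "\<not> p dvd Polynomial.degree (poly c0 1)"
    and \<sigma>: "\<sigma> \<in> carrier (galois_point_group (zero_locus F) P)" and A: "invertible A"
    and ind: "induces (zero_locus F) \<sigma> (rat_map (zero_locus F) (lin_forms A))"
    and c: "c \<noteq> 0" "\<alpha> \<noteq> 0" "\<alpha> \<noteq> 1" and AM: "\<forall>v. A *v (M *v v) = c *s (M *v (mat_row1 \<alpha> 0 0 *v v))"
    using standard_form[OF assms(1-4,6-8)] by (elim exE conjE)
  have degG: "Polynomial.degree (subst_mat F M) > 0"
  proof -
    have "Polynomial.coeff (subst_mat F M) p = cp" unfolding FM using p0 by (simp add: coeff_const_poly)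
    moreover have "cp \<noteq> 0" using \<kappa> by auto
    ultimately have "p \<le> Polynomial.degree (subst_mat F M)" by (intro le_degree) simp
    then show ?thesis using p0 by simp
  qed
  have R: "proj_eq Pbar (Finite_Cartesian_Product.transpose N *v axis 1 1)"
    by (rule associated_point_axis[OF assms(1,2) d2 MN(1,3) degG \<sigma> A ind c AM[rule_format] assms(9)])
  have R0: "Pbar \<noteq> 0" using assms(9) unfolding associated_point_def by (rule conjunct1)
  obtain x0 where x0: "poly (map_poly emb (subst_mat F M)) x0 = 0" using gpt_root_exists[OF degG] by (elim exE)
  define \<xi> where "\<xi> = grad_at kemb F (hmat kemb M *v gpt x0)"
  from dual_datum[OF assms(1,2) d2 assms(4) MN assms(6) R FM \<kappa> deg x0 assms(10) assms(11)[unfolded assms(12)] \<xi>_def]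
  obtain \<rho> z z2 x q q2 where \<rho>: "projection_from Pbar \<rho>"
    and datum: "galois_datum p (rat2 kemb (hmat kemb \<rho> *v \<xi>)) (rat3 kemb \<xi>) z z2 x q q2" by (elim exE conjE)
  interpret g: gen_pt ?D kemb \<xi> unfolding \<xi>_def by (rule gen_pt_dual[OF assms(1,2) d2 MN(1) degG x0])
  define K where "K = rat2 kemb (hmat kemb \<rho> *v \<xi>)"
  define E where "E = rat3 kemb \<xi>"
  have kF: "?k \<subseteq> carrier ?FF" by (rule g.projection_subfield_carrier)
  have Kim: "g.fval ` ?k = K" unfolding K_def by (rule g.projection_subfield_fval[OF \<rho> R0])
  have Eim: "g.fval ` carrier ?FF = E" unfolding E_def by (rule g.fval_carrier)
  \<comment> \<open>The embedding of the function field into \<open>L\<close>, transported to the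
    concrete field of values at the generic point. The images of the two fields in \<open>L\<close>,
    and with them the Galois group, stay the same.\<close>
  define j where "j w = \<iota> (inv_into (carrier ?FF) g.fval w)" for w
  have inj: "inj_on g.fval (carrier ?FF)" by (rule inj_onI) (rule g.fval_inj)
  have jf: "j (g.fval S) = \<iota> S" if "S \<in> carrier ?FF" for S
    unfolding j_def by (simp only: inv_into_f_f[OF inj that])
  note closure = assms(13)[unfolded galois_closure_def]
  have \<iota>: "\<iota> \<in> Ring.ring_hom ?FF L" and gal: "galois_extension L (\<iota> ` ?k)"
    and min: "\<forall>M. subfield M L \<and> \<iota> ` carrier ?FF \<subseteq> M \<and> galois_extension (L\<lparr>carrier := M\<rparr>) (\<iota> ` ?k) \<longrightarrow> M = carrier L"
    by (rule closure[THEN conjunct1], rule closure[THEN conjunct2, THEN conjunct1], rule closure[THEN conjunct2, THEN conjunct2])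
  have jK: "j ` K = \<iota> ` ?k" unfolding Kim[symmetric] image_image by (rule image_cong[OF refl]) (rule jf[OF set_mp[OF kF]])
  have jE: "j ` E = \<iota> ` carrier ?FF" unfolding Eim[symmetric] image_image by (rule image_cong[OF refl]) (rule jf)
  have fE: "\<exists>S. S \<in> carrier ?FF \<and> w = g.fval S" if "w \<in> E" for w using that unfolding Eim[symmetric] by (elim imageE) (intro exI conjI)
  note fm = ring_iso_memE[OF g.fval_iso]
  note im = ring_hom_memE[OF \<iota>]
  have FFr: "Ring.ring ?FF"
  proof -
    have "ideal (vanishing_ideal ?D) (local_ring ?D)" using g.kernel_rval ring_hom_ring.kernel_is_ideal[OF g.ring_hom_ring_rval] by simp
    then show ?thesis unfolding function_field_def by (rule ideal.quotient_is_ring)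
  qed
  interpret FF: Ring.ring ?FF by (rule FFr)
  have hj: "j \<in> Ring.ring_hom (RT\<lparr>carrier := E\<rparr>) L"
  proof (rule ring_hom_memI)
    fix a assume "a \<in> carrier (RT\<lparr>carrier := E\<rparr>)"
    then have "a \<in> E" by simp
    from fE[OF this] obtain S where S: "S \<in> carrier ?FF" "a = g.fval S" by (elim exE conjE)
    show "j a \<in> carrier L" unfolding S(2) jf[OF S(1)] by (rule im(1)[OF S(1)])
    fix b assume "b \<in> carrier (RT\<lparr>carrier := E\<rparr>)"
    then have "b \<in> E" by simp
    from fE[OF this] obtain T where T: "T \<in> carrier ?FF" "b = g.fval T" by (elim exE conjE)
    note m = g.fval_hom(4,3)[OF S(1) T(1)]
    have "a \<otimes>\<^bsub>RT\<lparr>carrier := E\<rparr>\<^esub> b = g.fval (S \<otimes>\<^bsub>?FF\<^esub> T)" "a \<oplus>\<^bsub>RT\<lparr>carrier := E\<rparr>\<^esub> b = g.fval (S \<oplus>\<^bsub>?FF\<^esub> T)"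
      unfolding S(2) T(2) g.fval_hom(1,2)[OF S(1) T(1)] by simp_all
    then show "j (a \<otimes>\<^bsub>RT\<lparr>carrier := E\<rparr>\<^esub> b) = j a \<otimes>\<^bsub>L\<^esub> j b" "j (a \<oplus>\<^bsub>RT\<lparr>carrier := E\<rparr>\<^esub> b) = j a \<oplus>\<^bsub>L\<^esub> j b"
      unfolding S(2) T(2) by (simp_all only: jf[OF m(1)] jf[OF m(2)] im(2,3)[OF S(1) T(1)] jf[OF S(1)] jf[OF T(1)])
  next
    have "j (g.fval \<one>\<^bsub>?FF\<^esub>) = \<one>\<^bsub>L\<^esub>" unfolding jf[OF FF.one_closed] by (rule im(4))
    then show "j \<one>\<^bsub>RT\<lparr>carrier := E\<rparr>\<^esub> = \<one>\<^bsub>L\<^esub>" using fm(4) by simp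
  qed
  \<comment> \<open>The root of unity is taken among the constants, so that its image lies in
    \<open>K\<close>.\<close>
  obtain \<zeta> :: 'a where \<zeta>: "\<zeta> ^ p = 1" "\<zeta> \<noteq> 1" using primitive_root_exists[OF assms(4)] by (elim exE conjE)
  interpret dihedral_galois L K E j p z z2 x q q2 "kemb \<zeta>"
  proof (rule dihedral_galois.intro)
    show "subfield K RT" "subfield E RT" unfolding K_def E_def by (rule subfield_rat2[OF k], rule subfield_rat3[OF k])
    show "K \<subseteq> E" unfolding Kim[symmetric] Eim[symmetric] using kF by (rule image_mono)
    show "j \<in> Ring.ring_hom (RT\<lparr>carrier := E\<rparr>) L" by (rule hj)
    show "galois_extension L (j ` K)" unfolding jK by (rule gal)
    show "M = carrier L" if "subfield M L" "j ` E \<subseteq> M" "galois_extension (L\<lparr>carrier := M\<rparr>) (j ` K)" for M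
      by (rule min[rule_format, OF conjI[OF that(1) conjI[OF that(2)[unfolded jE] that(3)[unfolded jK]]]])
    show "galois_datum p K E z z2 x q q2" unfolding K_def E_def by (rule datum)
    show "kemb \<zeta> \<in> K" unfolding K_def by (rule rat2_closed(1)[OF k])
    show "kemb \<zeta> ^ p = (1 :: 'a gen)" unfolding k.hom_power[symmetric] \<zeta>(1) by (rule k.hom_one)
    show "kemb \<zeta> \<noteq> (1 :: 'a gen)"
    proof
      assume "kemb \<zeta> = (1 :: 'a gen)"
      then have "kemb (\<zeta> - 1) = (0 :: 'a gen)" by (simp add: k.hom_minus k.hom_one)
      then show False using \<zeta>(2) by simp
    qed
    show "Factorial_Ring.prime p" "odd p" by fact+
  qed
  show ?thesis using gal_iso_dihedral unfolding jK .
qed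

end
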